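(* Let $\Gamma$ be a basic finite-dimensional algebra over a field $\mathbb{K}$ with $\operatorname{domdim}\Gamma=d+1>0$ and maximal projective-injective summand $\Pi$, and let $1\leq k\leq d+1$. Let $C^k$ be the $k$-coshifted module of $\Gamma$ and $B^k=\operatorname{End}_\Gamma(C^k)^{\mathrm{op}}$. Write $P^k=\operatorname{Hom}_\Gamma(C^k,\Pi)$. Then $P^k$ is a projective summand of the $B^k$-module $DC^k$, and the tilting subcategories associated to $C^k$ are $$\mathcal{C}_j(C^k)=\begin{cases}\operatorname{cogen}^{k-1}(\Pi),&j=0,\\ \ker\operatorname{Hom}_\Gamma(-,\Pi),&j=k,\\ \{0\},&\text{otherwise},\end{cases}\qquad \mathcal{T}_j(DC^k)=\begin{cases}\operatorname{gen}_{k-1}(P^k),&j=0,\\ \ker\operatorname{Hom}_{B^k}(P^k,-),&j=k,\\ \{0\},&\text{otherwise}.\end{cases}$$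
   Context: Modules are finitely generated left modules; morphisms are composed right-to-left; $D=\operatorname{Hom}_{\mathbb{K}}(-,\mathbb{K})$. $\operatorname{domdim}\Gamma\geq k$ if ${}_\Gamma\Gamma$ has an injective resolution whose first $k$ terms are projective-injective; $\operatorname{domdim}\Gamma=k$ if moreover not $\geq k+1$. A $\Gamma$-module $C$ is $k$-cotilting if $\operatorname{idim}C\leq k$, $\operatorname{Ext}^i_\Gamma(C,C)=0$ for $i>0$, and there is an exact sequence $0\to c^k\to\cdots\to c^0\to D\Gamma\to0$ with all $c^j\in\operatorname{add}C$. It is $I$-special, for $I$ injective, if $I\in\operatorname{add}C$ and there is such a sequence with $c^j\in\operatorname{add}I$ for $0\leq j\leq k-1$. For $0\leq k\leq\operatorname{domdim}\Gamma$, the $k$-coshifted module $C^k$ is the basic $\Pi$-special $k$-cotilting module (unique up to isomorphism). For $j\geq0$: $\mathcal{C}_j(C)=\bigcap_{i\geq0,\,i\neq j}\ker\operatorname{Ext}^i_\Gamma(-,C)$ and, for $B=\operatorname{End}_\Gamma(C)^{\mathrm{op}}$, $\mathcal{T}_j(DC)=\bigcap_{i\geq0,\,i\neq j}\ker\operatorname{Ext}^i_B(DC,-)$, as full subcategories of the categories of $\Gamma$-modules and $B$-modules respectively ($\operatorname{Ext}^0=\operatorname{Hom}$). For a module $X$ and $m\geq0$, $\operatorname{gen}_m(X)$ is the full subcategory of modules $M$ admitting an exact sequence $X^m\to\cdots\to X^0\to M\to0$ with all $X^i\in\operatorname{add}X$ that stays exact under $\operatorname{Hom}(X,-)$. $\operatorname{cogen}^m(X)$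 is the full subcategory of modules $N$ admitting an exact sequence $0\to N\to X_0\to\cdots\to X_m$ with all $X_i\in\operatorname{add}X$ that stays exact under $\operatorname{Hom}(-,X)$. *)

theory Defs
  imports "HOL-Algebra.Module" "HOL-Algebra.Elementary_Groups"
begin

section \<open>Modules over finite-dimensional algebras\<close>

text \<open>A \<open>K\<close>-algebra and a left module over it are both represented by the record type
  \<open>module\<close> of \<open>HOL-Algebra\<close>. In an algebra \<open>A :: ('k, 'a) module\<close> the field \<open>smult\<close> is the
  scalar action of \<open>K\<close>; in an \<open>A\<close>-module \<open>M :: ('a, 'm) module\<close> it is the action of \<open>A\<close>, and the
  ring fields \<open>mult\<close> and \<open>one\<close> are irrelevant. The library locale \<open>module\<close> requires a commutative
  ring of scalars, so left modules over an arbitrary ring are introduced here.\<close>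

locale left_module = R?: ring R + M?: abelian_group M
  for R :: "('r, 'x) ring_scheme" (structure) and M :: "('r, 'm, 'y) module_scheme" (structure) +
  assumes smult_closed [simp, intro]:
      "\<lbrakk>a \<in> carrier R; x \<in> carrier M\<rbrakk> \<Longrightarrow> a \<odot>\<^bsub>M\<^esub> x \<in> carrier M"
    and smult_l_distr:
      "\<lbrakk>a \<in> carrier R; b \<in> carrier R; x \<in> carrier M\<rbrakk> \<Longrightarrow>
        (a \<oplus> b) \<odot>\<^bsub>M\<^esub> x = a \<odot>\<^bsub>M\<^esub> x \<oplus>\<^bsub>M\<^esub> b \<odot>\<^bsub>M\<^esub> x"
    and smult_r_distr:
      "\<lbrakk>a \<in> carrier R; x \<in> carrier M; y \<in> carrier M\<rbrakk> \<Longrightarrow>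
        a \<odot>\<^bsub>M\<^esub> (x \<oplus>\<^bsub>M\<^esub> y) = a \<odot>\<^bsub>M\<^esub> x \<oplus>\<^bsub>M\<^esub> a \<odot>\<^bsub>M\<^esub> y"
    and smult_assoc:
      "\<lbrakk>a \<in> carrier R; b \<in> carrier R; x \<in> carrier M\<rbrakk> \<Longrightarrow>
        (a \<otimes> b) \<odot>\<^bsub>M\<^esub> x = a \<odot>\<^bsub>M\<^esub> (b \<odot>\<^bsub>M\<^esub> x)"
    and smult_one [simp]:
      "x \<in> carrier M \<Longrightarrow> \<one> \<odot>\<^bsub>M\<^esub> x = x"

definition finitely_generated ::
    "('r, 'x) ring_scheme \<Rightarrow> ('r, 'm, 'y) module_scheme \<Rightarrow> bool" where
  "finitely_generated R M \<longleftrightarrow>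
     (\<exists>S. finite S \<and> S \<subseteq> carrier M \<and>
        (\<forall>x \<in> carrier M. \<exists>a \<in> S \<rightarrow> carrier R. x = (\<Oplus>\<^bsub>M\<^esub>s\<in>S. a s \<odot>\<^bsub>M\<^esub> s)))"

definition fg_module :: "('r, 'x) ring_scheme \<Rightarrow> ('r, 'm) module \<Rightarrow> bool" where
  "fg_module R M \<longleftrightarrow> left_module R M \<and> finitely_generated R M"

definition fd_algebra :: "'k ring \<Rightarrow> ('k, 'a) module \<Rightarrow> bool" where
  "fd_algebra K A \<longleftrightarrow>
     field K \<and> ring A \<and> module K A \<and> finitely_generated K A \<and>
     (\<forall>c \<in> carrier K. \<forall>x \<in> carrier A. \<forall>y \<in> carrier A.
        (c \<odot>\<^bsub>A\<^esub> x) \<otimes>\<^bsub>A\<^esub> y = c \<odot>\<^bsub>A\<^esub> (x \<otimes>\<^bsub>A\<^esub> y) \<and>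
        x \<otimes>\<^bsub>A\<^esub> (c \<odot>\<^bsub>A\<^esub> y) = c \<odot>\<^bsub>A\<^esub> (x \<otimes>\<^bsub>A\<^esub> y))"

definition opp :: "('k, 'a) module \<Rightarrow> ('k, 'a) module" where
  "opp A = A\<lparr>mult := \<lambda>x y. y \<otimes>\<^bsub>A\<^esub> x\<rparr>"

definition regular :: "('a, 'x) ring_scheme \<Rightarrow> ('a, 'a) module" where
  "regular A = \<lparr>carrier = carrier A, mult = mult A, one = one A,
                zero = zero A, add = add A, smult = mult A\<rparr>"

text \<open>Homomorphisms are extensional outside the domain, so that equality of homomorphisms is equality
  of functions.\<close>

definition mhom :: "('r, 'x) ring_scheme \<Rightarrow> ('r, 'm) module \<Rightarrow> ('r, 'n) module \<Rightarrow> ('m \<Rightarrow> 'n) set" where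
  "mhom R M N =
     {f \<in> carrier M \<rightarrow>\<^sub>E carrier N.
        (\<forall>x \<in> carrier M. \<forall>y \<in> carrier M. f (x \<oplus>\<^bsub>M\<^esub> y) = f x \<oplus>\<^bsub>N\<^esub> f y) \<and>
        (\<forall>a \<in> carrier R. \<forall>x \<in> carrier M. f (a \<odot>\<^bsub>M\<^esub> x) = a \<odot>\<^bsub>N\<^esub> f x)}"

definition iso_mod :: "('r, 'x) ring_scheme \<Rightarrow> ('r, 'm) module \<Rightarrow> ('r, 'n) module \<Rightarrow> bool" where
  "iso_mod R M N \<longleftrightarrow> (\<exists>f \<in> mhom R M N. bij_betw f (carrier M) (carrier N))"

definition zero_module :: "('r, 'm) module \<Rightarrow> bool" where
  "zero_module M \<longleftrightarrow> carrier M = {\<zero>\<^bsub>M\<^esub>}"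

text \<open>The \<open>K\<close>-vector space underlying a module over the \<open>K\<close>-algebra \<open>A\<close>.\<close>

definition kspace :: "('k, 'a) module \<Rightarrow> ('a, 'm) module \<Rightarrow> ('k, 'm) module" where
  "kspace A M = \<lparr>carrier = carrier M, mult = mult M, one = one M,
                 zero = zero M, add = add M, smult = \<lambda>c x. (c \<odot>\<^bsub>A\<^esub> \<one>\<^bsub>A\<^esub>) \<odot>\<^bsub>M\<^esub> x\<rparr>"

definition Hom :: "('k, 'a) module \<Rightarrow> ('a, 'm) module \<Rightarrow> ('a, 'n) module \<Rightarrow> ('k, 'm \<Rightarrow> 'n) module" where
  "Hom A M N =
     \<lparr>carrier = mhom A M N, mult = undefined, one = undefined,
      zero = (\<lambda>x \<in> carrier M. \<zero>\<^bsub>N\<^esub>),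
      add = (\<lambda>f g. \<lambda>x \<in> carrier M. f x \<oplus>\<^bsub>N\<^esub> g x),
      smult = (\<lambda>c f. \<lambda>x \<in> carrier M. c \<odot>\<^bsub>kspace A N\<^esub> f x)\<rparr>"

definition End :: "('k, 'a) module \<Rightarrow> ('a, 'm) module \<Rightarrow> ('k, 'm \<Rightarrow> 'm) module" where
  "End A M = (Hom A M M)\<lparr>mult := \<lambda>f g. compose (carrier M) f g, one := \<lambda>x \<in> carrier M. x\<rparr>"

text \<open>\<open>M\<close> as a left module over \<open>End A M\<close>, that is, as a right module over its opposite algebra.\<close>

definition over_End :: "('a, 'm) module \<Rightarrow> ('m \<Rightarrow> 'm, 'm) module" where
  "over_End M = \<lparr>carrier = carrier M, mult = mult M, one = one M,
                 zero = zero M, add = add M, smult = \<lambda>f x. f x\<rparr>"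

text \<open>The space \<open>Hom\<^sub>A(C, X)\<close> as a left module over \<open>opp (End A C)\<close>, acting by precomposition.\<close>

definition Hom_over_End :: "('k, 'a) module \<Rightarrow> ('a, 'c) module \<Rightarrow> ('a, 'n) module \<Rightarrow>
    ('c \<Rightarrow> 'c, 'c \<Rightarrow> 'n) module" where
  "Hom_over_End A C X =
     \<lparr>carrier = carrier (Hom A C X), mult = undefined, one = undefined,
      zero = zero (Hom A C X), add = add (Hom A C X),
      smult = \<lambda>b f. compose (carrier C) f b\<rparr>"

text \<open>For a left \<open>A\<close>-module \<open>M\<close>, the dual \<open>D M = Hom\<^sub>K(M, K)\<close> is a left \<open>opp A\<close>-module.\<close>

definition dual :: "'k ring \<Rightarrow> ('k, 'a) module \<Rightarrow> ('a, 'm) module \<Rightarrow> ('a, 'm \<Rightarrow> 'k) module" where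
  "dual K A M =
     \<lparr>carrier = mhom K (kspace A M) (regular K), mult = undefined, one = undefined,
      zero = (\<lambda>x \<in> carrier M. \<zero>\<^bsub>K\<^esub>),
      add = (\<lambda>\<phi> \<psi>. \<lambda>x \<in> carrier M. \<phi> x \<oplus>\<^bsub>K\<^esub> \<psi> x),
      smult = (\<lambda>a \<phi>. \<lambda>x \<in> carrier M. \<phi> (a \<odot>\<^bsub>M\<^esub> x))\<rparr>"

text \<open>The left \<open>A\<close>-module \<open>D A\<close> is the dual of the right regular module, which is the regular left
  module of \<open>opp A\<close>.\<close>

definition dual_regular :: "'k ring \<Rightarrow> ('k, 'a) module \<Rightarrow> ('a, 'a \<Rightarrow> 'k) module" where
  "dual_regular K A = dual K (opp A) (regular (opp A))"

text \<open>The left \<open>opp (End A C)\<close>-module \<open>D C\<close>.\<close>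

definition dual_over_End :: "'k ring \<Rightarrow> ('k, 'a) module \<Rightarrow> ('a, 'c) module \<Rightarrow>
    ('c \<Rightarrow> 'c, 'c \<Rightarrow> 'k) module" where
  "dual_over_End K A C = dual K (End A C) (over_End C)"

section \<open>Direct sums and summands\<close>

text \<open>Existentially or universally quantified auxiliary modules (complements, terms of resolutions,
  test objects) over a \<open>K\<close>-algebra \<open>A :: ('k, 'a) module\<close> range over all module structures on
  subsets of \<open>nat \<Rightarrow> 'k\<close>. Since \<open>nat \<Rightarrow> 'k\<close> contains a copy of \<open>K\<^sup>n\<close> for every \<open>n\<close>, every finitely
  generated module over a finite-dimensional \<open>K\<close>-algebra is isomorphic to one of these.\<close>

type_synonym ('k, 'a) umodule = "('a, nat \<Rightarrow> 'k) module"

definition dsum :: "('a, 'm) module \<Rightarrow> ('a, 'n) module \<Rightarrow> ('a, 'm \<times> 'n) module" where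
  "dsum M N =
     \<lparr>carrier = carrier M \<times> carrier N, mult = undefined, one = undefined,
      zero = (\<zero>\<^bsub>M\<^esub>, \<zero>\<^bsub>N\<^esub>),
      add = (\<lambda>x y. (fst x \<oplus>\<^bsub>M\<^esub> fst y, snd x \<oplus>\<^bsub>N\<^esub> snd y)),
      smult = (\<lambda>a x. (a \<odot>\<^bsub>M\<^esub> fst x, a \<odot>\<^bsub>N\<^esub> snd x))\<rparr>"

definition dsum_upto :: "nat \<Rightarrow> (nat \<Rightarrow> ('a, 'm) module) \<Rightarrow> ('a, nat \<Rightarrow> 'm) module" where
  "dsum_upto n M =
     \<lparr>carrier = (\<Pi>\<^sub>E i\<in>{..<n}. carrier (M i)), mult = undefined, one = undefined,
      zero = (\<lambda>i \<in> {..<n}. \<zero>\<^bsub>M i\<^esub>),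
      add = (\<lambda>x y. \<lambda>i \<in> {..<n}. x i \<oplus>\<^bsub>M i\<^esub> y i),
      smult = (\<lambda>a x. \<lambda>i \<in> {..<n}. a \<odot>\<^bsub>M i\<^esub> x i)\<rparr>"

definition summand :: "('k, 'a) module \<Rightarrow> ('a, 'm) module \<Rightarrow> ('a, 'n) module \<Rightarrow> bool" where
  "summand A N M \<longleftrightarrow>
     fg_module A N \<and> (\<exists>L :: ('k, 'a) umodule. fg_module A L \<and> iso_mod A (dsum N L) M)"

definition in_add :: "('k, 'a) module \<Rightarrow> ('a, 'm) module \<Rightarrow> ('a, 'n) module \<Rightarrow> bool" where
  "in_add A X M \<longleftrightarrow> (\<exists>n. summand A M (dsum_upto n (\<lambda>_. X)))"

definition indecomposable :: "('k, 'a) module \<Rightarrow> ('a, 'm) module \<Rightarrow> bool" where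
  "indecomposable A M \<longleftrightarrow>
     fg_module A M \<and> \<not> zero_module M \<and>
     (\<forall>(N :: ('k, 'a) umodule) (L :: ('k, 'a) umodule).
        fg_module A N \<and> fg_module A L \<and> iso_mod A (dsum N L) M \<longrightarrow> zero_module N \<or> zero_module L)"

definition basic_module :: "('k, 'a) module \<Rightarrow> ('a, 'm) module \<Rightarrow> bool" where
  "basic_module A M \<longleftrightarrow>
     (\<exists>n (X :: nat \<Rightarrow> ('k, 'a) umodule).
        (\<forall>i<n. indecomposable A (X i)) \<and>
        (\<forall>i<n. \<forall>j<n. i \<noteq> j \<longrightarrow> \<not> iso_mod A (X i) (X j)) \<and>
        iso_mod A (dsum_upto n X) M)"

definition basic_algebra :: "('k, 'a) module \<Rightarrow> bool" where
  "basic_algebra A \<longleftrightarrow> basic_module A (regular A)"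

section \<open>Projectives, injectives and exact sequences\<close>

definition projective :: "('k, 'a) module \<Rightarrow> ('a, 'm) module \<Rightarrow> bool" where
  "projective A P \<longleftrightarrow>
     fg_module A P \<and>
     (\<forall>(M :: ('k, 'a) umodule) (N :: ('k, 'a) umodule) g f.
        fg_module A M \<and> fg_module A N \<and>
        g \<in> mhom A M N \<and> g ` carrier M = carrier N \<and> f \<in> mhom A P N \<longrightarrow>
        (\<exists>h \<in> mhom A P M. compose (carrier P) g h = f))"

definition injective :: "('k, 'a) module \<Rightarrow> ('a, 'm) module \<Rightarrow> bool" where
  "injective A I \<longleftrightarrow>
     fg_module A I \<and>
     (\<forall>(M :: ('k, 'a) umodule) (N :: ('k, 'a) umodule) g f.
        fg_module A M \<and> fg_module A N \<and>
        g \<in> mhom A M N \<and> inj_on g (carrier M) \<and> f \<in> mhom A M I \<longrightarrow>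
        (\<exists>h \<in> mhom A N I. compose (carrier M) h g = f))"

definition exact_at ::
    "('r, 'l) module \<Rightarrow> ('l \<Rightarrow> 'm) \<Rightarrow> ('s, 'm) module \<Rightarrow> ('m \<Rightarrow> 'n) \<Rightarrow> ('t, 'n) module \<Rightarrow> bool" where
  "exact_at L f M g N \<longleftrightarrow> f ` carrier L = {x \<in> carrier M. g x = \<zero>\<^bsub>N\<^esub>}"

text \<open>Exactness of \<open>X\<^sub>m \<rightarrow> \<dots> \<rightarrow> X\<^sub>0 \<rightarrow> M \<rightarrow> 0\<close> at \<open>M, X\<^sub>0, \<dots>, X\<^sub>m\<^sub>-\<^sub>1\<close>, where
  \<open>d i : X\<^sub>i\<^sub>+\<^sub>1 \<rightarrow> X\<^sub>i\<close> and \<open>e : X\<^sub>0 \<rightarrow> M\<close>.\<close>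

definition exact_onto :: "nat \<Rightarrow> (nat \<Rightarrow> ('r, 'x) module) \<Rightarrow> (nat \<Rightarrow> 'x \<Rightarrow> 'x) \<Rightarrow>
    ('x \<Rightarrow> 'm) \<Rightarrow> ('r, 'm) module \<Rightarrow> bool" where
  "exact_onto m X d e M \<longleftrightarrow>
     e ` carrier (X 0) = carrier M \<and>
     (0 < m \<longrightarrow> exact_at (X 1) (d 0) (X 0) e M) \<and>
     (\<forall>i. Suc i < m \<longrightarrow> exact_at (X (Suc (Suc i))) (d (Suc i)) (X (Suc i)) (d i) (X i))"

text \<open>Exactness of \<open>0 \<rightarrow> N \<rightarrow> X\<^sub>0 \<rightarrow> \<dots> \<rightarrow> X\<^sub>m\<close> at \<open>N, X\<^sub>0, \<dots>, X\<^sub>m\<^sub>-\<^sub>1\<close>, where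
  \<open>e : N \<rightarrow> X\<^sub>0\<close> and \<open>d i : X\<^sub>i \<rightarrow> X\<^sub>i\<^sub>+\<^sub>1\<close>.\<close>

definition exact_into :: "nat \<Rightarrow> ('r, 'n) module \<Rightarrow> ('n \<Rightarrow> 'x) \<Rightarrow> (nat \<Rightarrow> ('r, 'x) module) \<Rightarrow>
    (nat \<Rightarrow> 'x \<Rightarrow> 'x) \<Rightarrow> bool" where
  "exact_into m N e X d \<longleftrightarrow>
     inj_on e (carrier N) \<and>
     (0 < m \<longrightarrow> exact_at N e (X 0) (d 0) (X 1)) \<and>
     (\<forall>i. Suc i < m \<longrightarrow> exact_at (X i) (d i) (X (Suc i)) (d (Suc i)) (X (Suc (Suc i))))"

definition exact_seq_onto :: "('k, 'a) module \<Rightarrow> nat \<Rightarrow> (nat \<Rightarrow> ('a, 'x) module) \<Rightarrow>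
    (nat \<Rightarrow> 'x \<Rightarrow> 'x) \<Rightarrow> ('x \<Rightarrow> 'm) \<Rightarrow> ('a, 'm) module \<Rightarrow> bool" where
  "exact_seq_onto A m X d e M \<longleftrightarrow>
     (\<forall>i\<le>m. fg_module A (X i)) \<and> fg_module A M \<and>
     (\<forall>i<m. d i \<in> mhom A (X (Suc i)) (X i)) \<and> e \<in> mhom A (X 0) M \<and>
     exact_onto m X d e M"

definition exact_seq_into :: "('k, 'a) module \<Rightarrow> nat \<Rightarrow> ('a, 'n) module \<Rightarrow> ('n \<Rightarrow> 'x) \<Rightarrow>
    (nat \<Rightarrow> ('a, 'x) module) \<Rightarrow> (nat \<Rightarrow> 'x \<Rightarrow> 'x) \<Rightarrow> bool" where
  "exact_seq_into A m N e X d \<longleftrightarrow>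
     (\<forall>i\<le>m. fg_module A (X i)) \<and> fg_module A N \<and>
     (\<forall>i<m. d i \<in> mhom A (X i) (X (Suc i))) \<and> e \<in> mhom A N (X 0) \<and>
     exact_into m N e X d"

definition proj_resolution :: "('k, 'a) module \<Rightarrow> (nat \<Rightarrow> ('k, 'a) umodule) \<Rightarrow>
    (nat \<Rightarrow> (nat \<Rightarrow> 'k) \<Rightarrow> nat \<Rightarrow> 'k) \<Rightarrow> ((nat \<Rightarrow> 'k) \<Rightarrow> 'm) \<Rightarrow> ('a, 'm) module \<Rightarrow> bool" where
  "proj_resolution A P d e M \<longleftrightarrow>
     (\<forall>m. exact_seq_onto A m P d e M) \<and> (\<forall>i. projective A (P i))"

definition inj_resolution :: "('k, 'a) module \<Rightarrow> ('a, 'm) module \<Rightarrow> ('m \<Rightarrow> nat \<Rightarrow> 'k) \<Rightarrow>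
    (nat \<Rightarrow> ('k, 'a) umodule) \<Rightarrow> (nat \<Rightarrow> (nat \<Rightarrow> 'k) \<Rightarrow> nat \<Rightarrow> 'k) \<Rightarrow> bool" where
  "inj_resolution A M e I d \<longleftrightarrow>
     (\<forall>m. exact_seq_into A m M e I d) \<and> (\<forall>i. injective A (I i))"

section \<open>Ext groups\<close>

definition cocycles :: "('k, 'a) module \<Rightarrow> nat \<Rightarrow> (nat \<Rightarrow> ('a, 'x) module) \<Rightarrow>
    (nat \<Rightarrow> 'x \<Rightarrow> 'x) \<Rightarrow> ('a, 'n) module \<Rightarrow> ('x \<Rightarrow> 'n) set" where
  "cocycles A i P d N =
     {f \<in> mhom A (P i) N. compose (carrier (P (Suc i))) f (d i) = \<zero>\<^bsub>Hom A (P (Suc i)) N\<^esub>}"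

definition coboundaries :: "('k, 'a) module \<Rightarrow> nat \<Rightarrow> (nat \<Rightarrow> ('a, 'x) module) \<Rightarrow>
    (nat \<Rightarrow> 'x \<Rightarrow> 'x) \<Rightarrow> ('a, 'n) module \<Rightarrow> ('x \<Rightarrow> 'n) set" where
  "coboundaries A i P d N =
     (case i of 0 \<Rightarrow> {\<zero>\<^bsub>Hom A (P 0) N\<^esub>}
              | Suc j \<Rightarrow> (\<lambda>g. compose (carrier (P (Suc j))) g (d j)) ` mhom A (P j) N)"

text \<open>The additive group \<open>Ext\<^sup>i\<^sub>A(M, N)\<close>: the \<open>i\<close>-th cohomology of \<open>Hom\<^sub>A(P, N)\<close> for a chosen
  projective resolution \<open>P\<close> of \<open>M\<close>. In particular \<open>Ext\<^sup>0\<^sub>A(M, N)\<close> is isomorphic to \<open>Hom\<^sub>A(M, N)\<close>.\<close>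

definition Ext :: "('k, 'a) module \<Rightarrow> nat \<Rightarrow> ('a, 'm) module \<Rightarrow> ('a, 'n) module \<Rightarrow>
    (((nat \<Rightarrow> 'k) \<Rightarrow> 'n) set) monoid" where
  "Ext A i M N =
     (let (P, d, _) = (SOME (P, d, e). proj_resolution A P d e M)
      in (add_monoid (Hom A (P i) N))\<lparr>carrier := cocycles A i P d N\<rparr> Mod coboundaries A i P d N)"

section \<open>Dominant dimension and coshifted modules\<close>

definition domdim_ge :: "('k, 'a) module \<Rightarrow> nat \<Rightarrow> bool" where
  "domdim_ge A k \<longleftrightarrow>
     (\<exists>e I d. inj_resolution A (regular A) e I d \<and> (\<forall>i<k. projective A (I i) \<and> injective A (I i)))"

definition domdim_eq :: "('k, 'a) module \<Rightarrow> nat \<Rightarrow> bool" where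
  "domdim_eq A k \<longleftrightarrow> domdim_ge A k \<and> \<not> domdim_ge A (Suc k)"

definition proj_inj_summand :: "('k, 'a) module \<Rightarrow> ('a, 'm) module \<Rightarrow> bool" where
  "proj_inj_summand A X \<longleftrightarrow> projective A X \<and> injective A X \<and> summand A X (regular A)"

definition maximal_proj_inj_summand :: "('k, 'a) module \<Rightarrow> ('a, 'm) module \<Rightarrow> bool" where
  "maximal_proj_inj_summand A Q \<longleftrightarrow>
     proj_inj_summand A Q \<and>
     (\<forall>X :: ('k, 'a) umodule. proj_inj_summand A X \<and> summand A Q X \<longrightarrow> iso_mod A Q X)"

text \<open>A zero module in position \<open>k + 1\<close> encodes the outer \<open>0\<close> of a finite exact sequence.\<close>

definition idim_le :: "('k, 'a) module \<Rightarrow> ('a, 'm) module \<Rightarrow> nat \<Rightarrow> bool" where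
  "idim_le A M k \<longleftrightarrow>
     (\<exists>e (I :: nat \<Rightarrow> ('k, 'a) umodule) d.
        exact_seq_into A (Suc k) M e I d \<and> zero_module (I (Suc k)) \<and> (\<forall>i\<le>k. injective A (I i)))"

definition cotilting_sequence :: "'k ring \<Rightarrow> ('k, 'a) module \<Rightarrow> nat \<Rightarrow> ('a, 'c) module \<Rightarrow>
    (nat \<Rightarrow> ('k, 'a) umodule) \<Rightarrow> bool" where
  "cotilting_sequence K A k C c \<longleftrightarrow>
     (\<exists>d e. exact_seq_onto A (Suc k) c d e (dual_regular K A)) \<and>
     zero_module (c (Suc k)) \<and> (\<forall>j\<le>k. in_add A C (c j))"

definition cotilting :: "'k ring \<Rightarrow> ('k, 'a) module \<Rightarrow> nat \<Rightarrow> ('a, 'c) module \<Rightarrow> bool" where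
  "cotilting K A k C \<longleftrightarrow>
     fg_module A C \<and> idim_le A C k \<and> (\<forall>i>0. trivial_group (Ext A i C C)) \<and>
     (\<exists>c. cotilting_sequence K A k C c)"

definition special_cotilting :: "'k ring \<Rightarrow> ('k, 'a) module \<Rightarrow> ('a, 'm) module \<Rightarrow> nat \<Rightarrow>
    ('a, 'c) module \<Rightarrow> bool" where
  "special_cotilting K A I k C \<longleftrightarrow>
     injective A I \<and> cotilting K A k C \<and> in_add A C I \<and>
     (\<exists>c. cotilting_sequence K A k C c \<and> (\<forall>j<k. in_add A I (c j)))"

text \<open>\<open>C\<close> is (isomorphic to) the \<open>k\<close>-coshifted module, where \<open>Q\<close> is the maximal
  projective-injective summand (usually denoted by a capital Pi, which is reserved syntax).\<close>

definition coshifted :: "'k ring \<Rightarrow> ('k, 'a) module \<Rightarrow> ('a, 'm) module \<Rightarrow> nat \<Rightarrow>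
    ('a, 'c) module \<Rightarrow> bool" where
  "coshifted K A Q k C \<longleftrightarrow> basic_module A C \<and> special_cotilting K A Q k C"

section \<open>Subcategories\<close>

text \<open>Full subcategories are represented by their classes of objects; the type of elements of the
  objects is left arbitrary.\<close>

definition zero_modules :: "('k, 'a) module \<Rightarrow> ('a, 'm) module set" where
  "zero_modules A = {M. fg_module A M \<and> zero_module M}"

definition ker_Hom_to :: "('k, 'a) module \<Rightarrow> ('a, 'x) module \<Rightarrow> ('a, 'm) module set" where
  "ker_Hom_to A X = {M. fg_module A M \<and> zero_module (Hom A M X)}"

definition ker_Hom_from :: "('k, 'a) module \<Rightarrow> ('a, 'x) module \<Rightarrow> ('a, 'm) module set" where
  "ker_Hom_from A X = {M. fg_module A M \<and> zero_module (Hom A X M)}"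

definition cotilt_class :: "('k, 'a) module \<Rightarrow> nat \<Rightarrow> ('a, 'c) module \<Rightarrow> ('a, 'm) module set" where
  "cotilt_class A j C =
     {M. fg_module A M \<and> (\<forall>i. i \<noteq> j \<longrightarrow> trivial_group (Ext A i M C))}"

definition tilt_class :: "('k, 'a) module \<Rightarrow> nat \<Rightarrow> ('a, 't) module \<Rightarrow> ('a, 'm) module set" where
  "tilt_class A j T =
     {M. fg_module A M \<and> (\<forall>i. i \<noteq> j \<longrightarrow> trivial_group (Ext A i T M))}"

definition gen :: "('k, 'a) module \<Rightarrow> nat \<Rightarrow> ('a, 'x) module \<Rightarrow> ('a, 'm) module set" where
  "gen A m X =
     {M. \<exists>(Y :: nat \<Rightarrow> ('k, 'a) umodule) d e.
        exact_seq_onto A m Y d e M \<and> (\<forall>i\<le>m. in_add A X (Y i)) \<and>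
        exact_onto m (\<lambda>i. Hom A X (Y i)) (\<lambda>i f. compose (carrier X) (d i) f)
          (\<lambda>f. compose (carrier X) e f) (Hom A X M)}"

definition cogen :: "('k, 'a) module \<Rightarrow> nat \<Rightarrow> ('a, 'x) module \<Rightarrow> ('a, 'm) module set" where
  "cogen A m X =
     {N. \<exists>(Y :: nat \<Rightarrow> ('k, 'a) umodule) d e.
        exact_seq_into A m N e Y d \<and> (\<forall>i\<le>m. in_add A X (Y i)) \<and>
        exact_onto m (\<lambda>i. Hom A (Y i) X) (\<lambda>i f. compose (carrier (Y i)) f (d i))
          (\<lambda>f. compose (carrier N) f e) (Hom A N X)}"

end

(*
  The cotilting sequence 0 -> c k -> ... -> c 0 -> D Gamma -> 0 has its terms c j, j < k, in add Q. As
  these are injective it is an injective resolution of c k, and Hom(C, -) turns it into a projective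
  resolution of D C. Since C is a summand of sums of c k and c 0, Ext between M and C can be read off
  this resolution: outside degree k it only involves Q, and in degree k also D Gamma, which detects
  zero modules. Vanishing of the higher Ext groups forces successive left approximations by add Q to
  be injective; over B the same holds for right approximations by add P, with surjectivity.
  P is a summand of D C because Q is a summand of D Gamma: by Fitting's lemma an indecomposable
  summand of a power of D Gamma is a summand of D Gamma, and Q has no repeated summands since Gamma
  is basic.
*)
theory Submission
  imports Defs
begin

section \<open>Linear maps and submodules\<close>

text \<open>Quotient modules are never formed. A module Y with a submodule S stands for Y/S where
  maps out of it matter (\<open>pe\<close>) and for S where maps into it matter (\<open>pg\<close>),
  and dimension shifting moves such pairs along a sequence. Vanishing of Ext is expressed as
  exactness of a Hom complex (\<open>hexl\<close>, \<open>hexr\<close>), a property that passes to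
  finite sums and summands (\<open>addr\<close>). As \<open>Ext\<close> is computed from one chosen
  projective resolution, the two kinds of resolution have to be compared
  (\<open>resolution_balance\<close>) before either argument can be varied. A cotilting sequence
  describes the \<open>c j\<close> by C and not C by the \<open>c j\<close>. That C is nevertheless
  a summand of sums of \<open>c k\<close> and \<open>c 0\<close> comes from its finite injective
  dimension: a coresolution of C by such sums shifts Ext^1 of the first cokernel into degree k + 1,
  where it vanishes, so the first map splits. The k - 1 in \<open>cogen\<close> and
  \<open>gen\<close> arises because an approximation is injective, or onto, once Ext^k vanishes,
  while each approximation raises by one the degree from which vanishing is known; so k of them can
  be made.\<close>

abbreviation lmod where "lmod \<equiv> left_module"
abbreviation fgm where "fgm \<equiv> fg_module"

text \<open>Drops the extensionality of \<open>mhom\<close>, so that sums and composites of maps can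
  be written as plain lambda terms; \<open>lhom_mhom\<close> restricts the result when a member of
  \<open>mhom\<close> is required.\<close>

definition lhom :: "('r, 'x) ring_scheme \<Rightarrow> ('r, 'm) module \<Rightarrow> ('r, 'n) module \<Rightarrow> ('m \<Rightarrow> 'n) set" where
  "lhom R M N =
     {f \<in> carrier M \<rightarrow> carrier N.
        (\<forall>x \<in> carrier M. \<forall>y \<in> carrier M. f (x \<oplus>\<^bsub>M\<^esub> y) = f x \<oplus>\<^bsub>N\<^esub> f y) \<and>
        (\<forall>a \<in> carrier R. \<forall>x \<in> carrier M. f (a \<odot>\<^bsub>M\<^esub> x) = a \<odot>\<^bsub>N\<^esub> f x)}"

definition submod :: "('r, 'x) ring_scheme \<Rightarrow> ('r, 'm, 'y) module_scheme \<Rightarrow> 'm set \<Rightarrow> bool" where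
  "submod R M S \<longleftrightarrow> S \<subseteq> carrier M \<and> zero M \<in> S \<and> (\<forall>x\<in>S. \<forall>y\<in>S. x \<oplus>\<^bsub>M\<^esub> y \<in> S) \<and>
     (\<forall>a\<in>carrier R. \<forall>x\<in>S. a \<odot>\<^bsub>M\<^esub> x \<in> S)"

text \<open>Only the carrier changes, so arithmetic in a submodule is literally that of
  \<open>M\<close>.\<close>

abbreviation subm :: "('r, 'm) module \<Rightarrow> 'm set \<Rightarrow> ('r, 'm) module" where
  "subm M S \<equiv> M\<lparr>carrier := S\<rparr>"

text \<open>Sums over initial segments unfold by recursion without the closure conditions that
  \<open>finsum\<close> carries, and linear maps commute with them by a plain induction.\<close>

primrec msum :: "('r, 'm, 'y) module_scheme \<Rightarrow> (nat \<Rightarrow> 'm) \<Rightarrow> nat \<Rightarrow> 'm" where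
  "msum M f 0 = zero M"
| "msum M f (Suc n) = msum M f n \<oplus>\<^bsub>M\<^esub> f n"

lemma lm_ring: "lmod R M \<Longrightarrow> ring R" and lm_abelian: "lmod R M \<Longrightarrow> abelian_group M"
  by (auto simp: left_module_def)

lemma left_moduleI:
  assumes "ring R" "abelian_group M"
    "\<And>a x. a \<in> carrier R \<Longrightarrow> x \<in> carrier M \<Longrightarrow> a \<odot>\<^bsub>M\<^esub> x \<in> carrier M"
    "\<And>a b x. a \<in> carrier R \<Longrightarrow> b \<in> carrier R \<Longrightarrow> x \<in> carrier M \<Longrightarrow>
        (a \<oplus>\<^bsub>R\<^esub> b) \<odot>\<^bsub>M\<^esub> x = a \<odot>\<^bsub>M\<^esub> x \<oplus>\<^bsub>M\<^esub> b \<odot>\<^bsub>M\<^esub> x"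
    "\<And>a x y. a \<in> carrier R \<Longrightarrow> x \<in> carrier M \<Longrightarrow> y \<in> carrier M \<Longrightarrow>
        a \<odot>\<^bsub>M\<^esub> (x \<oplus>\<^bsub>M\<^esub> y) = a \<odot>\<^bsub>M\<^esub> x \<oplus>\<^bsub>M\<^esub> a \<odot>\<^bsub>M\<^esub> y"
    "\<And>a b x. a \<in> carrier R \<Longrightarrow> b \<in> carrier R \<Longrightarrow> x \<in> carrier M \<Longrightarrow>
        (a \<otimes>\<^bsub>R\<^esub> b) \<odot>\<^bsub>M\<^esub> x = a \<odot>\<^bsub>M\<^esub> (b \<odot>\<^bsub>M\<^esub> x)"
    "\<And>x. x \<in> carrier M \<Longrightarrow> (one R) \<odot>\<^bsub>M\<^esub> x = x"
  shows "lmod R M" using assms by (simp add: left_module_def left_module_axioms_def)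

context left_module begin

lemma smult_l_null [simp]: "x \<in> carrier M \<Longrightarrow> \<zero> \<odot>\<^bsub>M\<^esub> x = zero M"
  by (metis R.zero_closed R.l_zero smult_l_distr smult_closed M.add.l_cancel_one)

lemma smult_r_null [simp]: "a \<in> carrier R \<Longrightarrow> a \<odot>\<^bsub>M\<^esub> zero M = zero M"
  by (metis M.zero_closed M.l_zero smult_r_distr smult_closed M.add.l_cancel_one)

lemma smult_l_minus: "\<lbrakk>a \<in> carrier R; x \<in> carrier M\<rbrakk> \<Longrightarrow> (\<ominus> a) \<odot>\<^bsub>M\<^esub> x = \<ominus>\<^bsub>M\<^esub> (a \<odot>\<^bsub>M\<^esub> x)"
  by (metis M.minus_equality R.a_inv_closed R.l_neg smult_closed smult_l_distr smult_l_null)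

lemma smult_r_minus: "\<lbrakk>a \<in> carrier R; x \<in> carrier M\<rbrakk> \<Longrightarrow> a \<odot>\<^bsub>M\<^esub> (\<ominus>\<^bsub>M\<^esub> x) = \<ominus>\<^bsub>M\<^esub> (a \<odot>\<^bsub>M\<^esub> x)"
  by (metis M.minus_equality M.a_inv_closed M.l_neg smult_closed smult_r_distr smult_r_null)

lemma msum_closed [simp]: "(\<And>s. s < n \<Longrightarrow> f s \<in> carrier M) \<Longrightarrow> msum M f n \<in> carrier M"
  by (induction n) auto

lemma msum_zero: "(\<And>s. s < n \<Longrightarrow> f s = zero M) \<Longrightarrow> msum M f n = zero M" by (induction n) auto

lemma msum_single: "(\<And>s. s < n \<Longrightarrow> s \<noteq> t \<Longrightarrow> f s = zero M) \<Longrightarrow> t < n \<Longrightarrow> f t \<in> carrier M \<Longrightarrow> msum M f n = f t"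
proof (induction n)
  case (Suc n)
  show ?case
  proof (cases "t = n")
    case True
    then have "msum M f n = zero M" using Suc.prems by (intro msum_zero) auto
    then show ?thesis using Suc.prems True by auto
  next
    case False
    then show ?thesis using Suc by auto
  qed
qed simp

lemma minus_diff_zero_iff: "x \<in> carrier M \<Longrightarrow> y \<in> carrier M \<Longrightarrow> x \<ominus>\<^bsub>M\<^esub> y = zero M \<longleftrightarrow> x = y"
  by (metis M.minus_eq M.minus_equality M.minus_minus M.r_neg M.a_inv_closed)

lemma diff_add_cancel: "x \<in> carrier M \<Longrightarrow> y \<in> carrier M \<Longrightarrow> y \<oplus>\<^bsub>M\<^esub> (x \<ominus>\<^bsub>M\<^esub> y) = x"
  by (metis M.minus_eq M.a_inv_closed M.a_lcomm M.r_neg M.r_zero)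

lemma submod_carrier [simp]: "submod R M (carrier M)" by (auto simp: submod_def)

lemma submod_zero [simp]: "submod R M {zero M}" by (auto simp: submod_def)

lemma submod_neg: "submod R M S \<Longrightarrow> x \<in> S \<Longrightarrow> \<ominus>\<^bsub>M\<^esub> x \<in> S"
  using smult_l_minus[of \<one> x] unfolding submod_def by (metis R.a_inv_closed R.one_closed smult_one subsetD)

lemma submod_diff: "submod R M S \<Longrightarrow> x \<in> S \<Longrightarrow> y \<in> S \<Longrightarrow> x \<ominus>\<^bsub>M\<^esub> y \<in> S"
  using submod_neg unfolding submod_def by (metis M.minus_eq)

lemma submod_msum: "submod R M S \<Longrightarrow> (\<And>s. s < n \<Longrightarrow> f s \<in> S) \<Longrightarrow> msum M f n \<in> S"
  by (induction n) (auto simp: submod_def)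

end

lemma msum_cong: "(\<And>s. s < n \<Longrightarrow> f s = g s) \<Longrightarrow> msum M f n = msum M g n" by (induction n) auto

lemma subm_module:
  assumes M: "lmod R M" and S: "submod R M S"
  shows "lmod R (subm M S)"
proof -
  interpret left_module R M by fact
  have sub: "S \<subseteq> carrier M" using S by (simp add: submod_def)
  have "abelian_group (subm M S)"
  proof (rule abelian_groupI)
    fix x assume "x \<in> carrier (subm M S)"
    then have x: "x \<in> S" "x \<in> carrier M" using sub by auto
    show "\<exists>y\<in>carrier (subm M S). y \<oplus>\<^bsub>subm M S\<^esub> x = zero (subm M S)"
      using submod_neg[OF S x(1)] x(2) by (auto intro!: bexI[of _ "\<ominus>\<^bsub>M\<^esub> x"] simp: M.l_neg)
  qed (use S sub in \<open>auto simp: submod_def M.a_assoc subsetD intro: M.a_comm\<close>)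
  then show ?thesis by (rule left_moduleI[OF lm_ring[OF M]])
      (use S sub in \<open>auto simp: submod_def smult_l_distr smult_r_distr smult_assoc subsetD\<close>)
qed

section \<open>Calculus of linear maps\<close>

lemma lhomI:
  assumes "\<And>x. x \<in> carrier M \<Longrightarrow> f x \<in> carrier N"
    "\<And>x y. x \<in> carrier M \<Longrightarrow> y \<in> carrier M \<Longrightarrow> f (x \<oplus>\<^bsub>M\<^esub> y) = f x \<oplus>\<^bsub>N\<^esub> f y"
    "\<And>a x. a \<in> carrier R \<Longrightarrow> x \<in> carrier M \<Longrightarrow> f (a \<odot>\<^bsub>M\<^esub> x) = a \<odot>\<^bsub>N\<^esub> f x"
  shows "f \<in> lhom R M N" using assms by (auto simp: lhom_def)

lemma lhom_in: "f \<in> lhom R M N \<Longrightarrow> x \<in> carrier M \<Longrightarrow> f x \<in> carrier N"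
  and lhom_add: "f \<in> lhom R M N \<Longrightarrow> x \<in> carrier M \<Longrightarrow> y \<in> carrier M \<Longrightarrow> f (x \<oplus>\<^bsub>M\<^esub> y) = f x \<oplus>\<^bsub>N\<^esub> f y"
  and lhom_smult: "f \<in> lhom R M N \<Longrightarrow> a \<in> carrier R \<Longrightarrow> x \<in> carrier M \<Longrightarrow> f (a \<odot>\<^bsub>M\<^esub> x) = a \<odot>\<^bsub>N\<^esub> f x"
  by (auto simp: lhom_def)

lemma lhom_zero:
  assumes "lmod R M" "lmod R N" "f \<in> lhom R M N"
  shows "f (zero M) = zero N"
proof -
  interpret M: left_module R M by fact
  interpret N: left_module R N by fact
  show ?thesis using lhom_smult[OF assms(3) M.R.zero_closed M.M.zero_closed] lhom_in[OF assms(3) M.M.zero_closed] by simp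
qed

lemma lhom_neg:
  assumes "lmod R M" "lmod R N" "f \<in> lhom R M N" "x \<in> carrier M"
  shows "f (\<ominus>\<^bsub>M\<^esub> x) = \<ominus>\<^bsub>N\<^esub> f x"
proof -
  interpret M: left_module R M by fact
  interpret N: left_module R N by fact
  have "f (\<ominus>\<^bsub>M\<^esub> x) \<oplus>\<^bsub>N\<^esub> f x = zero N"
    using lhom_add[OF assms(3) M.M.a_inv_closed[OF assms(4)] assms(4)] lhom_zero[OF assms(1-3)] by (simp add: M.M.l_neg assms(4))
  then show ?thesis using N.M.minus_equality lhom_in[OF assms(3)] assms(4) by simp
qed

lemma lhom_minus:
  assumes "lmod R M" "lmod R N" "f \<in> lhom R M N" "x \<in> carrier M" "y \<in> carrier M"
  shows "f (x \<ominus>\<^bsub>M\<^esub> y) = f x \<ominus>\<^bsub>N\<^esub> f y"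
proof -
  interpret M: left_module R M by fact
  interpret N: left_module R N by fact
  show ?thesis using assms by (simp add: M.M.minus_eq N.M.minus_eq lhom_add[OF assms(3)] lhom_neg[OF assms(1-3)])
qed

lemma lhom_simps:
  assumes "lmod R M" "lmod R N" "f \<in> lhom R M N"
  shows "\<And>x. x \<in> carrier M \<Longrightarrow> f x \<in> carrier N"
    and "\<And>x y. x \<in> carrier M \<Longrightarrow> y \<in> carrier M \<Longrightarrow> f (x \<oplus>\<^bsub>M\<^esub> y) = f x \<oplus>\<^bsub>N\<^esub> f y"
    and "\<And>a x. a \<in> carrier R \<Longrightarrow> x \<in> carrier M \<Longrightarrow> f (a \<odot>\<^bsub>M\<^esub> x) = a \<odot>\<^bsub>N\<^esub> f x"
    and "f (zero M) = zero N"
    and "\<And>x. x \<in> carrier M \<Longrightarrow> f (\<ominus>\<^bsub>M\<^esub> x) = \<ominus>\<^bsub>N\<^esub> f x"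
    and "\<And>x y. x \<in> carrier M \<Longrightarrow> y \<in> carrier M \<Longrightarrow> f (x \<ominus>\<^bsub>M\<^esub> y) = f x \<ominus>\<^bsub>N\<^esub> f y"
  by (rule lhom_in[OF assms(3)] lhom_add[OF assms(3)] lhom_smult[OF assms(3)] lhom_zero[OF assms]
      lhom_neg[OF assms] lhom_minus[OF assms] | assumption)+

lemma lhom_msum:
  assumes M: "lmod R M" and N: "lmod R N" and f: "f \<in> lhom R M N" and x: "\<And>s. s < n \<Longrightarrow> x s \<in> carrier M"
  shows "f (msum M x n) = msum N (\<lambda>s. f (x s)) n"
proof -
  interpret M: left_module R M by fact
  show ?thesis using x by (induction n) (auto simp: lhom_simps[OF M N f])
qed

lemma lhom_id: "(\<lambda>x. x) \<in> lhom R M M" by (auto intro: lhomI)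

lemma lhom_o: "f \<in> lhom R M N \<Longrightarrow> g \<in> lhom R N L \<Longrightarrow> (\<lambda>x. g (f x)) \<in> lhom R M L"
  by (auto simp: lhom_def Pi_iff)

lemma lhom_cong: "f \<in> lhom R M N \<Longrightarrow> lmod R M \<Longrightarrow> (\<And>x. x \<in> carrier M \<Longrightarrow> g x = f x) \<Longrightarrow> g \<in> lhom R M N"
proof -
  assume f: "f \<in> lhom R M N" and M: "lmod R M" and eq: "\<And>x. x \<in> carrier M \<Longrightarrow> g x = f x"
  interpret M: left_module R M by fact
  show ?thesis using f eq by (auto simp: lhom_def Pi_iff)
qed

lemma lhom_const0: "lmod R N \<Longrightarrow> (\<lambda>_. zero N) \<in> lhom R M N"
proof -
  assume "lmod R N"
  then interpret left_module R N .
  show ?thesis by (auto intro: lhomI)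
qed

lemma lhom_plus:
  assumes N: "lmod R N" and f: "f \<in> lhom R M N" and g: "g \<in> lhom R M N"
  shows "(\<lambda>x. f x \<oplus>\<^bsub>N\<^esub> g x) \<in> lhom R M N"
proof -
  interpret left_module R N by fact
  show ?thesis using f g by (auto simp: lhom_def Pi_iff M.a_ac smult_r_distr)
qed

lemma lhom_uminus:
  assumes N: "lmod R N" and f: "f \<in> lhom R M N"
  shows "(\<lambda>x. \<ominus>\<^bsub>N\<^esub> f x) \<in> lhom R M N"
proof -
  interpret left_module R N by fact
  show ?thesis using f by (auto simp: lhom_def Pi_iff M.minus_add smult_r_minus)
qed

lemma lhom_diff:
  assumes N: "lmod R N" and f: "f \<in> lhom R M N" and g: "g \<in> lhom R M N"
  shows "(\<lambda>x. f x \<ominus>\<^bsub>N\<^esub> g x) \<in> lhom R M N"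
proof -
  interpret left_module R N by fact
  show ?thesis using lhom_plus[OF N f lhom_uminus[OF N g]] by (simp add: M.minus_eq)
qed

lemma lhom_msum_map:
  assumes N: "lmod R N" and f: "\<And>s. s < n \<Longrightarrow> f s \<in> lhom R M N"
  shows "(\<lambda>x. msum N (\<lambda>s. f s x) n) \<in> lhom R M N"
  using f by (induction n) (auto intro: lhom_const0[OF N] lhom_plus[OF N])

lemma mhom_lhom: "f \<in> mhom R M N \<Longrightarrow> f \<in> lhom R M N" by (auto simp: mhom_def lhom_def)

lemma lhom_mhom:
  assumes "lmod R M" "f \<in> lhom R M N"
  shows "restrict f (carrier M) \<in> mhom R M N"
proof -
  interpret left_module R M by fact
  show ?thesis using assms(2) by (auto simp: mhom_def lhom_def)
qed

lemma submod_kernel: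
  assumes M: "lmod R M" and N: "lmod R N" and f: "f \<in> lhom R M N"
  shows "submod R M {x \<in> carrier M. f x = zero N}"
proof -
  interpret M: left_module R M by fact
  interpret N: left_module R N by fact
  show ?thesis by (auto simp: submod_def lhom_simps[OF M N f])
qed

lemma submod_vimage:
  assumes M: "lmod R M" and N: "lmod R N" and f: "f \<in> lhom R M N" and T: "submod R N T"
  shows "submod R M {x \<in> carrier M. f x \<in> T}"
proof -
  interpret M: left_module R M by fact
  interpret N: left_module R N by fact
  show ?thesis using T by (auto simp: submod_def lhom_simps[OF M N f])
qed

lemma submod_image:
  assumes M: "lmod R M" and N: "lmod R N" and f: "f \<in> lhom R M N" and S: "submod R M S"
  shows "submod R N (f ` S)"
proof -
  interpret M: left_module R M by fact
  interpret N: left_module R N by fact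
  have sub: "S \<subseteq> carrier M" using S by (simp add: submod_def)
  have cl: "zero M \<in> S" "\<And>x y. x \<in> S \<Longrightarrow> y \<in> S \<Longrightarrow> x \<oplus>\<^bsub>M\<^esub> y \<in> S" "\<And>a x. a \<in> carrier R \<Longrightarrow> x \<in> S \<Longrightarrow> a \<odot>\<^bsub>M\<^esub> x \<in> S"
    using S by (auto simp: submod_def)
  have 1: "f x \<oplus>\<^bsub>N\<^esub> f y \<in> f ` S" if "x \<in> S" "y \<in> S" for x y
    using that cl(2)[OF that] sub lhom_add[OF f] by (metis image_eqI subsetD)
  have 2: "a \<odot>\<^bsub>N\<^esub> f x \<in> f ` S" if "a \<in> carrier R" "x \<in> S" for a x
    using that cl(3)[OF that] sub lhom_smult[OF f] by (metis image_eqI subsetD)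
  have 3: "zero N \<in> f ` S" using cl(1) lhom_zero[OF M N f] by (metis image_eqI)
  show ?thesis using sub 1 2 3 lhom_in[OF f] by (auto simp: submod_def)
qed

lemma lhom_inj_iff:
  assumes M: "lmod R M" and N: "lmod R N" and f: "f \<in> lhom R M N"
  shows "inj_on f (carrier M) \<longleftrightarrow> (\<forall>x\<in>carrier M. f x = zero N \<longrightarrow> x = zero M)"
proof -
  interpret M: left_module R M by fact
  interpret N: left_module R N by fact
  show ?thesis
  proof
    assume inj: "inj_on f (carrier M)"
    show "\<forall>x\<in>carrier M. f x = zero N \<longrightarrow> x = zero M"
      using inj_onD[OF inj, of _ "zero M"] lhom_zero[OF M N f] by simp
  next
    assume *: "\<forall>x\<in>carrier M. f x = zero N \<longrightarrow> x = zero M"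
    show "inj_on f (carrier M)"
    proof (rule inj_onI)
      fix x y assume xy: "x \<in> carrier M" "y \<in> carrier M" "f x = f y"
      have "f (x \<ominus>\<^bsub>M\<^esub> y) = f x \<ominus>\<^bsub>N\<^esub> f y" by (rule lhom_minus[OF M N f xy(1,2)])
      also have "\<dots> = zero N" using N.minus_diff_zero_iff xy lhom_in[OF f] by blast
      finally have "x \<ominus>\<^bsub>M\<^esub> y = zero M" using * M.M.minus_closed[OF xy(1,2)] by blast
      then show "x = y" using M.minus_diff_zero_iff[OF xy(1,2)] by blast
    qed
  qed
qed

lemma lhom_inverse:
  assumes M: "lmod R M" and f: "f \<in> lhom R M N" and b: "bij_betw f (carrier M) (carrier N)"
  shows "inv_into (carrier M) f \<in> lhom R N M"
proof -
  interpret M: left_module R M by fact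
  define g where "g = inv_into (carrier M) f"
  have g: "\<And>y. y \<in> carrier N \<Longrightarrow> g y \<in> carrier M" "\<And>y. y \<in> carrier N \<Longrightarrow> f (g y) = y"
    "\<And>x. x \<in> carrier M \<Longrightarrow> g (f x) = x" using b by (auto simp: bij_betw_def inv_into_into f_inv_into_f g_def)
  have "g \<in> lhom R N M"
  proof (rule lhomI)
    fix x y assume xy: "x \<in> carrier N" "y \<in> carrier N"
    have "f (g x \<oplus>\<^bsub>M\<^esub> g y) = x \<oplus>\<^bsub>N\<^esub> y" using lhom_add[OF f g(1) g(1)] xy g(2) by simp
    then show "g (x \<oplus>\<^bsub>N\<^esub> y) = g x \<oplus>\<^bsub>M\<^esub> g y"
      using g(3)[of "g x \<oplus>\<^bsub>M\<^esub> g y"] g(1) xy by simp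
  next
    fix a x assume ax: "a \<in> carrier R" "x \<in> carrier N"
    have "f (a \<odot>\<^bsub>M\<^esub> g x) = a \<odot>\<^bsub>N\<^esub> x" using lhom_smult[OF f _ g(1)] ax g(2) by simp
    then show "g (a \<odot>\<^bsub>N\<^esub> x) = a \<odot>\<^bsub>M\<^esub> g x"
      using g(3)[of "a \<odot>\<^bsub>M\<^esub> g x"] g(1) ax by simp
  qed (use g in auto)
  then show ?thesis by (simp add: g_def)
qed

section \<open>Direct sums and finite generation\<close>

lemma regular_simps [simp]: "carrier (regular R) = carrier R" "add (regular R) = add R" "zero (regular R) = zero R"
  "smult (regular R) = mult R" by (simp_all add: regular_def)

lemma abelian_group_cong:
  assumes "abelian_group G" "carrier H = carrier G" "add H = add G" "zero H = zero G"
  shows "abelian_group H"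
proof -
  interpret abelian_group G by fact
  show ?thesis
    by (rule abelian_groupI) (use assms in \<open>auto simp: a_assoc intro: a_comm bexI[of _ "\<ominus>\<^bsub>G\<^esub> _"] simp: l_neg\<close>)
qed

lemma regular_module: "ring R \<Longrightarrow> lmod R (regular R)"
proof -
  assume "ring R"
  then interpret ring R .
  have "abelian_group (regular R)" by (rule abelian_group_cong[OF abelian_group_axioms]) auto
  then show ?thesis by (rule left_moduleI[OF \<open>ring R\<close>]) (auto simp: l_distr r_distr m_assoc)
qed

lemma dsum_simps [simp]: "carrier (dsum M N) = carrier M \<times> carrier N" "zero (dsum M N) = (zero M, zero N)"
  "x \<oplus>\<^bsub>dsum M N\<^esub> y = (fst x \<oplus>\<^bsub>M\<^esub> fst y, snd x \<oplus>\<^bsub>N\<^esub> snd y)"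
  "a \<odot>\<^bsub>dsum M N\<^esub> x = (a \<odot>\<^bsub>M\<^esub> fst x, a \<odot>\<^bsub>N\<^esub> snd x)" by (simp_all add: dsum_def)

lemma dsum_upto_simps [simp]: "carrier (dsum_upto n X) = (\<Pi>\<^sub>E i\<in>{..<n}. carrier (X i))"
  "zero (dsum_upto n X) = (\<lambda>i\<in>{..<n}. zero (X i))"
  "x \<oplus>\<^bsub>dsum_upto n X\<^esub> y = (\<lambda>i\<in>{..<n}. x i \<oplus>\<^bsub>X i\<^esub> y i)"
  "a \<odot>\<^bsub>dsum_upto n X\<^esub> x = (\<lambda>i\<in>{..<n}. a \<odot>\<^bsub>X i\<^esub> x i)" by (simp_all add: dsum_upto_def)

lemma lm_zero: "lmod R M \<Longrightarrow> zero M \<in> carrier M"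
  and lm_l_zero: "lmod R M \<Longrightarrow> x \<in> carrier M \<Longrightarrow> zero M \<oplus>\<^bsub>M\<^esub> x = x"
  by (auto simp: abelian_monoid.zero_closed abelian_monoid.l_zero lm_abelian abelian_group.axioms(1))

lemma dsum_module:
  assumes M: "lmod R M" and N: "lmod R N"
  shows "lmod R (dsum M N)"
proof -
  interpret M: left_module R M by fact
  interpret N: left_module R N by fact
  have "abelian_group (dsum M N)"
  proof (rule abelian_groupI)
    fix x assume "x \<in> carrier (dsum M N)"
    then show "\<exists>y\<in>carrier (dsum M N). y \<oplus>\<^bsub>dsum M N\<^esub> x = zero (dsum M N)"
      by (intro bexI[of _ "(\<ominus>\<^bsub>M\<^esub> fst x, \<ominus>\<^bsub>N\<^esub> snd x)"]) (auto simp: M.M.l_neg N.M.l_neg)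
  qed (auto simp: M.M.a_ac N.M.a_ac)
  then show ?thesis by (rule left_moduleI[OF lm_ring[OF M]])
      (auto simp: M.smult_l_distr N.smult_l_distr M.smult_r_distr N.smult_r_distr M.smult_assoc N.smult_assoc)
qed

lemma dsum_upto_module:
  assumes "ring R" and X: "\<And>i. i < n \<Longrightarrow> lmod R (X i)"
  shows "lmod R (dsum_upto n X)"
proof -
  have A: "abelian_group (X i)" if "i < n" for i using X[OF that] by (rule lm_abelian)
  have "abelian_group (dsum_upto n X)"
  proof (rule abelian_groupI)
    fix x assume x: "x \<in> carrier (dsum_upto n X)"
    show "\<exists>y\<in>carrier (dsum_upto n X). y \<oplus>\<^bsub>dsum_upto n X\<^esub> x = zero (dsum_upto n X)"
      using x A by (intro bexI[of _ "\<lambda>i\<in>{..<n}. \<ominus>\<^bsub>X i\<^esub> x i"])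
        (auto simp: PiE_iff abelian_group.l_neg abelian_group.a_inv_closed intro!: restrict_ext)
  next
    fix x y assume "x \<in> carrier (dsum_upto n X)" "y \<in> carrier (dsum_upto n X)"
    then show "x \<oplus>\<^bsub>dsum_upto n X\<^esub> y = y \<oplus>\<^bsub>dsum_upto n X\<^esub> x"
      using A by (auto simp: PiE_iff intro!: restrict_ext abelian_monoid.a_comm abelian_group.axioms(1))
  next
    fix x y z assume "x \<in> carrier (dsum_upto n X)" "y \<in> carrier (dsum_upto n X)" "z \<in> carrier (dsum_upto n X)"
    then show "(x \<oplus>\<^bsub>dsum_upto n X\<^esub> y) \<oplus>\<^bsub>dsum_upto n X\<^esub> z = x \<oplus>\<^bsub>dsum_upto n X\<^esub> (y \<oplus>\<^bsub>dsum_upto n X\<^esub> z)"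
      using A by (auto simp: PiE_iff intro!: restrict_ext abelian_monoid.a_assoc abelian_group.axioms(1))
  next
    fix x assume "x \<in> carrier (dsum_upto n X)"
    then show "zero (dsum_upto n X) \<oplus>\<^bsub>dsum_upto n X\<^esub> x = x"
      using A by (auto simp: PiE_iff fun_eq_iff extensional_def abelian_group.axioms(1) abelian_monoid.l_zero)
  next
    fix x y assume "x \<in> carrier (dsum_upto n X)" "y \<in> carrier (dsum_upto n X)"
    then show "x \<oplus>\<^bsub>dsum_upto n X\<^esub> y \<in> carrier (dsum_upto n X)"
      using A by (auto simp: PiE_iff abelian_group.axioms(1) abelian_monoid.a_closed)
  qed (use A in \<open>auto simp: PiE_iff abelian_group.axioms(1) abelian_monoid.zero_closed\<close>)
  then show ?thesis
  proof (rule left_moduleI[OF assms(1)])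
    fix a x assume "a \<in> carrier R" "x \<in> carrier (dsum_upto n X)"
    then show "a \<odot>\<^bsub>dsum_upto n X\<^esub> x \<in> carrier (dsum_upto n X)"
      by (auto simp: PiE_iff left_module.smult_closed[OF X])
  next
    fix a b x assume "a \<in> carrier R" "b \<in> carrier R" "x \<in> carrier (dsum_upto n X)"
    then show "(a \<oplus>\<^bsub>R\<^esub> b) \<odot>\<^bsub>dsum_upto n X\<^esub> x = a \<odot>\<^bsub>dsum_upto n X\<^esub> x \<oplus>\<^bsub>dsum_upto n X\<^esub> b \<odot>\<^bsub>dsum_upto n X\<^esub> x"
      by (auto simp: PiE_iff left_module.smult_l_distr[OF X] intro!: restrict_ext)
  next
    fix a x y assume "a \<in> carrier R" "x \<in> carrier (dsum_upto n X)" "y \<in> carrier (dsum_upto n X)"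
    then show "a \<odot>\<^bsub>dsum_upto n X\<^esub> (x \<oplus>\<^bsub>dsum_upto n X\<^esub> y) = a \<odot>\<^bsub>dsum_upto n X\<^esub> x \<oplus>\<^bsub>dsum_upto n X\<^esub> a \<odot>\<^bsub>dsum_upto n X\<^esub> y"
      by (auto simp: PiE_iff left_module.smult_r_distr[OF X] intro!: restrict_ext)
  next
    fix a b x assume "a \<in> carrier R" "b \<in> carrier R" "x \<in> carrier (dsum_upto n X)"
    then show "(a \<otimes>\<^bsub>R\<^esub> b) \<odot>\<^bsub>dsum_upto n X\<^esub> x = a \<odot>\<^bsub>dsum_upto n X\<^esub> (b \<odot>\<^bsub>dsum_upto n X\<^esub> x)"
      by (auto simp: PiE_iff left_module.smult_assoc[OF X] intro!: restrict_ext)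
  next
    fix x assume "x \<in> carrier (dsum_upto n X)"
    then show "one R \<odot>\<^bsub>dsum_upto n X\<^esub> x = x"
      by (auto simp: PiE_iff fun_eq_iff extensional_def left_module.smult_one[OF X])
  qed
qed

lemma lhom_proj: "i < n \<Longrightarrow> (\<lambda>x. x i) \<in> lhom R (dsum_upto n X) (X i)" by (rule lhomI) auto

lemma lhom_tuple:
  assumes "\<And>s. s < n \<Longrightarrow> h s \<in> lhom R M (X s)"
  shows "(\<lambda>m. \<lambda>s\<in>{..<n}. h s m) \<in> lhom R M (dsum_upto n X)"
  by (intro lhomI) (auto intro!: restrict_ext simp: lhom_in[OF assms] lhom_add[OF assms] lhom_smult[OF assms])

lemma lhom_cotuple:
  assumes R: "ring R" and X: "\<And>i. i < n \<Longrightarrow> lmod R (X i)" and M: "lmod R M"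
    and h: "\<And>s. s < n \<Longrightarrow> h s \<in> lhom R (X s) M"
  shows "(\<lambda>x. msum M (\<lambda>s. h s (x s)) n) \<in> lhom R (dsum_upto n X) M"
  by (intro lhom_msum_map[OF M] lhom_o[OF lhom_proj h])

text \<open>Embedding of the summand \<open>X i\<close>; the restriction to \<open>{..<n}\<close>
  keeps its values extensional, as the carrier of \<open>dsum_upto\<close> demands.\<close>

definition single :: "nat \<Rightarrow> (nat \<Rightarrow> ('r, 'm) module) \<Rightarrow> nat \<Rightarrow> 'm \<Rightarrow> nat \<Rightarrow> 'm" where
  "single n X i x = (\<lambda>j\<in>{..<n}. if j = i then x else zero (X j))"

lemma lhom_single:
  assumes X: "\<And>i. i < n \<Longrightarrow> lmod R (X i)" and i: "i < n"
  shows "single n X i \<in> lhom R (X i) (dsum_upto n X)"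
proof (rule lhomI)
  fix x assume "x \<in> carrier (X i)"
  then show "single n X i x \<in> carrier (dsum_upto n X)" by (auto simp: single_def lm_zero[OF X])
next
  fix x y
  show "single n X i (x \<oplus>\<^bsub>X i\<^esub> y) = single n X i x \<oplus>\<^bsub>dsum_upto n X\<^esub> single n X i y"
    by (auto simp: single_def fun_eq_iff lm_zero[OF X] lm_l_zero[OF X])
next
  fix a x assume "a \<in> carrier R"
  then show "single n X i (a \<odot>\<^bsub>X i\<^esub> x) = a \<odot>\<^bsub>dsum_upto n X\<^esub> single n X i x"
    by (auto simp: single_def fun_eq_iff left_module.smult_r_null[OF X])
qed

lemma dsum_upto_msum:
  assumes R: "ring R" and X: "\<And>i. i < n \<Longrightarrow> lmod R (X i)"
    and f: "\<And>s. s < m \<Longrightarrow> f s \<in> carrier (dsum_upto n X)" and i: "i < n"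
  shows "msum (dsum_upto n X) f m i = msum (X i) (\<lambda>s. f s i) m"
  using lhom_msum[OF dsum_upto_module[OF R X] X[OF i] lhom_proj[OF i] f] by simp

lemma dsum_upto_expand:
  assumes R: "ring R" and X: "\<And>i. i < n \<Longrightarrow> lmod R (X i)" and x: "x \<in> carrier (dsum_upto n X)"
  shows "msum (dsum_upto n X) (\<lambda>s. single n X s (x s)) n = x"
proof -
  interpret D: left_module R "dsum_upto n X" by (rule dsum_upto_module[OF R X])
  have cl: "single n X s (x s) \<in> carrier (dsum_upto n X)" if "s < n" for s
    using lhom_in[OF lhom_single[where X = X, OF X that]] x that by (auto simp: PiE_iff)
  have c: "msum (dsum_upto n X) (\<lambda>s. single n X s (x s)) n \<in> carrier (dsum_upto n X)" by (rule D.msum_closed[OF cl])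
  have "msum (dsum_upto n X) (\<lambda>s. single n X s (x s)) n i = x i" if i: "i < n" for i
  proof -
    interpret Xi: left_module R "X i" by (rule X[OF i])
    have "msum (dsum_upto n X) (\<lambda>s. single n X s (x s)) n i = msum (X i) (\<lambda>s. single n X s (x s) i) n"
      by (rule dsum_upto_msum[OF R X cl i])
    also have "\<dots> = single n X i (x i) i" by (rule Xi.msum_single) (use i x in \<open>auto simp: single_def PiE_iff\<close>)
    finally show ?thesis using i by (simp add: single_def)
  qed
  then show ?thesis using c x by (auto simp: PiE_iff extensional_def fun_eq_iff) (metis)
qed

section \<open>Finite generation\<close>

text \<open>Generation as minimality among submodules: a property holds for all elements as soon as
  it holds on \<open>S\<close> and cuts out a submodule. \<open>fg_iff\<close> compares this with
  linear combinations.\<close>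

definition gens :: "('r, 'x) ring_scheme \<Rightarrow> ('r, 'm, 'y) module_scheme \<Rightarrow> 'm set \<Rightarrow> bool" where
  "gens R M S \<longleftrightarrow> finite S \<and> S \<subseteq> carrier M \<and> (\<forall>T. submod R M T \<longrightarrow> S \<subseteq> T \<longrightarrow> carrier M \<subseteq> T)"

lemma (in left_module) finsum_submod:
  assumes T: "submod R M T" and "finite S" "S \<subseteq> T" "a \<in> S \<rightarrow> carrier R"
  shows "(\<Oplus>\<^bsub>M\<^esub>s\<in>S. a s \<odot>\<^bsub>M\<^esub> s) \<in> T" using assms(2-)
proof (induction S)
  case (insert x F)
  have T': "T \<subseteq> carrier M" using T by (simp add: submod_def)
  then have cl: "(\<lambda>s. a s \<odot>\<^bsub>M\<^esub> s) \<in> F \<rightarrow> carrier M" "a x \<odot>\<^bsub>M\<^esub> x \<in> carrier M"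
    using insert.prems by (auto simp: Pi_iff)
  have "(\<Oplus>\<^bsub>M\<^esub>s\<in>F. a s \<odot>\<^bsub>M\<^esub> s) \<in> T" using insert by auto
  moreover have "a x \<odot>\<^bsub>M\<^esub> x \<in> T" using insert.prems T by (auto simp: submod_def)
  ultimately show ?case using M.finsum_insert[OF insert.hyps cl] T by (auto simp: submod_def)
qed (use T in \<open>simp add: submod_def\<close>)

lemma (in left_module) finsum_smult':
  assumes "finite S" "f \<in> S \<rightarrow> carrier M" "a \<in> carrier R"
  shows "a \<odot>\<^bsub>M\<^esub> (\<Oplus>\<^bsub>M\<^esub>s\<in>S. f s) = (\<Oplus>\<^bsub>M\<^esub>s\<in>S. a \<odot>\<^bsub>M\<^esub> f s)"
  using assms(1,2)
proof (induction S)
  case (insert x F)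
  then have "f \<in> F \<rightarrow> carrier M" "f x \<in> carrier M" by auto
  moreover have "(\<lambda>s. a \<odot>\<^bsub>M\<^esub> f s) \<in> F \<rightarrow> carrier M" using insert.prems assms(3) by auto
  ultimately show ?case using insert assms(3) M.finsum_insert[of F x f] M.finsum_insert[of F x "\<lambda>s. a \<odot>\<^bsub>M\<^esub> f s"]
    by (simp add: smult_r_distr)
qed (use assms(3) in simp)

text \<open>A submodule containing \<open>S\<close> contains all linear combinations of
  \<open>S\<close>; conversely the combinations themselves form a submodule containing
  \<open>S\<close>.\<close>

lemma (in left_module) fg_iff: "finitely_generated R M \<longleftrightarrow> (\<exists>S. gens R M S)"
proof
  assume "finitely_generated R M"
  then obtain S where S: "finite S" "S \<subseteq> carrier M"
    "\<forall>x \<in> carrier M. \<exists>a \<in> S \<rightarrow> carrier R. x = (\<Oplus>\<^bsub>M\<^esub>s\<in>S. a s \<odot>\<^bsub>M\<^esub> s)"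
    by (auto simp: finitely_generated_def)
  have "carrier M \<subseteq> T" if "submod R M T" "S \<subseteq> T" for T
  proof
    fix x assume "x \<in> carrier M"
    with S(3) obtain a where "a \<in> S \<rightarrow> carrier R" "x = (\<Oplus>\<^bsub>M\<^esub>s\<in>S. a s \<odot>\<^bsub>M\<^esub> s)" by blast
    then show "x \<in> T" using finsum_submod[OF that(1) S(1) that(2)] by simp
  qed
  then show "\<exists>S. gens R M S" using S unfolding gens_def by blast
next
  assume "\<exists>S. gens R M S"
  then obtain S where S: "finite S" "S \<subseteq> carrier M"
    and gen: "\<And>T. submod R M T \<Longrightarrow> S \<subseteq> T \<Longrightarrow> carrier M \<subseteq> T" by (auto simp: gens_def)
  let ?g = "\<lambda>a. \<Oplus>\<^bsub>M\<^esub>s\<in>S. a s \<odot>\<^bsub>M\<^esub> s"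
  let ?T = "?g ` (S \<rightarrow> carrier R)"
  have fun1: "(\<lambda>s. a s \<odot>\<^bsub>M\<^esub> s) \<in> S \<rightarrow> carrier M" if "a \<in> S \<rightarrow> carrier R" for a
    using that S(2) by (auto simp: Pi_iff)
  have "submod R M ?T" unfolding submod_def
  proof (intro conjI ballI)
    show "?T \<subseteq> carrier M" using fun1 by (auto intro: M.finsum_closed)
    have "zero M = ?g (\<lambda>_. \<zero>)"
      using S(2) M.finsum_cong'[of S S "\<lambda>_. zero M" "\<lambda>s. \<zero> \<odot>\<^bsub>M\<^esub> s"] by (auto simp: subsetD)
    then show "zero M \<in> ?T" by (intro image_eqI[of _ _ "\<lambda>_. \<zero>"]) auto
  next
    fix x y assume "x \<in> ?T" "y \<in> ?T"
    then obtain a b where ab: "a \<in> S \<rightarrow> carrier R" "b \<in> S \<rightarrow> carrier R" "x = ?g a" "y = ?g b" by blast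
    have "x \<oplus>\<^bsub>M\<^esub> y = (\<Oplus>\<^bsub>M\<^esub>s\<in>S. a s \<odot>\<^bsub>M\<^esub> s \<oplus>\<^bsub>M\<^esub> b s \<odot>\<^bsub>M\<^esub> s)"
      using M.finsum_addf[OF fun1[OF ab(1)] fun1[OF ab(2)]] ab by simp
    also have "\<dots> = ?g (\<lambda>s. a s \<oplus> b s)"
      using ab S(2) by (intro M.finsum_cong') (auto simp: Pi_iff smult_l_distr subsetD)
    finally show "x \<oplus>\<^bsub>M\<^esub> y \<in> ?T" using ab by (intro image_eqI[of _ _ "\<lambda>s. a s \<oplus> b s"]) auto
  next
    fix r x assume r: "r \<in> carrier R" and "x \<in> ?T"
    then obtain a where a: "a \<in> S \<rightarrow> carrier R" "x = ?g a" by blast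
    have "r \<odot>\<^bsub>M\<^esub> x = (\<Oplus>\<^bsub>M\<^esub>s\<in>S. r \<odot>\<^bsub>M\<^esub> (a s \<odot>\<^bsub>M\<^esub> s))"
      using finsum_smult'[OF S(1) fun1[OF a(1)] r] a by simp
    also have "\<dots> = ?g (\<lambda>s. r \<otimes> a s)" using a S(2) r by (intro M.finsum_cong') (auto simp: Pi_iff smult_assoc subsetD)
    finally show "r \<odot>\<^bsub>M\<^esub> x \<in> ?T" using a r by (intro image_eqI[of _ _ "\<lambda>s. r \<otimes> a s"]) auto
  qed
  moreover have "S \<subseteq> ?T"
  proof
    fix s assume s: "s \<in> S"
    have "?g (\<lambda>t. if s = t then \<one> else \<zero>) = (\<Oplus>\<^bsub>M\<^esub>t\<in>S. if s = t then s else zero M)"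
      using S(2) s by (intro M.finsum_cong') (auto simp: subsetD)
    also have "\<dots> = s" using S s M.finsum_singleton[of s S "\<lambda>_. s"] by (auto simp: Pi_iff)
    finally show "s \<in> ?T" by (intro image_eqI[of _ _ "\<lambda>t. if s = t then \<one> else \<zero>"]) auto
  qed
  ultimately have "carrier M \<subseteq> ?T" by (rule gen)
  then show "finitely_generated R M" unfolding finitely_generated_def using S by blast
qed

lemma fg_moduleI: "lmod R M \<Longrightarrow> gens R M S \<Longrightarrow> fgm R M" using left_module.fg_iff by (auto simp: fg_module_def)

lemma fg_moduleD: "fgm R M \<Longrightarrow> lmod R M" "fgm R M \<Longrightarrow> \<exists>S. gens R M S"
  using left_module.fg_iff by (auto simp: fg_module_def)

lemmas fg_left = fg_moduleD(1)

lemma gens_image: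
  assumes M: "lmod R M" and N: "lmod R N" and f: "f \<in> lhom R M N" and s: "f ` carrier M = carrier N" and S: "gens R M S"
  shows "gens R N (f ` S)" unfolding gens_def
proof (intro conjI allI impI)
  show "finite (f ` S)" "f ` S \<subseteq> carrier N" using S s by (auto simp: gens_def)
  fix T assume T: "submod R N T" "f ` S \<subseteq> T"
  have "S \<subseteq> {x \<in> carrier M. f x \<in> T}" using S T(2) unfolding gens_def by blast
  then have "carrier M \<subseteq> {x \<in> carrier M. f x \<in> T}" using S submod_vimage[OF M N f T(1)] unfolding gens_def by blast
  then show "carrier N \<subseteq> T" unfolding s[symmetric] by auto
qed

lemma fg_image:
  assumes "fgm R M" "lmod R N" "f \<in> lhom R M N" "f ` carrier M = carrier N"
  shows "fgm R N"
proof -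
  have M: "lmod R M" by (rule fg_left[OF assms(1)])
  obtain S where "gens R M S" using fg_moduleD(2)[OF assms(1)] by blast
  from gens_image[OF M assms(2-4) this] show ?thesis by (rule fg_moduleI[OF assms(2)])
qed

lemma fg_zero:
  assumes M: "lmod R M" and z: "zero_module M"
  shows "fgm R M"
proof -
  have "gens R M {}" unfolding gens_def
  proof (intro conjI allI impI)
    fix T assume "submod R M T"
    then show "carrier M \<subseteq> T" using z by (simp add: submod_def zero_module_def)
  qed auto
  then show ?thesis by (rule fg_moduleI[OF M])
qed

lemma fg_dsum_upto:
  assumes R: "ring R" and X: "\<And>i. i < n \<Longrightarrow> fgm R (X i)"
  shows "fgm R (dsum_upto n X)"
proof -
  have X': "lmod R (X i)" if "i < n" for i using X[OF that] by (rule fg_moduleD)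
  have "\<forall>i\<in>{..<n}. \<exists>S. gens R (X i) S" using X fg_moduleD(2) by auto
  from bchoice[OF this] obtain S where S: "\<And>i. i < n \<Longrightarrow> gens R (X i) (S i)" by auto
  let ?G = "\<Union>i<n. single n X i ` S i"
  let ?D = "dsum_upto n X"
  have D: "lmod R ?D" by (rule dsum_upto_module[OF R X'])
  interpret D: left_module R ?D by (rule D)
  have "gens R ?D ?G" unfolding gens_def
  proof (intro conjI allI impI)
    show "finite ?G" using S by (auto simp: gens_def)
    show "?G \<subseteq> carrier ?D"
    proof
      fix y assume "y \<in> ?G"
      then obtain i x where "i < n" "x \<in> S i" "y = single n X i x" by auto
      then show "y \<in> carrier ?D" using S[of i] lhom_in[OF lhom_single[where X = X, OF X']] unfolding gens_def by blast
    qed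
    fix T assume T: "submod R ?D T" "?G \<subseteq> T"
    show "carrier ?D \<subseteq> T"
    proof
      fix x assume x: "x \<in> carrier ?D"
      \<comment> \<open>The elements of \<open>X i\<close> whose embedding lies in \<open>T\<close>
        form a submodule containing the generators of \<open>X i\<close>.\<close>
      have "single n X i (x i) \<in> T" if i: "i < n" for i
      proof -
        have "carrier (X i) \<subseteq> {y \<in> carrier (X i). single n X i y \<in> T}"
          using S[OF i] submod_vimage[OF X'[OF i] D lhom_single[where X = X, OF X' i] T(1)] T(2) i unfolding gens_def by blast
        then show ?thesis using x i by (auto simp: PiE_iff)
      qed
      then have "msum ?D (\<lambda>s. single n X s (x s)) n \<in> T" by (rule D.submod_msum[OF T(1)])
      then show "x \<in> T" using dsum_upto_expand[OF R X' x] by simp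
    qed
  qed
  then show ?thesis by (rule fg_moduleI[OF D])
qed

lemma fg_dsum:
  assumes "fgm R M" "fgm R N"
  shows "fgm R (dsum M N)"
proof -
  have M: "lmod R M" and N: "lmod R N" using assms fg_moduleD by auto
  interpret M: left_module R M by fact
  interpret N: left_module R N by fact
  obtain S T where S: "gens R M S" and T: "gens R N T" using fg_moduleD(2)[OF assms(1)] fg_moduleD(2)[OF assms(2)] by blast
  let ?i = "\<lambda>x. (x, zero N)" and ?j = "\<lambda>y. (zero M, y)"
  have i: "?i \<in> lhom R M (dsum M N)" and j: "?j \<in> lhom R N (dsum M N)" by (auto intro!: lhomI)
  have D: "lmod R (dsum M N)" by (rule dsum_module[OF M N])
  have "gens R (dsum M N) (?i ` S \<union> ?j ` T)" unfolding gens_def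
  proof (intro conjI allI impI)
    show "finite (?i ` S \<union> ?j ` T)" "?i ` S \<union> ?j ` T \<subseteq> carrier (dsum M N)" using S T by (auto simp: gens_def)
    fix U assume U: "submod R (dsum M N) U" "?i ` S \<union> ?j ` T \<subseteq> U"
    have 1: "carrier M \<subseteq> {y \<in> carrier M. ?i y \<in> U}" using S submod_vimage[OF M D i U(1)] U(2) unfolding gens_def by blast
    have 2: "carrier N \<subseteq> {y \<in> carrier N. ?j y \<in> U}" using T submod_vimage[OF N D j U(1)] U(2) unfolding gens_def by blast
    show "carrier (dsum M N) \<subseteq> U"
    proof
      fix z assume z: "z \<in> carrier (dsum M N)"
      have "?i (fst z) \<in> U" "?j (snd z) \<in> U" using 1 2 z by auto
      then have "?i (fst z) \<oplus>\<^bsub>dsum M N\<^esub> ?j (snd z) \<in> U" using U(1) unfolding submod_def by blast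
      then show "z \<in> U" using z by auto
    qed
  qed
  then show ?thesis by (rule fg_moduleI[OF D])
qed

section \<open>Finite-dimensional vector spaces\<close>

lemma (in left_module) add_lcancel:
  assumes "x \<in> carrier M" "y \<in> carrier M" "z \<in> carrier M" "x \<oplus>\<^bsub>M\<^esub> y = x \<oplus>\<^bsub>M\<^esub> z"
  shows "y = z"
proof -
  have "\<ominus>\<^bsub>M\<^esub> x \<oplus>\<^bsub>M\<^esub> (x \<oplus>\<^bsub>M\<^esub> y) = \<ominus>\<^bsub>M\<^esub> x \<oplus>\<^bsub>M\<^esub> (x \<oplus>\<^bsub>M\<^esub> z)" by (simp only: assms(4))
  then show ?thesis using assms(1-3) by (simp add: M.l_neg flip: M.a_assoc)
qed

lemma subm_self: "subm M (carrier M) = M" by simp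

locale fspace = F?: field K + left_module K V
  for K :: "'k ring" (structure) and V :: "('k, 'v) module" (structure)

lemma fspaceI: "field K \<Longrightarrow> lmod K V \<Longrightarrow> fspace K V" by (simp add: fspace_def)

context fspace begin

text \<open>Division by a nonzero scalar, through which the field property enters this section:
  \<open>decomp_unique\<close> and the exchange argument of \<open>gdim_surj_less\<close> rest on
  it.\<close>

lemma submod_inv:
  assumes T: "submod K V T" and x: "x \<in> carrier V" and a: "a \<in> carrier K" "a \<noteq> \<zero>" and ax: "a \<odot>\<^bsub>V\<^esub> x \<in> T"
  shows "x \<in> T"
proof -
  have i: "inv\<^bsub>K\<^esub> a \<in> carrier K" "inv\<^bsub>K\<^esub> a \<otimes> a = \<one>" using a field_Units by auto
  have "inv\<^bsub>K\<^esub> a \<odot>\<^bsub>V\<^esub> (a \<odot>\<^bsub>V\<^esub> x) \<in> T" using T ax i by (auto simp: submod_def)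
  then show ?thesis using smult_assoc[OF i(1) a(1) x] i x by simp
qed

lemma decomp_unique:
  assumes T: "submod K V T" and x: "x \<in> carrier V" "x \<notin> T"
    and t: "t \<in> T" "t' \<in> T" and a: "a \<in> carrier K" "a' \<in> carrier K"
    and eq: "t \<oplus>\<^bsub>V\<^esub> a \<odot>\<^bsub>V\<^esub> x = t' \<oplus>\<^bsub>V\<^esub> a' \<odot>\<^bsub>V\<^esub> x"
  shows "t = t'" "a = a'"
proof -
  have c: "t \<in> carrier V" "t' \<in> carrier V" using T t by (auto simp: submod_def)
  have ax: "a \<odot>\<^bsub>V\<^esub> x \<in> carrier V" "a' \<odot>\<^bsub>V\<^esub> x \<in> carrier V" using a x by auto
  have "(a \<ominus> a') \<odot>\<^bsub>V\<^esub> x = a \<odot>\<^bsub>V\<^esub> x \<ominus>\<^bsub>V\<^esub> a' \<odot>\<^bsub>V\<^esub> x"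
    using a x by (simp add: F.minus_eq M.minus_eq smult_l_distr smult_l_minus)
  also have "\<dots> = t' \<ominus>\<^bsub>V\<^esub> t"
  proof -
    have "t \<oplus>\<^bsub>V\<^esub> (a \<odot>\<^bsub>V\<^esub> x \<ominus>\<^bsub>V\<^esub> a' \<odot>\<^bsub>V\<^esub> x) = (t \<oplus>\<^bsub>V\<^esub> a \<odot>\<^bsub>V\<^esub> x) \<ominus>\<^bsub>V\<^esub> a' \<odot>\<^bsub>V\<^esub> x"
      using c ax by (simp add: M.minus_eq M.a_assoc)
    also have "\<dots> = t'" unfolding eq using c ax by (simp add: M.minus_eq M.a_assoc M.r_neg)
    finally have "t \<oplus>\<^bsub>V\<^esub> (a \<odot>\<^bsub>V\<^esub> x \<ominus>\<^bsub>V\<^esub> a' \<odot>\<^bsub>V\<^esub> x) = t \<oplus>\<^bsub>V\<^esub> (t' \<ominus>\<^bsub>V\<^esub> t)"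
      using c by (simp add: diff_add_cancel)
    from add_lcancel[OF c(1) _ _ this] show ?thesis using c ax by auto
  qed
  finally have "(a \<ominus> a') \<odot>\<^bsub>V\<^esub> x \<in> T" using submod_diff[OF T t(2,1)] by simp
  then have z: "a \<ominus> a' = \<zero>" using submod_inv[OF T x(1)] x(2) a by blast
  have "a = (a \<ominus> a') \<oplus> a'" using a by (simp add: F.minus_eq F.a_assoc F.l_neg)
  also have "\<dots> = a'" using a unfolding z by simp
  finally show "a = a'" .
  then show "t = t'" using eq c ax add_lcancel[of "a \<odot>\<^bsub>V\<^esub> x" t t'] by (simp add: M.a_comm)
qed

text \<open>\<open>T'\<close> is \<open>T + K x\<close>, and \<open>\<tau>\<close>,
  \<open>\<alpha>\<close> are the two coordinates; they are linear because the decomposition is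
  unique.\<close>

lemma adjoin:
  assumes T: "submod K V T" and x: "x \<in> carrier V" "x \<notin> T"
  obtains T' \<tau> \<alpha> where "submod K V T'" "T \<subseteq> T'" "x \<in> T'"
    "\<tau> \<in> lhom K (subm V T') V" "\<alpha> \<in> lhom K (subm V T') (regular K)"
    "\<forall>y\<in>T'. \<tau> y \<in> T" "\<forall>y\<in>T'. y = \<tau> y \<oplus>\<^bsub>V\<^esub> \<alpha> y \<odot>\<^bsub>V\<^esub> x"
    "\<forall>y\<in>T. \<tau> y = y" "\<forall>y\<in>T. \<alpha> y = \<zero>"
proof -
  define T' where "T' = {t \<oplus>\<^bsub>V\<^esub> a \<odot>\<^bsub>V\<^esub> x | t a. t \<in> T \<and> a \<in> carrier K}"
  have Tc: "T \<subseteq> carrier V" and Tz: "zero V \<in> T" and Ta: "\<And>x y. x \<in> T \<Longrightarrow> y \<in> T \<Longrightarrow> x \<oplus>\<^bsub>V\<^esub> y \<in> T"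
    and Ts: "\<And>a x. a \<in> carrier K \<Longrightarrow> x \<in> T \<Longrightarrow> a \<odot>\<^bsub>V\<^esub> x \<in> T"
    using T by (auto simp: submod_def)
  have "\<forall>y\<in>T'. \<exists>p. fst p \<in> T \<and> snd p \<in> carrier K \<and> y = fst p \<oplus>\<^bsub>V\<^esub> snd p \<odot>\<^bsub>V\<^esub> x"
    by (auto simp: T'_def)
  from bchoice[OF this] obtain p where
    p: "\<And>y. y \<in> T' \<Longrightarrow> fst (p y) \<in> T \<and> snd (p y) \<in> carrier K \<and> y = fst (p y) \<oplus>\<^bsub>V\<^esub> snd (p y) \<odot>\<^bsub>V\<^esub> x"
    by blast
  define \<tau> where "\<tau> y = fst (p y)" for y
  define \<alpha> where "\<alpha> y = snd (p y)" for y
  have \<tau>: "\<tau> y \<in> T" "\<tau> y \<in> carrier V" and \<alpha>: "\<alpha> y \<in> carrier K" and eq: "y = \<tau> y \<oplus>\<^bsub>V\<^esub> \<alpha> y \<odot>\<^bsub>V\<^esub> x" if "y \<in> T'" for y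
    using p[OF that] Tc by (auto simp: \<tau>_def \<alpha>_def)
  have uniq: "\<tau> y = t" "\<alpha> y = a" and in': "y \<in> T'"
    if "y = t \<oplus>\<^bsub>V\<^esub> a \<odot>\<^bsub>V\<^esub> x" "t \<in> T" "a \<in> carrier K" for y t a
  proof -
    show y: "y \<in> T'" using that by (auto simp: T'_def)
    have e: "\<tau> y \<oplus>\<^bsub>V\<^esub> \<alpha> y \<odot>\<^bsub>V\<^esub> x = t \<oplus>\<^bsub>V\<^esub> a \<odot>\<^bsub>V\<^esub> x" using eq[OF y] that(1) by simp
    show "\<tau> y = t" "\<alpha> y = a" by (rule decomp_unique[OF T x \<tau>(1)[OF y] that(2) \<alpha>[OF y] that(3) e])+
  qed
  have add: "y \<oplus>\<^bsub>V\<^esub> z = (\<tau> y \<oplus>\<^bsub>V\<^esub> \<tau> z) \<oplus>\<^bsub>V\<^esub> (\<alpha> y \<oplus> \<alpha> z) \<odot>\<^bsub>V\<^esub> x" if yz: "y \<in> T'" "z \<in> T'" for y z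
  proof -
    have "y \<oplus>\<^bsub>V\<^esub> z = (\<tau> y \<oplus>\<^bsub>V\<^esub> \<alpha> y \<odot>\<^bsub>V\<^esub> x) \<oplus>\<^bsub>V\<^esub> (\<tau> z \<oplus>\<^bsub>V\<^esub> \<alpha> z \<odot>\<^bsub>V\<^esub> x)"
      using eq[OF yz(1)] eq[OF yz(2)] by simp
    also have "\<dots> = (\<tau> y \<oplus>\<^bsub>V\<^esub> \<tau> z) \<oplus>\<^bsub>V\<^esub> (\<alpha> y \<oplus> \<alpha> z) \<odot>\<^bsub>V\<^esub> x"
      using \<tau>(2) \<alpha> x(1) yz by (simp add: smult_l_distr M.a_ac)
    finally show ?thesis .
  qed
  have smul: "a \<odot>\<^bsub>V\<^esub> y = a \<odot>\<^bsub>V\<^esub> \<tau> y \<oplus>\<^bsub>V\<^esub> (a \<otimes> \<alpha> y) \<odot>\<^bsub>V\<^esub> x" if ay: "a \<in> carrier K" "y \<in> T'" for a y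
  proof -
    have "a \<odot>\<^bsub>V\<^esub> y = a \<odot>\<^bsub>V\<^esub> (\<tau> y \<oplus>\<^bsub>V\<^esub> \<alpha> y \<odot>\<^bsub>V\<^esub> x)" using eq[OF ay(2)] by simp
    also have "\<dots> = a \<odot>\<^bsub>V\<^esub> \<tau> y \<oplus>\<^bsub>V\<^esub> (a \<otimes> \<alpha> y) \<odot>\<^bsub>V\<^esub> x"
      using \<tau>(2) \<alpha> x(1) ay by (simp add: smult_r_distr smult_assoc)
    finally show ?thesis .
  qed
  have T'c: "T' \<subseteq> carrier V" using Tc x by (auto simp: T'_def)
  have TT': "T \<subseteq> T'"
  proof
    fix t assume t: "t \<in> T"
    show "t \<in> T'" by (rule in'[of t t \<zero>]) (use t x Tc in auto)
  qed
  have xT': "x \<in> T'" by (rule in'[of x "zero V" \<one>]) (use Tz x in auto)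
  have sub: "submod K V T'" unfolding submod_def
    by (intro conjI ballI T'c subsetD[OF TT' Tz] in'[OF add Ta[OF \<tau>(1) \<tau>(1)]] in'[OF smul Ts[OF _ \<tau>(1)]])
      (use \<alpha> in auto)
  show thesis
  proof (rule that[OF sub TT' xT'])
    show "\<tau> \<in> lhom K (subm V T') V" by (rule lhomI)
        (auto simp: \<tau>(2) intro!: uniq(1)[OF add Ta[OF \<tau>(1) \<tau>(1)]] uniq(1)[OF smul Ts[OF _ \<tau>(1)]] \<alpha>)
    show "\<alpha> \<in> lhom K (subm V T') (regular K)" by (rule lhomI)
        (auto simp: \<alpha> intro!: uniq(2)[OF add Ta[OF \<tau>(1) \<tau>(1)]] uniq(2)[OF smul Ts[OF _ \<tau>(1)]] \<alpha>)
    show "\<forall>y\<in>T'. \<tau> y \<in> T" "\<forall>y\<in>T'. y = \<tau> y \<oplus>\<^bsub>V\<^esub> \<alpha> y \<odot>\<^bsub>V\<^esub> x"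
      using \<tau>(1) eq by blast+
    have "\<tau> y = y \<and> \<alpha> y = \<zero>" if y: "y \<in> T" for y
    proof -
      have e: "y = y \<oplus>\<^bsub>V\<^esub> \<zero> \<odot>\<^bsub>V\<^esub> x" using y x Tc by auto
      show ?thesis using uniq(1)[OF e y F.zero_closed] uniq(2)[OF e y F.zero_closed] by simp
    qed
    then show "\<forall>y\<in>T. \<tau> y = y" "\<forall>y\<in>T. \<alpha> y = \<zero>" by blast+
  qed
qed

text \<open>The identity of \<open>S\<close> is extended one generator of \<open>V\<close> at a
  time: a new vector is sent to zero by the retraction and contributes its coordinate as a further
  functional. So \<open>S\<close> is at once a retract and a common kernel of finitely many
  functionals.\<close>

lemma retraction_functionals:
  assumes fg: "finitely_generated K V" and S: "submod K V S"
  obtains \<rho> n \<phi> where "\<rho> \<in> lhom K V V" "\<forall>y\<in>carrier V. \<rho> y \<in> S" "\<forall>y\<in>S. \<rho> y = y"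
    "\<forall>i<(n::nat). \<phi> i \<in> lhom K V (regular K)" "S = {y \<in> carrier V. \<forall>i<n. \<phi> i y = \<zero>}"
proof -
  obtain G where G: "gens K V G" using fg fg_iff by blast
  let ?P = "\<lambda>T \<rho> n \<phi>. \<rho> \<in> lhom K (subm V T) V \<and> (\<forall>y\<in>T. \<rho> y \<in> S) \<and> (\<forall>y\<in>S. \<rho> y = y) \<and>
    (\<forall>i<(n::nat). \<phi> i \<in> lhom K (subm V T) (regular K)) \<and> S = {y \<in> T. \<forall>i<n. \<phi> i y = \<zero>}"
  have "\<exists>T \<rho> n \<phi>. submod K V T \<and> S \<union> H \<subseteq> T \<and> ?P T \<rho> n \<phi>" if "finite H" "H \<subseteq> carrier V" for H
    using that
  proof (induction H)
    case empty
    have "(\<lambda>y. y) \<in> lhom K (subm V S) V" using S by (auto intro!: lhomI simp: submod_def)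
    then have "?P S (\<lambda>y. y) 0 (\<lambda>_ _. \<zero>)" by auto
    then show ?case using S by blast
  next
    case (insert x H)
    then obtain T \<rho> n \<phi> where T: "submod K V T" "S \<union> H \<subseteq> T" and P: "?P T \<rho> n \<phi>" by auto
    show ?case
    proof (cases "x \<in> T")
      case True
      then show ?thesis using T P by blast
    next
      case False
      have x: "x \<in> carrier V" using insert.prems by auto
      obtain T' \<tau> \<alpha> where T': "submod K V T'" "T \<subseteq> T'" "x \<in> T'"
        and \<tau>: "\<tau> \<in> lhom K (subm V T') V" and \<alpha>: "\<alpha> \<in> lhom K (subm V T') (regular K)"
        and \<tau>T: "\<forall>y\<in>T'. \<tau> y \<in> T" and eq: "\<forall>y\<in>T'. y = \<tau> y \<oplus>\<^bsub>V\<^esub> \<alpha> y \<odot>\<^bsub>V\<^esub> x"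
        and id: "\<forall>y\<in>T. \<tau> y = y" "\<forall>y\<in>T. \<alpha> y = \<zero>" by (rule adjoin[OF T(1) x False])
      have \<tau>': "\<tau> \<in> lhom K (subm V T') (subm V T)" using \<tau> \<tau>T by (auto simp: lhom_def)
      \<comment> \<open>The new coordinate is functional number \<open>n\<close>; where it vanishes,
        \<open>\<tau> y = y\<close>, so \<open>y\<close> already lies in \<open>T\<close>.\<close>
      define \<psi> where "\<psi> i = (if i < n then (\<lambda>y. \<phi> i (\<tau> y)) else \<alpha>)" for i
      have "?P T' (\<lambda>y. \<rho> (\<tau> y)) (Suc n) \<psi>"
      proof (intro conjI allI impI ballI)
        show "(\<lambda>y. \<rho> (\<tau> y)) \<in> lhom K (subm V T') V" using P by (intro lhom_o[OF \<tau>']) auto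
        show "\<rho> (\<tau> y) \<in> S" if "y \<in> T'" for y using P \<tau>T that by blast
        show "\<rho> (\<tau> y) = y" if "y \<in> S" for y using P id(1) that T(2) by auto
        show "\<psi> i \<in> lhom K (subm V T') (regular K)" if "i < Suc n" for i
        proof (cases "i < n")
          case True
          then have "\<phi> i \<in> lhom K (subm V T) (regular K)" using P by auto
          then show ?thesis using lhom_o[OF \<tau>'] True by (simp add: \<psi>_def)
        qed (simp add: \<psi>_def \<alpha>)
        show "S = {y \<in> T'. \<forall>i<Suc n. \<psi> i y = \<zero>}"
        proof (intro equalityI subsetI)
          fix y assume y: "y \<in> S"
          then have "y \<in> T" using T by auto
          then show "y \<in> {y \<in> T'. \<forall>i<Suc n. \<psi> i y = \<zero>}" using y P T' id by (auto simp: \<psi>_def)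
        next
          fix y assume y: "y \<in> {y \<in> T'. \<forall>i<Suc n. \<psi> i y = \<zero>}"
          then have "\<alpha> y = \<zero>" by (auto simp: \<psi>_def)
          moreover have "\<tau> y \<in> carrier V" using \<tau>T y T(1) unfolding submod_def by blast
          ultimately have e: "\<tau> y = y" using bspec[OF eq, of y] y x by auto
          have "\<tau> y \<in> T" using \<tau>T y by blast
          then have "y \<in> T" unfolding e .
          moreover have "\<forall>i<n. \<phi> i y = \<zero>"
          proof (intro allI impI)
            fix i assume "i < n"
            then have "\<psi> i y = \<phi> i (\<tau> y)" "i < Suc n" by (auto simp: \<psi>_def)
            then show "\<phi> i y = \<zero>" using y unfolding e by auto
          qed
          ultimately show "y \<in> S" using P by auto
        qed
      qed
      note A = this
      have "S \<union> insert x H \<subseteq> T'" using T' T by auto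
      from conjI[OF T'(1) conjI[OF this A]] show ?thesis
        by (intro exI[of _ T'] exI[of _ "\<lambda>y. \<rho> (\<tau> y)"] exI[of _ "Suc n"] exI[of _ \<psi>])
    qed
  qed
  moreover have "finite G" "G \<subseteq> carrier V" using G by (auto simp: gens_def)
  ultimately have "\<exists>T \<rho> n \<phi>. submod K V T \<and> S \<union> G \<subseteq> T \<and> ?P T \<rho> n \<phi>" by blast
  then obtain T \<rho> n \<phi> where T: "submod K V T \<and> S \<union> G \<subseteq> T \<and> ?P T \<rho> n \<phi>" by (elim exE) (rule that)
  have "T = carrier V" using G conjunct1[OF T] conjunct1[OF conjunct2[OF T]] unfolding gens_def submod_def by blast
  note P = conjunct2[OF conjunct2[OF T], unfolded \<open>T = carrier V\<close> subm_self]
  show thesis using P by (elim conjE) (rule that)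
qed

end

text \<open>A subspace is the image of a retraction, and images inherit finite generation.\<close>

lemma fspace_fg_submod:
  assumes "field (K :: 'k ring)" and V: "fgm K V" and S: "submod K V S"
  shows "fgm K (subm V S)"
proof -
  have V': "lmod K V" using V by (rule fg_moduleD)
  interpret fspace K V by (rule fspaceI[OF assms(1) V'])
  have fg: "finitely_generated K V" using V by (simp add: fg_module_def)
  obtain \<rho> n \<phi> where \<rho>: "\<rho> \<in> lhom K V V" "\<forall>y\<in>carrier V. \<rho> y \<in> S" "\<forall>y\<in>S. \<rho> y = y"
    and "\<forall>i<(n::nat). \<phi> i \<in> lhom K V (regular K)" "S = {y \<in> carrier V. \<forall>i<n. \<phi> i y = zero K}"
    by (rule retraction_functionals[OF fg S])
  have "\<rho> \<in> lhom K V (subm V S)" using \<rho> by (auto simp: lhom_def)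
  moreover have "\<rho> ` carrier V = carrier (subm V S)"
  proof (intro equalityI subsetI)
    fix y assume "y \<in> carrier (subm V S)"
    then have y: "y \<in> S" by simp
    then have "y \<in> carrier V" using S unfolding submod_def by blast
    then show "y \<in> \<rho> ` carrier V" using bspec[OF \<rho>(3) y] by (intro image_eqI[of _ _ y]) auto
  qed (use \<rho>(2) in auto)
  ultimately show ?thesis by (rule fg_image[OF V subm_module[OF V' S]])
qed

lemma fspace_retract:
  assumes "field (K :: 'k ring)" and V: "lmod K V" and W: "fgm K W" and f: "f \<in> lhom K V W" and inj: "inj_on f (carrier V)"
  obtains g where "g \<in> lhom K W V" "\<forall>x\<in>carrier V. g (f x) = x"
proof -
  have W': "lmod K W" using W by (rule fg_moduleD)
  interpret fspace K W by (rule fspaceI[OF assms(1) W'])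
  interpret V: left_module K V by fact
  let ?S = "f ` carrier V"
  have S: "submod K W ?S" by (rule submod_image[OF V W' f V.submod_carrier])
  have fg: "finitely_generated K W" using W by (simp add: fg_module_def)
  obtain \<rho> n \<phi> where \<rho>: "\<rho> \<in> lhom K W W" "\<forall>y\<in>carrier W. \<rho> y \<in> ?S" "\<forall>y\<in>?S. \<rho> y = y"
    and "\<forall>i<(n::nat). \<phi> i \<in> lhom K W (regular K)" "?S = {y \<in> carrier W. \<forall>i<n. \<phi> i y = zero K}"
    by (rule retraction_functionals[OF fg S])
  have f': "f \<in> lhom K V (subm W ?S)" using f by (auto simp: lhom_def)
  have "inv_into (carrier V) f \<in> lhom K (subm W ?S) V"
    by (rule lhom_inverse[OF V f']) (use inj in \<open>auto simp: bij_betw_def\<close>)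
  moreover have "\<rho> \<in> lhom K W (subm W ?S)" using \<rho> by (auto simp: lhom_def)
  ultimately have "(\<lambda>y. inv_into (carrier V) f (\<rho> y)) \<in> lhom K W V" by (rule lhom_o[rotated])
  then show thesis by (rule that) (use \<rho>(3) inj in auto)
qed

lemma fspace_fg_inj:
  assumes "field (K :: 'k ring)" and V: "lmod K V" and W: "fgm K W" and f: "f \<in> lhom K V W" and inj: "inj_on f (carrier V)"
  shows "fgm K V"
proof -
  obtain g where g: "g \<in> lhom K W V" "\<forall>x\<in>carrier V. g (f x) = x" by (rule fspace_retract[OF assms])
  have "g ` carrier W = carrier V"
  proof (intro equalityI subsetI)
    fix x assume x: "x \<in> carrier V"
    then show "x \<in> g ` carrier W" using bspec[OF g(2) x] lhom_in[OF f x] by (intro image_eqI[of _ _ "f x"]) auto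
  qed (use lhom_in[OF g(1)] in auto)
  then show ?thesis by (rule fg_image[OF W V g(1)])
qed

section \<open>Dimension as the least number of generators\<close>

text \<open>Over a field this serves as the dimension. What counts is that it is monotone under
  injections and surjections, strictly so when they are not bijective; no bases are chosen.\<close>

definition gdim :: "('r, 'x) ring_scheme \<Rightarrow> ('r, 'm) module \<Rightarrow> nat" where
  "gdim R M = (LEAST n. \<exists>S. gens R M S \<and> card S = n)"

lemma gdim_gens:
  assumes "fgm R M"
  obtains S where "gens R M S" "card S = gdim R M"
proof -
  have "\<exists>n S. gens R M S \<and> card S = n" using fg_moduleD(2)[OF assms] by blast
  then have "\<exists>S. gens R M S \<and> card S = gdim R M" unfolding gdim_def by (rule LeastI_ex)
  then show thesis using that by blast
qed

lemma gdim_le: "gens R M S \<Longrightarrow> gdim R M \<le> card S" unfolding gdim_def by (rule Least_le) blast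

lemma gdim_surj_le:
  assumes M: "fgm R M" and N: "lmod R N" and f: "f \<in> lhom R M N" and s: "f ` carrier M = carrier N"
  shows "gdim R N \<le> gdim R M"
proof -
  obtain S where S: "gens R M S" "card S = gdim R M" using gdim_gens[OF M] .
  have "gdim R N \<le> card (f ` S)" by (rule gdim_le[OF gens_image[OF fg_left[OF M] N f s S(1)]])
  also have "\<dots> \<le> card S" using S(1) by (auto simp: gens_def card_image_le)
  finally show ?thesis using S by simp
qed

definition span :: "('r, 'x) ring_scheme \<Rightarrow> ('r, 'm) module \<Rightarrow> 'm set \<Rightarrow> 'm set" where
  "span R M S = \<Inter>{T. submod R M T \<and> S \<subseteq> T}"

lemma span_superset: "S \<subseteq> span R M S" by (auto simp: span_def)

lemma span_min: "submod R M T \<Longrightarrow> S \<subseteq> T \<Longrightarrow> span R M S \<subseteq> T" by (auto simp: span_def)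

lemma span_submod:
  assumes "lmod R M" "S \<subseteq> carrier M"
  shows "submod R M (span R M S)"
proof -
  have "span R M S \<subseteq> carrier M" by (rule span_min[OF left_module.submod_carrier[OF assms(1)] assms(2)])
  then show ?thesis unfolding submod_def by (auto simp: span_def submod_def)
qed

text \<open>Adjoining the elements of \<open>S\<close> one at a time, there is a moment at which
  \<open>v\<close> enters the span; \<open>s\<close> is the element adjoined then.\<close>

lemma span_last: "finite S \<Longrightarrow> v \<in> span R M S \<Longrightarrow> v \<notin> span R M {} \<Longrightarrow>
     \<exists>S1 s. insert s S1 \<subseteq> S \<and> s \<notin> S1 \<and> v \<notin> span R M S1 \<and> v \<in> span R M (insert s S1)"
proof (induction S rule: finite_induct)
  case (insert x F)
  show ?case
  proof (cases "v \<in> span R M F")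
    case True
    then show ?thesis using insert by blast
  next
    case False
    then show ?thesis using insert by blast
  qed
qed auto

lemma gdim_surj_less:
  assumes F: "field (K :: 'k ring)" and V: "fgm K V" and W: "lmod K W" and f: "f \<in> lhom K V W"
    and s: "f ` carrier V = carrier W" and v: "v \<in> carrier V" "v \<noteq> zero V" "f v = zero W"
  shows "gdim K W < gdim K V"
proof -
  have V': "lmod K V" using V by (rule fg_moduleD)
  interpret fspace K V by (rule fspaceI[OF F V'])
  interpret W: left_module K W by fact
  obtain S where S: "gens K V S" "card S = gdim K V" using gdim_gens[OF V] .
  have fin: "finite S" "S \<subseteq> carrier V" using S(1) by (auto simp: gens_def)
  have "v \<in> span K V S" using S(1) span_submod[OF V' fin(2)] span_superset[of S] v(1) unfolding gens_def by blast
  moreover have "v \<notin> span K V {}" using span_min[OF submod_zero, of "{}"] v(2) by auto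
  ultimately obtain S1 x where x: "insert x S1 \<subseteq> S" "x \<notin> S1" "v \<notin> span K V S1" "v \<in> span K V (insert x S1)"
    using span_last[OF fin(1)] by blast
  let ?T = "span K V S1"
  have T: "submod K V ?T" by (rule span_submod[OF V']) (use x fin in auto)
  have xc: "x \<in> carrier V" using x fin by auto
  have xT: "x \<notin> ?T"
  proof
    assume "x \<in> ?T"
    then have "insert x S1 \<subseteq> ?T" using span_superset[of S1] by auto
    then have "span K V (insert x S1) \<subseteq> ?T" by (rule span_min[OF T])
    then show False using x by auto
  qed
  obtain T' \<tau> \<alpha> where T': "submod K V T'" "?T \<subseteq> T'" "x \<in> T'"
    and \<tau>: "\<tau> \<in> lhom K (subm V T') V" and \<alpha>: "\<alpha> \<in> lhom K (subm V T') (regular K)"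
    and \<tau>T: "\<forall>y\<in>T'. \<tau> y \<in> ?T" and eq: "\<forall>y\<in>T'. y = \<tau> y \<oplus>\<^bsub>V\<^esub> \<alpha> y \<odot>\<^bsub>V\<^esub> x"
    and id: "\<forall>y\<in>?T. \<tau> y = y" "\<forall>y\<in>?T. \<alpha> y = zero K" by (rule adjoin[OF T xc xT])
  have "span K V (insert x S1) \<subseteq> T'" using T' span_superset[of S1] by (intro span_min) auto
  then have vT': "v \<in> T'" using x by auto
  define a where "a = \<alpha> v"
  have a: "a \<in> carrier K" using lhom_in[OF \<alpha>] vT' by (auto simp: a_def)
  have va: "v = \<tau> v \<oplus>\<^bsub>V\<^esub> a \<odot>\<^bsub>V\<^esub> x" using bspec[OF eq vT'] by (simp add: a_def)
  have \<tau>v: "\<tau> v \<in> ?T" "\<tau> v \<in> carrier V" using bspec[OF \<tau>T vT'] T by (auto simp: submod_def)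
  \<comment> \<open>Otherwise \<open>v = \<tau> v\<close> would lie in the span of
    \<open>S1\<close>, against the choice of \<open>S1\<close>.\<close>
  have a0: "a \<noteq> zero K" using va \<tau>v x(3) xc by auto
  have ax: "a \<odot>\<^bsub>V\<^esub> x = v \<ominus>\<^bsub>V\<^esub> \<tau> v"
    by (rule add_lcancel[OF \<tau>v(2)]) (use a xc v \<tau>v in \<open>auto simp: diff_add_cancel va[symmetric]\<close>)
  have "gens K W (f ` (S - {x}))" unfolding gens_def
  proof (intro conjI allI impI)
    show "finite (f ` (S - {x}))" using fin by auto
    show "f ` (S - {x}) \<subseteq> carrier W" using fin s by auto
    fix U assume U: "submod K W U" "f ` (S - {x}) \<subseteq> U"
    let ?U = "{y \<in> carrier V. f y \<in> U}"
    have sU: "submod K V ?U" by (rule submod_vimage[OF V' W f U(1)])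
    have 1: "S - {x} \<subseteq> ?U" using U fin by auto
    then have "?T \<subseteq> ?U" using x by (intro span_min[OF sU]) auto
    moreover have "v \<in> ?U" using v U(1) by (auto simp: submod_def)
    ultimately have "a \<odot>\<^bsub>V\<^esub> x \<in> ?U" unfolding ax using submod_diff[OF sU] \<tau>v by blast
    then have "x \<in> ?U" by (rule submod_inv[OF sU xc a a0])
    then have "S \<subseteq> ?U" using 1 by auto
    then have "carrier V \<subseteq> ?U" using S(1) sU by (auto simp: gens_def)
    then show "carrier W \<subseteq> U" unfolding s[symmetric] by auto
  qed
  then have "gdim K W \<le> card (f ` (S - {x}))" by (rule gdim_le)
  also have "\<dots> \<le> card (S - {x})" using fin by (simp add: card_image_le)
  also have "\<dots> < card S" using x fin by (intro psubset_card_mono) auto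
  finally show ?thesis using S by simp
qed

text \<open>A retraction \<open>g\<close> of \<open>f\<close> is onto, and if \<open>w\<close> lies
  outside the image of \<open>f\<close>, then \<open>w - f (g w)\<close> is a nonzero element of the
  kernel of \<open>g\<close>.\<close>

lemma gdim_inj_le:
  assumes F: "field (K :: 'k ring)" and V: "fgm K V" and W: "fgm K W" and f: "f \<in> lhom K V W" and inj: "inj_on f (carrier V)"
  shows "gdim K V \<le> gdim K W" and "f ` carrier V \<noteq> carrier W \<Longrightarrow> gdim K V < gdim K W"
proof -
  have V': "lmod K V" and W': "lmod K W" using V W fg_moduleD by auto
  interpret V: left_module K V by fact
  interpret W: left_module K W by fact
  obtain g where g: "g \<in> lhom K W V" "\<forall>x\<in>carrier V. g (f x) = x" by (rule fspace_retract[OF F V' W f inj])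
  have s: "g ` carrier W = carrier V"
  proof (intro equalityI subsetI)
    fix x assume x: "x \<in> carrier V"
    then show "x \<in> g ` carrier W" using bspec[OF g(2) x] lhom_in[OF f x] by (intro image_eqI[of _ _ "f x"]) auto
  qed (use lhom_in[OF g(1)] in auto)
  show "gdim K V \<le> gdim K W" by (rule gdim_surj_le[OF W V' g(1) s])
  assume "f ` carrier V \<noteq> carrier W"
  then obtain w where w: "w \<in> carrier W" "w \<notin> f ` carrier V" using lhom_in[OF f] by auto
  have gw: "g w \<in> carrier V" "f (g w) \<in> carrier W" using lhom_in[OF g(1)] lhom_in[OF f] w by auto
  let ?v = "w \<ominus>\<^bsub>W\<^esub> f (g w)"
  have "?v \<noteq> zero W" using W.minus_diff_zero_iff[OF w(1) gw(2)] w(2) gw(1) by auto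
  moreover have "g ?v = zero V"
    using lhom_minus[OF W' V' g(1) w(1) gw(2)] bspec[OF g(2) gw(1)] V.minus_diff_zero_iff[OF gw(1) gw(1)] by simp
  ultimately show "gdim K V < gdim K W" using gdim_surj_less[OF F W V' g(1) s, of ?v] w gw by auto
qed

lemma endo_surj_inj:
  assumes F: "field (K :: 'k ring)" and V: "fgm K V" and f: "f \<in> lhom K V V" and s: "f ` carrier V = carrier V"
  shows "inj_on f (carrier V)" using gdim_surj_less[OF F V fg_left[OF V] f s] lhom_inj_iff[OF fg_left[OF V] fg_left[OF V] f] by blast

section \<open>Modules over a finite-dimensional algebra\<close>

locale fdalg =
  fixes K :: "'k ring" and A :: "('k, 'a) module"
  assumes fd: "fd_algebra K A"
begin

lemma field_K: "field K" and ring_A: "ring A" and module_KA: "module K A" and fg_KA: "finitely_generated K A"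
  and alg_l: "\<lbrakk>c \<in> carrier K; x \<in> carrier A; y \<in> carrier A\<rbrakk> \<Longrightarrow> (c \<odot>\<^bsub>A\<^esub> x) \<otimes>\<^bsub>A\<^esub> y = c \<odot>\<^bsub>A\<^esub> (x \<otimes>\<^bsub>A\<^esub> y)"
  and alg_r: "\<lbrakk>c \<in> carrier K; x \<in> carrier A; y \<in> carrier A\<rbrakk> \<Longrightarrow> x \<otimes>\<^bsub>A\<^esub> (c \<odot>\<^bsub>A\<^esub> y) = c \<odot>\<^bsub>A\<^esub> (x \<otimes>\<^bsub>A\<^esub> y)"
  using fd unfolding fd_algebra_def by blast+

sublocale A: ring A by (rule ring_A)
sublocale K: field K by (rule field_K)
sublocale KA: module K A by (rule module_KA)

lemma ring_K: "ring K" by (rule K.ring_axioms)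

lemma left_module_KA: "lmod K A" by (rule left_moduleI[OF ring_K A.abelian_group_axioms])
    (auto simp: KA.smult_l_distr KA.smult_r_distr KA.smult_assoc1)

lemma fg_module_KA: "fgm K A" by (simp add: fg_module_def left_module_KA fg_KA)

lemma unit_closed [simp]: "c \<in> carrier K \<Longrightarrow> c \<odot>\<^bsub>A\<^esub> one A \<in> carrier A" by auto

lemma kspace_simps [simp]: "carrier (kspace A M) = carrier M" "zero (kspace A M) = zero M" "add (kspace A M) = add M"
  "c \<odot>\<^bsub>kspace A M\<^esub> x = (c \<odot>\<^bsub>A\<^esub> one A) \<odot>\<^bsub>M\<^esub> x" by (simp_all add: kspace_def)

lemma kspace_module:
  assumes M: "lmod A M"
  shows "lmod K (kspace A M)"
proof -
  interpret M: left_module A M by fact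
  have "abelian_group (kspace A M)" by (rule abelian_group_cong[OF M.M.abelian_group_axioms]) auto
  then show ?thesis
  proof (rule left_moduleI[OF ring_K])
    fix a b x assume ab: "a \<in> carrier K" "b \<in> carrier K" "x \<in> carrier (kspace A M)"
    have "(a \<otimes>\<^bsub>K\<^esub> b) \<odot>\<^bsub>A\<^esub> one A = (a \<odot>\<^bsub>A\<^esub> one A) \<otimes>\<^bsub>A\<^esub> (b \<odot>\<^bsub>A\<^esub> one A)"
      using ab by (simp add: alg_l KA.smult_assoc1)
    then show "(a \<otimes>\<^bsub>K\<^esub> b) \<odot>\<^bsub>kspace A M\<^esub> x = a \<odot>\<^bsub>kspace A M\<^esub> (b \<odot>\<^bsub>kspace A M\<^esub> x)"
      using ab by (simp add: M.smult_assoc)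
  qed (auto simp: KA.smult_l_distr M.smult_l_distr M.smult_r_distr)
qed

lemma lhom_kspace: "f \<in> lhom A M N \<Longrightarrow> f \<in> lhom K (kspace A M) (kspace A N)" by (auto simp: lhom_def)

lemma submod_kspace: "submod A M S \<Longrightarrow> submod K (kspace A M) S" by (auto simp: submod_def)

lemma kspace_subm: "kspace A (subm M S) = subm (kspace A M) S" by (simp add: kspace_def)

text \<open>Products of generators of \<open>A\<close> over \<open>K\<close> with generators of
  \<open>M\<close> over \<open>A\<close> generate \<open>M\<close> over \<open>K\<close>. Through
  this, finiteness questions about modules become linear algebra.\<close>

lemma fg_kspace_iff:
  assumes M: "lmod A M"
  shows "fgm A M \<longleftrightarrow> fgm K (kspace A M)"
proof
  assume "fgm K (kspace A M)"
  then obtain S where S: "gens K (kspace A M) S" using fg_moduleD(2) by blast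
  have "gens A M S" unfolding gens_def
  proof (intro conjI allI impI)
    show "finite S" "S \<subseteq> carrier M" using S by (auto simp: gens_def)
    show "carrier M \<subseteq> T" if "submod A M T" "S \<subseteq> T" for T
      using S submod_kspace[OF that(1)] that(2) unfolding gens_def by simp
  qed
  then show "fgm A M" by (rule fg_moduleI[OF M])
next
  interpret M: left_module A M by fact
  assume "fgm A M"
  then obtain S where S: "gens A M S" using fg_moduleD(2) by blast
  obtain G where G: "gens K A G" using fg_moduleD(2)[OF fg_module_KA] by blast
  have GS: "finite S" "S \<subseteq> carrier M" "finite G" "G \<subseteq> carrier A" using S G by (auto simp: gens_def)
  let ?H = "(\<lambda>(g, s). g \<odot>\<^bsub>M\<^esub> s) ` (G \<times> S)"
  note km = kspace_module[OF M]
  have "gens K (kspace A M) ?H" unfolding gens_def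
  proof (intro conjI allI impI)
    show "finite ?H" using GS by auto
    show "?H \<subseteq> carrier (kspace A M)" using GS by auto
    fix T assume T: "submod K (kspace A M) T" "?H \<subseteq> T"
    \<comment> \<open>The largest \<open>A\<close>-submodule inside the subspace \<open>T\<close>;
      it will be shown to contain the generators of \<open>M\<close>.\<close>
    define T' where "T' = {x \<in> carrier M. \<forall>a\<in>carrier A. a \<odot>\<^bsub>M\<^esub> x \<in> T}"
    have Tc: "zero M \<in> T" "\<And>x y. x \<in> T \<Longrightarrow> y \<in> T \<Longrightarrow> x \<oplus>\<^bsub>M\<^esub> y \<in> T" using T(1) by (auto simp: submod_def)
    have "submod A M T'" using Tc by (auto simp: submod_def T'_def M.smult_r_distr simp flip: M.smult_assoc)
    moreover have "S \<subseteq> T'"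
    proof
      fix s assume s: "s \<in> S"
      then have sc: "s \<in> carrier M" using GS by auto
      have l: "(\<lambda>a. a \<odot>\<^bsub>M\<^esub> s) \<in> lhom K A (kspace A M)"
      proof (rule lhomI)
        fix c a assume ca: "c \<in> carrier K" "a \<in> carrier A"
        have "c \<odot>\<^bsub>A\<^esub> a = (c \<odot>\<^bsub>A\<^esub> one A) \<otimes>\<^bsub>A\<^esub> a" using ca by (simp add: alg_l)
        then show "(c \<odot>\<^bsub>A\<^esub> a) \<odot>\<^bsub>M\<^esub> s = c \<odot>\<^bsub>kspace A M\<^esub> (a \<odot>\<^bsub>M\<^esub> s)"
          using ca sc by (simp add: M.smult_assoc)
      qed (use sc in \<open>auto simp: M.smult_l_distr\<close>)
      have "G \<subseteq> {a \<in> carrier A. a \<odot>\<^bsub>M\<^esub> s \<in> T}" using T(2) s GS by auto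
      then have "carrier A \<subseteq> {a \<in> carrier A. a \<odot>\<^bsub>M\<^esub> s \<in> T}"
        using G submod_vimage[OF left_module_KA km l T(1)] unfolding gens_def by blast
      then show "s \<in> T'" using sc by (auto simp: T'_def)
    qed
    ultimately have "carrier M \<subseteq> T'" using S unfolding gens_def by blast
    have "x \<in> T" if "x \<in> carrier M" for x
    proof -
      have "one A \<odot>\<^bsub>M\<^esub> x \<in> T" using \<open>carrier M \<subseteq> T'\<close> that A.one_closed unfolding T'_def by blast
      then show ?thesis using that by simp
    qed
    then show "carrier (kspace A M) \<subseteq> T" by auto
  qed
  then show "fgm K (kspace A M)" by (rule fg_moduleI[OF km])
qed

lemma fg_kspace: "fgm A M \<Longrightarrow> fgm K (kspace A M)" using fg_kspace_iff fg_left by blast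

text \<open>Finite generation is tested over \<open>K\<close>, where it passes to subspaces.\<close>

lemma fg_submodule:
  assumes "fgm A M" "submod A M S"
  shows "fgm A (subm M S)"
proof -
  have "fgm K (kspace A (subm M S))"
    unfolding kspace_subm by (rule fspace_fg_submod[OF field_K fg_kspace[OF assms(1)] submod_kspace[OF assms(2)]])
  then show ?thesis using fg_kspace_iff[OF subm_module[OF fg_left[OF assms(1)] assms(2)]] by blast
qed

end

section \<open>Copies on the type of test modules, and lifting properties\<close>

definition transp :: "('m \<Rightarrow> 'n) \<Rightarrow> ('r, 'm) module \<Rightarrow> ('r, 'n) module" where
  "transp \<phi> M = \<lparr>carrier = \<phi> ` carrier M, mult = undefined, one = undefined, zero = \<phi> (zero M),
     add = (\<lambda>x y. \<phi> (inv_into (carrier M) \<phi> x \<oplus>\<^bsub>M\<^esub> inv_into (carrier M) \<phi> y)),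
     smult = (\<lambda>a x. \<phi> (a \<odot>\<^bsub>M\<^esub> inv_into (carrier M) \<phi> x))\<rparr>"

lemma transp:
  assumes M: "lmod R M" and inj: "inj_on \<phi> (carrier M)"
  shows "lmod R (transp \<phi> M)" "\<phi> \<in> lhom R M (transp \<phi> M)" "bij_betw \<phi> (carrier M) (carrier (transp \<phi> M))"
proof -
  interpret M: left_module R M by fact
  let ?N = "transp \<phi> M"
  note [simp] = inv_into_f_f[OF inj]
  have sm: "carrier ?N = \<phi> ` carrier M" "zero ?N = \<phi> (zero M)"
    "\<And>x y. x \<in> carrier M \<Longrightarrow> y \<in> carrier M \<Longrightarrow> \<phi> x \<oplus>\<^bsub>?N\<^esub> \<phi> y = \<phi> (x \<oplus>\<^bsub>M\<^esub> y)"
    "\<And>a x. a \<in> carrier R \<Longrightarrow> x \<in> carrier M \<Longrightarrow> a \<odot>\<^bsub>?N\<^esub> \<phi> x = \<phi> (a \<odot>\<^bsub>M\<^esub> x)"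
    by (simp_all add: transp_def)
  have "abelian_group ?N"
  proof (rule abelian_groupI)
    fix x assume "x \<in> carrier ?N"
    then obtain y where y: "y \<in> carrier M" "x = \<phi> y" by (auto simp: sm)
    then show "\<exists>z\<in>carrier ?N. z \<oplus>\<^bsub>?N\<^esub> x = zero ?N"
      by (intro bexI[of _ "\<phi> (\<ominus>\<^bsub>M\<^esub> y)"]) (auto simp: sm M.M.l_neg)
  qed (auto simp: sm M.M.a_ac)
  then show "lmod R ?N" by (rule left_moduleI[OF lm_ring[OF M]])
      (auto simp: sm M.smult_l_distr M.smult_r_distr M.smult_assoc)
  show "\<phi> \<in> lhom R M ?N" by (rule lhomI) (auto simp: sm)
  show "bij_betw \<phi> (carrier M) (carrier ?N)" using inj by (simp add: bij_betw_def sm)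
qed

text \<open>Unlike \<open>iso_mod\<close> it names the inverse and works with \<open>lhom\<close>,
  so that isomorphisms can be composed with other maps in both directions.\<close>

definition mod_iso :: "('r, 'x) ring_scheme \<Rightarrow> ('r, 'm) module \<Rightarrow> ('r, 'n) module \<Rightarrow> ('m \<Rightarrow> 'n) \<Rightarrow> ('n \<Rightarrow> 'm) \<Rightarrow> bool" where
  "mod_iso R M N \<phi> \<psi> \<longleftrightarrow> \<phi> \<in> lhom R M N \<and> \<psi> \<in> lhom R N M \<and>
     (\<forall>x\<in>carrier M. \<psi> (\<phi> x) = x) \<and> (\<forall>y\<in>carrier N. \<phi> (\<psi> y) = y)"

lemma mod_isoD:
  assumes "mod_iso R M N \<phi> \<psi>"
  shows "\<phi> \<in> lhom R M N" "\<psi> \<in> lhom R N M"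
    "\<And>x. x \<in> carrier M \<Longrightarrow> \<psi> (\<phi> x) = x" "\<And>y. y \<in> carrier N \<Longrightarrow> \<phi> (\<psi> y) = y"
    "\<And>x. x \<in> carrier M \<Longrightarrow> \<phi> x \<in> carrier N" "\<And>y. y \<in> carrier N \<Longrightarrow> \<psi> y \<in> carrier M"
    "bij_betw \<phi> (carrier M) (carrier N)"
proof -
  show 1: "\<phi> \<in> lhom R M N" "\<psi> \<in> lhom R N M"
    "\<And>x. x \<in> carrier M \<Longrightarrow> \<psi> (\<phi> x) = x" "\<And>y. y \<in> carrier N \<Longrightarrow> \<phi> (\<psi> y) = y"
    using assms by (auto simp: mod_iso_def)
  show 2: "\<And>x. x \<in> carrier M \<Longrightarrow> \<phi> x \<in> carrier N" "\<And>y. y \<in> carrier N \<Longrightarrow> \<psi> y \<in> carrier M"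
    using lhom_in[OF 1(1)] lhom_in[OF 1(2)] by auto
  show "bij_betw \<phi> (carrier M) (carrier N)" by (rule bij_betwI[of _ _ _ \<psi>]) (use 1 2 in auto)
qed

lemma mod_iso_bij:
  assumes M: "lmod R M" and f: "f \<in> lhom R M N" and b: "bij_betw f (carrier M) (carrier N)"
  shows "mod_iso R M N f (inv_into (carrier M) f)" unfolding mod_iso_def
  using f lhom_inverse[OF M f b] b by (auto simp: bij_betw_def f_inv_into_f)

lemma mod_iso_sym: "mod_iso R M N \<phi> \<psi> \<Longrightarrow> mod_iso R N M \<psi> \<phi>" by (auto simp: mod_iso_def)

lemma mod_iso_fg:
  assumes "mod_iso R M N \<phi> \<psi>" "fgm R M" "lmod R N"
  shows "fgm R N" by (rule fg_image[OF assms(2,3) mod_isoD(1)[OF assms(1)]])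
    (use mod_isoD(7)[OF assms(1)] in \<open>simp add: bij_betw_def\<close>)

context fdalg begin

text \<open>An element is encoded by chosen coefficients with respect to finitely many
  \<open>K\<close>-generators. The encoding has to be injective but may fail to be linear, since the
  module structure is transported along it.\<close>

lemma umodule_copy:
  fixes M :: "('a, 'm) module"
  assumes M: "fgm A M"
  obtains U :: "('k, 'a) umodule" and \<phi> \<psi> where "fgm A U" "mod_iso A M U \<phi> \<psi>"
proof -
  have M': "lmod A M" by (rule fg_left[OF M])
  let ?V = "kspace A M"
  interpret V: left_module K ?V by (rule kspace_module[OF M'])
  obtain S where S: "finite S" "S \<subseteq> carrier ?V"
    "\<forall>x \<in> carrier ?V. \<exists>a. a \<in> S \<rightarrow> carrier K \<and> x = (\<Oplus>\<^bsub>?V\<^esub>s\<in>S. a s \<odot>\<^bsub>?V\<^esub> s)"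
    using fg_kspace[OF M] unfolding fg_module_def finitely_generated_def Bex_def by (elim conjE exE) (rule that)
  from bchoice[OF S(3)] obtain a where
    a: "\<forall>x\<in>carrier ?V. a x \<in> S \<rightarrow> carrier K \<and> x = (\<Oplus>\<^bsub>?V\<^esub>s\<in>S. a x s \<odot>\<^bsub>?V\<^esub> s)" by blast
  obtain n and f :: "nat \<Rightarrow> 'm" where f: "S = f ` {i. i < n}" using finite_imp_nat_seg_image_inj_on[OF S(1)] by blast
  define \<phi> where "\<phi> x = (\<lambda>i. a x (f i))" for x
  have inj: "inj_on \<phi> (carrier M)"
  proof (rule inj_onI)
    fix x y assume xy: "x \<in> carrier M" "y \<in> carrier M" "\<phi> x = \<phi> y"
    have eq: "a x s = a y s" if "s \<in> S" for s using that xy(3) f by (auto simp: \<phi>_def fun_eq_iff)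
    have "(\<Oplus>\<^bsub>?V\<^esub>s\<in>S. a x s \<odot>\<^bsub>?V\<^esub> s) = (\<Oplus>\<^bsub>?V\<^esub>s\<in>S. a y s \<odot>\<^bsub>?V\<^esub> s)"
    proof (rule V.M.finsum_cong')
      show "(\<lambda>s. a y s \<odot>\<^bsub>?V\<^esub> s) \<in> S \<rightarrow> carrier ?V"
      proof
        fix s assume s: "s \<in> S"
        have "a y s \<in> carrier K" "s \<in> carrier ?V" using a xy(2) s S(2) by auto
        then show "a y s \<odot>\<^bsub>?V\<^esub> s \<in> carrier ?V" by (rule V.smult_closed)
      qed
    qed (auto simp: eq)
    then show "x = y" using a xy by auto
  qed
  note tr = transp[OF M' inj]
  have iso: "mod_iso A M (transp \<phi> M) \<phi> (inv_into (carrier M) \<phi>)" by (rule mod_iso_bij[OF M' tr(2,3)])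
  show thesis by (rule that[OF mod_iso_fg[OF iso M tr(1)] iso])
qed

text \<open>\<open>projective\<close> tests only modules on \<open>nat \<Rightarrow> 'k\<close> and
  surjections. Copies of \<open>X\<close> and of the image of \<open>g\<close> bring the general
  case into that form, the surjection being the one onto the image.\<close>

lemma projective_lift:
  assumes P: "projective A P" and X: "fgm A X" and Y: "fgm A Y"
    and g: "g \<in> lhom A X Y" and f: "f \<in> lhom A P Y" and sub: "f ` carrier P \<subseteq> g ` carrier X"
  obtains h where "h \<in> lhom A P X" "\<forall>p\<in>carrier P. g (h p) = f p"
proof -
  have X': "lmod A X" and Y': "lmod A Y" and P': "lmod A P" using X Y P unfolding projective_def fg_module_def by auto
  let ?S = "g ` carrier X"
  have S: "submod A Y ?S" by (rule submod_image[OF X' Y' g left_module.submod_carrier[OF X']])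
  obtain U :: "('k, 'a) umodule" and \<phi> \<psi> where U: "fgm A U" "mod_iso A X U \<phi> \<psi>" by (rule umodule_copy[OF X])
  obtain V :: "('k, 'a) umodule" and \<phi>' \<psi>' where V: "fgm A V" "mod_iso A (subm Y ?S) V \<phi>' \<psi>'"
    by (rule umodule_copy[OF fg_submodule[OF Y S]])
  note u = mod_isoD[OF U(2)] and v = mod_isoD[OF V(2)]
  have U': "lmod A U" using U(1) by (rule fg_left)
  have gS: "g \<in> lhom A X (subm Y ?S)" and fS: "f \<in> lhom A P (subm Y ?S)" using g f sub by (auto simp: lhom_def)
  let ?g = "restrict (\<lambda>x. \<phi>' (g (\<psi> x))) (carrier U)" and ?f = "restrict (\<lambda>x. \<phi>' (f x)) (carrier P)"
  have "?g \<in> mhom A U V" by (rule lhom_mhom[OF U' lhom_o[OF lhom_o[OF u(2) gS] v(1)]])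
  moreover have "?f \<in> mhom A P V" by (rule lhom_mhom[OF P' lhom_o[OF fS v(1)]])
  moreover have "?g ` carrier U = carrier V"
  proof (intro equalityI subsetI)
    fix y assume y: "y \<in> carrier V"
    then have "\<psi>' y \<in> ?S" using v(6)[OF y] by simp
    then obtain x where x: "x \<in> carrier X" "\<psi>' y = g x" by blast
    then have "?g (\<phi> x) = y" using v(4)[OF y] u(3,5)[OF x(1)] by auto
    then show "y \<in> ?g ` carrier U" using u(5)[OF x(1)] by (intro image_eqI[of _ _ "\<phi> x"]) auto
  qed (use u v in auto)
  ultimately obtain h where h: "h \<in> mhom A P U" "compose (carrier P) ?g h = ?f" using P U V unfolding projective_def by blast
  have hl: "h \<in> lhom A P U" by (rule mhom_lhom[OF h(1)])
  show thesis
  proof (rule that[OF lhom_o[OF hl u(2)]], rule ballI)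
    fix p assume p: "p \<in> carrier P"
    then have hp: "h p \<in> carrier U" by (rule lhom_in[OF hl])
    have "\<phi>' (g (\<psi> (h p))) = \<phi>' (f p)" using fun_cong[OF h(2), of p] p hp by (simp add: compose_def)
    then have "\<psi>' (\<phi>' (g (\<psi> (h p)))) = \<psi>' (\<phi>' (f p))" by (rule arg_cong)
    moreover have "g (\<psi> (h p)) \<in> ?S" "f p \<in> ?S" using u(6)[OF hp] sub p by auto
    ultimately show "g (\<psi> (h p)) = f p" using v(3)[of "g (\<psi> (h p))"] v(3)[of "f p"] by simp
  qed
qed

end

text \<open>The homomorphism theorem in a form that replaces quotients: the surjection
  \<open>e\<close> presents \<open>M\<close> by its kernel.\<close>

lemma lhom_factor_surj:
  assumes P: "lmod R P" and M: "lmod R M" and N: "lmod R N"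
    and e: "e \<in> lhom R P M" and surj: "e ` carrier P = carrier M" and g: "g \<in> lhom R P N"
    and ker: "\<forall>x\<in>carrier P. e x = zero M \<longrightarrow> g x = zero N"
  obtains f where "f \<in> lhom R M N" "\<forall>x\<in>carrier P. f (e x) = g x"
proof -
  interpret P: left_module R P by fact
  interpret M: left_module R M by fact
  interpret N: left_module R N by fact
  have g_eq: "g x = g x'" if "x \<in> carrier P" "x' \<in> carrier P" "e x = e x'" for x x'
  proof -
    have "e (x \<ominus>\<^bsub>P\<^esub> x') = zero M"
      using lhom_minus[OF P M e that(1,2)] M.minus_diff_zero_iff that lhom_in[OF e] by simp
    then have "g (x \<ominus>\<^bsub>P\<^esub> x') = zero N" using ker that by simp
    then have "g x \<ominus>\<^bsub>N\<^esub> g x' = zero N" using lhom_minus[OF P N g that(1,2)] by simp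
    then show ?thesis using N.minus_diff_zero_iff that lhom_in[OF g] by simp
  qed
  define f where "f y = g (inv_into (carrier P) e y)" for y
  have fe: "f (e x) = g x" if "x \<in> carrier P" for x
    unfolding f_def by (rule g_eq) (use that in \<open>auto simp: inv_into_into f_inv_into_f\<close>)
  have ex: "\<exists>x. x \<in> carrier P \<and> y = e x" if "y \<in> carrier M" for y using that surj by auto
  have "f \<in> lhom R M N"
  proof (rule lhomI)
    fix u v assume "u \<in> carrier M" "v \<in> carrier M"
    then obtain x y where "x \<in> carrier P" "u = e x" "y \<in> carrier P" "v = e y" using ex by blast
    then show "f (u \<oplus>\<^bsub>M\<^esub> v) = f u \<oplus>\<^bsub>N\<^esub> f v"
      using fe[of "x \<oplus>\<^bsub>P\<^esub> y"] by (simp add: fe lhom_add[OF g] lhom_add[OF e])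
  next
    fix a u assume "a \<in> carrier R" "u \<in> carrier M"
    then obtain x where "x \<in> carrier P" "u = e x" "a \<in> carrier R" using ex by blast
    then show "f (a \<odot>\<^bsub>M\<^esub> u) = a \<odot>\<^bsub>N\<^esub> f u"
      using fe[of "a \<odot>\<^bsub>P\<^esub> x"] by (simp add: fe lhom_smult[OF g] lhom_smult[OF e])
  next
    fix u assume "u \<in> carrier M"
    then obtain x where "x \<in> carrier P" "u = e x" using ex by blast
    then show "f u \<in> carrier N" using fe lhom_in[OF g] by simp
  qed
  then show thesis by (rule that) (use fe in blast)
qed

context fdalg begin

text \<open>\<open>g\<close> may have a kernel as long as \<open>f\<close> vanishes on it:
  \<open>f\<close> factors through the image of \<open>g\<close>, and from that submodule of
  \<open>Y\<close> it extends.\<close>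

lemma injective_lift:
  assumes I: "injective A I" and X: "fgm A X" and Y: "fgm A Y" and g: "g \<in> lhom A X Y" and f: "f \<in> lhom A X I"
    and ker: "\<forall>x\<in>carrier X. g x = zero Y \<longrightarrow> f x = zero I"
  obtains h where "h \<in> lhom A Y I" "\<forall>x\<in>carrier X. h (g x) = f x"
proof -
  have X': "lmod A X" and Y': "lmod A Y" and I': "lmod A I" using X Y I unfolding injective_def fg_module_def by auto
  interpret X: left_module A X by fact
  let ?S = "g ` carrier X"
  have S: "submod A Y ?S" by (rule submod_image[OF X' Y' g X.submod_carrier])
  have gS: "g \<in> lhom A X (subm Y ?S)" using g by (auto simp: lhom_def)
  obtain f' where f': "f' \<in> lhom A (subm Y ?S) I" and f'g: "\<forall>x\<in>carrier X. f' (g x) = f x"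
    by (rule lhom_factor_surj[OF X' subm_module[OF Y' S] I' gS _ f]) (use ker in simp_all)
  obtain U :: "('k, 'a) umodule" and \<phi> \<psi> where U: "fgm A U" "mod_iso A (subm Y ?S) U \<phi> \<psi>"
    by (rule umodule_copy[OF fg_submodule[OF Y S]])
  obtain V :: "('k, 'a) umodule" and \<phi>' \<psi>' where V: "fgm A V" "mod_iso A Y V \<phi>' \<psi>'" by (rule umodule_copy[OF Y])
  note u = mod_isoD[OF U(2)] and v = mod_isoD[OF V(2)]
  have U': "lmod A U" by (rule fg_left[OF U(1)])
  have inc: "(\<lambda>x. x) \<in> lhom A (subm Y ?S) Y" using S by (auto intro!: lhomI simp: submod_def)
  have \<psi>c: "\<psi> x \<in> carrier Y" if "x \<in> carrier U" for x using lhom_in[OF lhom_o[OF u(2) inc] that] .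
  let ?g = "restrict (\<lambda>x. \<phi>' (\<psi> x)) (carrier U)" and ?f = "restrict (\<lambda>x. f' (\<psi> x)) (carrier U)"
  have "?g \<in> mhom A U V" by (rule lhom_mhom[OF U' lhom_o[OF lhom_o[OF u(2) inc] v(1)]])
  moreover have "?f \<in> mhom A U I" by (rule lhom_mhom[OF U' lhom_o[OF u(2) f']])
  moreover have "inj_on ?g (carrier U)"
  proof (rule inj_onI)
    fix x y assume xy: "x \<in> carrier U" "y \<in> carrier U" "?g x = ?g y"
    then have "\<psi>' (\<phi>' (\<psi> x)) = \<psi>' (\<phi>' (\<psi> y))" by simp
    then have "\<psi> x = \<psi> y" using v(3) \<psi>c xy by simp
    then have "\<phi> (\<psi> x) = \<phi> (\<psi> y)" by simp
    then show "x = y" using u(4) xy by simp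
  qed
  ultimately obtain h where h: "h \<in> mhom A V I" "compose (carrier U) h ?g = ?f" using I U V unfolding injective_def by blast
  have hl: "h \<in> lhom A V I" by (rule mhom_lhom[OF h(1)])
  show thesis
  proof (rule that[OF lhom_o[OF v(1) hl]], rule ballI)
    fix x assume x: "x \<in> carrier X"
    have gx: "g x \<in> carrier (subm Y ?S)" using x by simp
    have "\<phi> (g x) \<in> carrier U" by (rule u(5)[OF gx])
    then have "h (\<phi>' (\<psi> (\<phi> (g x)))) = f' (\<psi> (\<phi> (g x)))"
      using fun_cong[OF h(2), of "\<phi> (g x)"] by (simp add: compose_def)
    then show "h (\<phi>' (g x)) = f x" using u(3)[OF gx] bspec[OF f'g x] by simp
  qed
qed

end

section \<open>Direct summands of powers\<close>

text \<open>The additive closure of a class: the identity of \<open>M\<close> is a finite sum of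
  maps factoring through members of \<open>\<X>\<close>. For a summand of a power these maps come
  from the components of inclusion and projection. In contrast to \<open>in_add\<close>, no
  complement has to be named and different members may be mixed.\<close>

definition addr :: "('r, 'x) ring_scheme \<Rightarrow> ('r, 'y) module set \<Rightarrow> ('r, 'm) module \<Rightarrow> bool" where
  "addr R \<X> M \<longleftrightarrow> (\<exists>(n::nat) X i r.
     (\<forall>s<n. X s \<in> \<X> \<and> i s \<in> lhom R M (X s) \<and> r s \<in> lhom R (X s) M) \<and>
     (\<forall>m\<in>carrier M. m = msum M (\<lambda>s. r s (i s m)) n))"

lemma addrE:
  assumes "addr R \<X> M" obtains n X i r where "\<forall>s<(n::nat). X s \<in> \<X>" "\<forall>s<n. i s \<in> lhom R M (X s)"
    "\<forall>s<n. r s \<in> lhom R (X s) M" "\<forall>m\<in>carrier M. m = msum M (\<lambda>s. r s (i s m)) n"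
proof -
  from assms obtain n X i r where
    *: "(\<forall>s<(n::nat). X s \<in> \<X> \<and> i s \<in> lhom R M (X s) \<and> r s \<in> lhom R (X s) M) \<and>
     (\<forall>m\<in>carrier M. m = msum M (\<lambda>s. r s (i s m)) n)" unfolding addr_def by (elim exE) (rule that)
  show thesis by (rule that[of n X i r]) (use * in blast)+
qed

lemma addr_retract:
  assumes M: "lmod R M" and X: "X \<in> \<X>" and i: "i \<in> lhom R M X" and r: "r \<in> lhom R X M"
    and ri: "\<forall>m\<in>carrier M. r (i m) = m"
  shows "addr R \<X> M"
proof -
  interpret left_module R M by fact
  show ?thesis unfolding addr_def
    by (rule exI[of _ "Suc 0"], rule exI[of _ "\<lambda>_. X"], rule exI[of _ "\<lambda>_. i"], rule exI[of _ "\<lambda>_. r"])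
      (use X i r ri in auto)
qed

lemma addr_refl: "lmod R X \<Longrightarrow> X \<in> \<X> \<Longrightarrow> addr R \<X> X"
  by (rule addr_retract[OF _ _ lhom_id lhom_id]) auto

lemma addr_iso: "lmod R M \<Longrightarrow> X \<in> \<X> \<Longrightarrow> mod_iso R M X \<phi> \<psi> \<Longrightarrow> addr R \<X> M"
  by (rule addr_retract[of R M X \<X> \<phi> \<psi>]) (auto simp: mod_iso_def)

lemma in_add_addr:
  fixes A :: "('k, 'a) module" and M :: "('a, 'm) module"
  assumes R: "ring A" and X: "lmod A X" and M: "in_add A X M"
  shows "addr A {X} M"
proof -
  obtain n and L :: "('k, 'a) umodule" where M: "fgm A M" and L: "fgm A L" and iso: "iso_mod A (dsum M L) (dsum_upto n (\<lambda>_. X))"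
    using M unfolding in_add_def summand_def by blast
  let ?D = "dsum_upto n (\<lambda>_. X)" and ?S = "dsum M L"
  have M': "lmod A M" and L': "lmod A L" using M L unfolding fg_module_def by auto
  interpret M: left_module A M by fact
  interpret L: left_module A L by fact
  have S: "lmod A ?S" by (rule dsum_module[OF M' L'])
  have D: "lmod A ?D" by (rule dsum_upto_module[OF R X])
  obtain f where f: "f \<in> mhom A ?S ?D" "bij_betw f (carrier ?S) (carrier ?D)" using iso unfolding iso_mod_def by blast
  note iso' = mod_isoD[OF mod_iso_bij[OF S mhom_lhom[OF f(1)] f(2)]]
  define g where "g = inv_into (carrier ?S) f"
  have g: "g \<in> lhom A ?D ?S" "\<And>x. x \<in> carrier ?S \<Longrightarrow> g (f x) = x" using iso' by (auto simp: g_def)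
  have inM: "(\<lambda>m. (m, zero L)) \<in> lhom A M ?S" by (rule lhomI) auto
  have fst: "fst \<in> lhom A ?S M" by (rule lhomI) auto
  have fl: "(\<lambda>m. f (m, zero L)) \<in> lhom A M ?D" by (rule lhom_o[OF inM iso'(1)])
  have gl: "(\<lambda>x. fst (g x)) \<in> lhom A ?D M" by (rule lhom_o[OF g(1) fst])
  show ?thesis unfolding addr_def
  proof (rule exI[of _ n], rule exI[of _ "\<lambda>_. X"], rule exI[of _ "\<lambda>s m. f (m, zero L) s"],
      rule exI[of _ "\<lambda>s x. fst (g (single n (\<lambda>_. X) s x))"], intro conjI allI impI ballI)
    fix s assume s: "s < n"
    show "X \<in> {X}" by simp
    show "(\<lambda>m. f (m, zero L) s) \<in> lhom A M X" by (rule lhom_o[OF fl lhom_proj[OF s]])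
    show "(\<lambda>x. fst (g (single n (\<lambda>_. X) s x))) \<in> lhom A X M" by (rule lhom_o[OF lhom_single[OF X s] gl])
  next
    fix m assume m: "m \<in> carrier M"
    let ?x = "f (m, zero L)"
    have x: "?x \<in> carrier ?D" by (rule lhom_in[OF fl m])
    have sc: "single n (\<lambda>_. X) s (?x s) \<in> carrier ?D" if "s < n" for s
      by (rule lhom_in[OF lhom_single[where X = "\<lambda>_. X", OF X that]]) (use x that in \<open>auto simp: PiE_iff\<close>)
    have "m = fst (g ?x)" using g(2)[of "(m, zero L)"] m by simp
    also have "\<dots> = fst (g (msum ?D (\<lambda>s. single n (\<lambda>_. X) s (?x s)) n))" using dsum_upto_expand[OF R X x] by simp
    also have "\<dots> = msum M (\<lambda>s. fst (g (single n (\<lambda>_. X) s (?x s)))) n" by (rule lhom_msum[OF D M' gl sc])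
    finally show "m = msum M (\<lambda>s. fst (g (single n (\<lambda>_. X) s (?x s)))) n" .
  qed
qed

text \<open>Exactness of \<open>Hom(-, I)\<close> at \<open>Hom(Y, I)\<close> and of \<open>Hom(A, -)\<close> at \<open>Hom(A, I)\<close>.\<close>

definition hexl where
  "hexl R X f Y g Z I \<longleftrightarrow> (\<forall>w\<in>lhom R Y I. (\<forall>x\<in>carrier X. w (f x) = zero I) \<longrightarrow>
     (\<exists>w'\<in>lhom R Z I. \<forall>y\<in>carrier Y. w y = w' (g y)))"

definition hexr where
  "hexr R A J j I i L \<longleftrightarrow> (\<forall>u\<in>lhom R A I. (\<forall>a\<in>carrier A. i (u a) = zero L) \<longrightarrow>
     (\<exists>u'\<in>lhom R A J. \<forall>a\<in>carrier A. u a = j (u' a)))"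

text \<open>The index lies one below the degree: index \<open>n\<close> concerns cohomology in
  degree \<open>n + 1\<close>, so that degree 0, where a different condition applies, never
  occurs.\<close>

abbreviation hexl_at where "hexl_at R P d n I \<equiv> hexl R (P (Suc (Suc n))) (d (Suc n)) (P (Suc n)) (d n) (P n) I"

abbreviation hexr_at where "hexr_at R A J \<delta> n \<equiv> hexr R A (J n) (\<delta> n) (J (Suc n)) (\<delta> (Suc n)) (J (Suc (Suc n)))"

lemma hexlD:
  assumes "hexl R X f Y g Z I" "w \<in> lhom R Y I" "\<And>x. x \<in> carrier X \<Longrightarrow> w (f x) = zero I"
  obtains w' where "w' \<in> lhom R Z I" "\<forall>y\<in>carrier Y. w y = w' (g y)"
proof -
  from assms obtain w' where "w' \<in> lhom R Z I" "\<forall>y\<in>carrier Y. w y = w' (g y)" unfolding hexl_def by blast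
  then show thesis using that by blast
qed

lemma hexrD:
  assumes "hexr R A J j I i L" "u \<in> lhom R A I" "\<And>a. a \<in> carrier A \<Longrightarrow> i (u a) = zero L"
  obtains u' where "u' \<in> lhom R A J" "\<forall>a\<in>carrier A. u a = j (u' a)"
proof -
  from assms obtain w' where "w' \<in> lhom R A J" "\<forall>y\<in>carrier A. u y = j (w' y)" unfolding hexr_def by blast
  then show thesis using that by blast
qed

text \<open>The component of \<open>w\<close> under each \<open>i s\<close> lands in a member of
  \<open>\<X>\<close> and is factored there; the factorizations are reassembled with the
  \<open>r s\<close>.\<close>

lemma addr_hexl:
  assumes I: "lmod R I" and a: "addr R \<X> I"
    and mod: "\<And>X. X \<in> \<X> \<Longrightarrow> lmod R X" and h: "\<And>X. X \<in> \<X> \<Longrightarrow> hexl R A f B g C X"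
    and f: "f \<in> carrier A \<rightarrow> carrier B"
  shows "hexl R A f B g C I" unfolding hexl_def
proof (intro ballI impI)
  fix w assume w: "w \<in> lhom R B I" and wf: "\<forall>x\<in>carrier A. w (f x) = zero I"
  obtain n X i r where X: "\<forall>s<(n::nat). X s \<in> \<X>" and i: "\<forall>s<n. i s \<in> lhom R I (X s)"
    and r: "\<forall>s<n. r s \<in> lhom R (X s) I" and eq: "\<forall>m\<in>carrier I. m = msum I (\<lambda>s. r s (i s m)) n"
    by (rule addrE[OF a])
  have "\<forall>s. \<exists>w'. s < n \<longrightarrow> w' \<in> lhom R C (X s) \<and> (\<forall>y\<in>carrier B. i s (w y) = w' (g y))"
  proof (intro allI)
    fix s
    show "\<exists>w'. s < n \<longrightarrow> w' \<in> lhom R C (X s) \<and> (\<forall>y\<in>carrier B. i s (w y) = w' (g y))"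
    proof (cases "s < n")
      case True
      have i': "i s \<in> lhom R I (X s)" using i True by blast
      have hX: "hexl R A f B g C (X s)" and Xm: "lmod R (X s)" using X True h mod by auto
      have "\<forall>x\<in>carrier A. i s (w (f x)) = zero (X s)" using wf lhom_zero[OF I Xm i'] by simp
      from mp[OF bspec[OF hX[unfolded hexl_def] lhom_o[OF w i']] this] show ?thesis by auto
    qed auto
  qed
  from choice[OF this] obtain w' where
    w': "\<forall>s. s < n \<longrightarrow> w' s \<in> lhom R C (X s) \<and> (\<forall>y\<in>carrier B. i s (w y) = w' s (g y))" by blast
  show "\<exists>w'\<in>lhom R C I. \<forall>y\<in>carrier B. w y = w' (g y)"
  proof (rule bexI[of _ "\<lambda>c. msum I (\<lambda>s. r s (w' s c)) n"], rule ballI)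
    fix y assume y: "y \<in> carrier B"
    have "w y = msum I (\<lambda>s. r s (i s (w y))) n" using eq lhom_in[OF w y] by blast
    also have "\<dots> = msum I (\<lambda>s. r s (w' s (g y))) n" by (rule msum_cong) (use w' y in auto)
    finally show "w y = msum I (\<lambda>s. r s (w' s (g y))) n" .
  next
    show "(\<lambda>c. msum I (\<lambda>s. r s (w' s c)) n) \<in> lhom R C I"
      by (rule lhom_msum_map[OF I]) (use r w' in \<open>auto intro: lhom_o\<close>)
  qed
qed

text \<open>Dually, \<open>u\<close> is lifted after composition with each \<open>r s\<close>, and
  the lifts are summed after the \<open>p s\<close>.\<close>

lemma addr_hexr:
  assumes A: "lmod R A" and J: "lmod R J" and I: "lmod R I" and j: "j \<in> lhom R J I" and a: "addr R \<X> A"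
    and mod: "\<And>X. X \<in> \<X> \<Longrightarrow> lmod R X" and h: "\<And>X. X \<in> \<X> \<Longrightarrow> hexr R X J j I i L"
  shows "hexr R A J j I i L" unfolding hexr_def
proof (intro ballI impI)
  fix u assume u: "u \<in> lhom R A I" and iu: "\<forall>x\<in>carrier A. i (u x) = zero L"
  obtain n X p r where X: "\<forall>s<(n::nat). X s \<in> \<X>" and p: "\<forall>s<n. p s \<in> lhom R A (X s)"
    and r: "\<forall>s<n. r s \<in> lhom R (X s) A" and eq: "\<forall>m\<in>carrier A. m = msum A (\<lambda>s. r s (p s m)) n"
    by (rule addrE[OF a])
  have "\<forall>s. \<exists>u'. s < n \<longrightarrow> u' \<in> lhom R (X s) J \<and> (\<forall>y\<in>carrier (X s). u (r s y) = j (u' y))"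
  proof (intro allI)
    fix s
    show "\<exists>u'. s < n \<longrightarrow> u' \<in> lhom R (X s) J \<and> (\<forall>y\<in>carrier (X s). u (r s y) = j (u' y))"
    proof (cases "s < n")
      case True
      have rs: "r s \<in> lhom R (X s) A" using r True by blast
      have hX: "hexr R (X s) J j I i L" using X True h by auto
      have "\<forall>x\<in>carrier (X s). i (u (r s x)) = zero L" using iu lhom_in[OF rs] by simp
      from mp[OF bspec[OF hX[unfolded hexr_def] lhom_o[OF rs u]] this] show ?thesis by auto
    qed auto
  qed
  from choice[OF this] obtain u' where
    u': "\<forall>s. s < n \<longrightarrow> u' s \<in> lhom R (X s) J \<and> (\<forall>y\<in>carrier (X s). u (r s y) = j (u' s y))" by blast
  have pc: "p s y \<in> carrier (X s)" if "s < n" "y \<in> carrier A" for s y using lhom_in[of "p s" R A "X s"] p that by auto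
  have rc: "r s y \<in> carrier A" if "s < n" "y \<in> carrier (X s)" for s y using lhom_in[of "r s" R "X s" A] r that by auto
  have uc: "u' s y \<in> carrier J" if "s < n" "y \<in> carrier (X s)" for s y using lhom_in[of "u' s" R "X s" J] u' that by auto
  show "\<exists>u'\<in>lhom R A J. \<forall>y\<in>carrier A. u y = j (u' y)"
  proof (rule bexI[of _ "\<lambda>c. msum J (\<lambda>s. u' s (p s c)) n"], rule ballI)
    fix y assume y: "y \<in> carrier A"
    have "u y = u (msum A (\<lambda>s. r s (p s y)) n)" using bspec[OF eq y] by (rule arg_cong)
    also have "\<dots> = msum I (\<lambda>s. u (r s (p s y))) n" by (rule lhom_msum[OF A I u]) (rule rc[OF _ pc[OF _ y]])
    also have "\<dots> = msum I (\<lambda>s. j (u' s (p s y))) n" by (rule msum_cong) (use u' pc y in auto)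
    also have "\<dots> = j (msum J (\<lambda>s. u' s (p s y)) n)" by (rule lhom_msum[OF J I j, symmetric]) (rule uc[OF _ pc[OF _ y]])
    finally show "u y = j (msum J (\<lambda>s. u' s (p s y)) n)" .
  next
    show "(\<lambda>c. msum J (\<lambda>s. u' s (p s c)) n) \<in> lhom R A J"
      by (rule lhom_msum_map[OF J]) (use p u' in \<open>auto intro: lhom_o\<close>)
  qed
qed

text \<open>The biproduct identities for \<open>M\<close> as the direct sum of \<open>N\<close> and
  \<open>L\<close>, with \<open>\<psi>\<close> the inclusion and \<open>\<rho>\<close> the
  projection of \<open>L\<close>.\<close>

definition split_by where
  "split_by R M N i r L \<psi> \<rho> \<longleftrightarrow> i \<in> lhom R N M \<and> r \<in> lhom R M N \<and> \<psi> \<in> lhom R L M \<and> \<rho> \<in> lhom R M L \<and>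
     (\<forall>x\<in>carrier N. r (i x) = x \<and> \<rho> (i x) = zero L) \<and> (\<forall>x\<in>carrier L. \<rho> (\<psi> x) = x \<and> r (\<psi> x) = zero N) \<and>
     (\<forall>x\<in>carrier M. x = i (r x) \<oplus>\<^bsub>M\<^esub> \<psi> (\<rho> x))"

lemma split_byD:
  assumes "split_by R M N i r L \<psi> \<rho>"
  shows "i \<in> lhom R N M" "r \<in> lhom R M N" "\<psi> \<in> lhom R L M" "\<rho> \<in> lhom R M L"
    "\<And>x. x \<in> carrier N \<Longrightarrow> r (i x) = x" "\<And>x. x \<in> carrier N \<Longrightarrow> \<rho> (i x) = zero L"
    "\<And>x. x \<in> carrier L \<Longrightarrow> \<rho> (\<psi> x) = x" "\<And>x. x \<in> carrier L \<Longrightarrow> r (\<psi> x) = zero N"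
    "\<And>x. x \<in> carrier M \<Longrightarrow> x = i (r x) \<oplus>\<^bsub>M\<^esub> \<psi> (\<rho> x)"
  using assms unfolding split_by_def by blast+

lemma iso_modI:
  assumes M: "lmod R M" and f: "f \<in> lhom R M N" and b: "bij_betw f (carrier M) (carrier N)"
  shows "iso_mod R M N" unfolding iso_mod_def
proof (rule bexI[OF _ lhom_mhom[OF M f]])
  have "bij_betw (restrict f (carrier M)) (carrier M) (carrier N) = bij_betw f (carrier M) (carrier N)"
    by (rule bij_betw_cong) (rule restrict_apply')
  then show "bij_betw (restrict f (carrier M)) (carrier M) (carrier N)" using b by blast
qed

context fdalg begin

text \<open>The complement is the kernel of \<open>r\<close>, copied to
  \<open>nat \<Rightarrow> 'k\<close> because \<open>summand\<close> and
  \<open>indecomposable\<close> take complements there; \<open>x - i (r x)\<close> projects onto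
  it.\<close>

lemma retract_split:
  assumes M: "fgm A M" and N: "fgm A N"
    and i: "i \<in> lhom A N M" and r: "r \<in> lhom A M N" and ri: "\<forall>x\<in>carrier N. r (i x) = x"
  obtains L :: "('k, 'a) umodule" and \<psi> \<rho> where "fgm A L" "split_by A M N i r L \<psi> \<rho>" "iso_mod A (dsum N L) M"
proof -
  have M': "lmod A M" and N': "lmod A N" using M N fg_left by auto
  interpret M: left_module A M by fact
  interpret N: left_module A N by fact
  let ?Z = "{x \<in> carrier M. r x = zero N}"
  have Z: "submod A M ?Z" by (rule submod_kernel[OF M' N' r])
  obtain L :: "('k, 'a) umodule" and t \<psi> where L: "fgm A L" "mod_iso A (subm M ?Z) L t \<psi>"
    by (rule umodule_copy[OF fg_submodule[OF M Z]])
  note v = mod_isoD[OF L(2)]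
  have L': "lmod A L" by (rule fg_left[OF L(1)])
  have \<psi>: "\<psi> \<in> lhom A L M" by (rule lhom_o[OF v(2)]) (auto intro!: lhomI)
  have ic: "i x \<in> carrier M" if "x \<in> carrier N" for x using lhom_in[OF i that] .
  have e: "(\<lambda>x. x \<ominus>\<^bsub>M\<^esub> i (r x)) \<in> lhom A M M" by (rule lhom_diff[OF M' lhom_id lhom_o[OF r i]])
  have eZ: "x \<ominus>\<^bsub>M\<^esub> i (r x) \<in> ?Z" if x: "x \<in> carrier M" for x
    using lhom_minus[OF M' N' r x ic[OF lhom_in[OF r x]]] ri lhom_in[OF r x] lhom_in[OF e x] N.minus_diff_zero_iff by simp
  have e': "(\<lambda>x. x \<ominus>\<^bsub>M\<^esub> i (r x)) \<in> lhom A M (subm M ?Z)" using e eZ by (auto simp: lhom_def)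
  let ?\<rho> = "\<lambda>x. t (x \<ominus>\<^bsub>M\<^esub> i (r x))"
  have sp: "split_by A M N i r L \<psi> ?\<rho>" unfolding split_by_def
  proof (intro conjI ballI i r \<psi> lhom_o[OF e' v(1)])
    fix x assume x: "x \<in> carrier N"
    show rix: "r (i x) = x" using ri x by blast
    have "i x \<ominus>\<^bsub>M\<^esub> i (r (i x)) = zero (subm M ?Z)" using ic[OF x] rix M.minus_diff_zero_iff by simp
    then show "?\<rho> (i x) = zero L" using lhom_zero[OF subm_module[OF M' Z] L' v(1)] by simp
  next
    fix x assume x: "x \<in> carrier L"
    have z: "\<psi> x \<in> ?Z" using v(6)[OF x] by simp
    then show rz: "r (\<psi> x) = zero N" by simp
    have "\<psi> x \<ominus>\<^bsub>M\<^esub> i (r (\<psi> x)) = \<psi> x" using z lhom_zero[OF N' M' i] by (simp add: M.M.minus_eq)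
    then show "?\<rho> (\<psi> x) = x" using v(4)[OF x] by simp
  next
    fix x assume x: "x \<in> carrier M"
    have "\<psi> (?\<rho> x) = x \<ominus>\<^bsub>M\<^esub> i (r x)" by (rule v(3)) (use eZ[OF x] in simp)
    then show "x = i (r x) \<oplus>\<^bsub>M\<^esub> \<psi> (?\<rho> x)" using M.diff_add_cancel[OF x ic[OF lhom_in[OF r x]]] by simp
  qed
  note s = split_byD[OF sp]
  have S: "lmod A (dsum N L)" by (rule dsum_module[OF N' L'])
  interpret L: left_module A L by fact
  have "fst \<in> lhom A (dsum N L) N" "snd \<in> lhom A (dsum N L) L" by (auto intro!: lhomI)
  then have f: "(\<lambda>x. i (fst x) \<oplus>\<^bsub>M\<^esub> \<psi> (snd x)) \<in> lhom A (dsum N L) M"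
    by (intro lhom_plus[OF M' lhom_o[OF _ i] lhom_o[OF _ \<psi>]])
  have "bij_betw (\<lambda>x. i (fst x) \<oplus>\<^bsub>M\<^esub> \<psi> (snd x)) (carrier (dsum N L)) (carrier M)"
  proof (rule bij_betw_byWitness[where f' = "\<lambda>x. (r x, ?\<rho> x)"])
    show "\<forall>x\<in>carrier (dsum N L). (r (i (fst x) \<oplus>\<^bsub>M\<^esub> \<psi> (snd x)), ?\<rho> (i (fst x) \<oplus>\<^bsub>M\<^esub> \<psi> (snd x))) = x"
    proof
      fix x assume "x \<in> carrier (dsum N L)"
      then have x: "fst x \<in> carrier N" "snd x \<in> carrier L" by auto
      have "r (i (fst x) \<oplus>\<^bsub>M\<^esub> \<psi> (snd x)) = fst x" "?\<rho> (i (fst x) \<oplus>\<^bsub>M\<^esub> \<psi> (snd x)) = snd x"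
        using lhom_add[OF s(2) ic[OF x(1)] lhom_in[OF \<psi> x(2)]] s(5,6)[OF x(1)] s(7,8)[OF x(2)]
          lhom_add[OF s(4) ic[OF x(1)] lhom_in[OF \<psi> x(2)]] x by simp_all
      then show "(r (i (fst x) \<oplus>\<^bsub>M\<^esub> \<psi> (snd x)), ?\<rho> (i (fst x) \<oplus>\<^bsub>M\<^esub> \<psi> (snd x))) = x" by simp
    qed
    show "\<forall>x\<in>carrier M. i (fst (r x, ?\<rho> x)) \<oplus>\<^bsub>M\<^esub> \<psi> (snd (r x, ?\<rho> x)) = x" using s(9)[symmetric] by simp
    show "(\<lambda>x. i (fst x) \<oplus>\<^bsub>M\<^esub> \<psi> (snd x)) ` carrier (dsum N L) \<subseteq> carrier M" using lhom_in[OF f] by blast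
    show "(\<lambda>x. (r x, ?\<rho> x)) ` carrier M \<subseteq> carrier (dsum N L)" using lhom_in[OF s(2)] lhom_in[OF s(4)] by auto
  qed
  then show thesis by (rule that[OF L(1) sp iso_modI[OF S f]])
qed

lemma summand_retract: 
  fixes M :: "('a, 'm) module" and N :: "('a, 'n) module"
  assumes M: "fgm A M" and N: "fgm A N"
    and i: "i \<in> lhom A N M" and r: "r \<in> lhom A M N" and ri: "\<forall>x\<in>carrier N. r (i x) = x"
  shows "summand A N M"
proof -
  obtain L :: "('k, 'a) umodule" and \<psi> \<rho> where "fgm A L" "split_by A M N i r L \<psi> \<rho>" "iso_mod A (dsum N L) M"
    by (rule retract_split[OF M N i r]) (rule ri)
  then show ?thesis using N unfolding summand_def by blast
qed

lemma in_addI: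
  assumes X: "fgm A X" and U: "fgm A U" and iso: "mod_iso A U (dsum_upto n (\<lambda>_. X)) \<phi> \<psi>"
  shows "in_add A X U"
proof -
  have "summand A U (dsum_upto n (\<lambda>_. X))"
    by (rule summand_retract[OF fg_dsum_upto[OF ring_A X] U mod_isoD(1)[OF iso] mod_isoD(2)[OF iso]])
      (use iso in \<open>simp add: mod_iso_def\<close>)
  then show ?thesis unfolding in_add_def by blast
qed

lemma injective_fg: "injective A I \<Longrightarrow> fgm A I" and projective_fg: "projective A P \<Longrightarrow> fgm A P"
  by (auto simp: injective_def projective_def)

text \<open>Extending maps along an injective \<open>g\<close> is exactness of Hom into
  \<open>M\<close> on \<open>0 -> Y -> Z\<close>, which \<open>addr_hexl\<close> passes on from the
  members of \<open>\<X>\<close>.\<close>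

lemma addr_injective:
  fixes M :: "('a, 'm) module" and \<X> :: "('a, 'x) module set"
  assumes M: "fgm A M" and a: "addr A \<X> M" and X: "\<And>X. X \<in> \<X> \<Longrightarrow> injective A X"
  shows "injective A M" unfolding injective_def
proof (intro conjI allI impI M)
  fix Y :: "('k, 'a) umodule" and Z :: "('k, 'a) umodule" and g f
  assume "fgm A Y \<and> fgm A Z \<and> g \<in> mhom A Y Z \<and> inj_on g (carrier Y) \<and> f \<in> mhom A Y M"
  then have Y: "fgm A Y" and Z: "fgm A Z" and g: "g \<in> lhom A Y Z" and inj: "inj_on g (carrier Y)"
    and f: "f \<in> mhom A Y M" and fl: "f \<in> lhom A Y M" using mhom_lhom by auto
  have M': "lmod A M" and Y': "lmod A Y" and Z': "lmod A Z" using M Y Z unfolding fg_module_def by auto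
  have "hexl A (subm Y {zero Y}) (\<lambda>x. x) Y g Z M"
  proof (rule addr_hexl[OF M' a])
    fix X assume "X \<in> \<X>"
    then have X: "injective A X" by (rule X)
    then have X': "lmod A X" by (simp add: injective_def fg_module_def)
    then show "lmod A X" .
    show "hexl A (subm Y {zero Y}) (\<lambda>x. x) Y g Z X" unfolding hexl_def
    proof (intro ballI impI)
      fix w assume w: "w \<in> lhom A Y X"
      have "\<forall>x\<in>carrier Y. g x = zero Z \<longrightarrow> w x = zero X"
        using inj[unfolded lhom_inj_iff[OF Y' Z' g]] lhom_zero[OF Y' X' w] by auto
      then obtain h where "h \<in> lhom A Z X" "\<forall>x\<in>carrier Y. h (g x) = w x" by (rule injective_lift[OF X Y Z g w])
      then show "\<exists>w'\<in>lhom A Z X. \<forall>y\<in>carrier Y. w y = w' (g y)" by (intro bexI[of _ h]) auto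
    qed
  qed (use left_module.submod_zero[OF Y'] in \<open>auto simp: submod_def\<close>)
  then obtain h where h: "h \<in> lhom A Z M" "\<forall>y\<in>carrier Y. f y = h (g y)"
    by (rule hexlD[OF _ fl]) (use lhom_zero[OF Y' M' fl] in auto)
  have "compose (carrier Y) (restrict h (carrier Z)) g = f"
    using h(2) f lhom_in[OF g] by (auto simp: compose_def mhom_def fun_eq_iff PiE_iff extensional_def)
  then show "\<exists>h\<in>mhom A Z M. compose (carrier Y) h g = f" using lhom_mhom[OF Z' h(1)] by blast
qed

text \<open>Lifting along a surjection is exactness of Hom from \<open>M\<close> on
  \<open>Y -> Z -> 0\<close>, with the zero map of \<open>Z\<close> as outgoing map;
  \<open>addr_hexr\<close> passes it on.\<close>

lemma addr_projective:
  fixes M :: "('a, 'm) module" and \<X> :: "('a, 'x) module set"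
  assumes M: "fgm A M" and a: "addr A \<X> M" and X: "\<And>X. X \<in> \<X> \<Longrightarrow> projective A X"
  shows "projective A M" unfolding projective_def
proof (intro conjI allI impI M)
  fix Y :: "('k, 'a) umodule" and Z :: "('k, 'a) umodule" and g f
  assume "fgm A Y \<and> fgm A Z \<and> g \<in> mhom A Y Z \<and> g ` carrier Y = carrier Z \<and> f \<in> mhom A M Z"
  then have Y: "fgm A Y" and Z: "fgm A Z" and g: "g \<in> lhom A Y Z" and s: "g ` carrier Y = carrier Z"
    and f: "f \<in> mhom A M Z" and fl: "f \<in> lhom A M Z" using mhom_lhom by auto
  have M': "lmod A M" and Y': "lmod A Y" and Z': "lmod A Z" using M Y Z unfolding fg_module_def by auto
  have "hexr A M Y g Z (\<lambda>_. zero Z) Z"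
  proof (rule addr_hexr[OF M' Y' Z' g a])
    fix X assume "X \<in> \<X>"
    then have X: "projective A X" by (rule X)
    then show "lmod A X" by (simp add: projective_def fg_module_def)
    show "hexr A X Y g Z (\<lambda>_. zero Z) Z" unfolding hexr_def
    proof (intro ballI impI)
      fix w assume w: "w \<in> lhom A X Z"
      have "w ` carrier X \<subseteq> g ` carrier Y" using s lhom_in[OF w] by auto
      then obtain h where "h \<in> lhom A X Y" "\<forall>x\<in>carrier X. g (h x) = w x" by (rule projective_lift[OF X Y Z g w])
      then show "\<exists>w'\<in>lhom A X Y. \<forall>y\<in>carrier X. w y = g (w' y)" by (intro bexI[of _ h]) auto
    qed
  qed
  then obtain h where h: "h \<in> lhom A M Y" "\<forall>y\<in>carrier M. f y = g (h y)" by (rule hexrD[OF _ fl]) auto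
  have "compose (carrier M) g (restrict h (carrier M)) = f"
    using h(2) f by (auto simp: compose_def mhom_def fun_eq_iff PiE_iff extensional_def)
  then show "\<exists>h\<in>mhom A M Y. compose (carrier M) g h = f" using lhom_mhom[OF M' h(1)] by blast
qed

end

lemma hexlI:
  assumes "\<And>w. w \<in> lhom R Y I \<Longrightarrow> (\<And>x. x \<in> carrier X \<Longrightarrow> w (f x) = zero I) \<Longrightarrow>
     \<exists>w'. w' \<in> lhom R Z I \<and> (\<forall>y\<in>carrier Y. w y = w' (g y))"
  shows "hexl R X f Y g Z I" using assms unfolding hexl_def by blast

lemma hexrI:
  assumes "\<And>u. u \<in> lhom R A I \<Longrightarrow> (\<And>a. a \<in> carrier A \<Longrightarrow> i (u a) = zero L) \<Longrightarrow>
     \<exists>u'. u' \<in> lhom R A J \<and> (\<forall>a\<in>carrier A. u a = j (u' a))"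
  shows "hexr R A J j I i L" using assms unfolding hexr_def by blast

section \<open>Duality, injective and projective resolutions\<close>

lemma fdalg_opp: "fdalg K A \<Longrightarrow> fdalg K (opp A)"
proof -
  assume "fdalg K A"
  then interpret fdalg K A .
  have ab: "abelian_group (opp A)" by (rule abelian_group_cong[OF A.abelian_group_axioms]) (auto simp: opp_def)
  have "ring (opp A)"
  proof (rule ringI[OF ab])
    show "Group.monoid (opp A)" by (rule monoidI) (auto simp: opp_def A.m_assoc)
  qed (auto simp: opp_def A.l_distr A.r_distr)
  moreover have "module K (opp A)"
    by (rule moduleI[OF K.cring_axioms ab]) (auto simp: opp_def KA.smult_l_distr KA.smult_r_distr KA.smult_assoc1)
  moreover have "finitely_generated K (opp A)" using fg_KA by (simp add: finitely_generated_def opp_def finsum_def)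
  ultimately show "fdalg K (opp A)" using field_K by (auto simp: fdalg_def fd_algebra_def alg_l alg_r) (auto simp: opp_def alg_l alg_r)
qed

lemma opp_opp [simp]: "opp (opp A) = A" by (simp add: opp_def)

lemma opp_simps [simp]: "carrier (opp A) = carrier A" "zero (opp A) = zero A" "one (opp A) = one A" "add (opp A) = add A"
  "x \<otimes>\<^bsub>opp A\<^esub> y = y \<otimes>\<^bsub>A\<^esub> x" "smult (opp A) = smult A" by (simp_all add: opp_def)

lemma fg_regular:
  assumes "ring R"
  shows "fgm R (regular R)"
proof -
  interpret ring R by fact
  have "gens R (regular R) {one R}" unfolding gens_def
  proof (intro conjI allI impI subsetI)
    fix T x assume T: "submod R (regular R) T" "{one R} \<subseteq> T" and x: "x \<in> carrier (regular R)"
    have "\<forall>a\<in>carrier R. \<forall>y\<in>T. a \<otimes>\<^bsub>R\<^esub> y \<in> T" using T(1) by (simp add: submod_def)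
    then have "x \<otimes>\<^bsub>R\<^esub> one R \<in> T" using T(2) x unfolding regular_simps by blast
    then show "x \<in> T" using x by simp
  qed auto
  then show ?thesis by (rule fg_moduleI[OF regular_module[OF assms]])
qed

context fdalg begin

lemma regular_K: "lmod K (regular K)" by (rule regular_module[OF ring_K])

lemma dual_simps [simp]: "zero (dual K A M) = (\<lambda>x\<in>carrier M. zero K)"
  "\<phi> \<oplus>\<^bsub>dual K A M\<^esub> \<psi> = (\<lambda>x\<in>carrier M. \<phi> x \<oplus>\<^bsub>K\<^esub> \<psi> x)"
  "a \<odot>\<^bsub>dual K A M\<^esub> \<phi> = (\<lambda>x\<in>carrier M. \<phi> (a \<odot>\<^bsub>M\<^esub> x))"
  by (simp_all add: dual_def)

lemma dual_carrier:
  "\<phi> \<in> carrier (dual K A M) \<longleftrightarrow> \<phi> \<in> extensional (carrier M) \<and> \<phi> \<in> lhom K (kspace A M) (regular K)"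
  by (auto simp: dual_def mhom_def lhom_def PiE_def)

lemma dual_mem_restrict:
  assumes M: "lmod A M" and \<phi>: "\<phi> \<in> lhom K (kspace A M) (regular K)"
  shows "restrict \<phi> (carrier M) \<in> carrier (dual K A M)"
  unfolding dual_carrier by (auto intro: lhom_cong[OF \<phi> kspace_module[OF M]])

lemma smult_central:
  assumes M: "lmod A M" and a: "a \<in> carrier A" "c \<in> carrier K" and x: "x \<in> carrier M"
  shows "a \<odot>\<^bsub>M\<^esub> ((c \<odot>\<^bsub>A\<^esub> one A) \<odot>\<^bsub>M\<^esub> x) = (c \<odot>\<^bsub>A\<^esub> one A) \<odot>\<^bsub>M\<^esub> (a \<odot>\<^bsub>M\<^esub> x)"
proof -
  interpret M: left_module A M by fact
  have "a \<otimes>\<^bsub>A\<^esub> (c \<odot>\<^bsub>A\<^esub> one A) = (c \<odot>\<^bsub>A\<^esub> one A) \<otimes>\<^bsub>A\<^esub> a" using a by (simp add: alg_l alg_r)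
  then show ?thesis using a x by (simp flip: M.smult_assoc)
qed

lemma lhom_smult_kspace:
  assumes M: "lmod A M" and a: "a \<in> carrier A"
  shows "(\<lambda>x. a \<odot>\<^bsub>M\<^esub> x) \<in> lhom K (kspace A M) (kspace A M)"
proof -
  interpret M: left_module A M by fact
  show ?thesis by (rule lhomI) (use a in \<open>auto simp: M.smult_r_distr smult_central[OF M]\<close>)
qed

lemma dual_module:
  assumes M: "lmod A M"
  shows "lmod (opp A) (dual K A M)"
proof -
  interpret M: left_module A M by fact
  interpret oA: fdalg K "opp A" by (rule fdalg_opp[OF fdalg_axioms])
  note km = kspace_module[OF M]
  interpret RK: left_module K "regular K" by (rule regular_K)
  have D: "\<phi> \<in> extensional (carrier M)" "\<And>x. x \<in> carrier M \<Longrightarrow> \<phi> x \<in> carrier K" "\<phi> \<in> lhom K (kspace A M) (regular K)"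
    "\<And>x y. x \<in> carrier M \<Longrightarrow> y \<in> carrier M \<Longrightarrow> \<phi> (x \<oplus>\<^bsub>M\<^esub> y) = \<phi> x \<oplus>\<^bsub>K\<^esub> \<phi> y"
    if "\<phi> \<in> carrier (dual K A M)" for \<phi>
    using that lhom_in[of \<phi> K "kspace A M" "regular K"] lhom_add[of \<phi> K "kspace A M" "regular K"]
    unfolding dual_carrier by auto
  have plus: "\<phi> \<oplus>\<^bsub>dual K A M\<^esub> \<psi> \<in> carrier (dual K A M)" if "\<phi> \<in> carrier (dual K A M)" "\<psi> \<in> carrier (dual K A M)" for \<phi> \<psi>
    using dual_mem_restrict[OF M lhom_plus[OF regular_K D(3)[OF that(1)] D(3)[OF that(2)]]] by simp
  have neg: "(\<lambda>x\<in>carrier M. \<ominus>\<^bsub>K\<^esub> \<phi> x) \<in> carrier (dual K A M)" if "\<phi> \<in> carrier (dual K A M)" for \<phi>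
  proof -
    have "(\<lambda>x\<in>carrier M. \<ominus>\<^bsub>regular K\<^esub> \<phi> x) \<in> carrier (dual K A M)"
      by (rule dual_mem_restrict[OF M lhom_uminus[OF regular_K D(3)[OF that]]])
    moreover have "\<ominus>\<^bsub>regular K\<^esub> c = \<ominus>\<^bsub>K\<^esub> c" for c by (simp add: a_inv_def m_inv_def)
    ultimately show ?thesis by simp
  qed
  have zer: "zero (dual K A M) \<in> carrier (dual K A M)" using dual_mem_restrict[OF M lhom_const0[OF regular_K]] by simp
  have "abelian_group (dual K A M)"
  proof (rule abelian_groupI)
    fix \<phi> assume \<phi>: "\<phi> \<in> carrier (dual K A M)"
    show "\<exists>\<psi>\<in>carrier (dual K A M). \<psi> \<oplus>\<^bsub>dual K A M\<^esub> \<phi> = zero (dual K A M)"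
      using \<phi> by (intro bexI[OF _ neg[OF \<phi>]]) (auto intro!: restrict_ext simp: D(2) K.l_neg)
    show "zero (dual K A M) \<oplus>\<^bsub>dual K A M\<^esub> \<phi> = \<phi>"
      using D(1,2)[OF \<phi>] by (auto simp: fun_eq_iff extensional_def)
  next
    fix \<phi> \<psi> assume "\<phi> \<in> carrier (dual K A M)" "\<psi> \<in> carrier (dual K A M)"
    then show "\<phi> \<oplus>\<^bsub>dual K A M\<^esub> \<psi> = \<psi> \<oplus>\<^bsub>dual K A M\<^esub> \<phi>"
      by (auto intro!: restrict_ext K.a_comm D(2))
  qed (auto intro!: plus[simplified] zer[simplified] restrict_ext simp: D(2) K.a_assoc simp del: dual_simps(3))
  then show ?thesis
  proof (rule left_moduleI[OF oA.ring_A])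
    fix a \<phi> assume a: "a \<in> carrier (opp A)" and \<phi>: "\<phi> \<in> carrier (dual K A M)"
    have "(\<lambda>x. \<phi> (a \<odot>\<^bsub>M\<^esub> x)) \<in> lhom K (kspace A M) (regular K)"
      by (rule lhom_o[OF lhom_smult_kspace[OF M] D(3)[OF \<phi>]]) (use a in auto)
    from dual_mem_restrict[OF M this] show "a \<odot>\<^bsub>dual K A M\<^esub> \<phi> \<in> carrier (dual K A M)" by simp
  next
    fix a b \<phi> assume "a \<in> carrier (opp A)" "b \<in> carrier (opp A)" "\<phi> \<in> carrier (dual K A M)"
    then show "(a \<oplus>\<^bsub>opp A\<^esub> b) \<odot>\<^bsub>dual K A M\<^esub> \<phi> = a \<odot>\<^bsub>dual K A M\<^esub> \<phi> \<oplus>\<^bsub>dual K A M\<^esub> b \<odot>\<^bsub>dual K A M\<^esub> \<phi>"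
      by (auto intro!: restrict_ext simp: M.smult_l_distr D(4))
  next
    fix a b \<phi> assume "a \<in> carrier (opp A)" "b \<in> carrier (opp A)" "\<phi> \<in> carrier (dual K A M)"
    then show "(a \<otimes>\<^bsub>opp A\<^esub> b) \<odot>\<^bsub>dual K A M\<^esub> \<phi> = a \<odot>\<^bsub>dual K A M\<^esub> (b \<odot>\<^bsub>dual K A M\<^esub> \<phi>)"
      by (auto intro!: restrict_ext simp: M.smult_assoc)
  next
    fix \<phi> assume \<phi>: "\<phi> \<in> carrier (dual K A M)"
    then show "one (opp A) \<odot>\<^bsub>dual K A M\<^esub> \<phi> = \<phi>"
      using D(1)[OF \<phi>] by (auto simp: fun_eq_iff extensional_def)
  qed (auto intro!: restrict_ext)
qed

text \<open>Evaluation on a finite generating set embeds the dual in a finite power of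
  \<open>K\<close>.\<close>

lemma fg_dual:
  assumes M: "fgm A M"
  shows "fgm (opp A) (dual K A M)"
proof -
  interpret oA: fdalg K "opp A" by (rule fdalg_opp[OF fdalg_axioms])
  have M': "lmod A M" by (rule fg_left[OF M])
  note km = kspace_module[OF M'] and D = dual_module[OF M']
  obtain S where S: "gens K (kspace A M) S" using fg_moduleD(2)[OF fg_kspace[OF M]] by blast
  then obtain n and f :: "nat \<Rightarrow> _" where f: "S = f ` {i. i < n}"
    using finite_imp_nat_seg_image_inj_on[of S] by (auto simp: gens_def)
  have fM: "f i \<in> carrier M" if "i < n" for i using S f that by (auto simp: gens_def)
  let ?V = "kspace (opp A) (dual K A M)" and ?W = "dsum_upto n (\<lambda>_. regular K)"
  have V: "lmod K ?V" by (rule oA.kspace_module[OF D])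
  have fgW: "fgm K ?W" by (rule fg_dsum_upto[OF ring_K fg_regular[OF ring_K]])
  have ev: "(\<lambda>\<phi>. \<phi> x) \<in> lhom K ?V (regular K)" if x: "x \<in> carrier M" for x
  proof (rule lhomI)
    fix c \<phi> assume c: "c \<in> carrier K" "\<phi> \<in> carrier ?V"
    then have "\<phi> \<in> lhom K (kspace A M) (regular K)" using dual_carrier by auto
    from lhom_smult[OF this c(1), of x] show "(c \<odot>\<^bsub>?V\<^esub> \<phi>) x = c \<odot>\<^bsub>regular K\<^esub> \<phi> x" using x by simp
  next
    fix \<phi> assume "\<phi> \<in> carrier ?V"
    then have "\<phi> \<in> lhom K (kspace A M) (regular K)" using dual_carrier by auto
    from lhom_in[OF this, of x] show "\<phi> x \<in> carrier (regular K)" using x by simp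
  qed (use x in simp)
  let ?e = "\<lambda>\<phi>. \<lambda>i\<in>{..<n}. \<phi> (f i)"
  have e: "?e \<in> lhom K ?V ?W" by (rule lhom_tuple) (rule ev[OF fM])
  have "inj_on ?e (carrier ?V)" unfolding lhom_inj_iff[OF V fg_left[OF fgW] e]
  proof (intro ballI impI)
    fix \<phi> assume \<phi>: "\<phi> \<in> carrier ?V" "?e \<phi> = zero ?W"
    then have l: "\<phi> \<in> lhom K (kspace A M) (regular K)" "\<phi> \<in> extensional (carrier M)" using dual_carrier by auto
    have "\<phi> (f i) = zero K" if "i < n" for i using fun_cong[OF \<phi>(2), of i] that by simp
    then have "S \<subseteq> {x \<in> carrier (kspace A M). \<phi> x = zero (regular K)}" using fM by (auto simp: f)
    then have "carrier (kspace A M) \<subseteq> {x \<in> carrier (kspace A M). \<phi> x = zero (regular K)}"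
      using S submod_kernel[OF km regular_K l(1)] unfolding gens_def by blast
    then show "\<phi> = zero ?V" using l(2) by (auto simp: fun_eq_iff extensional_def)
  qed
  from fspace_fg_inj[OF field_K V fgW e this] show ?thesis using oA.fg_kspace_iff[OF D] by blast
qed

section \<open>D A as an injective cogenerator; enough injectives and projectives\<close>

abbreviation DA where "DA \<equiv> dual_regular K A"

lemma DA_simps [simp]: "zero DA = (\<lambda>x\<in>carrier A. zero K)"
  "\<phi> \<oplus>\<^bsub>DA\<^esub> \<psi> = (\<lambda>x\<in>carrier A. \<phi> x \<oplus>\<^bsub>K\<^esub> \<psi> x)"
  "a \<odot>\<^bsub>DA\<^esub> \<phi> = (\<lambda>x\<in>carrier A. \<phi> (x \<otimes>\<^bsub>A\<^esub> a))"
  by (simp_all add: dual_regular_def dual_def)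

lemma DA_carrier: "\<phi> \<in> carrier DA \<longleftrightarrow> \<phi> \<in> extensional (carrier A) \<and> \<phi> \<in> lhom K A (regular K)"
proof -
  interpret oA: fdalg K "opp A" by (rule fdalg_opp[OF fdalg_axioms])
  have "x \<otimes>\<^bsub>A\<^esub> (c \<odot>\<^bsub>A\<^esub> one A) = c \<odot>\<^bsub>A\<^esub> x" if "x \<in> carrier A" "c \<in> carrier K" for x c
    using that by (simp add: alg_r)
  then show ?thesis unfolding dual_regular_def oA.dual_carrier by (auto simp: lhom_def)
qed

lemma DA_module: "lmod A DA" and fg_DA: "fgm A DA"
proof -
  interpret oA: fdalg K "opp A" by (rule fdalg_opp[OF fdalg_axioms])
  show "lmod A DA" using oA.dual_module[OF regular_module[OF oA.ring_A]] by (simp add: dual_regular_def)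
  show "fgm A DA" using oA.fg_dual[OF fg_regular[OF oA.ring_A]] by (simp add: dual_regular_def)
qed

text \<open>The adjunction between \<open>K\<close>-linear functionals on \<open>M\<close> and
  \<open>A\<close>-linear maps from \<open>M\<close> to \<open>D A\<close>; its inverse is
  evaluation at \<open>one A\<close>.\<close>

definition hat :: "('a, 'm) module \<Rightarrow> ('m \<Rightarrow> 'k) \<Rightarrow> 'm \<Rightarrow> 'a \<Rightarrow> 'k" where
  "hat M \<psi> m = (\<lambda>x\<in>carrier A. \<psi> (x \<odot>\<^bsub>M\<^esub> m))"

lemma lhom_hat:
  assumes M: "lmod A M" and \<psi>: "\<psi> \<in> lhom K (kspace A M) (regular K)"
  shows "hat M \<psi> \<in> lhom A M DA"
proof (rule lhomI)
  interpret M: left_module A M by fact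
  note s = lhom_simps[OF kspace_module[OF M] regular_K \<psi>, simplified]
  fix m assume m: "m \<in> carrier M"
  have "(\<lambda>x. \<psi> (x \<odot>\<^bsub>M\<^esub> m)) \<in> lhom K A (regular K)"
  proof (rule lhomI)
    fix c x assume cx: "c \<in> carrier K" "x \<in> carrier A"
    have "c \<odot>\<^bsub>A\<^esub> x = (c \<odot>\<^bsub>A\<^esub> one A) \<otimes>\<^bsub>A\<^esub> x" using cx by (simp add: alg_l)
    then show "\<psi> ((c \<odot>\<^bsub>A\<^esub> x) \<odot>\<^bsub>M\<^esub> m) = c \<odot>\<^bsub>regular K\<^esub> \<psi> (x \<odot>\<^bsub>M\<^esub> m)"
      using cx m by (simp add: M.smult_assoc s)
  qed (use m in \<open>auto simp: M.smult_l_distr s\<close>)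
  from lhom_cong[OF this left_module_KA]
  show "hat M \<psi> m \<in> carrier DA" unfolding DA_carrier hat_def by auto
next
  interpret M: left_module A M by fact
  note s = lhom_simps[OF kspace_module[OF M] regular_K \<psi>, simplified]
  show "hat M \<psi> (x \<oplus>\<^bsub>M\<^esub> y) = hat M \<psi> x \<oplus>\<^bsub>DA\<^esub> hat M \<psi> y" if "x \<in> carrier M" "y \<in> carrier M" for x y
    using that by (auto intro!: restrict_ext simp: hat_def M.smult_r_distr s)
  show "hat M \<psi> (a \<odot>\<^bsub>M\<^esub> x) = a \<odot>\<^bsub>DA\<^esub> hat M \<psi> x" if "a \<in> carrier A" "x \<in> carrier M" for a x
    using that by (auto intro!: restrict_ext simp: hat_def M.smult_assoc)
qed

lemma lhom_DA_functional:
  assumes M: "lmod A M" and f: "f \<in> lhom A M DA"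
  shows "(\<lambda>m. f m (one A)) \<in> lhom K (kspace A M) (regular K)"
    and "\<And>m x. m \<in> carrier M \<Longrightarrow> x \<in> carrier A \<Longrightarrow> f m x = f (x \<odot>\<^bsub>M\<^esub> m) (one A)"
proof -
  interpret M: left_module A M by fact
  show 1: "f m x = f (x \<odot>\<^bsub>M\<^esub> m) (one A)" if "m \<in> carrier M" "x \<in> carrier A" for m x
    using lhom_smult[OF f that(2,1)] that by simp
  have fm: "f m \<in> lhom K A (regular K)" if "m \<in> carrier M" for m using lhom_in[OF f that] DA_carrier by blast
  show "(\<lambda>m. f m (one A)) \<in> lhom K (kspace A M) (regular K)"
  proof (rule lhomI)
    fix c m assume cm: "c \<in> carrier K" "m \<in> carrier (kspace A M)"
    then have "f (c \<odot>\<^bsub>kspace A M\<^esub> m) (one A) = f m (c \<odot>\<^bsub>A\<^esub> one A)"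
      using 1[of m "c \<odot>\<^bsub>A\<^esub> one A", symmetric] by simp
    then show "f (c \<odot>\<^bsub>kspace A M\<^esub> m) (one A) = c \<odot>\<^bsub>regular K\<^esub> f m (one A)"
      using lhom_smult[OF fm cm(1), of m "one A"] cm by simp
  next
    fix m assume "m \<in> carrier (kspace A M)"
    then show "f m (one A) \<in> carrier (regular K)" using lhom_in[OF fm, of m "one A"] by simp
  qed (simp add: lhom_add[OF f])
qed

text \<open>By the adjunction it suffices to extend a functional from \<open>M\<close> to
  \<open>N\<close>, which is done by composing it with a \<open>K\<close>-linear retraction of
  \<open>g\<close>.\<close>

lemma DA_injective: "injective A DA" unfolding injective_def
proof (intro conjI allI impI fg_DA)
  fix M :: "('k, 'a) umodule" and N :: "('k, 'a) umodule" and g f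
  assume "fgm A M \<and> fgm A N \<and> g \<in> mhom A M N \<and> inj_on g (carrier M) \<and> f \<in> mhom A M DA"
  then have M: "fgm A M" and N: "fgm A N" and g: "g \<in> lhom A M N" and inj: "inj_on g (carrier M)"
    and f: "f \<in> mhom A M DA" and fl: "f \<in> lhom A M DA" using mhom_lhom by auto
  have M': "lmod A M" and N': "lmod A N" using M N unfolding fg_module_def by auto
  interpret M: left_module A M by fact
  note fd = lhom_DA_functional[OF M' fl]
  obtain g' where g': "g' \<in> lhom K (kspace A N) (kspace A M)" "\<forall>x\<in>carrier (kspace A M). g' (g x) = x"
    by (rule fspace_retract[OF field_K kspace_module[OF M'] fg_kspace[OF N] lhom_kspace[OF g]]) (use inj in simp)
  have \<chi>: "(\<lambda>n. f (g' n) (one A)) \<in> lhom K (kspace A N) (regular K)" by (rule lhom_o[OF g'(1) fd(1)])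
  let ?h = "restrict (hat N (\<lambda>n. f (g' n) (one A))) (carrier N)"
  have h: "?h \<in> mhom A N DA" by (rule lhom_mhom[OF N' lhom_hat[OF N' \<chi>]])
  have "compose (carrier M) ?h g m = f m" for m
  proof (cases "m \<in> carrier M")
    case True
    have "hat N (\<lambda>n. f (g' n) (one A)) (g m) x = f m x" for x
    proof (cases "x \<in> carrier A")
      case x: True
      have "x \<odot>\<^bsub>N\<^esub> g m = g (x \<odot>\<^bsub>M\<^esub> m)" using lhom_smult[OF g x True] by simp
      then show ?thesis using g'(2) x True fd(2)[OF True x] by (simp add: hat_def)
    next
      case False
      then show ?thesis using lhom_in[OF fl True] by (auto simp: hat_def DA_carrier extensional_def)
    qed
    then show ?thesis using True lhom_in[OF g True] by (auto simp: compose_def)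
  next
    case False
    then show ?thesis using f by (auto simp: compose_def mhom_def PiE_def extensional_def)
  qed
  then show "\<exists>h\<in>mhom A N DA. compose (carrier M) h g = f" by (intro bexI[OF _ h]) (rule ext)
qed

text \<open>Finitely many functionals cut out \<open>S\<close> as a subspace; because
  \<open>S\<close> is stable under \<open>A\<close>, their adjoint maps to \<open>D A\<close> cut
  out the same set. With \<open>S\<close> in place of zero this expresses that M/S embeds in a power
  of \<open>D A\<close>.\<close>

lemma DA_separates:
  assumes M: "fgm A M" and S: "submod A M S"
  obtains n f where "\<forall>i<(n::nat). f i \<in> lhom A M DA" "S = {m \<in> carrier M. \<forall>i<n. f i m = zero DA}"
proof -
  have M': "lmod A M" by (rule fg_left[OF M])
  interpret M: left_module A M by fact
  interpret V: fspace K "kspace A M" by (rule fspaceI[OF field_K kspace_module[OF M']])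
  have "finitely_generated K (kspace A M)" using fg_kspace[OF M] by (simp add: fg_module_def)
  then obtain \<rho> n \<phi> where "\<rho> \<in> lhom K (kspace A M) (kspace A M)" "\<forall>y\<in>carrier (kspace A M). \<rho> y \<in> S" "\<forall>y\<in>S. \<rho> y = y"
    and \<phi>: "\<forall>i<(n::nat). \<phi> i \<in> lhom K (kspace A M) (regular K)" "S = {y \<in> carrier (kspace A M). \<forall>i<n. \<phi> i y = zero K}"
    by (rule V.retraction_functionals[OF _ submod_kspace[OF S]])
  show thesis
  proof (rule that[of n "\<lambda>i. hat M (\<phi> i)"])
    show "\<forall>i<n. hat M (\<phi> i) \<in> lhom A M DA" using \<phi>(1) lhom_hat[OF M'] by blast
    show "S = {m \<in> carrier M. \<forall>i<n. hat M (\<phi> i) m = zero DA}"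
    proof (intro equalityI subsetI)
      fix m assume m: "m \<in> S"
      have "\<phi> i (x \<odot>\<^bsub>M\<^esub> m) = zero K" if "i < n" "x \<in> carrier A" for i x
      proof -
        have "x \<odot>\<^bsub>M\<^esub> m \<in> S" using S m that unfolding submod_def by blast
        then show ?thesis using that unfolding \<phi>(2) by blast
      qed
      moreover have "m \<in> carrier M" using S m unfolding submod_def by blast
      ultimately show "m \<in> {m \<in> carrier M. \<forall>i<n. hat M (\<phi> i) m = zero DA}" by (auto simp: hat_def intro!: restrict_ext)
    next
      fix m assume m: "m \<in> {m \<in> carrier M. \<forall>i<n. hat M (\<phi> i) m = zero DA}"
      have "\<phi> i m = zero K" if "i < n" for i
      proof -
        have "hat M (\<phi> i) m (one A) = zero DA (one A)" using m that by simp
        then show ?thesis using m by (simp add: hat_def)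
      qed
      then show "m \<in> S" unfolding \<phi>(2) using m by simp
    qed
  qed
qed

text \<open>The tuple of the \<open>f i\<close>, taken into a copy of a power of \<open>X\<close>.
  The last clause recovers each \<open>f i\<close> from it, which is what makes it an approximation
  in \<open>left_approx\<close>.\<close>

lemma tuple_kernel:
  assumes M: "fgm A M" and X: "fgm A X" and f: "\<forall>i<(n::nat). f i \<in> lhom A M X"
  obtains U :: "('k, 'a) umodule" and g where "in_add A X U" "fgm A U" "g \<in> lhom A M U"
    "{m \<in> carrier M. g m = zero U} = {m \<in> carrier M. \<forall>i<n. f i m = zero X}"
    "\<forall>i<n. \<exists>p\<in>lhom A U X. \<forall>m\<in>carrier M. f i m = p (g m)"
proof -
  let ?D = "dsum_upto n (\<lambda>_. X)"
  have X': "lmod A X" and M': "lmod A M" using X M fg_left by auto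
  have D: "fgm A ?D" by (rule fg_dsum_upto[OF ring_A X])
  obtain U :: "('k, 'a) umodule" and \<phi> \<psi> where U: "fgm A U" "mod_iso A ?D U \<phi> \<psi>" by (rule umodule_copy[OF D])
  note u = mod_isoD[OF U(2)]
  have U': "lmod A U" and D': "lmod A ?D" using U D fg_left by auto
  let ?t = "\<lambda>m. \<lambda>i\<in>{..<n}. f i m"
  have t: "?t \<in> lhom A M ?D" by (rule lhom_tuple) (use f in auto)
  have inj: "\<phi> x = zero U \<longleftrightarrow> x = zero ?D" if x: "x \<in> carrier ?D" for x
  proof
    assume "\<phi> x = zero U"
    then have "\<psi> (\<phi> x) = zero ?D" using lhom_zero[OF U' D' u(2)] by simp
    then show "x = zero ?D" using u(3)[OF x] by simp
  qed (use lhom_zero[OF D' U' u(1)] in simp)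
  show thesis
  proof (rule that[of U "\<lambda>m. \<phi> (?t m)"])
    show "in_add A X U" by (rule in_addI[OF X U(1) mod_iso_sym[OF U(2)]])
    show "(\<lambda>m. \<phi> (?t m)) \<in> lhom A M U" by (rule lhom_o[OF t u(1)])
    show "{m \<in> carrier M. \<phi> (?t m) = zero U} = {m \<in> carrier M. \<forall>i<n. f i m = zero X}"
    proof (rule Collect_cong, rule conj_cong[OF refl])
      fix m assume m: "m \<in> carrier M"
      have "\<phi> (?t m) = zero U \<longleftrightarrow> ?t m = zero ?D" by (rule inj[OF lhom_in[OF t m]])
      also have "\<dots> \<longleftrightarrow> (\<forall>i<n. f i m = zero X)" by (auto simp: fun_eq_iff restrict_def)
      finally show "\<phi> (?t m) = zero U \<longleftrightarrow> (\<forall>i<n. f i m = zero X)" .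
    qed
    show "\<forall>i<n. \<exists>p\<in>lhom A U X. \<forall>m\<in>carrier M. f i m = p (\<phi> (?t m))"
    proof (intro allI impI)
      fix i assume i: "i < n"
      show "\<exists>p\<in>lhom A U X. \<forall>m\<in>carrier M. f i m = p (\<phi> (?t m))"
      proof (rule bexI[of _ "\<lambda>x. \<psi> x i"], rule ballI)
        fix m assume m: "m \<in> carrier M"
        show "f i m = \<psi> (\<phi> (?t m)) i" using u(3)[OF lhom_in[OF t m]] i by simp
      next
        show "(\<lambda>x. \<psi> x i) \<in> lhom A U X" by (rule lhom_o[OF u(2) lhom_proj[OF i]])
      qed
    qed
  qed (rule U(1))
qed

text \<open>The sum of the \<open>f i\<close> on a copy of a power of \<open>X\<close>; evaluating
  it on vectors with one nonzero entry shows that its image contains each of theirs.\<close>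

lemma cotuple_image:
  fixes M :: "('a, 'm) module" and X :: "('a, 'x) module"
  assumes M: "lmod A M" and X: "fgm A X" and f: "\<forall>i<(n::nat). f i \<in> lhom A X M"
    and S: "submod A M S" and fS: "\<forall>i<n. f i ` carrier X \<subseteq> S"
  obtains U :: "('k, 'a) umodule" and g where "in_add A X U" "fgm A U" "g \<in> lhom A U M"
    "g ` carrier U \<subseteq> S" "\<forall>i<n. f i ` carrier X \<subseteq> g ` carrier U"
proof -
  let ?D = "dsum_upto n (\<lambda>_. X)"
  interpret M: left_module A M by fact
  have X': "lmod A X" using X fg_left by auto
  have D: "fgm A ?D" by (rule fg_dsum_upto[OF ring_A X])
  obtain U :: "('k, 'a) umodule" and \<phi> \<psi> where U: "fgm A U" "mod_iso A ?D U \<phi> \<psi>" by (rule umodule_copy[OF D])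
  note u = mod_isoD[OF U(2)]
  let ?t = "\<lambda>x. msum M (\<lambda>s. f s (x s)) n"
  have t: "?t \<in> lhom A ?D M" by (rule lhom_cotuple[OF ring_A X' M]) (use f in auto)
  show thesis
  proof (rule that[of U "\<lambda>x. ?t (\<psi> x)"])
    show "in_add A X U" by (rule in_addI[OF X U(1) mod_iso_sym[OF U(2)]])
    show "(\<lambda>x. ?t (\<psi> x)) \<in> lhom A U M" by (rule lhom_o[OF u(2) t])
    show "(\<lambda>x. ?t (\<psi> x)) ` carrier U \<subseteq> S"
    proof (intro image_subsetI M.submod_msum[OF S])
      fix x s assume "x \<in> carrier U" "s < n"
      then have "\<psi> x s \<in> carrier X" using u(6)[of x] by (auto simp: PiE_iff)
      then show "f s (\<psi> x s) \<in> S" using fS \<open>s < n\<close> by auto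
    qed
    show "\<forall>i<n. f i ` carrier X \<subseteq> (\<lambda>x. ?t (\<psi> x)) ` carrier U"
    proof (intro allI impI image_subsetI)
      fix i x assume i: "i < n" and x: "x \<in> carrier X"
      have fi: "f i \<in> lhom A X M" using f i by blast
      let ?s = "single n (\<lambda>_. X) i x"
      have s: "?s \<in> carrier ?D" by (rule lhom_in[OF lhom_single[where X = "\<lambda>_. X", OF X' i] x])
      have "?t ?s = f i (?s i)"
      proof (rule M.msum_single[OF _ i])
        fix s assume s: "s < n" "s \<noteq> i"
        then have "f s \<in> lhom A X M" using f by blast
        then show "f s (?s s) = zero M" using s lhom_zero[OF X' M] by (simp add: single_def)
      qed (use i lhom_in[OF fi x] in \<open>simp add: single_def\<close>)
      then have "?t (\<psi> (\<phi> ?s)) = f i x" using u(3)[OF s] i by (simp add: single_def)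
      then show "f i x \<in> (\<lambda>x. ?t (\<psi> x)) ` carrier U" using u(5)[OF s] by (intro image_eqI[of _ _ "\<phi> ?s"]) auto
    qed
  qed (rule U(1))
qed

text \<open>Prescribing the kernel amounts to embedding M/S. With the image of the previous map as
  \<open>S\<close> this is one step of an injective resolution.\<close>

lemma enough_injectives:
  assumes M: "fgm A M" and S: "submod A M S"
  obtains U :: "('k, 'a) umodule" and g where "injective A U" "g \<in> lhom A M U" "{m \<in> carrier M. g m = zero U} = S"
proof -
  obtain n f where f: "\<forall>i<(n::nat). f i \<in> lhom A M DA" "S = {m \<in> carrier M. \<forall>i<n. f i m = zero DA}"
    by (rule DA_separates[OF M S])
  obtain U :: "('k, 'a) umodule" and g where U: "in_add A DA U" "fgm A U" and g: "g \<in> lhom A M U"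
    "{m \<in> carrier M. g m = zero U} = {m \<in> carrier M. \<forall>i<n. f i m = zero DA}"
    and "\<forall>i<n. \<exists>p\<in>lhom A U DA. \<forall>m\<in>carrier M. f i m = p (g m)" by (rule tuple_kernel[OF M fg_DA f(1)])
  have "injective A U" by (rule addr_injective[OF U(2) in_add_addr[OF ring_A DA_module U(1)]]) (use DA_injective in auto)
  then show thesis by (rule that[OF _ g(1)]) (use g(2) f(2) in simp)
qed

lemma regular_projective: "projective A (regular A)" unfolding projective_def
proof (intro conjI allI impI fg_regular[OF ring_A])
  fix M :: "('k, 'a) umodule" and N :: "('k, 'a) umodule" and g f
  assume "fgm A M \<and> fgm A N \<and> g \<in> mhom A M N \<and> g ` carrier M = carrier N \<and> f \<in> mhom A (regular A) N"
  then have M: "fgm A M" and N: "fgm A N" and g: "g \<in> lhom A M N" and s: "g ` carrier M = carrier N"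
    and f: "f \<in> mhom A (regular A) N" and fl: "f \<in> lhom A (regular A) N" using mhom_lhom by auto
  have M': "lmod A M" using M unfolding fg_module_def by auto
  interpret M: left_module A M by fact
  have "f (one A) \<in> carrier N" using lhom_in[OF fl] by simp
  then have "f (one A) \<in> g ` carrier M" using s by simp
  then obtain m where m: "m \<in> carrier M" "g m = f (one A)" by (elim imageE) simp
  let ?h = "\<lambda>a. a \<odot>\<^bsub>M\<^esub> m"
  have h: "?h \<in> lhom A (regular A) M" by (rule lhomI) (use m in \<open>auto simp: M.smult_l_distr M.smult_assoc\<close>)
  have "compose (carrier (regular A)) g (restrict ?h (carrier (regular A))) x = f x" for x
  proof (cases "x \<in> carrier A")
    case True
    then show ?thesis using lhom_smult[OF g True m(1)] lhom_smult[OF fl True, of "one A"] m by (simp add: compose_def)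
  next
    case False
    then show ?thesis using f by (auto simp: compose_def mhom_def PiE_def extensional_def)
  qed
  then show "\<exists>h\<in>mhom A (regular A) M. compose (carrier (regular A)) g h = f"
    by (intro bexI[OF _ lhom_mhom[OF regular_module[OF ring_A] h]]) (rule ext)
qed

text \<open>With a kernel inside \<open>M\<close> as \<open>S\<close> this is one step of a
  projective resolution.\<close>

lemma enough_projectives:
  assumes M: "fgm A M" and S: "submod A M S"
  obtains U :: "('k, 'a) umodule" and g where "projective A U" "g \<in> lhom A U M" "g ` carrier U = S"
proof -
  have M': "lmod A M" by (rule fg_left[OF M])
  interpret M: left_module A M by fact
  obtain G where G: "gens A (subm M S) G" using fg_moduleD(2)[OF fg_submodule[OF M S]] by blast
  then obtain n and s :: "nat \<Rightarrow> _" where s: "G = s ` {i. i < n}"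
    using finite_imp_nat_seg_image_inj_on[of G] by (auto simp: gens_def)
  have sS: "s i \<in> S" if "i < n" for i using G s that by (auto simp: gens_def)
  have Sc: "S \<subseteq> carrier M" "\<And>a x. a \<in> carrier A \<Longrightarrow> x \<in> S \<Longrightarrow> a \<odot>\<^bsub>M\<^esub> x \<in> S" using S by (auto simp: submod_def)
  let ?f = "\<lambda>i a. a \<odot>\<^bsub>M\<^esub> s i"
  have f: "\<forall>i<n. ?f i \<in> lhom A (regular A) M" using sS Sc by (auto intro!: lhomI simp: M.smult_l_distr M.smult_assoc subsetD)
  have fS: "\<forall>i<n. ?f i ` carrier (regular A) \<subseteq> S" using sS Sc by auto
  obtain U :: "('k, 'a) umodule" and g where U: "in_add A (regular A) U" "fgm A U" and g: "g \<in> lhom A U M"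
    "g ` carrier U \<subseteq> S" "\<forall>i<n. ?f i ` carrier (regular A) \<subseteq> g ` carrier U"
    by (rule cotuple_image[OF M' fg_regular[OF ring_A] f S fS])
  have U': "lmod A U" by (rule fg_left[OF U(2)])
  have "projective A U" by (rule addr_projective[OF U(2) in_add_addr[OF ring_A regular_module[OF ring_A] U(1)]])
      (use regular_projective in auto)
  moreover have "S \<subseteq> g ` carrier U"
  proof -
    have "submod A M (g ` carrier U)" by (rule submod_image[OF U' M' g(1) left_module.submod_carrier[OF U']])
    then have "submod A (subm M S) (g ` carrier U)" using g(2) by (auto simp: submod_def)
    moreover have "G \<subseteq> g ` carrier U"
    proof
      fix x assume "x \<in> G"
      then obtain i where i: "i < n" "x = s i" using s by auto
      have "?f i ` carrier (regular A) \<subseteq> g ` carrier U" using g(3) i by blast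
      then have "?f i (one A) \<in> g ` carrier U" unfolding regular_simps using A.one_closed by blast
      then show "x \<in> g ` carrier U" using i sS[OF i(1)] Sc by auto
    qed
    ultimately show ?thesis using G unfolding gens_def by simp
  qed
  ultimately show thesis using that[OF _ g(1)] g(2) by blast
qed

end

section \<open>Resolutions and the vanishing of Ext\<close>

text \<open>Dependent choice along a sequence of modules \<open>Y\<close> with marked subsets
  \<open>S\<close>: \<open>P\<close> is the invariant of a stage, \<open>Q\<close> ties the
  connecting map \<open>g\<close> to both neighbours. The stage number allows finite constructions
  to demand nothing from some stage on.\<close>

lemma seq_build:
  assumes P0: "P 0 Y0 S0" and step: "\<And>n Y S. P n Y S \<Longrightarrow> \<exists>Y' S' g. P (Suc n) Y' S' \<and> Q n Y S g Y' S'"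
  obtains Y S g where "Y 0 = Y0" "S 0 = S0" "\<forall>n. P n (Y n) (S n)" "\<forall>n. Q n (Y n) (S n) (g n) (Y (Suc n)) (S (Suc n))"
proof -
  let ?P = "\<lambda>n p. P n (fst p) (snd p) \<and> (n = 0 \<longrightarrow> p = (Y0, S0))"
  let ?Q = "\<lambda>n p q. \<exists>g. Q n (fst p) (snd p) g (fst q) (snd q)"
  have "\<exists>f. \<forall>n. ?P n (f n) \<and> ?Q n (f n) (f (Suc n))"
  proof (rule dependent_nat_choice)
    show "\<exists>x. ?P 0 x" using P0 by auto
    fix x n assume "?P n x"
    then obtain Y' S' g where "P (Suc n) Y' S' \<and> Q n (fst x) (snd x) g Y' S'" using step by blast
    then show "\<exists>y. ?P (Suc n) y \<and> ?Q n x y" by (intro exI[of _ "(Y', S')"]) auto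
  qed
  then obtain f where f: "\<forall>n. ?P n (f n) \<and> ?Q n (f n) (f (Suc n))" by (elim exE)
  then have "\<forall>n. \<exists>g. Q n (fst (f n)) (snd (f n)) g (fst (f (Suc n))) (snd (f (Suc n)))" by blast
  from choice[OF this] obtain g where
    g: "\<forall>n. Q n (fst (f n)) (snd (f n)) (g n) (fst (f (Suc n))) (snd (f (Suc n)))" by (elim exE)
  have f0: "f 0 = (Y0, S0)" using f by blast
  show thesis by (rule that[of "\<lambda>n. fst (f n)" "\<lambda>n. snd (f n)" g]) (use f g f0 in auto)
qed

lemma inj_resolution_iff:
  "inj_resolution A M e I d \<longleftrightarrow> fgm A M \<and> (\<forall>i. injective A (I i)) \<and> e \<in> mhom A M (I 0) \<and>
     (\<forall>i. d i \<in> mhom A (I i) (I (Suc i))) \<and> inj_on e (carrier M) \<and>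
     e ` carrier M = {x \<in> carrier (I 0). d 0 x = zero (I 1)} \<and>
     (\<forall>i. d i ` carrier (I i) = {x \<in> carrier (I (Suc i)). d (Suc i) x = zero (I (Suc (Suc i)))})"
  (is "?L \<longleftrightarrow> ?R")
proof
  assume L: ?L
  have ex: "exact_seq_into A m M e I d" for m using L by (simp add: inj_resolution_def)
  have "d i \<in> mhom A (I i) (I (Suc i)) \<and>
      d i ` carrier (I i) = {x \<in> carrier (I (Suc i)). d (Suc i) x = zero (I (Suc (Suc i)))}" for i
    using ex[of "Suc (Suc i)"] by (simp add: exact_seq_into_def exact_into_def exact_at_def)
  moreover have "e \<in> mhom A M (I 0) \<and> inj_on e (carrier M) \<and> fgm A M \<and>
     e ` carrier M = {x \<in> carrier (I 0). d 0 x = zero (I 1)}"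
    using ex[of 1] by (simp add: exact_seq_into_def exact_into_def exact_at_def)
  moreover have "\<forall>i. injective A (I i)" using L by (simp add: inj_resolution_def)
  ultimately show ?R by blast
next
  assume ?R
  then show ?L by (auto simp: inj_resolution_def exact_seq_into_def exact_into_def exact_at_def injective_def)
qed

lemma proj_resolution_iff:
  "proj_resolution A P d e M \<longleftrightarrow> fgm A M \<and> (\<forall>i. projective A (P i)) \<and> e \<in> mhom A (P 0) M \<and>
     (\<forall>i. d i \<in> mhom A (P (Suc i)) (P i)) \<and> e ` carrier (P 0) = carrier M \<and>
     d 0 ` carrier (P 1) = {x \<in> carrier (P 0). e x = zero M} \<and>
     (\<forall>i. d (Suc i) ` carrier (P (Suc (Suc i))) = {x \<in> carrier (P (Suc i)). d i x = zero (P i)})"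
  (is "?L \<longleftrightarrow> ?R")
proof
  assume L: ?L
  have ex: "exact_seq_onto A m P d e M" for m using L by (simp add: proj_resolution_def)
  have "d i \<in> mhom A (P (Suc i)) (P i) \<and>
      d (Suc i) ` carrier (P (Suc (Suc i))) = {x \<in> carrier (P (Suc i)). d i x = zero (P i)}" for i
    using ex[of "Suc (Suc i)"] by (simp add: exact_seq_onto_def exact_onto_def exact_at_def)
  moreover have "e \<in> mhom A (P 0) M \<and> fgm A M \<and> e ` carrier (P 0) = carrier M \<and>
     d 0 ` carrier (P 1) = {x \<in> carrier (P 0). e x = zero M}"
    using ex[of 1] by (simp add: exact_seq_onto_def exact_onto_def exact_at_def)
  moreover have "\<forall>i. projective A (P i)" using L by (simp add: proj_resolution_def)
  ultimately show ?R by blast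
next
  assume ?R
  then show ?L by (auto simp: proj_resolution_def exact_seq_onto_def exact_onto_def exact_at_def projective_def)
qed

text \<open>Turns triviality of a quotient group such as \<open>Ext\<close> into an inclusion of
  cocycles in coboundaries.\<close>

lemma trivial_group_quotient:
  fixes V :: "('r, 'v) module"
  assumes V: "lmod R V" and S: "submod R V S" and H: "submod R V H" and HS: "H \<subseteq> S"
  shows "trivial_group ((add_monoid V)\<lparr>carrier := S\<rparr> Mod H) \<longleftrightarrow> S \<subseteq> H"
proof -
  let ?G = "(add_monoid V)\<lparr>carrier := S\<rparr>"
  have VS: "lmod R (subm V S)" by (rule subm_module[OF V S])
  have eq: "?G = add_monoid (subm V S)" by simp
  interpret G: comm_group ?G unfolding eq by (rule abelian_group.a_comm_group[OF lm_abelian[OF VS]])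
  interpret V: left_module R V by fact
  have inv: "inv\<^bsub>?G\<^esub> x = \<ominus>\<^bsub>V\<^esub> x" if "x \<in> S" for x
  proof (rule G.inv_equality)
    show "(\<ominus>\<^bsub>V\<^esub> x) \<otimes>\<^bsub>?G\<^esub> x = one ?G" using that S V.M.l_neg by (auto simp: submod_def)
  qed (use that V.submod_neg[OF S that] in auto)
  have sub: "subgroup H ?G" by (rule G.subgroupI) (use H HS inv V.submod_neg[OF H] in \<open>auto simp: submod_def\<close>)
  have N: "H \<lhd> ?G" using sub G.normal_iff_subgroup by blast
  show ?thesis
  proof
    assume "trivial_group (?G Mod H)"
    then have one: "carrier (?G Mod H) = {H}" by (simp add: trivial_group_def FactGroup_def)
    show "S \<subseteq> H"
    proof
      fix x assume x: "x \<in> S"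
      then have "H #>\<^bsub>?G\<^esub> x \<in> carrier (?G Mod H)" by (auto simp: FactGroup_def RCOSETS_def)
      then have "H #>\<^bsub>?G\<^esub> x = H" using one by simp
      moreover have "x \<in> H #>\<^bsub>?G\<^esub> x" by (rule G.rcos_self[OF _ sub]) (use x in simp)
      ultimately show "x \<in> H" by simp
    qed
  next
    assume "S \<subseteq> H"
    then have SH: "S = H" using HS by blast
    have "carrier (?G Mod H) = {H}"
    proof -
      have "H #>\<^bsub>?G\<^esub> x = H" if "x \<in> S" for x by (rule G.coset_join2[OF _ sub]) (use that SH in auto)
      moreover have "zero V \<in> S" using S by (simp add: submod_def)
      ultimately show ?thesis by (auto simp: FactGroup_def RCOSETS_def)
    qed
    then show "trivial_group (?G Mod H)" using normal.factorgroup_is_group[OF N] by (simp add: trivial_group_def FactGroup_def)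
  qed
qed

context fdalg begin

lemma inj_resolution_exists:
  assumes M: "fgm A M"
  obtains e I d where "inj_resolution A M e I d"
proof -
  have M': "lmod A M" by (rule fg_left[OF M])
  obtain I0 :: "('k, 'a) umodule" and e where I0: "injective A I0" and e: "e \<in> lhom A M I0"
    and ker: "{m \<in> carrier M. e m = zero I0} = {zero M}" by (rule enough_injectives[OF M left_module.submod_zero[OF M']])
  have I0': "lmod A I0" using fg_left[OF injective_fg[OF I0]] .
  let ?P = "\<lambda>(n::nat) Y S. injective A Y \<and> submod A Y S"
  \<comment> \<open>The marked set is the image of the preceding map, so the kernel condition is
    exactness.\<close>
  let ?Q = "\<lambda>(n::nat) Y S g Y' S'. g \<in> lhom A Y Y' \<and> {m \<in> carrier Y. g m = zero Y'} = S \<and> S' = g ` carrier Y"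
  have P0: "?P 0 I0 (e ` carrier M)" using I0 submod_image[OF M' I0' e left_module.submod_carrier[OF M']] by blast
  have step: "\<exists>(Y' :: ('k, 'a) umodule) S' g. ?P (Suc n) Y' S' \<and> ?Q n Y S g Y' S'" if P: "?P n Y S" for n and Y :: "('k, 'a) umodule" and S
  proof -
    have Y: "fgm A Y" and Y': "lmod A Y" and S: "submod A Y S" using P injective_fg[of Y] fg_left[of A Y] by auto
    obtain U :: "('k, 'a) umodule" and g where U: "injective A U" "g \<in> lhom A Y U" "{m \<in> carrier Y. g m = zero U} = S"
      by (rule enough_injectives[OF Y S])
    have "submod A U (g ` carrier Y)" by (rule submod_image[OF Y' fg_left[OF injective_fg[OF U(1)]] U(2) left_module.submod_carrier[OF Y']])
    then show ?thesis using U by (intro exI[of _ U] exI[of _ "g ` carrier Y"] exI[of _ g]) simp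
  qed
  obtain Y S g where Y: "Y 0 = I0" "S 0 = e ` carrier M" and YP: "\<forall>n. ?P n (Y n) (S n)"
    and YQ: "\<forall>n. ?Q n (Y n) (S n) (g n) (Y (Suc n)) (S (Suc n))" by (rule seq_build[where P = ?P and Q = ?Q, OF P0 step])
  have Ym: "lmod A (Y n)" for n using YP fg_left[OF injective_fg] by blast
  have Sn: "S n = {x \<in> carrier (Y n). g n x = zero (Y (Suc n))}" "S (Suc n) = g n ` carrier (Y n)" for n using YQ by auto
  have "inj_resolution A M (restrict e (carrier M)) Y (\<lambda>n. restrict (g n) (carrier (Y n)))" unfolding inj_resolution_iff
  proof (intro conjI allI M)
    show "injective A (Y i)" for i using YP by blast
    show "restrict e (carrier M) \<in> mhom A M (Y 0)" unfolding Y by (rule lhom_mhom[OF M' e])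
    show "restrict (g i) (carrier (Y i)) \<in> mhom A (Y i) (Y (Suc i))" for i by (rule lhom_mhom[OF Ym]) (use YQ in blast)
    have "inj_on e (carrier M)" unfolding lhom_inj_iff[OF M' I0' e] using ker by auto
    then show "inj_on (restrict e (carrier M)) (carrier M)" by simp
    show "restrict e (carrier M) ` carrier M = {x \<in> carrier (Y 0). restrict (g 0) (carrier (Y 0)) x = zero (Y 1)}"
      using Sn(1)[of 0] Y(2) by auto
    show "restrict (g i) (carrier (Y i)) ` carrier (Y i) =
      {x \<in> carrier (Y (Suc i)). restrict (g (Suc i)) (carrier (Y (Suc i))) x = zero (Y (Suc (Suc i)))}" for i
      using Sn(1)[of "Suc i"] Sn(2)[of i] by auto
  qed
  then show thesis by (rule that)
qed

lemma proj_resolution_exists: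
  assumes M: "fgm A M"
  obtains P d e where "proj_resolution A P d e M"
proof -
  have M': "lmod A M" by (rule fg_left[OF M])
  obtain P0 :: "('k, 'a) umodule" and e where P0: "projective A P0" and e: "e \<in> lhom A P0 M" and im: "e ` carrier P0 = carrier M"
    by (rule enough_projectives[OF M left_module.submod_carrier[OF M']])
  have P0': "lmod A P0" using fg_left[OF projective_fg[OF P0]] .
  let ?P = "\<lambda>(n::nat) Y S. projective A Y \<and> submod A Y S"
  let ?Q = "\<lambda>(n::nat) Y S g Y' S'. g \<in> lhom A Y' Y \<and> g ` carrier Y' = S \<and> S' = {m \<in> carrier Y'. g m = zero Y}"
  have P0P: "?P 0 P0 {m \<in> carrier P0. e m = zero M}" using P0 submod_kernel[OF P0' M' e] by blast
  have step: "\<exists>(Y' :: ('k, 'a) umodule) S' g. ?P (Suc n) Y' S' \<and> ?Q n Y S g Y' S'" if P: "?P n Y S" for n and Y :: "('k, 'a) umodule" and S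
  proof -
    have Y: "fgm A Y" and Y': "lmod A Y" and S: "submod A Y S" using P projective_fg[of Y] fg_left[of A Y] by auto
    obtain U :: "('k, 'a) umodule" and g where U: "projective A U" "g \<in> lhom A U Y" "g ` carrier U = S"
      by (rule enough_projectives[OF Y S])
    have "submod A U {m \<in> carrier U. g m = zero Y}" by (rule submod_kernel[OF fg_left[OF projective_fg[OF U(1)]] Y' U(2)])
    then show ?thesis using U by (intro exI[of _ U] exI[of _ "{m \<in> carrier U. g m = zero Y}"] exI[of _ g]) simp
  qed
  obtain Y S g where Y: "Y 0 = P0" "S 0 = {m \<in> carrier P0. e m = zero M}" and YP: "\<forall>n. ?P n (Y n) (S n)"
    and YQ: "\<forall>n. ?Q n (Y n) (S n) (g n) (Y (Suc n)) (S (Suc n))" by (rule seq_build[where P = ?P and Q = ?Q, OF P0P step])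
  have Ym: "lmod A (Y n)" for n using YP fg_left[OF projective_fg] by blast
  have Sn: "S n = g n ` carrier (Y (Suc n))" "S (Suc n) = {x \<in> carrier (Y (Suc n)). g n x = zero (Y n)}" for n using YQ by auto
  have "proj_resolution A Y (\<lambda>n. restrict (g n) (carrier (Y (Suc n)))) (restrict e (carrier P0)) M" unfolding proj_resolution_iff
  proof (intro conjI allI M)
    show "projective A (Y i)" for i using YP by blast
    show "restrict e (carrier P0) \<in> mhom A (Y 0) M" unfolding Y by (rule lhom_mhom[OF P0' e])
    show "restrict (g i) (carrier (Y (Suc i))) \<in> mhom A (Y (Suc i)) (Y i)" for i by (rule lhom_mhom[OF Ym]) (use YQ in blast)
    show "restrict e (carrier P0) ` carrier (Y 0) = carrier M" using im Y by auto
    show "restrict (g 0) (carrier (Y (Suc 0))) ` carrier (Y 1) =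
        {x \<in> carrier (Y 0). restrict e (carrier P0) x = zero M}"
      using Sn(1)[of 0] Y by auto
    show "restrict (g (Suc i)) (carrier (Y (Suc (Suc i)))) ` carrier (Y (Suc (Suc i))) =
      {x \<in> carrier (Y (Suc i)). restrict (g i) (carrier (Y (Suc i))) x = zero (Y i)}" for i
      using Sn(1)[of "Suc i"] Sn(2)[of i] by auto
  qed
  then show thesis by (rule that)
qed

lemma Hom_simps [simp]: "carrier (Hom A M N) = mhom A M N" "zero (Hom A M N) = (\<lambda>x\<in>carrier M. zero N)"
  "f \<oplus>\<^bsub>Hom A M N\<^esub> g = (\<lambda>x\<in>carrier M. f x \<oplus>\<^bsub>N\<^esub> g x)"
  "c \<odot>\<^bsub>Hom A M N\<^esub> f = (\<lambda>x\<in>carrier M. (c \<odot>\<^bsub>A\<^esub> one A) \<odot>\<^bsub>N\<^esub> f x)"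
  by (simp_all add: Hom_def)

lemma mhom_ext:
  assumes "f \<in> mhom A M N" "g \<in> mhom A M N" "\<And>x. x \<in> carrier M \<Longrightarrow> f x = g x"
  shows "f = g" by (rule extensionalityI[of _ "carrier M"]) (use assms in \<open>auto simp: mhom_def PiE_def\<close>)

lemma Hom_module:
  assumes M: "lmod A M" and N: "lmod A N"
  shows "lmod K (Hom A M N)"
proof -
  interpret M: left_module A M by fact
  interpret N: left_module A N by fact
  interpret kN: left_module K "kspace A N" by (rule kspace_module[OF N])
  have c: "f x \<in> carrier N" if "f \<in> mhom A M N" "x \<in> carrier M" for f x using lhom_in[OF mhom_lhom[OF that(1)] that(2)] .
  have plus: "(\<lambda>x\<in>carrier M. f x \<oplus>\<^bsub>N\<^esub> g x) \<in> mhom A M N" if "f \<in> mhom A M N" "g \<in> mhom A M N" for f g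
    by (rule lhom_mhom[OF M lhom_plus[OF N mhom_lhom[OF that(1)] mhom_lhom[OF that(2)]]])
  have zer: "(\<lambda>x\<in>carrier M. zero N) \<in> mhom A M N" by (rule lhom_mhom[OF M lhom_const0[OF N]])
  have neg: "(\<lambda>x\<in>carrier M. \<ominus>\<^bsub>N\<^esub> f x) \<in> mhom A M N" if "f \<in> mhom A M N" for f
    by (rule lhom_mhom[OF M lhom_uminus[OF N mhom_lhom[OF that]]])
  have scal: "(\<lambda>x\<in>carrier M. (c \<odot>\<^bsub>A\<^esub> one A) \<odot>\<^bsub>N\<^esub> f x) \<in> mhom A M N" if f: "f \<in> mhom A M N" and cK: "c \<in> carrier K" for f c
  proof (rule lhom_mhom[OF M], rule lhomI)
    note fl = mhom_lhom[OF f]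
    show "(c \<odot>\<^bsub>A\<^esub> one A) \<odot>\<^bsub>N\<^esub> f (a \<odot>\<^bsub>M\<^esub> x) = a \<odot>\<^bsub>N\<^esub> ((c \<odot>\<^bsub>A\<^esub> one A) \<odot>\<^bsub>N\<^esub> f x)"
      if "a \<in> carrier A" "x \<in> carrier M" for a x using smult_central[OF N that(1) cK c[OF f that(2)]] lhom_smult[OF fl that] by simp
  qed (use c[OF f] cK in \<open>auto simp: lhom_add[OF mhom_lhom[OF f]] N.smult_r_distr\<close>)
  have ab: "abelian_group (Hom A M N)"
  proof (rule abelian_groupI)
    fix f assume f: "f \<in> carrier (Hom A M N)"
    show "\<exists>g\<in>carrier (Hom A M N). g \<oplus>\<^bsub>Hom A M N\<^esub> f = zero (Hom A M N)"
      by (rule bexI[of _ "\<lambda>x\<in>carrier M. \<ominus>\<^bsub>N\<^esub> f x"]) (use f neg c in \<open>auto intro!: restrict_ext simp: N.M.l_neg\<close>)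
    have f': "f \<in> mhom A M N" using f by simp
    show "zero (Hom A M N) \<oplus>\<^bsub>Hom A M N\<^esub> f = f"
      unfolding Hom_simps by (rule mhom_ext[OF plus[OF zer f'] f']) (use c[OF f'] in simp)
  next
    fix f g assume "f \<in> carrier (Hom A M N)" "g \<in> carrier (Hom A M N)"
    then show "f \<oplus>\<^bsub>Hom A M N\<^esub> g = g \<oplus>\<^bsub>Hom A M N\<^esub> f" using c by (auto intro!: restrict_ext N.M.a_comm)
  qed (use plus zer c in \<open>auto intro!: restrict_ext N.M.a_assoc\<close>)
  show ?thesis
  proof (rule left_moduleI[OF ring_K ab])
    fix f assume f: "f \<in> carrier (Hom A M N)"
    then have f': "f \<in> mhom A M N" by simp
    have "one K \<odot>\<^bsub>A\<^esub> one A = one A" by simp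
    then show "one K \<odot>\<^bsub>Hom A M N\<^esub> f = f"
      unfolding Hom_simps by (intro mhom_ext[OF scal[OF f' K.one_closed] f']) (use c[OF f'] in simp)
  next
    fix a b f assume ab: "a \<in> carrier K" "b \<in> carrier K" "f \<in> carrier (Hom A M N)"
    then show "(a \<oplus>\<^bsub>K\<^esub> b) \<odot>\<^bsub>Hom A M N\<^esub> f = a \<odot>\<^bsub>Hom A M N\<^esub> f \<oplus>\<^bsub>Hom A M N\<^esub> b \<odot>\<^bsub>Hom A M N\<^esub> f"
      using kN.smult_l_distr[OF ab(1,2)] c by (auto intro!: restrict_ext)
    show "(a \<otimes>\<^bsub>K\<^esub> b) \<odot>\<^bsub>Hom A M N\<^esub> f = a \<odot>\<^bsub>Hom A M N\<^esub> (b \<odot>\<^bsub>Hom A M N\<^esub> f)"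
      using kN.smult_assoc[OF ab(1,2)] c ab by (auto intro!: restrict_ext)
  next
    fix a f g assume "a \<in> carrier K" "f \<in> carrier (Hom A M N)" "g \<in> carrier (Hom A M N)"
    then show "a \<odot>\<^bsub>Hom A M N\<^esub> (f \<oplus>\<^bsub>Hom A M N\<^esub> g) = a \<odot>\<^bsub>Hom A M N\<^esub> f \<oplus>\<^bsub>Hom A M N\<^esub> a \<odot>\<^bsub>Hom A M N\<^esub> g"
      using c by (auto intro!: restrict_ext simp: N.smult_r_distr)
  qed (use scal in auto)
qed

text \<open>A homomorphism is determined by its values on generators of \<open>M\<close>, which
  embeds the Hom space in a power of \<open>N\<close>. This finiteness is what makes approximations
  exist.\<close>

lemma fg_Hom:
  assumes M: "fgm A M" and N: "fgm A N"
  shows "fgm K (Hom A M N)"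
proof -
  have M': "lmod A M" and N': "lmod A N" using M N fg_left by auto
  interpret N: left_module A N by fact
  obtain S where S: "gens A M S" using fg_moduleD(2)[OF M] by blast
  then obtain n and s :: "nat \<Rightarrow> _" where s: "S = s ` {i. i < n}"
    using finite_imp_nat_seg_image_inj_on[of S] by (auto simp: gens_def)
  have sM: "s i \<in> carrier M" if "i < n" for i using S s that by (auto simp: gens_def)
  let ?V = "Hom A M N" and ?W = "dsum_upto n (\<lambda>_. kspace A N)"
  have V: "lmod K ?V" by (rule Hom_module[OF M' N'])
  have W: "fgm K ?W" by (rule fg_dsum_upto[OF ring_K fg_kspace[OF N]])
  let ?e = "\<lambda>f. \<lambda>i\<in>{..<n}. f (s i)"
  have e: "?e \<in> lhom K ?V ?W" by (rule lhom_tuple, rule lhomI) (use sM in \<open>auto intro: lhom_in[OF mhom_lhom]\<close>)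
  have "inj_on ?e (carrier ?V)" unfolding lhom_inj_iff[OF V fg_left[OF W] e]
  proof (intro ballI impI)
    fix f assume f: "f \<in> carrier ?V" "?e f = zero ?W"
    then have fm: "f \<in> mhom A M N" by simp
    have "f (s i) = zero N" if "i < n" for i using fun_cong[OF f(2), of i] that by simp
    then have "S \<subseteq> {x \<in> carrier M. f x = zero N}" using sM by (auto simp: s)
    then have "carrier M \<subseteq> {x \<in> carrier M. f x = zero N}"
      using S submod_kernel[OF M' N' mhom_lhom[OF fm]] unfolding gens_def by blast
    then show "f = zero ?V" unfolding Hom_simps by (intro mhom_ext[OF fm lhom_mhom[OF M' lhom_const0[OF N']]]) auto
  qed
  from fspace_fg_inj[OF field_K V W e this] show ?thesis .
qed

lemma lhom_Hom_pre:
  assumes L: "lmod A L" and M: "lmod A M" and N: "lmod A N" and d: "d \<in> lhom A L M"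
  shows "(\<lambda>f. compose (carrier L) f d) \<in> lhom K (Hom A M N) (Hom A L N)"
proof (rule lhomI)
  fix f assume "f \<in> carrier (Hom A M N)"
  then have "f \<in> lhom A M N" using mhom_lhom by auto
  from lhom_mhom[OF L lhom_o[OF d this]] show "compose (carrier L) f d \<in> carrier (Hom A L N)" by (simp add: compose_def)
qed (use lhom_in[OF d] in \<open>auto simp: compose_def intro!: restrict_ext\<close>)

lemma cocycles_submod:
  assumes P: "\<And>i. lmod A (P i)" and d: "\<And>i. d i \<in> lhom A (P (Suc i)) (P i)"
    and dd: "\<And>i x. x \<in> carrier (P (Suc (Suc i))) \<Longrightarrow> d i (d (Suc i) x) = zero (P i)" and N: "lmod A N"
  shows "submod K (Hom A (P i) N) (cocycles A i P d N)" and "submod K (Hom A (P i) N) (coboundaries A i P d N)"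
    and "coboundaries A i P d N \<subseteq> cocycles A i P d N"
proof -
  have H: "lmod K (Hom A (P i) N)" for i by (rule Hom_module[OF P N])
  show 1: "submod K (Hom A (P i) N) (cocycles A i P d N)" unfolding cocycles_def
    using submod_kernel[OF H H lhom_Hom_pre[OF P P N d], of i] by simp
  show "submod K (Hom A (P i) N) (coboundaries A i P d N)"
  proof (cases i)
    case 0
    then show ?thesis using left_module.submod_zero[OF H, of 0] by (simp add: coboundaries_def)
  next
    case (Suc j)
    then show ?thesis using submod_image[OF H H lhom_Hom_pre[OF P P N d] left_module.submod_carrier[OF H], of j]
      by (simp add: coboundaries_def)
  qed
  show "coboundaries A i P d N \<subseteq> cocycles A i P d N"
  proof (cases i)
    case 0
    then show ?thesis using 1 by (auto simp: coboundaries_def submod_def)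
  next
    case (Suc j)
    show ?thesis
    proof
      fix f assume "f \<in> coboundaries A i P d N"
      then obtain g where g: "g \<in> mhom A (P j) N" "f = compose (carrier (P (Suc j))) g (d j)" using Suc by (auto simp: coboundaries_def)
      have "f \<in> mhom A (P (Suc j)) N" using lhom_mhom[OF P lhom_o[OF d mhom_lhom[OF g(1)]]] by (simp add: g(2) compose_def)
      moreover have "compose (carrier (P (Suc (Suc j)))) f (d (Suc j)) = zero (Hom A (P (Suc (Suc j))) N)" unfolding Hom_simps g(2)
        using lhom_in[OF d] dd lhom_zero[OF P N mhom_lhom[OF g(1)]] by (auto simp: compose_def intro!: restrict_ext)
      ultimately show "f \<in> cocycles A i P d N" using Suc by (simp add: cocycles_def)
    qed
  qed
qed

text \<open>The two sides differ only by extensionality: maps are restricted in one direction and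
  evaluated pointwise in the other.\<close>

lemma cocycles_iff_hexl:
  assumes P: "\<And>i. lmod A (P i)" and d: "\<And>i. d i \<in> lhom A (P (Suc i)) (P i)" and N: "lmod A N"
  shows "cocycles A (Suc n) P d N \<subseteq> coboundaries A (Suc n) P d N \<longleftrightarrow>
    hexl_at A P d n N" (is "?L \<longleftrightarrow> ?R")
proof
  assume L: ?L
  show ?R
  proof (rule hexlI)
    fix w assume w: "w \<in> lhom A (P (Suc n)) N" and wz: "\<And>x. x \<in> carrier (P (Suc (Suc n))) \<Longrightarrow> w (d (Suc n) x) = zero N"
    have "restrict w (carrier (P (Suc n))) \<in> cocycles A (Suc n) P d N"
      unfolding cocycles_def using lhom_mhom[OF P w] wz lhom_in[OF d] by (auto simp: compose_def intro!: restrict_ext)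
    then have "restrict w (carrier (P (Suc n))) \<in> coboundaries A (Suc n) P d N" using L by blast
    then obtain g where g: "g \<in> mhom A (P n) N" "restrict w (carrier (P (Suc n))) = compose (carrier (P (Suc n))) g (d n)"
      by (auto simp: coboundaries_def)
    have "w y = g (d n y)" if "y \<in> carrier (P (Suc n))" for y using fun_cong[OF g(2), of y] that by (simp add: compose_def)
    then show "\<exists>w'. w' \<in> lhom A (P n) N \<and> (\<forall>y\<in>carrier (P (Suc n)). w y = w' (d n y))"
      using mhom_lhom[OF g(1)] by blast
  qed
next
  assume R: ?R
  show ?L
  proof
    fix f assume f: "f \<in> cocycles A (Suc n) P d N"
    then have fm: "f \<in> mhom A (P (Suc n)) N"
      and fz: "compose (carrier (P (Suc (Suc n)))) f (d (Suc n)) = (\<lambda>x\<in>carrier (P (Suc (Suc n))). zero N)"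
      by (auto simp: cocycles_def)
    have "f (d (Suc n) x) = zero N" if "x \<in> carrier (P (Suc (Suc n)))" for x using fun_cong[OF fz, of x] that by (simp add: compose_def)
    then obtain w' where w': "w' \<in> lhom A (P n) N" "\<forall>y\<in>carrier (P (Suc n)). f y = w' (d n y)"
      by (rule hexlD[OF R mhom_lhom[OF fm]])
    have "f = compose (carrier (P (Suc n))) (restrict w' (carrier (P n))) (d n)"
    proof (rule mhom_ext[OF fm])
      show "compose (carrier (P (Suc n))) (restrict w' (carrier (P n))) (d n) \<in> mhom A (P (Suc n)) N"
        using lhom_mhom[OF P lhom_o[OF d mhom_lhom[OF lhom_mhom[OF P w'(1)]]]] by (simp add: compose_def)
      show "f x = compose (carrier (P (Suc n))) (restrict w' (carrier (P n))) (d n) x"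
        if "x \<in> carrier (P (Suc n))" for x using w'(2) that lhom_in[OF d that] by (simp add: compose_def)
    qed
    then show "f \<in> coboundaries A (Suc n) P d N"
      unfolding coboundaries_def by (simp only: nat.case) (rule image_eqI[OF refl lhom_mhom[OF P w'(1)]])
  qed
qed

lemma proj_resD:
  assumes "proj_resolution A P d e M"
  shows "lmod A (P i)" "d i \<in> lhom A (P (Suc i)) (P i)" "e \<in> lhom A (P 0) M"
    "x \<in> carrier (P (Suc (Suc i))) \<Longrightarrow> d i (d (Suc i) x) = zero (P i)"
    "x \<in> carrier (P 1) \<Longrightarrow> e (d 0 x) = zero M" "projective A (P i)" "fgm A (P i)" "fgm A M" "lmod A M"
    "e ` carrier (P 0) = carrier M" "d 0 ` carrier (P 1) = {x \<in> carrier (P 0). e x = zero M}"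
    "d (Suc i) ` carrier (P (Suc (Suc i))) = {x \<in> carrier (P (Suc i)). d i x = zero (P i)}"
proof -
  note r = assms[unfolded proj_resolution_iff]
  note r1 = conjunct1[OF r] and s1 = conjunct2[OF r]
  note r2 = conjunct1[OF s1] and s2 = conjunct2[OF s1]
  note r3 = conjunct1[OF s2] and s3 = conjunct2[OF s2]
  note r4 = conjunct1[OF s3] and s4 = conjunct2[OF s3]
  note r5 = conjunct1[OF s4] and s5 = conjunct2[OF s4]
  note r6 = conjunct1[OF s5] and r7 = conjunct2[OF s5]
  show p: "projective A (P i)" for i using r2 by (rule spec)
  show f: "fgm A (P i)" for i by (rule projective_fg[OF p])
  show "lmod A (P i)" for i by (rule fg_left[OF f])
  show fM: "fgm A M" by (rule r1)
  show "lmod A M" by (rule fg_left[OF fM])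
  show "d i \<in> lhom A (P (Suc i)) (P i)" by (rule mhom_lhom[OF spec[OF r4]])
  show "e \<in> lhom A (P 0) M" by (rule mhom_lhom[OF r3])
  show "e ` carrier (P 0) = carrier M" by (rule r5)
  show 0: "d 0 ` carrier (P 1) = {x \<in> carrier (P 0). e x = zero M}" by (rule r6)
  show 1: "d (Suc i) ` carrier (P (Suc (Suc i))) = {x \<in> carrier (P (Suc i)). d i x = zero (P i)}" for i by (rule spec[OF r7])
  show "e (d 0 x) = zero M" if "x \<in> carrier (P 1)" using 0 that by blast
  show "d i (d (Suc i) x) = zero (P i)" if "x \<in> carrier (P (Suc (Suc i)))" using 1[of i] that by blast
qed

lemma inj_resD:
  assumes "inj_resolution A N e I d"
  shows "lmod A (I i)" "d i \<in> lhom A (I i) (I (Suc i))" "e \<in> lhom A N (I 0)"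
    "x \<in> carrier (I i) \<Longrightarrow> d (Suc i) (d i x) = zero (I (Suc (Suc i)))"
    "y \<in> carrier N \<Longrightarrow> d 0 (e y) = zero (I 1)" "injective A (I i)" "fgm A (I i)" "fgm A N" "lmod A N"
    "inj_on e (carrier N)" "e ` carrier N = {x \<in> carrier (I 0). d 0 x = zero (I 1)}"
    "d i ` carrier (I i) = {x \<in> carrier (I (Suc i)). d (Suc i) x = zero (I (Suc (Suc i)))}"
proof -
  note r = assms[unfolded inj_resolution_iff]
  note r1 = conjunct1[OF r] and s1 = conjunct2[OF r]
  note r2 = conjunct1[OF s1] and s2 = conjunct2[OF s1]
  note r3 = conjunct1[OF s2] and s3 = conjunct2[OF s2]
  note r4 = conjunct1[OF s3] and s4 = conjunct2[OF s3]
  note r5 = conjunct1[OF s4] and s5 = conjunct2[OF s4]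
  note r6 = conjunct1[OF s5] and r7 = conjunct2[OF s5]
  show p: "injective A (I i)" for i using r2 by (rule spec)
  show f: "fgm A (I i)" for i by (rule injective_fg[OF p])
  show "lmod A (I i)" for i by (rule fg_left[OF f])
  show fM: "fgm A N" by (rule r1)
  show "lmod A N" by (rule fg_left[OF fM])
  show "d i \<in> lhom A (I i) (I (Suc i))" by (rule mhom_lhom[OF spec[OF r4]])
  show "e \<in> lhom A N (I 0)" by (rule mhom_lhom[OF r3])
  show "inj_on e (carrier N)" by (rule r5)
  show 0: "e ` carrier N = {x \<in> carrier (I 0). d 0 x = zero (I 1)}" by (rule r6)
  show 1: "d i ` carrier (I i) = {x \<in> carrier (I (Suc i)). d (Suc i) x = zero (I (Suc (Suc i)))}" for i by (rule spec[OF r7])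
  show "d 0 (e y) = zero (I 1)" if "y \<in> carrier N" using 0 that by blast
  show "d (Suc i) (d i x) = zero (I (Suc (Suc i)))" if "x \<in> carrier (I i)" using 1[of i] that by blast
qed

text \<open>The choice made in \<open>Ext\<close> depends neither on the degree nor on
  \<open>N\<close>, so one resolution serves all \<open>i\<close> at once.\<close>

lemma Ext_resolution:
  fixes M :: "('a, 'm) module" and N :: "('a, 'n) module"
  assumes M: "fgm A M" and N: "lmod A N"
  obtains P d e where "proj_resolution A P d e M"
    "\<forall>i. trivial_group (Ext A i M N) \<longleftrightarrow> cocycles A i P d N \<subseteq> coboundaries A i P d N"
proof -
  obtain P0 d0 e0 where "proj_resolution A P0 d0 e0 M" by (rule proj_resolution_exists[OF M])
  then have "\<exists>t. case t of (P, d, e) \<Rightarrow> proj_resolution A P d e M" by (intro exI[of _ "(P0, d0, e0)"]) simp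
  then have s: "case (SOME (P, d, e). proj_resolution A P d e M) of (P, d, e) \<Rightarrow> proj_resolution A P d e M" by (rule someI_ex)
  obtain P d e where t: "(SOME (P, d, e). proj_resolution A P d e M) = (P, d, e)" by (rule prod_cases3)
  have r: "proj_resolution A P d e M" using s unfolding t by simp
  note l = proj_resD[OF r]
  have E: "Ext A i M N = (add_monoid (Hom A (P i) N))\<lparr>carrier := cocycles A i P d N\<rparr> Mod coboundaries A i P d N" for i
    unfolding Ext_def t by simp
  show thesis
  proof (rule that[OF r], rule allI)
    show "trivial_group (Ext A i M N) \<longleftrightarrow> cocycles A i P d N \<subseteq> coboundaries A i P d N" for i
      unfolding E by (rule trivial_group_quotient[OF Hom_module[OF l(1) N] cocycles_submod[where P = P and d = d, OF l(1) l(2) l(4) N]])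
  qed
qed

lemma inj_hexl:
  assumes I: "injective A I" and X: "fgm A X" "fgm A Y" "fgm A Z" and g: "g \<in> lhom A Y Z"
    and ex: "{y \<in> carrier Y. g y = zero Z} \<subseteq> f ` carrier X"
  shows "hexl A X f Y g Z I"
proof (rule hexlI)
  fix w assume w: "w \<in> lhom A Y I" and wz: "\<And>x. x \<in> carrier X \<Longrightarrow> w (f x) = zero I"
  have "\<forall>x\<in>carrier Y. g x = zero Z \<longrightarrow> w x = zero I"
  proof (intro ballI impI)
    fix y assume "y \<in> carrier Y" "g y = zero Z"
    then have "y \<in> f ` carrier X" using ex by blast
    then show "w y = zero I" using wz by auto
  qed
  then obtain h where "h \<in> lhom A Z I" "\<forall>x\<in>carrier Y. h (g x) = w x" by (rule injective_lift[OF I X(2,3) g w])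
  then show "\<exists>w'. w' \<in> lhom A Z I \<and> (\<forall>y\<in>carrier Y. w y = w' (g y))" by (intro exI[of _ h]) simp
qed

lemma proj_hexr:
  assumes P: "projective A P" and X: "fgm A J" "fgm A I" and j: "j \<in> lhom A J I"
    and ex: "{y \<in> carrier I. i y = zero L} \<subseteq> j ` carrier J"
  shows "hexr A P J j I i L"
proof (rule hexrI)
  fix u assume u: "u \<in> lhom A P I" and uz: "\<And>x. x \<in> carrier P \<Longrightarrow> i (u x) = zero L"
  have "u ` carrier P \<subseteq> j ` carrier J" using ex uz lhom_in[OF u] by auto
  then obtain h where "h \<in> lhom A P J" "\<forall>x\<in>carrier P. j (h x) = u x" by (rule projective_lift[OF P X j u])
  then show "\<exists>u'. u' \<in> lhom A P J \<and> (\<forall>y\<in>carrier P. u y = j (u' y))" by (intro exI[of _ h]) simp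
qed

end

context fdalg begin

lemma hexr_left_exact:
  assumes X: "lmod A X" and N: "lmod A N" and J: "lmod A J"
    and e: "e \<in> lhom A N J" and inj: "inj_on e (carrier N)" and ex: "e ` carrier N = {x \<in> carrier J. d x = zero L}"
  shows "hexr A X N e J d L"
proof (rule hexrI)
  fix u assume u: "u \<in> lhom A X J" and uz: "\<And>a. a \<in> carrier X \<Longrightarrow> d (u a) = zero L"
  have b: "bij_betw e (carrier N) (carrier (subm J (e ` carrier N)))" using inj by (simp add: bij_betw_def)
  have e': "e \<in> lhom A N (subm J (e ` carrier N))" using e by (auto simp: lhom_def)
  have u': "u \<in> lhom A X (subm J (e ` carrier N))" using u uz ex by (auto simp: lhom_def)
  have "(\<lambda>x. inv_into (carrier N) e (u x)) \<in> lhom A X N" by (rule lhom_o[OF u' lhom_inverse[OF N e' b]])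
  moreover have "\<forall>a\<in>carrier X. u a = e (inv_into (carrier N) e (u a))"
  proof
    fix a assume "a \<in> carrier X"
    then have "u a \<in> e ` carrier N" using lhom_in[OF u'] by simp
    then show "u a = e (inv_into (carrier N) e (u a))" by (simp add: f_inv_into_f)
  qed
  ultimately show "\<exists>u'. u' \<in> lhom A X N \<and> (\<forall>a\<in>carrier X. u a = e (u' a))" by (intro exI conjI)
qed

end

section \<open>Dimension shifting and balance of Ext\<close>

locale inj_res = fdalg K A
  for K :: "'k ring" and A :: "('k, 'a) module" +
  fixes N :: "('a, 'n) module" and \<eta> J \<delta>
  assumes Jres: "inj_resolution A N \<eta> J \<delta>"
begin

lemmas j = inj_resD[OF Jres]

text \<open>\<open>pe i Y S\<close> says that \<open>Ext\<^sup>i\<^sup>+\<^sup>1(Y/S, N) = 0\<close>, without forming the quotient.\<close>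

definition pe :: "nat \<Rightarrow> ('a, 'y) module \<Rightarrow> 'y set \<Rightarrow> bool" where
  "pe i Y S \<longleftrightarrow> (\<forall>f\<in>lhom A Y (J (Suc i)). (\<forall>y\<in>S. f y = zero (J (Suc i))) \<longrightarrow>
     (\<forall>y\<in>carrier Y. \<delta> (Suc i) (f y) = zero (J (Suc (Suc i)))) \<longrightarrow>
     (\<exists>h\<in>lhom A Y (J i). (\<forall>y\<in>S. h y = zero (J i)) \<and> (\<forall>y\<in>carrier Y. f y = \<delta> i (h y))))"

lemma peD:
  assumes "pe i Y S" "f \<in> lhom A Y (J (Suc i))" "\<forall>y\<in>S. f y = zero (J (Suc i))"
    "\<forall>y\<in>carrier Y. \<delta> (Suc i) (f y) = zero (J (Suc (Suc i)))"
  obtains h where "h \<in> lhom A Y (J i)" "\<forall>y\<in>S. h y = zero (J i)" "\<forall>y\<in>carrier Y. f y = \<delta> i (h y)"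
  using mp[OF mp[OF bspec[OF assms(1)[unfolded pe_def] assms(2)] assms(3)] assms(4)] that by blast

text \<open>Maps out of \<open>M\<close> are the maps out of \<open>Y\<close> that vanish on the
  kernel of \<open>e\<close>, so the pair stands for \<open>M\<close>.\<close>

lemma pe_surj:
  fixes M :: "('a, 'm) module" and Y :: "('a, 'y) module"
  assumes Y: "lmod A Y" and M: "lmod A M" and e: "e \<in> lhom A Y M" and s: "e ` carrier Y = carrier M"
  shows "pe i Y {y \<in> carrier Y. e y = zero M} \<longleftrightarrow> hexr_at A M J \<delta> i"
proof
  assume pe: "pe i Y {y \<in> carrier Y. e y = zero M}"
  show "hexr_at A M J \<delta> i"
  proof (rule hexrI)
    fix u assume u: "u \<in> lhom A M (J (Suc i))" and uz: "\<And>m. m \<in> carrier M \<Longrightarrow> \<delta> (Suc i) (u m) = zero (J (Suc (Suc i)))"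
    have 1: "\<forall>y\<in>{y \<in> carrier Y. e y = zero M}. u (e y) = zero (J (Suc i))" using lhom_zero[OF M j(1) u] by simp
    have 2: "\<forall>y\<in>carrier Y. \<delta> (Suc i) (u (e y)) = zero (J (Suc (Suc i)))" using uz lhom_in[OF e] by blast
    obtain h where h: "h \<in> lhom A Y (J i)" "\<forall>y\<in>{y \<in> carrier Y. e y = zero M}. h y = zero (J i)" "\<forall>y\<in>carrier Y. u (e y) = \<delta> i (h y)"
      by (rule peD[OF pe lhom_o[OF e u] 1 2])
    have "\<forall>y\<in>carrier Y. e y = zero M \<longrightarrow> h y = zero (J i)" using h(2) by blast
    then obtain u' where u': "u' \<in> lhom A M (J i)" "\<forall>y\<in>carrier Y. u' (e y) = h y"
      by (rule lhom_factor_surj[OF Y M j(1) e s h(1)])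
    have "u m = \<delta> i (u' m)" if m: "m \<in> carrier M" for m
    proof -
      obtain y where y: "y \<in> carrier Y" "m = e y" using m s by blast
      show ?thesis using bspec[OF h(3) y(1)] bspec[OF u'(2) y(1)] y(2) by simp
    qed
    then show "\<exists>u'. u' \<in> lhom A M (J i) \<and> (\<forall>m\<in>carrier M. u m = \<delta> i (u' m))" using u'(1) by blast
  qed
next
  assume hr: "hexr_at A M J \<delta> i"
  show "pe i Y {y \<in> carrier Y. e y = zero M}" unfolding pe_def
  proof (intro ballI impI)
    fix f assume f: "f \<in> lhom A Y (J (Suc i))" and fz: "\<forall>y\<in>{y \<in> carrier Y. e y = zero M}. f y = zero (J (Suc i))"
      and df: "\<forall>y\<in>carrier Y. \<delta> (Suc i) (f y) = zero (J (Suc (Suc i)))"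
    have "\<forall>y\<in>carrier Y. e y = zero M \<longrightarrow> f y = zero (J (Suc i))" using fz by blast
    then obtain u where u: "u \<in> lhom A M (J (Suc i))" "\<forall>y\<in>carrier Y. u (e y) = f y"
      by (rule lhom_factor_surj[OF Y M j(1) e s f])
    have "\<delta> (Suc i) (u m) = zero (J (Suc (Suc i)))" if m: "m \<in> carrier M" for m
    proof -
      obtain y where y: "y \<in> carrier Y" "m = e y" using m s by blast
      show ?thesis using bspec[OF u(2) y(1)] bspec[OF df y(1)] y(2) by simp
    qed
    then obtain v where v: "v \<in> lhom A M (J i)" "\<forall>m\<in>carrier M. u m = \<delta> i (v m)" by (rule hexrD[OF hr u(1)])
    have "\<forall>y\<in>carrier Y. f y = \<delta> i (v (e y))" using u(2) v(2) lhom_in[OF e] by simp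
    then show "\<exists>h\<in>lhom A Y (J i). (\<forall>y\<in>{y \<in> carrier Y. e y = zero M}. h y = zero (J i)) \<and> (\<forall>y\<in>carrier Y. f y = \<delta> i (h y))"
      using lhom_zero[OF M j(1) v(1)] by (intro bexI[OF _ lhom_o[OF e v(1)]]) simp
  qed
qed

lemma pe_zero:
  assumes Y: "lmod A Y"
  shows "pe i Y {zero Y} \<longleftrightarrow> hexr_at A Y J \<delta> i"
proof -
  have "{y \<in> carrier Y. y = zero Y} = {zero Y}" using lm_zero[OF Y] by blast
  then show ?thesis using pe_surj[OF Y Y lhom_id] by simp
qed

lemma pe_trivial:
  assumes Y: "lmod A Y" and z: "zero_module (J (Suc i))"
  shows "pe i Y S" unfolding pe_def
proof (intro ballI impI)
  fix f assume f: "f \<in> lhom A Y (J (Suc i))"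
  have "\<forall>y\<in>carrier Y. f y = \<delta> i (zero (J i))"
    using lhom_in[OF f] z lhom_zero[OF j(1) j(1) j(2)] by (simp add: zero_module_def)
  then show "\<exists>h\<in>lhom A Y (J i). (\<forall>y\<in>S. h y = zero (J i)) \<and> (\<forall>y\<in>carrier Y. f y = \<delta> i (h y))"
    by (intro bexI[OF _ lhom_const0[OF j(1)]]) simp
qed

text \<open>The final move shared by the shifting arguments: a lift \<open>h\<close> of
  \<open>f\<close> is altered by a map that \<open>\<delta> i\<close> kills, chosen so that the
  difference vanishes on the image of \<open>g\<close>.\<close>

lemma pe_correct:
  fixes Y :: "('a, 'y) module" and Y' :: "('a, 'z) module"
  assumes Y': "lmod A Y'" and g: "g \<in> lhom A Y Y'" and L: "lmod A L" and e: "e \<in> lhom A L (J i)"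
    and de: "\<And>x. x \<in> carrier L \<Longrightarrow> \<delta> i (e x) = zero (J (Suc i))"
    and h: "h \<in> lhom A Y' (J i)" and f: "\<forall>y\<in>carrier Y'. f y = \<delta> i (h y)"
    and u: "u \<in> lhom A Y' L" and hu: "\<forall>y\<in>carrier Y. h (g y) = e (u (g y))"
  shows "\<exists>h\<in>lhom A Y' (J i). (\<forall>y\<in>g ` carrier Y. h y = zero (J i)) \<and> (\<forall>y\<in>carrier Y'. f y = \<delta> i (h y))"
proof -
  interpret Ji: left_module A "J i" by (rule j(1))
  interpret JS: left_module A "J (Suc i)" by (rule j(1))
  have eu: "(\<lambda>y. e (u y)) \<in> lhom A Y' (J i)" by (rule lhom_o[OF u e])
  show ?thesis
  proof (rule bexI[OF _ lhom_diff[OF j(1) h eu]], intro conjI ballI)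
    fix y assume "y \<in> g ` carrier Y"
    then obtain x where x: "x \<in> carrier Y" "y = g x" by auto
    show "h y \<ominus>\<^bsub>J i\<^esub> e (u y) = zero (J i)"
      using hu x lhom_in[OF eu lhom_in[OF g x(1)]] Ji.minus_diff_zero_iff by simp
  next
    fix y assume y: "y \<in> carrier Y'"
    have c: "h y \<in> carrier (J i)" "e (u y) \<in> carrier (J i)" "u y \<in> carrier L"
      using lhom_in[OF h y] lhom_in[OF eu y] lhom_in[OF u y] by auto
    have "\<delta> i (h y) = f y" using f y by simp
    moreover have "\<delta> i (h y) \<in> carrier (J (Suc i))" by (rule lhom_in[OF j(2) c(1)])
    ultimately show "f y = \<delta> i (h y \<ominus>\<^bsub>J i\<^esub> e (u y))"
      using lhom_minus[OF j(1) j(1) j(2) c(1,2)] de[OF c(3)] by (simp add: JS.M.minus_eq)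
  qed
qed

text \<open>The connecting isomorphism of \<open>0 -> Y/S -> Y' -> Y'/g(Y) -> 0\<close>: as Ext of
  \<open>Y'\<close> vanishes in positive degrees (\<open>hr\<close>), Ext of Y/S in degree
  \<open>i + 1\<close> corresponds to Ext of the cokernel in degree \<open>i + 2\<close>. Maps on
  \<open>Y\<close> are carried to \<open>Y'\<close> by injectivity of the terms of
  \<open>J\<close>.\<close>

lemma pe_shift:
  assumes Y: "fgm A Y" and Y': "fgm A Y'" and g: "g \<in> lhom A Y Y'" and ker: "{y \<in> carrier Y. g y = zero Y'} = S"
    and hr: "\<And>i. hexr_at A Y' J \<delta> i"
  shows "pe i Y S \<longleftrightarrow> pe (Suc i) Y' (g ` carrier Y)"
proof
  have Ym: "lmod A Y" and Ym': "lmod A Y'" using Y Y' fg_left by auto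
  {
    assume p: "pe i Y S"
    show "pe (Suc i) Y' (g ` carrier Y)" unfolding pe_def
    proof (intro ballI impI)
      fix f assume f: "f \<in> lhom A Y' (J (Suc (Suc i)))" and fz: "\<forall>y\<in>g ` carrier Y. f y = zero (J (Suc (Suc i)))"
        and df: "\<forall>y\<in>carrier Y'. \<delta> (Suc (Suc i)) (f y) = zero (J (Suc (Suc (Suc i))))"
      obtain h where h: "h \<in> lhom A Y' (J (Suc i))" "\<forall>y\<in>carrier Y'. f y = \<delta> (Suc i) (h y)"
        by (rule hexrD[OF hr f]) (use df in blast)
      have hg: "(\<lambda>y. h (g y)) \<in> lhom A Y (J (Suc i))" by (rule lhom_o[OF g h(1)])
      have 1: "\<forall>y\<in>S. h (g y) = zero (J (Suc i))" using ker lhom_zero[OF Ym' j(1) h(1)] by auto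
      have 2: "\<forall>y\<in>carrier Y. \<delta> (Suc i) (h (g y)) = zero (J (Suc (Suc i)))"
      proof
        fix y assume y: "y \<in> carrier Y"
        show "\<delta> (Suc i) (h (g y)) = zero (J (Suc (Suc i)))"
          using bspec[OF h(2) lhom_in[OF g y]] bspec[OF fz imageI[OF y]] by simp
      qed
      obtain u where u: "u \<in> lhom A Y (J i)" "\<forall>y\<in>S. u y = zero (J i)" "\<forall>y\<in>carrier Y. h (g y) = \<delta> i (u y)"
        by (rule peD[OF p hg 1 2])
      have "\<forall>y\<in>carrier Y. g y = zero Y' \<longrightarrow> u y = zero (J i)" using u(2) ker by blast
      then obtain u' where u': "u' \<in> lhom A Y' (J i)" "\<forall>x\<in>carrier Y. u' (g x) = u x"
        by (rule injective_lift[OF j(6) Y Y' g u(1)])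
      show "\<exists>h\<in>lhom A Y' (J (Suc i)). (\<forall>y\<in>g ` carrier Y. h y = zero (J (Suc i))) \<and> (\<forall>y\<in>carrier Y'. f y = \<delta> (Suc i) (h y))"
        by (rule pe_correct[OF Ym' g j(1) j(2) j(4) h u'(1)]) (use u(3) u'(2) in auto)
    qed
  next
    assume p: "pe (Suc i) Y' (g ` carrier Y)"
    show "pe i Y S" unfolding pe_def
    proof (intro ballI impI)
      interpret J: left_module A "J (Suc i)" by (rule j(1))
      interpret JS: left_module A "J (Suc (Suc i))" by (rule j(1))
      fix f assume f: "f \<in> lhom A Y (J (Suc i))" and fz: "\<forall>y\<in>S. f y = zero (J (Suc i))"
        and df: "\<forall>y\<in>carrier Y. \<delta> (Suc i) (f y) = zero (J (Suc (Suc i)))"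
      have "\<forall>y\<in>carrier Y. g y = zero Y' \<longrightarrow> f y = zero (J (Suc i))" using fz ker by blast
      then obtain f' where f': "f' \<in> lhom A Y' (J (Suc i))" "\<forall>x\<in>carrier Y. f' (g x) = f x"
        by (rule injective_lift[OF j(6) Y Y' g f])
      have df': "(\<lambda>y. \<delta> (Suc i) (f' y)) \<in> lhom A Y' (J (Suc (Suc i)))" by (rule lhom_o[OF f'(1) j(2)])
      have 1: "\<forall>y\<in>g ` carrier Y. \<delta> (Suc i) (f' y) = zero (J (Suc (Suc i)))" using f'(2) df by simp
      have 2: "\<forall>y\<in>carrier Y'. \<delta> (Suc (Suc i)) (\<delta> (Suc i) (f' y)) = zero (J (Suc (Suc (Suc i))))"
        using j(4) lhom_in[OF f'(1)] by blast
      obtain u where u: "u \<in> lhom A Y' (J (Suc i))" "\<forall>y\<in>g ` carrier Y. u y = zero (J (Suc i))"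
        "\<forall>y\<in>carrier Y'. \<delta> (Suc i) (f' y) = \<delta> (Suc i) (u y)" by (rule peD[OF p df' 1 2])
      have dz: "\<delta> (Suc i) (f' y \<ominus>\<^bsub>J (Suc i)\<^esub> u y) = zero (J (Suc (Suc i)))" if y: "y \<in> carrier Y'" for y
        using lhom_minus[OF j(1) j(1) j(2) lhom_in[OF f'(1) y] lhom_in[OF u(1) y]] bspec[OF u(3) y]
          lhom_in[OF lhom_o[OF u(1) j(2)] y] by (simp add: JS.minus_diff_zero_iff)
      obtain v where v: "v \<in> lhom A Y' (J i)" "\<forall>y\<in>carrier Y'. f' y \<ominus>\<^bsub>J (Suc i)\<^esub> u y = \<delta> i (v y)"
        by (rule hexrD[OF hr lhom_diff[OF j(1) f'(1) u(1)]]) (rule dz)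
      show "\<exists>h\<in>lhom A Y (J i). (\<forall>y\<in>S. h y = zero (J i)) \<and> (\<forall>y\<in>carrier Y. f y = \<delta> i (h y))"
      proof (rule bexI[OF _ lhom_o[OF g v(1)]], intro conjI ballI)
        show "v (g y) = zero (J i)" if "y \<in> S" for y
        proof -
          have "g y = zero Y'" using that ker by blast
          then show ?thesis using lhom_zero[OF Ym' j(1) v(1)] by simp
        qed
        fix y assume y: "y \<in> carrier Y"
        have "f' (g y) \<ominus>\<^bsub>J (Suc i)\<^esub> u (g y) = f y"
          using bspec[OF f'(2) y] bspec[OF u(2) imageI[OF y]] lhom_in[OF f y] by (simp add: J.M.minus_eq)
        then show "f y = \<delta> i (v (g y))" using bspec[OF v(2) lhom_in[OF g y]] by simp
      qed
    qed
  }
qed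

text \<open>Shifting \<open>pe\<close> along a projective resolution moves the degree from \<open>J\<close> to \<open>P\<close>.\<close>

lemma hexl_iff_hexr:
  assumes Pr: "proj_resolution A P d e M"
  shows "hexl_at A P d n N \<longleftrightarrow>
    hexr_at A M J \<delta> n"
proof -
  note p = proj_resD[OF Pr]
  have hr: "hexr_at A (P m) J \<delta> i" for m i by (rule proj_hexr[OF p(6) j(7) j(7) j(2)]) (use j(12) in simp)
  \<comment> \<open>\<open>P m\<close> modulo the image of \<open>d m\<close> is the m-th syzygy of
    \<open>M\<close>, so each step along \<open>P\<close> lowers the degree by one.\<close>
  have "pe (i + m) (P 0) (d 0 ` carrier (P (Suc 0))) \<longleftrightarrow> pe i (P m) (d m ` carrier (P (Suc m)))" for i m
  proof (induction m arbitrary: i)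
    case (Suc m)
    have "pe i (P (Suc m)) (d (Suc m) ` carrier (P (Suc (Suc m)))) \<longleftrightarrow> pe (Suc i) (P m) (d m ` carrier (P (Suc m)))"
      by (rule pe_shift[OF p(7) p(7) p(2) p(12)[symmetric] hr])
    then show ?case using Suc[of "Suc i"] by simp
  qed simp
  from this[of 0 n] have "hexr_at A M J \<delta> n \<longleftrightarrow>
      pe 0 (P n) (d n ` carrier (P (Suc n)))" using pe_surj[OF p(1) p(9) p(3) p(10), of n] p(11) by simp
  \<comment> \<open>What remains is degree one for the n-th syzygy, where \<open>\<eta>\<close>
    embeds \<open>N\<close> in \<open>J 0\<close> and the two conditions can be compared
    directly.\<close>
  moreover have "pe 0 (P n) (d n ` carrier (P (Suc n))) \<longleftrightarrow>
      hexl_at A P d n N"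
  proof
    interpret J0: left_module A "J 0" by (rule j(1))
    interpret J1: left_module A "J (Suc 0)" by (rule j(1))
    have le: "hexr A (P m) N \<eta> (J 0) (\<delta> 0) (J 1)" for m by (rule hexr_left_exact[OF p(1) j(9) j(1) j(3) j(10) j(11)])
    have \<eta>: "x = y" if "\<eta> x = \<eta> y" "x \<in> carrier N" "y \<in> carrier N" for x y using inj_onD[OF j(10) that] .
    {
      assume pe: "pe 0 (P n) (d n ` carrier (P (Suc n)))"
      show "hexl_at A P d n N"
      proof (rule hexlI)
        fix w assume w: "w \<in> lhom A (P (Suc n)) N" and wz: "\<And>x. x \<in> carrier (P (Suc (Suc n))) \<Longrightarrow> w (d (Suc n) x) = zero N"
        \<comment> \<open>\<open>\<eta>\<close> after \<open>w\<close> vanishes on the kernel of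
          \<open>d n\<close> and therefore extends over \<open>P n\<close>; \<open>pe\<close> then
          corrects the extension so that it lands in \<open>N\<close>.\<close>
        have "\<forall>x\<in>carrier (P (Suc n)). d n x = zero (P n) \<longrightarrow> \<eta> (w x) = zero (J 0)"
        proof (intro ballI impI)
          fix x assume "x \<in> carrier (P (Suc n))" "d n x = zero (P n)"
          then have "x \<in> d (Suc n) ` carrier (P (Suc (Suc n)))" unfolding p(12) by simp
          then obtain z where z: "z \<in> carrier (P (Suc (Suc n)))" "x = d (Suc n) z" by blast
          then show "\<eta> (w x) = zero (J 0)" using wz[OF z(1)] lhom_zero[OF j(9) j(1) j(3)] by simp
        qed
        then obtain v where v: "v \<in> lhom A (P n) (J 0)" "\<forall>x\<in>carrier (P (Suc n)). v (d n x) = \<eta> (w x)"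
          by (rule injective_lift[OF j(6) p(7) p(7) p(2) lhom_o[OF w j(3)]])
        have 1: "\<forall>y\<in>d n ` carrier (P (Suc n)). \<delta> 0 (v y) = zero (J (Suc 0))" using v(2) j(5) lhom_in[OF w] by auto
        have 2: "\<forall>y\<in>carrier (P n). \<delta> (Suc 0) (\<delta> 0 (v y)) = zero (J (Suc (Suc 0)))" using j(4) lhom_in[OF v(1)] by blast
        obtain h where h: "h \<in> lhom A (P n) (J 0)" "\<forall>y\<in>d n ` carrier (P (Suc n)). h y = zero (J 0)"
          "\<forall>y\<in>carrier (P n). \<delta> 0 (v y) = \<delta> 0 (h y)" by (rule peD[OF pe lhom_o[OF v(1) j(2)] 1 2])
        have dz: "\<delta> 0 (v y \<ominus>\<^bsub>J 0\<^esub> h y) = zero (J 1)" if y: "y \<in> carrier (P n)" for y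
          using lhom_minus[OF j(1) j(1) j(2) lhom_in[OF v(1) y] lhom_in[OF h(1) y]] bspec[OF h(3) y]
            lhom_in[OF lhom_o[OF h(1) j(2)] y] by (simp add: J1.minus_diff_zero_iff)
        obtain w' where w': "w' \<in> lhom A (P n) N" "\<forall>y\<in>carrier (P n). v y \<ominus>\<^bsub>J 0\<^esub> h y = \<eta> (w' y)"
          by (rule hexrD[OF le lhom_diff[OF j(1) v(1) h(1)]]) (rule dz)
        have "w x = w' (d n x)" if x: "x \<in> carrier (P (Suc n))" for x
        proof (rule \<eta>)
          have "v (d n x) \<ominus>\<^bsub>J 0\<^esub> h (d n x) = \<eta> (w x)"
            using bspec[OF v(2) x] bspec[OF h(2) imageI[OF x]] lhom_in[OF lhom_o[OF w j(3)] x] by (simp add: J0.M.minus_eq)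
          then show "\<eta> (w x) = \<eta> (w' (d n x))" using bspec[OF w'(2) lhom_in[OF p(2) x]] by simp
        qed (rule lhom_in[OF w x], rule lhom_in[OF w'(1) lhom_in[OF p(2) x]])
        then show "\<exists>w'. w' \<in> lhom A (P n) N \<and> (\<forall>x\<in>carrier (P (Suc n)). w x = w' (d n x))" using w'(1) by blast
      qed
    next
      assume hl: "hexl_at A P d n N"
      show "pe 0 (P n) (d n ` carrier (P (Suc n)))" unfolding pe_def
      proof (intro ballI impI)
        fix f assume f: "f \<in> lhom A (P n) (J (Suc 0))" and fz: "\<forall>y\<in>d n ` carrier (P (Suc n)). f y = zero (J (Suc 0))"
          and df: "\<forall>y\<in>carrier (P n). \<delta> (Suc 0) (f y) = zero (J (Suc (Suc 0)))"
        obtain v where v: "v \<in> lhom A (P n) (J 0)" "\<forall>y\<in>carrier (P n). f y = \<delta> 0 (v y)"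
          by (rule hexrD[OF hr f]) (use df in blast)
        have vd: "(\<lambda>x. v (d n x)) \<in> lhom A (P (Suc n)) (J 0)" by (rule lhom_o[OF p(2) v(1)])
        have z: "\<delta> 0 (v (d n x)) = zero (J 1)" if x: "x \<in> carrier (P (Suc n))" for x
          using bspec[OF fz imageI[OF x]] bspec[OF v(2) lhom_in[OF p(2) x]] by simp
        obtain w where w: "w \<in> lhom A (P (Suc n)) N" "\<forall>x\<in>carrier (P (Suc n)). v (d n x) = \<eta> (w x)"
          by (rule hexrD[OF le vd]) (rule z)
        have "w (d (Suc n) x) = zero N" if x: "x \<in> carrier (P (Suc (Suc n)))" for x
        proof (rule \<eta>)
          show "\<eta> (w (d (Suc n) x)) = \<eta> (zero N)"
            using bspec[OF w(2) lhom_in[OF p(2) x]] p(4)[OF x] lhom_zero[OF p(1) j(1) v(1)] lhom_zero[OF j(9) j(1) j(3)] by simp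
        qed (rule lhom_in[OF w(1) lhom_in[OF p(2) x]], rule lm_zero[OF j(9)])
        then obtain w' where w': "w' \<in> lhom A (P n) N" "\<forall>x\<in>carrier (P (Suc n)). w x = w' (d n x)"
          by (rule hexlD[OF hl w(1)])
        show "\<exists>h\<in>lhom A (P n) (J 0). (\<forall>y\<in>d n ` carrier (P (Suc n)). h y = zero (J 0)) \<and> (\<forall>y\<in>carrier (P n). f y = \<delta> 0 (h y))"
          by (rule pe_correct[OF p(1) p(2) j(9) j(3) _ v w'(1)]) (use j(5) w(2) w'(2) in simp_all)
      qed
    }
  qed
  ultimately show ?thesis by blast
qed

end

context fdalg begin

text \<open>Both resolutions are arbitrary, so this also yields independence of the resolution on
  either side.\<close>

lemma resolution_balance:
  assumes "proj_resolution A P d e M" and "inj_resolution A N \<eta> J \<delta>"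
  shows "hexl_at A P d n N \<longleftrightarrow>
    hexr_at A M J \<delta> n" by (rule inj_res.hexl_iff_hexr[OF inj_res.intro[OF fdalg_axioms inj_res_axioms.intro[OF assms(2)]] assms(1)])

lemma Ext_hexr:
  fixes M :: "('a, 'm) module" and N :: "('a, 'n) module"
  assumes M: "fgm A M" and J: "inj_resolution A N \<eta> J \<delta>"
  shows "trivial_group (Ext A (Suc n) M N) \<longleftrightarrow>
    hexr_at A M J \<delta> n"
proof -
  have N: "lmod A N" by (rule inj_resD(9)[OF J])
  obtain P d e where P: "proj_resolution A P d e M"
    and E: "\<forall>i. trivial_group (Ext A i M N) \<longleftrightarrow> cocycles A i P d N \<subseteq> coboundaries A i P d N"
    by (rule Ext_resolution[OF M N])
  note p = proj_resD[OF P]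
  show ?thesis unfolding spec[OF E] cocycles_iff_hexl[where P = P and d = d, OF p(1) p(2) N] by (rule resolution_balance[OF P J])
qed

text \<open>\<open>Ext\<close> refers to its own chosen resolution; an auxiliary injective
  resolution of \<open>N\<close> links that one with the given \<open>P\<close>.\<close>

lemma Ext_hexl:
  fixes M :: "('a, 'm) module" and N :: "('a, 'n) module"
  assumes N: "fgm A N" and P: "proj_resolution A P d e M"
  shows "trivial_group (Ext A (Suc n) M N) \<longleftrightarrow>
    hexl_at A P d n N"
proof -
  obtain \<eta> J \<delta> where J: "inj_resolution A N \<eta> J \<delta>" by (rule inj_resolution_exists[OF N])
  have M: "fgm A M" by (rule proj_resD(8)[OF P])
  show ?thesis unfolding Ext_hexr[OF M J] resolution_balance[OF P J] ..
qed

lemma Ext_0: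
  fixes M :: "('a, 'm) module" and N :: "('a, 'n) module"
  assumes M: "fgm A M" and N: "lmod A N"
  shows "trivial_group (Ext A 0 M N) \<longleftrightarrow> (\<forall>f\<in>lhom A M N. \<forall>x\<in>carrier M. f x = zero N)"
proof -
  obtain P d e where P: "proj_resolution A P d e M"
    and E: "\<forall>i. trivial_group (Ext A i M N) \<longleftrightarrow> cocycles A i P d N \<subseteq> coboundaries A i P d N"
    by (rule Ext_resolution[OF M N])
  note p = proj_resD[OF P]
  have "cocycles A 0 P d N \<subseteq> coboundaries A 0 P d N \<longleftrightarrow> (\<forall>f\<in>lhom A M N. \<forall>x\<in>carrier M. f x = zero N)"
  proof
    assume *: "cocycles A 0 P d N \<subseteq> coboundaries A 0 P d N"
    show "\<forall>f\<in>lhom A M N. \<forall>x\<in>carrier M. f x = zero N"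
    proof (intro ballI)
      fix f x assume f: "f \<in> lhom A M N" and x: "x \<in> carrier M"
      have "restrict (\<lambda>x. f (e x)) (carrier (P 0)) \<in> cocycles A 0 P d N" unfolding cocycles_def
        using lhom_mhom[OF p(1) lhom_o[OF p(3) f]] lhom_in[OF p(2)] p(5) lhom_zero[OF p(9) N f]
        by (auto simp: compose_def intro!: restrict_ext)
      then have "restrict (\<lambda>x. f (e x)) (carrier (P 0)) = zero (Hom A (P 0) N)" using * by (auto simp: coboundaries_def)
      then have z: "restrict (\<lambda>x. f (e x)) (carrier (P 0)) = (\<lambda>x\<in>carrier (P 0). zero N)" by simp
      obtain y where y: "y \<in> carrier (P 0)" "x = e y" using p(10) x by auto
      show "f x = zero N" using fun_cong[OF z, of y] y by simp
    qed
  next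
    assume *: "\<forall>f\<in>lhom A M N. \<forall>x\<in>carrier M. f x = zero N"
    show "cocycles A 0 P d N \<subseteq> coboundaries A 0 P d N"
    proof
      fix g assume "g \<in> cocycles A 0 P d N"
      then have gm: "g \<in> mhom A (P 0) N" and gz: "compose (carrier (P 1)) g (d 0) = (\<lambda>x\<in>carrier (P 1). zero N)"
        by (auto simp: cocycles_def)
      have "g x = zero N" if "x \<in> carrier (P 0)" "e x = zero M" for x
      proof -
        have "x \<in> d 0 ` carrier (P 1)" using that p(11) by simp
        then obtain z where "z \<in> carrier (P 1)" "x = d 0 z" by auto
        then show ?thesis using fun_cong[OF gz, of z] by (simp add: compose_def)
      qed
      then have "\<forall>x\<in>carrier (P 0). e x = zero M \<longrightarrow> g x = zero N" by blast
      then obtain f where f: "f \<in> lhom A M N" "\<forall>x\<in>carrier (P 0). f (e x) = g x"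
        by (rule lhom_factor_surj[OF p(1) p(9) N p(3) p(10) mhom_lhom[OF gm]])
      have "g x = zero N" if "x \<in> carrier (P 0)" for x using bspec[OF f(2) that] * f(1) lhom_in[OF p(3) that] by simp
      then have "g = (\<lambda>x\<in>carrier (P 0). zero N)" by (intro mhom_ext[OF gm lhom_mhom[OF p(1) lhom_const0[OF N]]]) simp
      then show "g \<in> coboundaries A 0 P d N" by (simp add: coboundaries_def)
    qed
  qed
  then show ?thesis using E by blast
qed

section \<open>Finite resolutions\<close>

text \<open>A zero module is an empty sum, hence lies in \<open>addr\<close> of the empty
  class.\<close>

lemma zero_injective: "lmod A Z \<Longrightarrow> zero_module Z \<Longrightarrow> injective A Z"
  by (rule addr_injective[of Z "{} :: ('a, nat) module set"])
    (auto simp: fg_zero addr_def zero_module_def intro!: exI[of _ "0::nat"])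

lemma zero_projective: "lmod A Z \<Longrightarrow> zero_module Z \<Longrightarrow> projective A Z"
  by (rule addr_projective[of Z "{} :: ('a, nat) module set"])
    (auto simp: fg_zero addr_def zero_module_def intro!: exI[of _ "0::nat"])

lemma zero_umodule:
  obtains Z :: "('k, 'a) umodule" where "lmod A Z" "zero_module Z"
proof -
  interpret D: left_module A DA by (rule DA_module)
  obtain Z :: "('k, 'a) umodule" and \<phi> \<psi> where Z: "fgm A Z" "mod_iso A (subm DA {zero DA}) Z \<phi> \<psi>"
    by (rule umodule_copy[OF fg_submodule[OF fg_DA D.submod_zero]])
  note z = mod_isoD[OF Z(2)]
  have Z': "lmod A Z" by (rule fg_left[OF Z(1)])
  have "\<phi> ` {zero DA} = carrier Z" using z(7) by (simp add: bij_betw_def del: DA_simps)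
  then have "carrier Z = {\<phi> (zero DA)}" by (simp del: DA_simps)
  moreover have "zero Z \<in> carrier Z" by (rule lm_zero[OF Z'])
  ultimately have "zero_module Z" unfolding zero_module_def by auto
  then show thesis by (rule that[OF Z'])
qed

text \<open>Beyond \<open>k\<close> the terms are zero and exactness is automatic; the hypothesis
  \<open>ex\<close> for \<open>i = k - 1\<close> says that the last map into \<open>I k\<close> is
  onto.\<close>

lemma inj_resolution_finite:
  assumes M: "fgm A M" and e: "e \<in> lhom A M (I 0)" and inj: "inj_on e (carrier M)"
    and ex0: "e ` carrier M = {x \<in> carrier (I 0). d 0 x = zero (I 1)}" and d: "\<And>i. d i \<in> lhom A (I i) (I (Suc i))"
    and ex: "\<And>i. i < k \<Longrightarrow> d i ` carrier (I i) = {x \<in> carrier (I (Suc i)). d (Suc i) x = zero (I (Suc (Suc i)))}"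
    and I: "\<And>i. i \<le> k \<Longrightarrow> injective A (I i)"
    and Z: "\<And>i. k < i \<Longrightarrow> lmod A (I i)" "\<And>i. k < i \<Longrightarrow> zero_module (I i)"
  shows "inj_resolution A M (restrict e (carrier M)) I (\<lambda>i. restrict (d i) (carrier (I i)))"
proof -
  have Ii: "injective A (I i)" for i using I zero_injective[OF Z, of i] by (cases "i \<le> k") auto
  have Im: "lmod A (I i)" for i by (rule fg_left[OF injective_fg[OF Ii]])
  have ex': "d i ` carrier (I i) = {x \<in> carrier (I (Suc i)). d (Suc i) x = zero (I (Suc (Suc i)))}" for i
  proof (cases "i < k")
    case False
    then have z: "carrier (I (Suc i)) = {zero (I (Suc i))}" using Z(2)[of "Suc i"] by (simp add: zero_module_def)
    have "d i ` carrier (I i) = {zero (I (Suc i))}" using lhom_in[OF d, of _ i] lm_zero[OF Im, of i] z by auto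
    moreover have "d (Suc i) (zero (I (Suc i))) = zero (I (Suc (Suc i)))" by (rule lhom_zero[OF Im Im d])
    ultimately show ?thesis using z by auto
  qed (rule ex)
  show ?thesis unfolding inj_resolution_iff
  proof (intro conjI allI M Ii)
    show "restrict e (carrier M) \<in> mhom A M (I 0)" by (rule lhom_mhom[OF fg_left[OF M] e])
    show "restrict (d i) (carrier (I i)) \<in> mhom A (I i) (I (Suc i))" for i by (rule lhom_mhom[OF Im d])
    show "inj_on (restrict e (carrier M)) (carrier M)" using inj by simp
    show "restrict e (carrier M) ` carrier M = {x \<in> carrier (I 0). restrict (d 0) (carrier (I 0)) x = zero (I 1)}" using ex0 by auto
    show "restrict (d i) (carrier (I i)) ` carrier (I i) =
      {x \<in> carrier (I (Suc i)). restrict (d (Suc i)) (carrier (I (Suc i))) x = zero (I (Suc (Suc i)))}" for i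
      using ex'[of i] by auto
  qed
qed

lemma proj_resolution_finite:
  assumes M: "fgm A M" and e: "e \<in> lhom A (P 0) M" and surj: "e ` carrier (P 0) = carrier M"
    and ex0: "d 0 ` carrier (P 1) = {x \<in> carrier (P 0). e x = zero M}" and d: "\<And>i. d i \<in> lhom A (P (Suc i)) (P i)"
    and ex: "\<And>i. i < k \<Longrightarrow> d (Suc i) ` carrier (P (Suc (Suc i))) = {x \<in> carrier (P (Suc i)). d i x = zero (P i)}"
    and P: "\<And>i. i \<le> k \<Longrightarrow> projective A (P i)"
    and Z: "\<And>i. k < i \<Longrightarrow> lmod A (P i)" "\<And>i. k < i \<Longrightarrow> zero_module (P i)"
  shows "proj_resolution A P (\<lambda>i. restrict (d i) (carrier (P (Suc i)))) (restrict e (carrier (P 0))) M"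
proof -
  have Pi: "projective A (P i)" for i using P zero_projective[OF Z, of i] by (cases "i \<le> k") auto
  have Pm: "lmod A (P i)" for i by (rule fg_left[OF projective_fg[OF Pi]])
  have ex': "d (Suc i) ` carrier (P (Suc (Suc i))) = {x \<in> carrier (P (Suc i)). d i x = zero (P i)}" for i
  proof (cases "i < k")
    case False
    then have z: "carrier (P (Suc i)) = {zero (P (Suc i))}" "carrier (P (Suc (Suc i))) = {zero (P (Suc (Suc i)))}"
      using Z(2)[of "Suc i"] Z(2)[of "Suc (Suc i)"] by (simp_all add: zero_module_def)
    have "d i (zero (P (Suc i))) = zero (P i)" "d (Suc i) (zero (P (Suc (Suc i)))) = zero (P (Suc i))" by (rule lhom_zero[OF Pm Pm d])+
    then show ?thesis unfolding z by auto
  qed (rule ex)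
  show ?thesis unfolding proj_resolution_iff
  proof (intro conjI allI M Pi)
    show "restrict e (carrier (P 0)) \<in> mhom A (P 0) M" by (rule lhom_mhom[OF Pm e])
    show "restrict (d i) (carrier (P (Suc i))) \<in> mhom A (P (Suc i)) (P i)" for i by (rule lhom_mhom[OF Pm d])
    show "restrict e (carrier (P 0)) ` carrier (P 0) = carrier M" using surj by simp
    show "restrict (d 0) (carrier (P (Suc 0))) ` carrier (P 1) = {x \<in> carrier (P 0). restrict e (carrier (P 0)) x = zero M}"
      using ex0 by auto
    show "restrict (d (Suc i)) (carrier (P (Suc (Suc i)))) ` carrier (P (Suc (Suc i))) =
      {x \<in> carrier (P (Suc i)). restrict (d i) (carrier (P (Suc i))) x = zero (P i)}" for i
      using ex'[of i] by auto
  qed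
qed

text \<open>The given sequence ends with a single zero module, which is repeated to obtain an
  infinite resolution.\<close>

lemma idim_resolution:
  fixes C :: "('a, 'c) module"
  assumes "idim_le A C k"
  obtains \<eta> I \<delta> where "inj_resolution A C \<eta> I \<delta>" "\<forall>i>k. zero_module (I i)"
proof -
  obtain e and I :: "nat \<Rightarrow> ('k, 'a) umodule" and d where
    E: "exact_seq_into A (Suc k) C e I d" and z: "zero_module (I (Suc k))" and inj: "\<forall>i\<le>k. injective A (I i)"
    using assms unfolding idim_le_def by blast
  have fg: "\<forall>i\<le>Suc k. fgm A (I i)" and C: "fgm A C" and d: "\<forall>i<Suc k. d i \<in> mhom A (I i) (I (Suc i))"
    and e: "e \<in> mhom A C (I 0)" and ie: "inj_on e (carrier C)" and e0: "exact_at C e (I 0) (d 0) (I 1)"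
    and ex: "\<forall>i. Suc i < Suc k \<longrightarrow> exact_at (I i) (d i) (I (Suc i)) (d (Suc i)) (I (Suc (Suc i)))"
    using E by (auto simp: exact_seq_into_def exact_into_def)
  define I' where "I' i = (if i \<le> Suc k then I i else I (Suc k))" for i
  define d' where "d' i = (if i \<le> k then d i else (\<lambda>_. zero (I (Suc k))))" for i
  have Zm: "lmod A (I (Suc k))" by (rule fg_left) (use fg in simp)
  have "inj_resolution A C (restrict e (carrier C)) I' (\<lambda>i. restrict (d' i) (carrier (I' i)))"
  proof (rule inj_resolution_finite[where k = k, OF C])
    show "e \<in> lhom A C (I' 0)" using mhom_lhom[OF e] by (simp add: I'_def)
    show "e ` carrier C = {x \<in> carrier (I' 0). d' 0 x = zero (I' 1)}" using e0 by (simp add: exact_at_def I'_def d'_def)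
    show "d' i \<in> lhom A (I' i) (I' (Suc i))" for i
    proof (cases "i \<le> k")
      case True
      then show ?thesis using d by (simp add: I'_def d'_def mhom_lhom)
    next
      case False
      then show ?thesis using lhom_const0[OF Zm, of "I i"] lhom_const0[OF Zm, of "I (Suc k)"] by (simp add: I'_def d'_def)
    qed
    show "d' i ` carrier (I' i) = {x \<in> carrier (I' (Suc i)). d' (Suc i) x = zero (I' (Suc (Suc i)))}" if "i < k" for i
      using ex that by (simp add: exact_at_def I'_def d'_def)
    show "injective A (I' i)" if "i \<le> k" for i using inj that by (simp add: I'_def)
    show "lmod A (I' i)" "zero_module (I' i)" if "k < i" for i using that z Zm by (cases "i = Suc k"; simp add: I'_def)+
  qed (rule ie)
  moreover have "\<forall>i>k. zero_module (I' i)"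
  proof (intro allI impI)
    fix i assume "k < i"
    then show "zero_module (I' i)" using z by (cases "i = Suc k"; simp add: I'_def)
  qed
  ultimately show thesis by (rule that)
qed

end

section \<open>Maps factoring through a class, and vanishing of Hom\<close>

lemma msum_append:
  assumes "lmod R M" "\<And>s. s < n + m \<Longrightarrow> f s \<in> carrier M"
  shows "msum M f (n + m) = msum M f n \<oplus>\<^bsub>M\<^esub> msum M (\<lambda>s. f (n + s)) m" using assms(2)
proof (induction m)
  case 0
  interpret left_module R M by fact
  have "msum M f n \<in> carrier M" by (rule msum_closed) (use 0 in auto)
  then show ?case by simp
next
  case (Suc m)
  interpret left_module R M by fact
  have 1: "msum M f n \<in> carrier M" by (rule msum_closed) (use Suc in auto)
  have 2: "msum M (\<lambda>s. f (n + s)) m \<in> carrier M" by (rule msum_closed) (use Suc in auto)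
  have "f (n + m) \<in> carrier M" using Suc by auto
  then show ?case using Suc 1 2 by (simp add: M.a_assoc)
qed

text \<open>Sums of maps factoring through members of the class \<open>\<X>\<close>; a module lies in \<open>addr R \<X>\<close> iff its
  identity is such a sum.\<close>

definition factors :: "('r, 'x) ring_scheme \<Rightarrow> ('r, 'y) module set \<Rightarrow> ('r, 'm) module \<Rightarrow> ('r, 'n) module \<Rightarrow> ('m \<Rightarrow> 'n) \<Rightarrow> bool" where
  "factors R \<X> M N f \<longleftrightarrow> (\<exists>(n::nat) X i r.
     (\<forall>s<n. X s \<in> \<X> \<and> i s \<in> lhom R M (X s) \<and> r s \<in> lhom R (X s) N) \<and>
     (\<forall>m\<in>carrier M. f m = msum N (\<lambda>s. r s (i s m)) n))"

lemma factorsE: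
  assumes "factors R \<X> M N f" obtains n X i r where "\<forall>s<(n::nat). X s \<in> \<X>" "\<forall>s<n. i s \<in> lhom R M (X s)"
    "\<forall>s<n. r s \<in> lhom R (X s) N" "\<forall>m\<in>carrier M. f m = msum N (\<lambda>s. r s (i s m)) n"
proof -
  from assms obtain n X i r where
    *: "(\<forall>s<(n::nat). X s \<in> \<X> \<and> i s \<in> lhom R M (X s) \<and> r s \<in> lhom R (X s) N) \<and>
     (\<forall>m\<in>carrier M. f m = msum N (\<lambda>s. r s (i s m)) n)" unfolding factors_def by (elim exE) (rule that)
  show thesis by (rule that[of n X i r]) (use * in blast)+
qed

lemma factorsI:
  assumes "\<forall>s<(n::nat). X s \<in> \<X>" "\<forall>s<n. i s \<in> lhom R M (X s)"
    "\<forall>s<n. r s \<in> lhom R (X s) N" "\<forall>m\<in>carrier M. f m = msum N (\<lambda>s. r s (i s m)) n"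
  shows "factors R \<X> M N f" unfolding factors_def
  by (rule exI[of _ n], rule exI[of _ X], rule exI[of _ i], rule exI[of _ r]) (use assms in blast)

lemma addr_factors: "addr R \<X> M \<longleftrightarrow> factors R \<X> M M (\<lambda>m. m)" by (simp add: addr_def factors_def)

lemma factors_cong: "factors R \<X> M N f \<Longrightarrow> (\<And>m. m \<in> carrier M \<Longrightarrow> g m = f m) \<Longrightarrow> factors R \<X> M N g"
  by (simp add: factors_def)

lemma factors_add:
  assumes N: "lmod R N" and f: "factors R \<X> M N f" and g: "factors R \<X> M N g"
  shows "factors R \<X> M N (\<lambda>m. f m \<oplus>\<^bsub>N\<^esub> g m)"
proof -
  obtain n X i r where X: "\<forall>s<(n::nat). X s \<in> \<X>" and i: "\<forall>s<n. i s \<in> lhom R M (X s)"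
    and r: "\<forall>s<n. r s \<in> lhom R (X s) N" and eq: "\<forall>m\<in>carrier M. f m = msum N (\<lambda>s. r s (i s m)) n"
    by (rule factorsE[OF f])
  obtain n' X' i' r' where X': "\<forall>s<(n'::nat). X' s \<in> \<X>" and i': "\<forall>s<n'. i' s \<in> lhom R M (X' s)"
    and r': "\<forall>s<n'. r' s \<in> lhom R (X' s) N" and eq': "\<forall>m\<in>carrier M. g m = msum N (\<lambda>s. r' s (i' s m)) n'"
    by (rule factorsE[OF g])
  let ?X = "\<lambda>s. if s < n then X s else X' (s - n)" and ?i = "\<lambda>s. if s < n then i s else i' (s - n)"
    and ?r = "\<lambda>s. if s < n then r s else r' (s - n)"
  show ?thesis
  proof (rule factorsI[of "n + n'" ?X _ ?i _ _ ?r])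
    show "\<forall>s<n + n'. ?X s \<in> \<X>" using X X' by auto
    show i2: "\<forall>s<n + n'. ?i s \<in> lhom R M (?X s)" using i i' by auto
    show r2: "\<forall>s<n + n'. ?r s \<in> lhom R (?X s) N" using r r' by auto
    show "\<forall>m\<in>carrier M. f m \<oplus>\<^bsub>N\<^esub> g m = msum N (\<lambda>s. ?r s (?i s m)) (n + n')"
    proof
      fix m assume m: "m \<in> carrier M"
      have c: "?r s (?i s m) \<in> carrier N" if "s < n + n'" for s
        using lhom_in[OF r2[rule_format, OF that] lhom_in[OF i2[rule_format, OF that] m]] .
      have "msum N (\<lambda>s. ?r s (?i s m)) n = msum N (\<lambda>s. r s (i s m)) n" by (rule msum_cong) simp
      then show "f m \<oplus>\<^bsub>N\<^esub> g m = msum N (\<lambda>s. ?r s (?i s m)) (n + n')"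
        using msum_append[OF N, of n n' "\<lambda>s. ?r s (?i s m)", OF c] eq eq' m by simp
    qed
  qed
qed

lemma factors_zero: "factors R \<X> M N (\<lambda>m. zero N)" by (rule factorsI[of 0]) auto

lemma factors_msum:
  assumes N: "lmod R N" and f: "\<And>s. s < n \<Longrightarrow> factors R \<X> M N (f s)"
  shows "factors R \<X> M N (\<lambda>m. msum N (\<lambda>s. f s m) n)"
  using f by (induction n) (auto intro: factors_zero factors_add[OF N])

lemma factors_comp:
  assumes f: "factors R \<X> M N f" and N: "lmod R N" and N': "lmod R N'" and p: "p \<in> lhom R M' M" and q: "q \<in> lhom R N N'"
  shows "factors R \<X> M' N' (\<lambda>m. q (f (p m)))"
proof -
  obtain n X i r where X: "\<forall>s<(n::nat). X s \<in> \<X>" and i: "\<forall>s<n. i s \<in> lhom R M (X s)"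
    and r: "\<forall>s<n. r s \<in> lhom R (X s) N" and eq: "\<forall>m\<in>carrier M. f m = msum N (\<lambda>s. r s (i s m)) n"
    by (rule factorsE[OF f])
  show ?thesis
  proof (rule factorsI[of n X _ "\<lambda>s m. i s (p m)" _ _ "\<lambda>s x. q (r s x)"])
    show "\<forall>s<n. (\<lambda>m. i s (p m)) \<in> lhom R M' (X s)" using i lhom_o[OF p] by blast
    show "\<forall>s<n. (\<lambda>x. q (r s x)) \<in> lhom R (X s) N'" using r lhom_o[OF _ q] by blast
    show "\<forall>m\<in>carrier M'. q (f (p m)) = msum N' (\<lambda>s. q (r s (i s (p m)))) n"
    proof
      fix m assume m: "m \<in> carrier M'"
      have pm: "p m \<in> carrier M" by (rule lhom_in[OF p m])
      have "r s (i s (p m)) \<in> carrier N" if "s < n" for s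
        using lhom_in[OF r[rule_format, OF that] lhom_in[OF i[rule_format, OF that] pm]] .
      then show "q (f (p m)) = msum N' (\<lambda>s. q (r s (i s (p m)))) n" using bspec[OF eq pm] lhom_msum[OF N N' q] by simp
    qed
  qed (rule X)
qed

text \<open>The maps factoring through \<open>\<X>\<close> are closed under sums and under
  composition on both sides: the identity of each \<open>Y s\<close> is one of them, hence so are
  the composites of \<open>i s\<close> with \<open>r s\<close> and their sum.\<close>

lemma addr_trans:
  assumes M: "lmod R M" and \<Y>: "\<And>Y. Y \<in> \<Y> \<Longrightarrow> lmod R Y \<and> addr R \<X> Y" and a: "addr R \<Y> M"
  shows "addr R \<X> M"
proof -
  obtain n Y i r where Y: "\<forall>s<(n::nat). Y s \<in> \<Y>" and i: "\<forall>s<n. i s \<in> lhom R M (Y s)"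
    and r: "\<forall>s<n. r s \<in> lhom R (Y s) M" and eq: "\<forall>m\<in>carrier M. m = msum M (\<lambda>s. r s (i s m)) n"
    by (rule addrE[OF a])
  have "factors R \<X> M M (\<lambda>m. r s (i s m))" if s: "s < n" for s
  proof -
    have "lmod R (Y s)" "addr R \<X> (Y s)" using \<Y> Y s by auto
    then show ?thesis using factors_comp[of R \<X> "Y s" "Y s" "\<lambda>m. m" M "i s" M "r s"] M i r s unfolding addr_factors by simp
  qed
  from factors_msum[OF M this] have "factors R \<X> M M (\<lambda>m. msum M (\<lambda>s. r s (i s m)) n)" by simp
  then show ?thesis unfolding addr_factors by (rule factors_cong) (use eq in blast)
qed

text \<open>Vanishing of Hom for maps without extensionality; \<open>zero_Hom\<close> connects it
  with \<open>zero_module\<close> of \<open>Hom\<close>.\<close>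

definition hom0 where "hom0 R M X \<longleftrightarrow> (\<forall>f\<in>lhom R M X. \<forall>x\<in>carrier M. f x = zero X)"

lemma addr_hom0:
  assumes N: "lmod R N" and a: "addr R \<X> N" and X: "\<And>X. X \<in> \<X> \<Longrightarrow> lmod R X \<and> hom0 R M X"
  shows "hom0 R M N" unfolding hom0_def
proof (intro ballI)
  fix f x assume f: "f \<in> lhom R M N" and x: "x \<in> carrier M"
  interpret N: left_module R N by fact
  obtain n Y i r where Y: "\<forall>s<(n::nat). Y s \<in> \<X>" and i: "\<forall>s<n. i s \<in> lhom R N (Y s)"
    and r: "\<forall>s<n. r s \<in> lhom R (Y s) N" and eq: "\<forall>m\<in>carrier N. m = msum N (\<lambda>s. r s (i s m)) n"
    by (rule addrE[OF a])
  have "r s (i s (f x)) = zero N" if s: "s < n" for s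
  proof -
    have Ys: "lmod R (Y s)" "hom0 R M (Y s)" using X Y s by auto
    have "i s (f x) = zero (Y s)" using bspec[OF bspec[OF Ys(2)[unfolded hom0_def] lhom_o[OF f i[rule_format, OF s]]] x] .
    then show ?thesis using lhom_zero[OF Ys(1) N r[rule_format, OF s]] by simp
  qed
  then have "msum N (\<lambda>s. r s (i s (f x))) n = zero N" by (rule N.msum_zero)
  then show "f x = zero N" using bspec[OF eq lhom_in[OF f x]] by simp
qed

lemma addr_hom0_left:
  assumes M: "lmod R M" and N: "lmod R N" and a: "addr R \<X> M" and X: "\<And>X. X \<in> \<X> \<Longrightarrow> hom0 R X N"
  shows "hom0 R M N" unfolding hom0_def
proof (intro ballI)
  fix f x assume f: "f \<in> lhom R M N" and x: "x \<in> carrier M"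
  interpret N: left_module R N by fact
  obtain n Y i r where Y: "\<forall>s<(n::nat). Y s \<in> \<X>" and i: "\<forall>s<n. i s \<in> lhom R M (Y s)"
    and r: "\<forall>s<n. r s \<in> lhom R (Y s) M" and eq: "\<forall>m\<in>carrier M. m = msum M (\<lambda>s. r s (i s m)) n"
    by (rule addrE[OF a])
  have c: "i s x \<in> carrier (Y s)" "r s (i s x) \<in> carrier M" if s: "s < n" for s
    using lhom_in[OF i[rule_format, OF s] x] lhom_in[OF r[rule_format, OF s]] by auto
  have z: "f (r s (i s x)) = zero N" if s: "s < n" for s
    using bspec[OF bspec[OF X[OF Y[rule_format, OF s], unfolded hom0_def] lhom_o[OF r[rule_format, OF s] f]] c(1)[OF s]] .
  have "f x = f (msum M (\<lambda>s. r s (i s x)) n)" using bspec[OF eq x] by (rule arg_cong)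
  also have "\<dots> = msum N (\<lambda>s. f (r s (i s x))) n" by (rule lhom_msum[OF M N f c(2)])
  also have "\<dots> = zero N" by (rule N.msum_zero[OF z])
  finally show "f x = zero N" .
qed

lemma addr_dsum:
  assumes M: "lmod R M" and N: "lmod R N"
  shows "addr R {M, N} (dsum M N)"
proof -
  interpret M: left_module R M by fact
  interpret N: left_module R N by fact
  have D: "lmod R (dsum M N)" by (rule dsum_module[OF M N])
  interpret D: left_module R "dsum M N" by fact
  have 1: "factors R {M, N} (dsum M N) (dsum M N) (\<lambda>x. (fst x, zero N))"
    by (rule factorsI[of "Suc 0" "\<lambda>_. M" _ "\<lambda>_. fst" _ _ "\<lambda>_ x. (x, zero N)"]) (auto intro!: lhomI)
  have 2: "factors R {M, N} (dsum M N) (dsum M N) (\<lambda>x. (zero M, snd x))"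
    by (rule factorsI[of "Suc 0" "\<lambda>_. N" _ "\<lambda>_. snd" _ _ "\<lambda>_ x. (zero M, x)"]) (auto intro!: lhomI)
  show ?thesis unfolding addr_factors by (rule factors_cong[OF factors_add[OF D 1 2]]) auto
qed

context fdalg begin

text \<open>The maps from \<open>Y\<close> to \<open>X\<close> that kill \<open>S\<close> form a
  finite-dimensional space, and a finite generating family, read as one map into a power of
  \<open>X\<close>, factors all of them. This is a left approximation of Y/S by add X.\<close>

lemma left_approx:
  assumes Y: "fgm A Y" and X: "fgm A X" and S: "S \<subseteq> carrier Y"
  obtains U :: "('k, 'a) umodule" and g where "in_add A X U" "fgm A U" "g \<in> lhom A Y U"
    "\<forall>f\<in>lhom A Y X. (\<forall>y\<in>S. f y = zero X) \<longrightarrow> (\<exists>p\<in>lhom A U X. \<forall>y\<in>carrier Y. f y = p (g y))"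
    "\<forall>y\<in>S. g y = zero U"
proof -
  have Y': "lmod A Y" and X': "lmod A X" using Y X fg_left by auto
  interpret X: left_module A X by fact
  let ?V = "Hom A Y X"
  have V: "lmod K ?V" by (rule Hom_module[OF Y' X'])
  let ?T = "{f \<in> mhom A Y X. \<forall>y\<in>S. f y = zero X}"
  have Sc: "y \<in> S \<Longrightarrow> y \<in> carrier Y" for y using S by auto
  interpret V: left_module K ?V by fact
  have T: "submod K ?V ?T" unfolding submod_def
  proof (intro conjI ballI)
    show "zero ?V \<in> ?T" using V.M.zero_closed Sc by simp
    fix f g assume fg: "f \<in> ?T" "g \<in> ?T"
    have "f \<oplus>\<^bsub>?V\<^esub> g \<in> carrier ?V" by (rule V.M.a_closed) (use fg in auto)
    then show "f \<oplus>\<^bsub>?V\<^esub> g \<in> ?T" using fg Sc by simp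
  next
    fix c f assume c: "c \<in> carrier K" and f: "f \<in> ?T"
    have "c \<odot>\<^bsub>?V\<^esub> f \<in> carrier ?V" by (rule V.smult_closed) (use c f in auto)
    then show "c \<odot>\<^bsub>?V\<^esub> f \<in> ?T" using c f Sc by simp
  qed auto
  obtain G where G: "gens K (subm ?V ?T) G" using fg_moduleD(2)[OF fspace_fg_submod[OF field_K fg_Hom[OF Y X] T]] by blast
  then obtain n and f :: "nat \<Rightarrow> _" where f: "G = f ` {i. i < n}"
    using finite_imp_nat_seg_image_inj_on[of G] by (auto simp: gens_def)
  have fT: "f i \<in> ?T" if "i < n" for i using G f that by (auto simp: gens_def)
  have fl: "\<forall>i<n. f i \<in> lhom A Y X" using fT mhom_lhom by blast
  obtain U :: "('k, 'a) umodule" and g where U: "in_add A X U" "fgm A U" and g: "g \<in> lhom A Y U"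
    and ker: "{m \<in> carrier Y. g m = zero U} = {m \<in> carrier Y. \<forall>i<n. f i m = zero X}"
    and p: "\<forall>i<n. \<exists>p\<in>lhom A U X. \<forall>m\<in>carrier Y. f i m = p (g m)" by (rule tuple_kernel[OF Y X fl])
  \<comment> \<open>The maps that factor through \<open>g\<close> form a subspace containing the
    generators, hence are all of \<open>?T\<close>.\<close>
  let ?W = "{h \<in> ?T. \<exists>p\<in>lhom A U X. \<forall>y\<in>carrier Y. h y = p (g y)}"
  have W: "submod K (subm ?V ?T) ?W" unfolding submod_def
  proof (intro conjI ballI)
    have "zero ?V \<in> ?T" using T by (simp add: submod_def)
    then show "zero (subm ?V ?T) \<in> ?W" by (auto intro!: bexI[OF _ lhom_const0[OF X']])
    fix h h' assume h: "h \<in> ?W" "h' \<in> ?W"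
    then obtain p p' where "p \<in> lhom A U X" "p' \<in> lhom A U X" "\<forall>y\<in>carrier Y. h y = p (g y)" "\<forall>y\<in>carrier Y. h' y = p' (g y)"
      by blast
    moreover have "h \<oplus>\<^bsub>?V\<^esub> h' \<in> ?T" using T h unfolding submod_def by blast
    ultimately show "h \<oplus>\<^bsub>subm ?V ?T\<^esub> h' \<in> ?W" by (auto intro!: bexI[OF _ lhom_plus[OF X']])
  next
    fix c h assume c: "c \<in> carrier K" and h: "h \<in> ?W"
    then obtain p where p: "p \<in> lhom A U X" "\<forall>y\<in>carrier Y. h y = p (g y)" by blast
    have "c \<odot>\<^bsub>?V\<^esub> h \<in> ?T" using T h c unfolding submod_def by blast
    moreover have "(\<lambda>y. (c \<odot>\<^bsub>A\<^esub> one A) \<odot>\<^bsub>X\<^esub> p y) \<in> lhom A U X"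
      using smult_central[OF X' _ c] lhom_in[OF p(1)] c
      by (intro lhomI) (auto simp: lhom_add[OF p(1)] lhom_smult[OF p(1)] X.smult_r_distr)
    ultimately show "c \<odot>\<^bsub>subm ?V ?T\<^esub> h \<in> ?W"
      using p(2) by (auto intro!: bexI[of _ "\<lambda>y. (c \<odot>\<^bsub>A\<^esub> one A) \<odot>\<^bsub>X\<^esub> p y"])
  qed auto
  have "G \<subseteq> ?W" using f p fT by auto
  then have all: "?T \<subseteq> ?W" using G W unfolding gens_def by simp
  show thesis
  proof (rule that[OF U g], intro ballI impI)
    fix h assume h: "h \<in> lhom A Y X" and hS: "\<forall>y\<in>S. h y = zero X"
    have "restrict h (carrier Y) \<in> ?T" using lhom_mhom[OF Y' h] hS Sc by simp
    then have "restrict h (carrier Y) \<in> ?W" using all by blast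
    then obtain p where "p \<in> lhom A U X" "\<forall>y\<in>carrier Y. restrict h (carrier Y) y = p (g y)" by blast
    then show "\<exists>p\<in>lhom A U X. \<forall>y\<in>carrier Y. h y = p (g y)" by (intro bexI[of _ p]) auto
  next
    show "\<forall>y\<in>S. g y = zero U" using ker fT Sc by blast
  qed
qed

end

section \<open>Special cotilting modules\<close>

context fdalg begin

text \<open>With a projective resolution of \<open>M\<close> kept fixed, vanishing becomes a
  condition \<open>hexl\<close> on the second argument alone, which \<open>addr_hexl\<close>
  transfers.\<close>

lemma Ext_addr_right:
  fixes M :: "('a, 'm) module" and N :: "('a, 'n) module" and \<X> :: "('a, 'x) module set"
  assumes M: "fgm A M" and N: "fgm A N" and a: "addr A \<X> N"
    and X: "\<And>X. X \<in> \<X> \<Longrightarrow> fgm A X \<and> trivial_group (Ext A (Suc n) M X)"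
  shows "trivial_group (Ext A (Suc n) M N)"
proof -
  obtain P d e where P: "proj_resolution A P d e M" by (rule proj_resolution_exists[OF M])
  show ?thesis unfolding Ext_hexl[OF N P]
  proof (rule addr_hexl[OF fg_left[OF N] a])
    fix X assume "X \<in> \<X>"
    then have X': "fgm A X" "trivial_group (Ext A (Suc n) M X)" using X by auto
    show "lmod A X" by (rule fg_left[OF X'(1)])
    show "hexl_at A P d n X" using X'(2) unfolding Ext_hexl[OF X'(1) P] .
  qed (use lhom_in[OF proj_resD(2)[OF P]] in auto)
qed

lemma Ext_addr_left:
  fixes M :: "('a, 'm) module" and N :: "('a, 'n) module" and \<X> :: "('a, 'x) module set"
  assumes M: "fgm A M" and N: "fgm A N" and a: "addr A \<X> M"
    and X: "\<And>X. X \<in> \<X> \<Longrightarrow> fgm A X \<and> trivial_group (Ext A (Suc n) X N)"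
  shows "trivial_group (Ext A (Suc n) M N)"
proof -
  obtain \<eta> J \<delta> where J: "inj_resolution A N \<eta> J \<delta>" by (rule inj_resolution_exists[OF N])
  note j = inj_resD[OF J]
  show ?thesis unfolding Ext_hexr[OF M J]
  proof (rule addr_hexr[OF fg_left[OF M] j(1) j(1) j(2) a])
    fix X assume "X \<in> \<X>"
    then have X': "fgm A X" "trivial_group (Ext A (Suc n) X N)" using X by auto
    show "lmod A X" by (rule fg_left[OF X'(1)])
    show "hexr_at A X J \<delta> n" using X'(2) unfolding Ext_hexr[OF X'(1) J] .
  qed
qed

lemma Ext_injective:
  assumes M: "fgm A M" and N: "injective A N"
  shows "trivial_group (Ext A (Suc n) M N)"
proof -
  obtain P d e where P: "proj_resolution A P d e M" by (rule proj_resolution_exists[OF M])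
  note p = proj_resD[OF P]
  show ?thesis unfolding Ext_hexl[OF injective_fg[OF N] P] by (rule inj_hexl[OF N p(7) p(7) p(7) p(2)]) (use p(12) in blast)
qed

end

section \<open>The cotilting sequence as an injective resolution\<close>

text \<open>\<open>c\<close> is the sequence that witnesses speciality. Positive degrees of
  \<open>Ext\<close> are written as \<open>Suc n\<close>, matching \<open>hexl_at\<close> and
  \<open>hexr_at\<close>.\<close>

locale coshift = fdalg K A
  for K :: "'k ring" and A :: "('k, 'a) module" +
  fixes Q :: "('a, 'q) module" and C :: "('a, 'c) module" and k :: nat and c :: "nat \<Rightarrow> ('k, 'a) umodule" and dc ec
  assumes injQ: "injective A Q" and fgC: "fgm A C" and QC: "in_add A C Q"
    and rigid: "\<And>n. trivial_group (Ext A (Suc n) C C)" and idim: "idim_le A C k" and k1: "1 \<le> k"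
    and cseq: "exact_seq_onto A (Suc k) c dc ec DA" and cz: "zero_module (c (Suc k))"
    and cC: "\<And>j. j \<le> k \<Longrightarrow> in_add A C (c j)" and cQ: "\<And>j. j < k \<Longrightarrow> in_add A Q (c j)"
begin

lemma fgQ: "fgm A Q" by (rule injective_fg[OF injQ])
lemma modC: "lmod A C" by (rule fg_left[OF fgC])
lemma modQ: "lmod A Q" by (rule fg_left[OF fgQ])
lemma addrQC: "addr A {C} Q" by (rule in_add_addr[OF ring_A modC QC])
lemma addrcC: "j \<le> k \<Longrightarrow> addr A {C} (c j)" by (rule in_add_addr[OF ring_A modC cC])
lemma addrcQ: "j < k \<Longrightarrow> addr A {Q} (c j)" by (rule in_add_addr[OF ring_A modQ cQ])
lemma fgc: "j \<le> Suc k \<Longrightarrow> fgm A (c j)" using cseq by (simp add: exact_seq_onto_def)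
lemma modc: "j \<le> Suc k \<Longrightarrow> lmod A (c j)" by (rule fg_left[OF fgc])
lemma injc: "j < k \<Longrightarrow> injective A (c j)" by (rule addr_injective[OF fgc addrcQ]) (use injQ in auto)

lemma dc: "i \<le> k \<Longrightarrow> dc i \<in> lhom A (c (Suc i)) (c i)" using cseq by (auto simp: exact_seq_onto_def intro!: mhom_lhom)

lemma ec: "ec \<in> lhom A (c 0) DA" "ec ` carrier (c 0) = carrier DA"
  using cseq by (auto simp: exact_seq_onto_def exact_onto_def intro!: mhom_lhom)

lemma dc0: "dc 0 ` carrier (c 1) = {x \<in> carrier (c 0). ec x = zero DA}"
  using cseq unfolding exact_seq_onto_def exact_onto_def exact_at_def by blast

lemma dcS: "i < k \<Longrightarrow> dc (Suc i) ` carrier (c (Suc (Suc i))) = {x \<in> carrier (c (Suc i)). dc i x = zero (c i)}"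
  using cseq by (simp add: exact_seq_onto_def exact_onto_def exact_at_def)

lemma dc_inj: "inj_on (dc (k - 1)) (carrier (c k))"
proof -
  have k: "k - 1 < k" "Suc (k - 1) = k" using k1 by auto
  have d: "dc (k - 1) \<in> lhom A (c k) (c (k - 1))" using dc[of "k - 1"] k by simp
  have "{x \<in> carrier (c k). dc (k - 1) x = zero (c (k - 1))} = dc k ` carrier (c (Suc k))" using dcS[OF k(1)] k(2) by simp
  also have "\<dots> = {zero (c k)}" using cz lhom_zero[OF modc modc dc[OF order_refl]] by (simp add: zero_module_def)
  finally have ker: "{x \<in> carrier (c k). dc (k - 1) x = zero (c (k - 1))} = {zero (c k)}" .
  have m: "lmod A (c k)" "lmod A (c (k - 1))" by (auto intro: modc)
  show ?thesis unfolding lhom_inj_iff[OF m d] using ker by blast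
qed

text \<open>The numbering is reversed: \<open>c (k - 1), ..., c 0\<close> become
  \<open>J 0, ..., J (k - 1)\<close>, followed by \<open>D A\<close> and zeros. A copy of
  \<open>D A\<close> is taken because the terms must live on
  \<open>nat \<Rightarrow> 'k\<close>.\<close>

lemma resolution_c:
  obtains \<eta> J \<delta> \<phi> \<psi> where "inj_resolution A (c k) \<eta> J \<delta>" "\<forall>i<k. J i = c (k - 1 - i)"
    "mod_iso A DA (J k) \<phi> \<psi>" "\<forall>i>k. zero_module (J i)"
proof -
  obtain U :: "('k, 'a) umodule" and \<phi> \<psi> where U: "fgm A U" "mod_iso A DA U \<phi> \<psi>" by (rule umodule_copy[OF fg_DA])
  note u = mod_isoD[OF U(2)]
  have U': "lmod A U" by (rule fg_left[OF U(1)])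
  obtain Z :: "('k, 'a) umodule" where Z: "lmod A Z" "zero_module Z" by (rule zero_umodule)
  have injU: "injective A U" by (rule addr_injective[OF U(1) addr_iso[OF U' _ mod_iso_sym[OF U(2)]], of "{DA}"]) (use DA_injective in auto)
  have \<phi>0: "\<phi> x = zero U \<longleftrightarrow> x = zero DA" if "x \<in> carrier DA" for x
    using u(3)[OF that] lhom_zero[OF U' DA_module u(2)] lhom_zero[OF DA_module U' u(1)] by auto
  define J where "J i = (if i < k then c (k - 1 - i) else if i = k then U else Z)" for i
  \<comment> \<open>\<open>dc (k - 2 - i)\<close> runs from \<open>c (k - 1 - i)\<close> to
    \<open>c (k - 2 - i)\<close>; the map in position \<open>k - 1\<close> is \<open>ec\<close>
    followed by the passage to the copy of \<open>D A\<close>.\<close>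
  define \<delta> where "\<delta> i = (if Suc i < k then dc (k - 2 - i) else if Suc i = k then (\<lambda>x. \<phi> (ec x)) else (\<lambda>_. zero Z))" for i
  have \<delta>l: "\<delta> i \<in> lhom A (J i) (J (Suc i))" for i
  proof -
    consider "Suc i < k" | "Suc i = k" | "k \<le> i" by linarith
    then show ?thesis
    proof cases
      case 1
      then have "Suc (k - 2 - i) = k - 1 - i" "k - 1 - Suc i = k - 2 - i" "k - 2 - i \<le> k" by auto
      then show ?thesis using dc[of "k - 2 - i"] 1 by (simp add: J_def \<delta>_def)
    next
      case 2
      then have "k - 1 - i = 0" by simp
      then show ?thesis using lhom_o[OF ec(1) u(1)] 2 by (simp add: J_def \<delta>_def)
    next
      case 3
      then show ?thesis using lhom_const0[OF Z(1)] by (auto simp: J_def \<delta>_def)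
    qed
  qed
  have U_im: "(\<lambda>x. \<phi> (ec x)) ` carrier (c 0) = carrier U"
  proof -
    have "\<phi> ` ec ` carrier (c 0) = carrier U" using ec(2) u(7) by (simp add: bij_betw_def)
    then show ?thesis by (simp add: image_image)
  qed
  have ker_\<phi>ec: "{x \<in> carrier (c 0). \<phi> (ec x) = zero U} = dc 0 ` carrier (c 1)"
    unfolding dc0 using \<phi>0 lhom_in[OF ec(1)] by blast
  have ex: "\<delta> i ` carrier (J i) = {x \<in> carrier (J (Suc i)). \<delta> (Suc i) x = zero (J (Suc (Suc i)))}" if i: "i < k" for i
  proof -
    consider "Suc (Suc i) < k" | "Suc (Suc i) = k" | "Suc i = k" using i by linarith
    then show ?thesis
    proof cases
      case 1
      define a where "a = k - 3 - i"
      have "k - 2 - i = Suc a" "k - 2 - Suc i = a" "k - 1 - i = Suc (Suc a)" "k - 1 - Suc i = Suc a"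
        "k - 1 - Suc (Suc i) = a" "a < k" using 1 by (auto simp: a_def)
      then show ?thesis using dcS[of a] 1 by (simp add: J_def \<delta>_def)
    next
      case 2
      then have "k - 2 - i = 0" "k - 1 - i = 1" "k - 1 - Suc i = 0" by auto
      then show ?thesis using ker_\<phi>ec 2 by (simp add: J_def \<delta>_def)
    next
      case 3
      then have "k - 1 - i = 0" by simp
      then show ?thesis using U_im 3 by (simp add: J_def \<delta>_def)
    qed
  qed
  have kk: "Suc (k - 1) = k" "k - 1 \<le> k" using k1 by auto
  have "inj_resolution A (c k) (restrict (dc (k - 1)) (carrier (c k))) J (\<lambda>i. restrict (\<delta> i) (carrier (J i)))"
  proof (rule inj_resolution_finite[where I = J and d = \<delta> and k = k, OF fgc _ dc_inj _ \<delta>l ex])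
    show "dc (k - 1) \<in> lhom A (c k) (J 0)" using dc[OF kk(2)] kk k1 by (simp add: J_def)
    show "dc (k - 1) ` carrier (c k) = {x \<in> carrier (J 0). \<delta> 0 x = zero (J 1)}"
    proof (cases "k = 1")
      case True
      then show ?thesis using ker_\<phi>ec by (simp add: J_def \<delta>_def)
    next
      case False
      define a where "a = k - 2"
      have "k = Suc (Suc a)" using False k1 by (simp add: a_def)
      then show ?thesis using dcS[of a] by (simp add: J_def \<delta>_def)
    qed
    show "injective A (J i)" if "i \<le> k" for i using that injc injU k1 by (auto simp: J_def)
    show "lmod A (J i)" "zero_module (J i)" if "k < i" for i using that Z by (auto simp: J_def)
  qed auto
  then show thesis by (rule that) (use U(2) Z(2) in \<open>auto simp: J_def\<close>)
qed

end

locale coshift_res = coshift K A Q C k c dc ec + inj_res K A "c k" \<eta> J \<delta>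
  for K :: "'k ring" and A :: "('k, 'a) module" and Q :: "('a, 'q) module" and C :: "('a, 'c) module" and k c dc ec \<eta> J \<delta> +
  fixes \<phi> \<psi>
  assumes Jc: "\<And>i. i < k \<Longrightarrow> J i = c (k - 1 - i)"
    and JD: "mod_iso A DA (J k) \<phi> \<psi>" and Jz: "\<And>i. k < i \<Longrightarrow> zero_module (J i)"
begin

text \<open>The bottom of the shift. With \<open>S\<close> thought of as the kernel of
  \<open>g\<close>, Ext^1 of the cokernel of \<open>g\<close> sits in the long exact sequence
  between Hom from Y/S and Ext^1 from \<open>Y'\<close>: the map into it is zero by
  \<open>approx\<close>, and the term after it vanishes by \<open>hr\<close>.\<close>

lemma pe_step0:
  assumes Y: "fgm A Y" and Y': "fgm A Y'" and g: "g \<in> lhom A Y Y'" and S: "S \<subseteq> carrier Y"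
    and ker: "\<forall>y\<in>S. g y = zero Y'"
    and approx: "\<forall>u\<in>lhom A Y (c k). (\<forall>y\<in>S. u y = zero (c k)) \<longrightarrow> (\<exists>p\<in>lhom A Y' (c k). \<forall>y\<in>carrier Y. u y = p (g y))"
    and hr: "hexr_at A Y' J \<delta> 0"
  shows "pe 0 Y' (g ` carrier Y)" unfolding pe_def
proof (intro ballI impI)
  have Ym: "lmod A Y" and Ym': "lmod A Y'" using Y Y' fg_left by auto
  fix f assume f: "f \<in> lhom A Y' (J (Suc 0))" and fz: "\<forall>y\<in>g ` carrier Y. f y = zero (J (Suc 0))"
    and df: "\<forall>y\<in>carrier Y'. \<delta> (Suc 0) (f y) = zero (J (Suc (Suc 0)))"
  obtain h where h: "h \<in> lhom A Y' (J 0)" "\<forall>y\<in>carrier Y'. f y = \<delta> 0 (h y)" by (rule hexrD[OF hr f]) (use df in blast)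
  have hg: "(\<lambda>y. h (g y)) \<in> lhom A Y (J 0)" by (rule lhom_o[OF g h(1)])
  have 2: "\<delta> 0 (h (g y)) = zero (J 1)" if y: "y \<in> carrier Y" for y
    using bspec[OF h(2) lhom_in[OF g y]] bspec[OF fz imageI[OF y]] by simp
  obtain u where u: "u \<in> lhom A Y (c k)" "\<forall>y\<in>carrier Y. h (g y) = \<eta> (u y)"
    by (rule hexrD[OF hexr_left_exact[OF Ym j(9) j(1) j(3) j(10) j(11)] hg]) (rule 2)
  have "u y = zero (c k)" if y: "y \<in> S" for y
  proof -
    have yc: "y \<in> carrier Y" using S y by blast
    have "h (g y) = zero (J 0)" using ker y lhom_zero[OF Ym' j(1) h(1)] by simp
    then have "\<eta> (u y) = zero (J 0)" using u(2) yc by simp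
    then show ?thesis using j(10)[unfolded lhom_inj_iff[OF j(9) j(1) j(3)]] lhom_in[OF u(1) yc] by blast
  qed
  then obtain p where p: "p \<in> lhom A Y' (c k)" "\<forall>y\<in>carrier Y. u y = p (g y)" using approx u(1) by blast
  show "\<exists>h\<in>lhom A Y' (J 0). (\<forall>y\<in>g ` carrier Y. h y = zero (J 0)) \<and> (\<forall>y\<in>carrier Y'. f y = \<delta> 0 (h y))"
    by (rule pe_correct[OF Ym' g j(9) j(3) _ h p(1)]) (use u(2) p(2) j(5) in auto)
qed

text \<open>\<open>J (k - 1)\<close> is \<open>c 0\<close> and \<open>J k\<close> is
  \<open>D A\<close>, so vanishing of Ext^k from Y/S to \<open>c k\<close> lets every map from Y/S
  to \<open>D A\<close> lift to \<open>c 0\<close>. What all maps to \<open>c 0\<close> kill is then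
  killed by all maps to \<open>D A\<close>, hence is zero in Y/S.\<close>

lemma pe_separates:
  assumes Y: "fgm A Y" and S: "submod A Y S" and p: "pe (k - 1) Y S" and y: "y \<in> carrier Y"
    and hy: "\<forall>h\<in>lhom A Y (c 0). (\<forall>s\<in>S. h s = zero (c 0)) \<longrightarrow> h y = zero (c 0)"
  shows "y \<in> S"
proof -
  have k: "Suc (k - 1) = k" "J (k - 1) = c 0" using k1 Jc[of "k - 1"] by auto
  note iso = mod_isoD[OF JD]
  obtain n f where f: "\<forall>i<(n::nat). f i \<in> lhom A Y DA" and Sf: "S = {m \<in> carrier Y. \<forall>i<n. f i m = zero DA}"
    by (rule DA_separates[OF Y S])
  have "f i y = zero DA" if i: "i < n" for i
  proof -
    have fi: "f i \<in> lhom A Y DA" using f i by blast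
    have ff: "(\<lambda>m. \<phi> (f i m)) \<in> lhom A Y (J (Suc (k - 1)))" unfolding k by (rule lhom_o[OF fi iso(1)])
    have "\<forall>s\<in>S. f i s = zero DA" using Sf i by blast
    then have 1: "\<forall>s\<in>S. \<phi> (f i s) = zero (J (Suc (k - 1)))" unfolding k using lhom_zero[OF DA_module j(1) iso(1)] by simp
    have 2: "\<forall>y\<in>carrier Y. \<delta> (Suc (k - 1)) (\<phi> (f i y)) = zero (J (Suc (Suc (k - 1))))"
      using lhom_in[OF lhom_o[OF ff j(2)]] Jz[of "Suc (Suc (k - 1))"] by (simp add: zero_module_def)
    obtain h where h: "h \<in> lhom A Y (J (k - 1))" "\<forall>y\<in>S. h y = zero (J (k - 1))"
      "\<forall>y\<in>carrier Y. \<phi> (f i y) = \<delta> (k - 1) (h y)" by (rule peD[OF p ff 1 2])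
    have "h y = zero (c 0)" using hy h(1,2) unfolding k by blast
    then have "\<phi> (f i y) = zero (J k)" using h(3) y lhom_zero[OF j(1) j(1) j(2), of "k - 1"] k by simp
    then have "\<psi> (\<phi> (f i y)) = zero DA" using lhom_zero[OF j(1) DA_module iso(2)] by simp
    then show ?thesis using iso(3)[OF lhom_in[OF fi y]] by simp
  qed
  then show ?thesis using y unfolding Sf by blast
qed

text \<open>\<open>c k\<close> lies in add C, so rigidity extends to it. This supplies the acyclic
  modules that the hypothesis \<open>hr\<close> of \<open>pe_shift\<close> asks for.\<close>

lemma rigid_c:
  assumes T: "fgm A T" and a: "addr A {C} T"
  shows "trivial_group (Ext A (Suc n) T C)" "trivial_group (Ext A (Suc n) T (c k))" "hexr_at A T J \<delta> n"
proof -
  show 1: "trivial_group (Ext A (Suc n) T C)" by (rule Ext_addr_left[OF T fgC a]) (use fgC rigid in auto)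
  show "trivial_group (Ext A (Suc n) T (c k))" by (rule Ext_addr_right[OF T fgc addrcC]) (use fgC 1 in auto)
  then show "hexr_at A T J \<delta> n" unfolding Ext_hexr[OF T Jres] .
qed

text \<open>Coresolve \<open>C\<close> by left approximations by sums of \<open>c k\<close> and \<open>c 0\<close>; comparing with an injective
  resolution of \<open>C\<close>, which has finite length, shows that the first approximation splits.\<close>

lemma addr_C: "addr A {c k, c 0} C"
proof -
  have ck0: "fgm A (c k)" "fgm A (c 0)" by (auto intro: fgc)
  have mck0: "lmod A (c k)" "lmod A (c 0)" by (auto intro: modc)
  \<comment> \<open>Left approximations by this copy of the sum of \<open>c k\<close> and
    \<open>c 0\<close> do two things: the part \<open>c 0\<close> makes them injective on Y/S
    (\<open>pe_separates\<close>), the part \<open>c k\<close> makes Ext^1 of the cokernel vanish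
    (\<open>pe_step0\<close>).\<close>
  obtain X :: "('k, 'a) umodule" and \<alpha> \<beta> where X: "fgm A X" "mod_iso A (dsum (c k) (c 0)) X \<alpha> \<beta>"
    by (rule umodule_copy[OF fg_dsum[OF ck0]])
  note x = mod_isoD[OF X(2)]
  have Xm: "lmod A X" by (rule fg_left[OF X(1)])
  have Dm: "lmod A (dsum (c k) (c 0))" by (rule dsum_module[OF mck0])
  interpret mk: left_module A "c k" by (rule mck0)
  interpret m0: left_module A "c 0" by (rule mck0)
  have X_ck0: "addr A {c k, c 0} X" by (rule addr_trans[OF Xm _ addr_iso[OF Xm _ mod_iso_sym[OF X(2)], of "{dsum (c k) (c 0)}"]])
      (use Dm addr_dsum[OF mck0] in auto)
  have X_C: "addr A {C} X" by (rule addr_trans[OF Xm _ X_ck0]) (use mck0 addrcC in auto)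
  have in1: "(\<lambda>x. \<alpha> (x, zero (c 0))) \<in> lhom A (c k) X" and in2: "(\<lambda>x. \<alpha> (zero (c k), x)) \<in> lhom A (c 0) X"
    by (rule lhom_o[OF _ x(1)], rule lhomI, auto)+
  have pr1: "(\<lambda>x. fst (\<beta> x)) \<in> lhom A X (c k)" by (rule lhom_o[OF x(2)], rule lhomI) auto
  have \<alpha>0: "\<alpha> p = zero X \<Longrightarrow> p \<in> carrier (dsum (c k) (c 0)) \<Longrightarrow> p = (zero (c k), zero (c 0))" for p
    using x(3)[of p] lhom_zero[OF Xm Dm x(2)] by simp
  have step: "\<exists>(T :: ('k, 'a) umodule) g. fgm A T \<and> addr A {X} T \<and> g \<in> lhom A Y T \<and>
      {y \<in> carrier Y. g y = zero T} = S \<and> (\<forall>i. pe i T (g ` carrier Y))"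
    if Y: "fgm A Y" and S: "submod A Y S" and p: "\<forall>i. pe i Y S" for Y :: "('k, 'a) umodule" and S
  proof -
    have Ym: "lmod A Y" by (rule fg_left[OF Y])
    have Sc: "S \<subseteq> carrier Y" using S by (simp add: submod_def)
    obtain T :: "('k, 'a) umodule" and g where T: "in_add A X T" "fgm A T" and g: "g \<in> lhom A Y T"
      and ap: "\<forall>f\<in>lhom A Y X. (\<forall>y\<in>S. f y = zero X) \<longrightarrow> (\<exists>p\<in>lhom A T X. \<forall>y\<in>carrier Y. f y = p (g y))"
      and gS: "\<forall>y\<in>S. g y = zero T" by (rule left_approx[OF Y X(1) Sc])
    have Tm: "lmod A T" by (rule fg_left[OF T(2)])
    have TX: "addr A {X} T" by (rule in_add_addr[OF ring_A Xm T(1)])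
    have TC: "addr A {C} T" by (rule addr_trans[OF Tm _ TX]) (use Xm X_C in auto)
    have ker: "{y \<in> carrier Y. g y = zero T} = S"
    proof (intro equalityI subsetI)
      fix y assume y: "y \<in> {y \<in> carrier Y. g y = zero T}"
      show "y \<in> S"
      proof (rule pe_separates[OF Y S p[rule_format]])
        show "\<forall>h\<in>lhom A Y (c 0). (\<forall>s\<in>S. h s = zero (c 0)) \<longrightarrow> h y = zero (c 0)"
        proof (intro ballI impI)
          fix h assume h: "h \<in> lhom A Y (c 0)" and hS: "\<forall>s\<in>S. h s = zero (c 0)"
          have h': "(\<lambda>y. \<alpha> (zero (c k), h y)) \<in> lhom A Y X" by (rule lhom_o[OF h in2])
          have "\<forall>s\<in>S. \<alpha> (zero (c k), h s) = zero X" using hS lhom_zero[OF mck0(2) Xm in2] by simp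
          then obtain p where p: "p \<in> lhom A T X" "\<forall>y\<in>carrier Y. \<alpha> (zero (c k), h y) = p (g y)"
            using mp[OF bspec[OF ap h']] by blast
          then have "\<alpha> (zero (c k), h y) = zero X" using y lhom_zero[OF Tm Xm p(1)] by simp
          then show "h y = zero (c 0)" using \<alpha>0[of "(zero (c k), h y)"] lhom_in[OF h] y by simp
        qed
      qed (use y in simp)
    qed (use gS Sc in blast)
    have hr: "hexr_at A T J \<delta> n" for n by (rule rigid_c(3)[OF T(2) TC])
    have ap': "\<forall>u\<in>lhom A Y (c k). (\<forall>y\<in>S. u y = zero (c k)) \<longrightarrow> (\<exists>p\<in>lhom A T (c k). \<forall>y\<in>carrier Y. u y = p (g y))"
    proof (intro ballI impI)
      fix u assume u: "u \<in> lhom A Y (c k)" and uS: "\<forall>y\<in>S. u y = zero (c k)"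
      have u': "(\<lambda>y. \<alpha> (u y, zero (c 0))) \<in> lhom A Y X" by (rule lhom_o[OF u in1])
      have "\<forall>s\<in>S. \<alpha> (u s, zero (c 0)) = zero X" using uS lhom_zero[OF mck0(1) Xm in1] by simp
      then obtain p where p: "p \<in> lhom A T X" "\<forall>y\<in>carrier Y. \<alpha> (u y, zero (c 0)) = p (g y)"
        using mp[OF bspec[OF ap u']] by blast
      show "\<exists>p\<in>lhom A T (c k). \<forall>y\<in>carrier Y. u y = p (g y)"
      proof (rule bexI[OF _ lhom_o[OF p(1) pr1]], rule ballI)
        fix y assume y: "y \<in> carrier Y"
        have "fst (\<beta> (\<alpha> (u y, zero (c 0)))) = u y" using x(3)[of "(u y, zero (c 0))"] lhom_in[OF u y] by simp
        then show "u y = fst (\<beta> (p (g y)))" using p(2) y by simp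
      qed
    qed
    have "pe i T (g ` carrier Y)" for i
    proof (cases i)
      case 0
      show ?thesis unfolding 0 by (rule pe_step0[OF Y T(2) g Sc gS ap' hr])
    next
      case (Suc n)
      show ?thesis unfolding Suc by (rule iffD1[OF pe_shift[OF Y T(2) g ker hr] p[rule_format]])
    qed
    then show ?thesis using T(2) TX g ker by (intro exI[of _ T] exI[of _ g]) simp
  qed
  obtain C' :: "('k, 'a) umodule" and \<gamma> \<gamma>' where C': "fgm A C'" "mod_iso A C C' \<gamma> \<gamma>'"
    by (rule umodule_copy[OF fgC])
  note cc = mod_isoD[OF C'(2)]
  have Cm': "lmod A C'" by (rule fg_left[OF C'(1)])
  have C'C: "addr A {C} C'" by (rule addr_iso[OF Cm' _ mod_iso_sym[OF C'(2)]]) simp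
  \<comment> \<open>The coresolution starts with C itself, whose positive Ext groups into
    \<open>c k\<close> vanish by rigidity.\<close>
  have pC': "\<forall>i. pe i C' {zero C'}" using iffD2[OF pe_zero[OF Cm'] rigid_c(3)[OF C'(1) C'C]] by blast
  let ?P = "\<lambda>(n::nat) Y S. fgm A Y \<and> submod A Y S \<and> (\<forall>i. pe i Y S)"
  let ?Q = "\<lambda>(n::nat) Y S g T S'. addr A {X} T \<and> g \<in> lhom A Y T \<and> {y \<in> carrier Y. g y = zero T} = S \<and> S' = g ` carrier Y"
  have P0: "?P 0 C' {zero C'}" using C'(1) left_module.submod_zero[OF Cm'] pC' by blast
  have Pstep: "\<exists>(T :: ('k, 'a) umodule) S' g. ?P (Suc n) T S' \<and> ?Q n Y S g T S'" if P: "?P n Y S" for n and Y :: "('k, 'a) umodule" and S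
  proof -
    obtain T :: "('k, 'a) umodule" and g where T: "fgm A T" "addr A {X} T" "g \<in> lhom A Y T"
      "{y \<in> carrier Y. g y = zero T} = S" "\<forall>i. pe i T (g ` carrier Y)" using step[of Y S] P by blast
    have "submod A T (g ` carrier Y)" using submod_image[OF _ fg_left[OF T(1)] T(3) left_module.submod_carrier] P fg_left[of A Y] by blast
    then show ?thesis using T by (intro exI[of _ T] exI[of _ "g ` carrier Y"] exI[of _ g]) simp
  qed
  obtain T S g where T0: "T 0 = C'" "S 0 = {zero C'}" and TP: "\<forall>n. ?P n (T n) (S n)"
    and TQ: "\<forall>n. ?Q n (T n) (S n) (g n) (T (Suc n)) (S (Suc n))" by (rule seq_build[where P = ?P and Q = ?Q, OF P0 Pstep])
  have Tfg: "fgm A (T n)" for n using TP by blast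
  have Tm: "lmod A (T n)" for n by (rule fg_left[OF Tfg])
  have TX: "addr A {X} (T (Suc n))" and gl: "g n \<in> lhom A (T n) (T (Suc n))" for n using TQ by blast+
  have TC: "addr A {C} (T (Suc n))" for n by (rule addr_trans[OF Tm _ TX]) (use Xm X_C in auto)
  have ex: "{y \<in> carrier (T (Suc n)). g (Suc n) y = zero (T (Suc (Suc n)))} = g n ` carrier (T n)" for n
    using spec[OF TQ, of n] spec[OF TQ, of "Suc n"] by simp
  have g0: "{y \<in> carrier C'. g 0 y = zero (T (Suc 0))} = {zero C'}" using spec[OF TQ, of 0] T0 by simp
  obtain \<eta>' I d where I: "inj_resolution A C \<eta>' I d" and Iz: "\<forall>i>k. zero_module (I i)"
    by (rule idim_resolution[OF idim])
  note i = inj_resD[OF I]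
  interpret I: inj_res K A C \<eta>' I d by unfold_locales (rule I)
  have hrI: "hexr_at A (T (Suc s)) I d n" for s n by (rule rigid_c(1)[OF Tfg TC, unfolded Ext_hexr[OF Tfg I]])
  \<comment> \<open>The second argument is now C instead of \<open>c k\<close>. The terms
    \<open>T\<close> are acyclic for it as well, so Ext^1 of the first cokernel is shifted up to
    degree \<open>k + 1\<close>, beyond the injective dimension.\<close>
  have peI: "I.pe 0 (T (Suc 0)) (g 0 ` carrier (T 0))"
  proof (rule inc_induct[OF le0, of "\<lambda>m. I.pe m (T (Suc m)) (g m ` carrier (T m))" k])
    show "I.pe k (T (Suc k)) (g k ` carrier (T k))" by (rule I.pe_trivial[OF Tm]) (use Iz in simp)
    show "I.pe m (T (Suc m)) (g m ` carrier (T m))"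
      if "I.pe (Suc m) (T (Suc (Suc m))) (g (Suc m) ` carrier (T (Suc m)))" for m
      using that unfolding I.pe_shift[OF Tfg Tfg gl ex hrI, symmetric] .
  qed
  have g01: "\<forall>x\<in>carrier C'. g 0 x = zero (T (Suc 0)) \<longrightarrow> \<gamma>' x = zero C"
  proof (intro ballI impI)
    fix x assume "x \<in> carrier C'" "g 0 x = zero (T (Suc 0))"
    then have "x = zero C'" using g0 by blast
    then show "\<gamma>' x = zero C" using lhom_zero[OF Cm' modC cc(2)] by simp
  qed
  have e': "(\<lambda>x. \<eta>' (\<gamma>' x)) \<in> lhom A C' (I 0)" by (rule lhom_o[OF cc(2) i(3)])
  have "\<forall>x\<in>carrier C'. g 0 x = zero (T (Suc 0)) \<longrightarrow> \<eta>' (\<gamma>' x) = zero (I 0)"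
    using g01 lhom_zero[OF modC i(1) i(3)] by simp
  \<comment> \<open>\<open>w\<close> extends the inclusion of C in \<open>I 0\<close> to the first
    term of the coresolution. After subtraction of \<open>h\<close>, which vanishes on C, its values
    lie in C; this is the retraction.\<close>
  then obtain w where w: "w \<in> lhom A (T (Suc 0)) (I 0)" "\<forall>x\<in>carrier C'. w (g 0 x) = \<eta>' (\<gamma>' x)"
    by (rule injective_lift[OF i(6) C'(1) Tfg gl[of 0, unfolded T0] e'])
  have dw: "(\<lambda>x. d 0 (w x)) \<in> lhom A (T (Suc 0)) (I (Suc 0))" by (rule lhom_o[OF w(1) i(2)])
  have 1: "\<forall>y\<in>g 0 ` carrier (T 0). d 0 (w y) = zero (I (Suc 0))" using w(2) T0 i(5) cc(6) by auto
  have 2: "\<forall>y\<in>carrier (T (Suc 0)). d (Suc 0) (d 0 (w y)) = zero (I (Suc (Suc 0)))" using i(4) lhom_in[OF w(1)] by blast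
  obtain h where h: "h \<in> lhom A (T (Suc 0)) (I 0)" "\<forall>y\<in>g 0 ` carrier (T 0). h y = zero (I 0)"
    "\<forall>y\<in>carrier (T (Suc 0)). d 0 (w y) = d 0 (h y)" by (rule I.peD[OF peI dw 1 2])
  interpret I0: left_module A "I 0" by (rule i(1))
  interpret I1: left_module A "I (Suc 0)" by (rule i(1))
  have dwh: "d 0 (w x \<ominus>\<^bsub>I 0\<^esub> h x) = zero (I 1)" if x: "x \<in> carrier (T (Suc 0))" for x
    using lhom_minus[OF i(1) i(1) i(2) lhom_in[OF w(1) x] lhom_in[OF h(1) x]] bspec[OF h(3) x]
      lhom_in[OF lhom_o[OF h(1) i(2)] x] by (simp add: I1.minus_diff_zero_iff)
  obtain y' where y': "y' \<in> lhom A (T (Suc 0)) C" "\<forall>x\<in>carrier (T (Suc 0)). w x \<ominus>\<^bsub>I 0\<^esub> h x = \<eta>' (y' x)"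
    by (rule hexrD[OF hexr_left_exact[OF Tm modC i(1) i(3) i(10) i(11)] lhom_diff[OF i(1) w(1) h(1)]]) (rule dwh)
  have y'g: "y' (g 0 x) = \<gamma>' x" if xC: "x \<in> carrier C'" for x
  proof -
    have xT: "x \<in> carrier (T 0)" using xC T0 by simp
    have gx: "g 0 x \<in> carrier (T (Suc 0))" by (rule lhom_in[OF gl xT])
    have "h (g 0 x) = zero (I 0)" by (rule bspec[OF h(2) imageI[OF xT]])
    then have "\<eta>' (y' (g 0 x)) = \<eta>' (\<gamma>' x)"
      using bspec[OF y'(2) gx] bspec[OF w(2) xC] I0.diff_add_cancel[OF lhom_in[OF e' xC] lhom_in[OF h(1) gx]]
        I0.M.minus_closed[OF lhom_in[OF e' xC] lm_zero[OF i(1)]] by simp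
    then show ?thesis by (rule inj_onD[OF i(10) _ lhom_in[OF y'(1) gx] cc(6)[OF xC]])
  qed
  have "addr A {T (Suc 0)} C"
  proof (rule addr_retract[OF modC])
    show "(\<lambda>x. g 0 (\<gamma> x)) \<in> lhom A C (T (Suc 0))" using lhom_o[OF cc(1) gl[of 0, unfolded T0]] .
    show "y' \<in> lhom A (T (Suc 0)) C" by (rule y'(1))
    show "\<forall>m\<in>carrier C. y' (g 0 (\<gamma> m)) = m" using y'g cc(3,5) by simp
  qed simp
  then have "addr A {X} C" by (rule addr_trans[OF modC, rotated]) (use TX[of 0] Tm in auto)
  then show ?thesis by (rule addr_trans[OF modC, rotated]) (use X_ck0 Xm in auto)
qed

end

section \<open>Vanishing Hom, and copresentations by injectives\<close>

lemma hexr_hom0: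
  assumes J: "lmod R J" and I: "lmod R I" and j: "j \<in> lhom R J I" and h: "hom0 R A I"
  shows "hexr R A J j I i L"
proof (rule hexrI)
  fix u assume u: "u \<in> lhom R A I"
  have "\<forall>a\<in>carrier A. u a = j (zero J)" using h u lhom_zero[OF J I j] unfolding hom0_def by simp
  then show "\<exists>u'. u' \<in> lhom R A J \<and> (\<forall>a\<in>carrier A. u a = j (u' a))"
    using lhom_const0[OF J] by (intro exI[of _ "\<lambda>_. zero J"]) auto
qed

lemma hom0_zero_right: "zero_module N \<Longrightarrow> hom0 R M N" unfolding hom0_def zero_module_def using lhom_in by fastforce

lemma hom0_zero_left: "lmod R M \<Longrightarrow> lmod R N \<Longrightarrow> zero_module M \<Longrightarrow> hom0 R M N"
  unfolding hom0_def zero_module_def using lhom_zero by fastforce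

context fdalg begin

lemma zero_Hom:
  assumes M: "lmod A M" and X: "lmod A X"
  shows "zero_module (Hom A M X) \<longleftrightarrow> hom0 A M X"
proof
  assume z: "zero_module (Hom A M X)"
  show "hom0 A M X" unfolding hom0_def
  proof (intro ballI)
    fix f x assume f: "f \<in> lhom A M X" and x: "x \<in> carrier M"
    have "restrict f (carrier M) \<in> {\<lambda>x\<in>carrier M. zero X}" using lhom_mhom[OF M f] z by (simp add: zero_module_def)
    then have "restrict f (carrier M) = (\<lambda>x\<in>carrier M. zero X)" by simp
    from fun_cong[OF this, of x] show "f x = zero X" using x by simp
  qed
next
  assume h: "hom0 A M X"
  have zm: "(\<lambda>x\<in>carrier M. zero X) \<in> mhom A M X" by (rule lhom_mhom[OF M lhom_const0[OF X]])
  have "f = (\<lambda>x\<in>carrier M. zero X)" if f: "f \<in> mhom A M X" for f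
    by (rule mhom_ext[OF f zm]) (use h mhom_lhom[OF f] in \<open>simp add: hom0_def\<close>)
  then have "mhom A M X = {\<lambda>x\<in>carrier M. zero X}" by (intro equalityI subsetI) (simp_all add: zm)
  then show "zero_module (Hom A M X)" by (simp add: zero_module_def)
qed

lemma hom0_DA_zero:
  assumes M: "fgm A M" and h: "hom0 A M DA"
  shows "zero_module M"
proof -
  have M': "lmod A M" by (rule fg_left[OF M])
  obtain n f where f: "\<forall>i<(n::nat). f i \<in> lhom A M DA" "{zero M} = {m \<in> carrier M. \<forall>i<n. f i m = zero DA}"
    by (rule DA_separates[OF M left_module.submod_zero[OF M']])
  have "carrier M \<subseteq> {m \<in> carrier M. \<forall>i<n. f i m = zero DA}" using f(1) h unfolding hom0_def by blast
  then have "carrier M \<subseteq> {zero M}" using f(2) by simp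
  then show ?thesis using lm_zero[OF M'] by (auto simp: zero_module_def)
qed

lemma Hom_exact_injective:
  assumes I: "injective A I" and X: "fgm A X" "fgm A Y" "fgm A Z" and f: "f \<in> lhom A X Y" and g: "g \<in> lhom A Y Z"
    and ex: "f ` carrier X = {y \<in> carrier Y. g y = zero Z}"
  shows "(\<lambda>h. compose (carrier Y) h g) ` mhom A Z I =
     {h \<in> mhom A Y I. compose (carrier X) h f = (\<lambda>x\<in>carrier X. zero I)}"
proof (intro equalityI subsetI)
  have Ym: "lmod A Y" and Zm: "lmod A Z" and Im: "lmod A I" using X fg_left[OF injective_fg[OF I]] fg_left by auto
  have gf: "g (f x) = zero Z" if "x \<in> carrier X" for x using ex that by blast
  fix h
  {
    assume "h \<in> (\<lambda>h. compose (carrier Y) h g) ` mhom A Z I"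
    then obtain h' where h': "h' \<in> mhom A Z I" "h = compose (carrier Y) h' g" by blast
    have "h \<in> mhom A Y I" using lhom_mhom[OF Ym lhom_o[OF g mhom_lhom[OF h'(1)]]] by (simp add: h' compose_def)
    moreover have "compose (carrier X) h f = (\<lambda>x\<in>carrier X. zero I)"
      using h' gf lhom_in[OF f] lhom_zero[OF Zm Im mhom_lhom[OF h'(1)]] by (auto simp: compose_def intro!: restrict_ext)
    ultimately show "h \<in> {h \<in> mhom A Y I. compose (carrier X) h f = (\<lambda>x\<in>carrier X. zero I)}" by simp
  next
    assume h: "h \<in> {h \<in> mhom A Y I. compose (carrier X) h f = (\<lambda>x\<in>carrier X. zero I)}"
    then have hm: "h \<in> mhom A Y I" and hf: "compose (carrier X) h f = (\<lambda>x\<in>carrier X. zero I)" by auto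
    have "h (f x) = zero I" if "x \<in> carrier X" for x using fun_cong[OF hf, of x] that by (simp add: compose_def)
    then obtain w where w: "w \<in> lhom A Z I" "\<forall>y\<in>carrier Y. h y = w (g y)"
      by (rule hexlD[OF inj_hexl[OF I X g, of f] mhom_lhom[OF hm], rotated]) (use ex in auto)
    have "h = compose (carrier Y) (restrict w (carrier Z)) g"
    proof (rule mhom_ext[OF hm])
      show "compose (carrier Y) (restrict w (carrier Z)) g \<in> mhom A Y I"
        using lhom_mhom[OF Ym lhom_o[OF g mhom_lhom[OF lhom_mhom[OF Zm w(1)]]]] by (simp add: compose_def)
      show "h y = compose (carrier Y) (restrict w (carrier Z)) g y" if "y \<in> carrier Y" for y
        using w(2) that lhom_in[OF g that] by (simp add: compose_def)
    qed
    then show "h \<in> (\<lambda>h. compose (carrier Y) h g) ` mhom A Z I" by (rule image_eqI[OF _ lhom_mhom[OF Zm w(1)]])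
  }
qed

text \<open>Hom into the injective \<open>Q\<close> is exact, so the sequence stays exact under it,
  as \<open>cogen\<close> demands.\<close>

lemma cogenI:
  fixes N :: "('a, 'm) module" and Y :: "nat \<Rightarrow> ('k, 'a) umodule"
  assumes Q: "injective A Q" and E: "exact_seq_into A m N e Y d" and add: "\<forall>i\<le>m. in_add A Q (Y i)"
  shows "N \<in> cogen A m Q"
proof -
  have fg: "\<forall>i\<le>m. fgm A (Y i)" and N: "fgm A N" and d: "\<forall>i<m. d i \<in> mhom A (Y i) (Y (Suc i))"
    and e: "e \<in> mhom A N (Y 0)" and ie: "inj_on e (carrier N)"
    and e0: "0 < m \<longrightarrow> e ` carrier N = {x \<in> carrier (Y 0). d 0 x = zero (Y 1)}"
    and ex: "\<forall>i. Suc i < m \<longrightarrow> d i ` carrier (Y i) = {x \<in> carrier (Y (Suc i)). d (Suc i) x = zero (Y (Suc (Suc i)))}"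
    using E by (auto simp: exact_seq_into_def exact_into_def exact_at_def)
  have Nm: "lmod A N" by (rule fg_left[OF N])
  have Y0: "fgm A (Y 0)" using fg by simp
  \<comment> \<open>The zero submodule takes the place of the leading 0, which makes the first
    position an instance of \<open>Hom_exact_injective\<close>.\<close>
  have Z: "fgm A (subm N {zero N})" by (rule fg_submodule[OF N left_module.submod_zero[OF Nm]])
  note el = mhom_lhom[OF e]
  have "exact_onto m (\<lambda>i. Hom A (Y i) Q) (\<lambda>i f. compose (carrier (Y i)) f (d i))
          (\<lambda>f. compose (carrier N) f e) (Hom A N Q)" unfolding exact_onto_def exact_at_def Hom_simps
  proof (intro conjI allI impI)
    have k: "{y \<in> carrier N. e y = zero (Y 0)} = {zero N}"
      using ie[unfolded lhom_inj_iff[OF Nm fg_left[OF Y0] el]] lhom_zero[OF Nm fg_left[OF Y0] el]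
        lm_zero[OF Nm] by blast
    have "(\<lambda>x. x) \<in> lhom A (subm N {zero N}) N" using lm_zero[OF Nm] by (intro lhomI) auto
    from Hom_exact_injective[OF Q Z N Y0 this el] k
    have "(\<lambda>h. compose (carrier N) h e) ` mhom A (Y 0) Q =
      {h \<in> mhom A N Q. compose {zero N} h (\<lambda>x. x) = (\<lambda>x\<in>{zero N}. zero Q)}" by simp
    also have "\<dots> = mhom A N Q"
      using lhom_zero[OF Nm fg_left[OF injective_fg[OF Q]] mhom_lhom] by (auto simp: compose_def intro!: restrict_ext)
    finally show "(\<lambda>f. compose (carrier N) f e) ` mhom A (Y 0) Q = mhom A N Q" .
  next
    assume m: "0 < m"
    have "fgm A (Y 1)" "d 0 \<in> mhom A (Y 0) (Y 1)" using fg d m by auto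
    then show "(\<lambda>f. compose (carrier (Y 0)) f (d 0)) ` mhom A (Y 1) Q =
      {x \<in> mhom A (Y 0) Q. compose (carrier N) x e = (\<lambda>x\<in>carrier N. zero Q)}"
      using Hom_exact_injective[OF Q N Y0 _ el mhom_lhom] e0 m by blast
  next
    fix i assume i: "Suc i < m"
    have f3: "fgm A (Y i)" "fgm A (Y (Suc i))" "fgm A (Y (Suc (Suc i)))"
      and d2: "d i \<in> lhom A (Y i) (Y (Suc i))" "d (Suc i) \<in> lhom A (Y (Suc i)) (Y (Suc (Suc i)))"
      using fg d i by (auto intro: mhom_lhom)
    show "(\<lambda>f. compose (carrier (Y (Suc i))) f (d (Suc i))) ` mhom A (Y (Suc (Suc i))) Q =
      {x \<in> mhom A (Y (Suc i)) Q. compose (carrier (Y i)) x (d i) = (\<lambda>x\<in>carrier (Y i). zero Q)}"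
      by (rule Hom_exact_injective[OF Q f3 d2]) (use ex i in blast)
  qed
  then show ?thesis unfolding cogen_def using E add by blast
qed

end

section \<open>The cotilting classes of C\<close>

context coshift_res begin

lemma addrQ_C:
  assumes "lmod A T" "addr A {Q} T"
  shows "addr A {C} T" by (rule addr_trans[OF assms(1) _ assms(2)]) (use modQ addrQC in auto)

text \<open>Since \<open>c 0\<close> lies in add Q, whatever a left approximation by add Q kills is
  killed by all maps from Y/S to \<open>c 0\<close>, and \<open>pe_separates\<close> makes the
  approximation injective on Y/S. The new term is acyclic because add Q is contained in add
  C.\<close>

lemma cogen_step:
  assumes Y: "fgm A Y" and S: "submod A Y S" and p: "pe (k - 1) Y S"
  obtains U :: "('k, 'a) umodule" and g where "in_add A Q U" "fgm A U" "g \<in> lhom A Y U" "{y \<in> carrier Y. g y = zero U} = S"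
    "\<forall>i. pe i Y S \<longrightarrow> pe (Suc i) U (g ` carrier Y)"
proof -
  have Sc: "S \<subseteq> carrier Y" using S by (simp add: submod_def)
  obtain U :: "('k, 'a) umodule" and g where U: "in_add A Q U" "fgm A U" and g: "g \<in> lhom A Y U"
    and ap: "\<forall>f\<in>lhom A Y Q. (\<forall>y\<in>S. f y = zero Q) \<longrightarrow> (\<exists>p\<in>lhom A U Q. \<forall>y\<in>carrier Y. f y = p (g y))"
    and gS: "\<forall>y\<in>S. g y = zero U" by (rule left_approx[OF Y fgQ Sc])
  have Um: "lmod A U" by (rule fg_left[OF U(2)])
  have c0: "lmod A (c 0)" "addr A {Q} (c 0)" using k1 by (auto intro: modc addrcQ)
  interpret c0: left_module A "c 0" by (rule c0)
  obtain n X i r where X: "\<forall>s<(n::nat). X s \<in> {Q}" and i: "\<forall>s<n. i s \<in> lhom A (c 0) (X s)"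
    and r: "\<forall>s<n. r s \<in> lhom A (X s) (c 0)" and eq: "\<forall>m\<in>carrier (c 0). m = msum (c 0) (\<lambda>s. r s (i s m)) n"
    by (rule addrE[OF c0(2)])
  have ker: "{y \<in> carrier Y. g y = zero U} = S"
  proof (intro equalityI subsetI)
    fix y assume y: "y \<in> {y \<in> carrier Y. g y = zero U}"
    show "y \<in> S"
    proof (rule pe_separates[OF Y S p])
      show "\<forall>h\<in>lhom A Y (c 0). (\<forall>s\<in>S. h s = zero (c 0)) \<longrightarrow> h y = zero (c 0)"
      proof (intro ballI impI)
        fix h assume h: "h \<in> lhom A Y (c 0)" and hS: "\<forall>s\<in>S. h s = zero (c 0)"
        have "r s (i s (h y)) = zero (c 0)" if s: "s < n" for s
        proof -
          have i': "i s \<in> lhom A (c 0) Q" and rs: "r s \<in> lhom A Q (c 0)" using X i r s by auto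
          have ih: "(\<lambda>y. i s (h y)) \<in> lhom A Y Q" by (rule lhom_o[OF h i'])
          have "\<forall>y\<in>S. i s (h y) = zero Q" using hS lhom_zero[OF c0(1) modQ i'] by simp
          then obtain p where p: "p \<in> lhom A U Q" "\<forall>y\<in>carrier Y. i s (h y) = p (g y)" using mp[OF bspec[OF ap ih]] by blast
          then have "i s (h y) = zero Q" using y lhom_zero[OF Um modQ p(1)] by simp
          then show ?thesis using lhom_zero[OF modQ c0(1) rs] by simp
        qed
        then have "msum (c 0) (\<lambda>s. r s (i s (h y))) n = zero (c 0)" by (rule c0.msum_zero)
        then show "h y = zero (c 0)" using bspec[OF eq lhom_in[OF h, of y]] y by simp
      qed
    qed (use y in simp)
  qed (use gS Sc in blast)
  have UC: "addr A {C} U" by (rule addrQ_C[OF Um in_add_addr[OF ring_A modQ U(1)]])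
  show thesis by (rule that[OF U g ker]) (use pe_shift[OF Y U(2) g ker rigid_c(3)[OF U(2) UC]] in blast)
qed

lemma cotilt_cogen:
  assumes N: "fgm A N" and E: "\<forall>n. trivial_group (Ext A (Suc n) N C)"
  shows "N \<in> cogen A (k - 1) Q"
proof -
  have Nm: "lmod A N" by (rule fg_left[OF N])
  have "trivial_group (Ext A (Suc n) N (c k))" for n by (rule Ext_addr_right[OF N fgc addrcC]) (use fgC E in auto)
  then have p: "pe n N {zero N}" for n unfolding Ext_hexr[OF N Jres] pe_zero[OF Nm] .
  obtain Y0 :: "('k, 'a) umodule" and e where Y0: "in_add A Q Y0" "fgm A Y0" and e: "e \<in> lhom A N Y0"
    and ke: "{y \<in> carrier N. e y = zero Y0} = {zero N}" and pe: "\<forall>i. pe i N {zero N} \<longrightarrow> pe (Suc i) Y0 (e ` carrier N)"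
    by (rule cogen_step[OF N left_module.submod_zero[OF Nm] p])
  have Y0m: "lmod A Y0" by (rule fg_left[OF Y0(2)])
  have Y0s: "submod A Y0 (e ` carrier N)" by (rule submod_image[OF Nm Y0m e left_module.submod_carrier[OF Nm]])
  \<comment> \<open>At stage \<open>n\<close> vanishing is known from index \<open>n + 1\<close> on.
    The next step uses index \<open>k - 1\<close>, so it is possible as long as
    \<open>n + 1 < k\<close>; this yields the terms \<open>Y 0, ..., Y (k - 1)\<close>.\<close>
  let ?P = "\<lambda>n Y S. n < k \<longrightarrow> fgm A Y \<and> submod A Y S \<and> in_add A Q Y \<and> (\<forall>i. pe (Suc n + i) Y S)"
  let ?Q = "\<lambda>n Y S g T S'. Suc n < k \<longrightarrow> g \<in> lhom A Y T \<and> {y \<in> carrier Y. g y = zero T} = S \<and> S' = g ` carrier Y"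
  have P0: "?P 0 Y0 (e ` carrier N)" using Y0 Y0s pe p by simp
  have step: "\<exists>(T :: ('k, 'a) umodule) S' g. ?P (Suc n) T S' \<and> ?Q n Y S g T S'"
    if P: "?P n Y S" for n and Y :: "('k, 'a) umodule" and S
  proof (cases "Suc n < k")
    case False
    then show ?thesis by blast
  next
    case True
    then have Y: "fgm A Y" "submod A Y S" and pY: "\<forall>i. pe (Suc n + i) Y S" using P by auto
    have "Suc n + (k - 1 - Suc n) = k - 1" using True by simp
    then have "pe (k - 1) Y S" using spec[OF pY, of "k - 1 - Suc n"] by metis
    then obtain T :: "('k, 'a) umodule" and g where T: "in_add A Q T" "fgm A T" "g \<in> lhom A Y T"
      "{y \<in> carrier Y. g y = zero T} = S" "\<forall>i. pe i Y S \<longrightarrow> pe (Suc i) T (g ` carrier Y)"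
      by (rule cogen_step[OF Y])
    have "submod A T (g ` carrier Y)" by (rule submod_image[OF fg_left[OF Y(1)] fg_left[OF T(2)] T(3)
            left_module.submod_carrier[OF fg_left[OF Y(1)]]])
    moreover have "\<forall>i. pe (Suc (Suc n) + i) T (g ` carrier Y)" using T(5) pY by simp
    ultimately show ?thesis using T by (intro exI[of _ T] exI[of _ "g ` carrier Y"] exI[of _ g]) simp
  qed
  obtain Y S g where Yi: "Y 0 = Y0" "S 0 = e ` carrier N" and YP: "\<forall>n. ?P n (Y n) (S n)"
    and YQ: "\<forall>n. ?Q n (Y n) (S n) (g n) (Y (Suc n)) (S (Suc n))" by (rule seq_build[where P = ?P and Q = ?Q, OF P0 step])
  have Yfg: "fgm A (Y n)" "in_add A Q (Y n)" if "n < k" for n using YP that by blast+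
  have gl: "g n \<in> lhom A (Y n) (Y (Suc n))" and gk: "{y \<in> carrier (Y n). g n y = zero (Y (Suc n))} = S n"
    and gS: "S (Suc n) = g n ` carrier (Y n)" if "Suc n < k" for n using spec[OF YQ, of n] that by auto
  have "exact_seq_into A (k - 1) N (restrict e (carrier N)) Y (\<lambda>n. restrict (g n) (carrier (Y n)))"
    unfolding exact_seq_into_def exact_into_def exact_at_def
  proof (intro conjI allI impI N)
    show "fgm A (Y i)" if "i \<le> k - 1" for i using Yfg that k1 by simp
    show "restrict (g i) (carrier (Y i)) \<in> mhom A (Y i) (Y (Suc i))" if "i < k - 1" for i
      by (rule lhom_mhom[OF fg_left[OF Yfg(1)] gl]) (use that in auto)
    show "restrict e (carrier N) \<in> mhom A N (Y 0)" unfolding Yi by (rule lhom_mhom[OF Nm e])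
    have "inj_on e (carrier N)" unfolding lhom_inj_iff[OF Nm Y0m e] using ke by blast
    then show "inj_on (restrict e (carrier N)) (carrier N)" by simp
    show "restrict e (carrier N) ` carrier N = {x \<in> carrier (Y 0). restrict (g 0) (carrier (Y 0)) x = zero (Y 1)}"
      if "0 < k - 1" using gk[of 0] that Yi(2) by auto
    show "restrict (g i) (carrier (Y i)) ` carrier (Y i) =
      {x \<in> carrier (Y (Suc i)). restrict (g (Suc i)) (carrier (Y (Suc i))) x = zero (Y (Suc (Suc i)))}"
      if s: "Suc i < k - 1" for i
    proof -
      have "Suc (Suc i) < k" "Suc i < k" using s by auto
      then have "{y \<in> carrier (Y (Suc i)). g (Suc i) y = zero (Y (Suc (Suc i)))} = g i ` carrier (Y i)"
        using gk[of "Suc i"] gS[of i] by simp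
      then show ?thesis by auto
    qed
  qed
  then show ?thesis by (rule cogenI[OF injQ]) (use Yfg k1 in auto)
qed

text \<open>The \<open>k\<close> terms of the sequence shift Ext of \<open>N\<close> from degree
  \<open>n + 1\<close> to degree \<open>n + k + 1\<close>, where it vanishes by the injective
  dimension of C.\<close>

lemma cogen_cotilt:
  assumes "N \<in> cogen A (k - 1) Q"
  shows "fgm A N" "trivial_group (Ext A (Suc n) N C)"
proof -
  obtain Y :: "nat \<Rightarrow> ('k, 'a) umodule" and d e where E: "exact_seq_into A (k - 1) N e Y d"
    and add: "\<forall>i\<le>k - 1. in_add A Q (Y i)" using assms unfolding cogen_def by blast
  have fg: "\<forall>i\<le>k - 1. fgm A (Y i)" and N: "fgm A N" and d: "\<forall>i<k - 1. d i \<in> mhom A (Y i) (Y (Suc i))"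
    and e: "e \<in> mhom A N (Y 0)" and ie: "inj_on e (carrier N)"
    and e0: "0 < k - 1 \<longrightarrow> e ` carrier N = {x \<in> carrier (Y 0). d 0 x = zero (Y (Suc 0))}"
    and ex: "\<forall>i. Suc i < k - 1 \<longrightarrow> d i ` carrier (Y i) = {x \<in> carrier (Y (Suc i)). d (Suc i) x = zero (Y (Suc (Suc i)))}"
    using E by (auto simp: exact_seq_into_def exact_into_def exact_at_def)
  show "fgm A N" by (rule N)
  have Nm: "lmod A N" by (rule fg_left[OF N])
  note el = mhom_lhom[OF e]
  obtain \<eta>' I \<delta>' where I: "inj_resolution A C \<eta>' I \<delta>'" and Iz: "\<forall>i>k. zero_module (I i)"
    by (rule idim_resolution[OF idim])
  note i = inj_resD[OF I]
  interpret I: inj_res K A C \<eta>' I \<delta>' by unfold_locales (rule I)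
  have Yf: "fgm A (Y s)" if "s \<le> k - 1" for s using fg that by blast
  have dl: "d s \<in> lhom A (Y s) (Y (Suc s))" if "s < k - 1" for s using d that by (auto intro: mhom_lhom)
  have hr: "hexr_at A (Y s) I \<delta>' m" if s: "s \<le> k - 1" for s m
  proof -
    have "addr A {C} (Y s)" by (rule addrQ_C[OF fg_left[OF Yf[OF s]] in_add_addr[OF ring_A modQ]]) (use add s in blast)
    from rigid_c(1)[OF Yf[OF s] this, of m] show ?thesis unfolding Ext_hexr[OF Yf[OF s] I] .
  qed
  \<comment> \<open>The image of the incoming map, so that \<open>Y s\<close> with
    \<open>S s\<close> stands for its cokernel.\<close>
  define S where "S s = (case s of 0 \<Rightarrow> e ` carrier N | Suc s \<Rightarrow> d s ` carrier (Y s))" for s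
  have kS: "{y \<in> carrier (Y s). d s y = zero (Y (Suc s))} = S s" if "s < k - 1" for s
    using e0 ex that by (cases s) (simp_all add: S_def)
  \<comment> \<open>Descending induction from \<open>Y (k - 1)\<close>, where index
    \<open>n + k\<close> already lies beyond the nonzero terms of \<open>I\<close>; the summand 0
    gives the goal the shape of the induction predicate.\<close>
  have "I.pe (Suc (n + 0)) (Y 0) (S 0)"
  proof (rule inc_induct[OF le0, of "\<lambda>s. I.pe (Suc (n + s)) (Y s) (S s)" "k - 1"])
    show "I.pe (Suc (n + (k - 1))) (Y (k - 1)) (S (k - 1))" by (rule I.pe_trivial[OF fg_left[OF Yf[OF order_refl]]]) (use Iz k1 in simp)
    show "I.pe (Suc (n + s)) (Y s) (S s)" if s: "s < k - 1" and pe: "I.pe (Suc (n + Suc s)) (Y (Suc s)) (S (Suc s))" for s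
    proof -
      have l: "s \<le> k - 1" "Suc s \<le> k - 1" using s by auto
      show ?thesis by (rule iffD2[OF I.pe_shift[OF Yf[OF l(1)] Yf[OF l(2)] dl[OF s] kS[OF s] hr[OF l(2)]]])
          (use pe in \<open>simp add: S_def\<close>)
    qed
  qed
  then have pe: "I.pe (Suc n) (Y 0) (e ` carrier N)" by (simp add: S_def)
  have "{y \<in> carrier N. e y = zero (Y 0)} = {zero N}" using ie[unfolded lhom_inj_iff[OF Nm fg_left[OF Yf[OF le0]] el]] lm_zero[OF Nm]
      lhom_zero[OF Nm fg_left[OF Yf[OF le0]] el] by blast
  from iffD2[OF I.pe_shift[OF N Yf[OF le0] el this hr[OF le0]] pe]
  show "trivial_group (Ext A (Suc n) N C)" unfolding Ext_hexr[OF N I] I.pe_zero[OF Nm] .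
qed

lemma cotilt_0: "(cotilt_class A 0 C :: ('a, 'm) module set) = cogen A (k - 1) Q"
proof (intro equalityI subsetI)
  fix N :: "('a, 'm) module"
  {
    assume "N \<in> cotilt_class A 0 C"
    then show "N \<in> cogen A (k - 1) Q" by (intro cotilt_cogen) (auto simp: cotilt_class_def)
  next
    assume N: "N \<in> cogen A (k - 1) Q"
    show "N \<in> cotilt_class A 0 C" unfolding cotilt_class_def
    proof (intro CollectI conjI allI impI)
      show "fgm A N" by (rule cogen_cotilt(1)[OF N])
      show "trivial_group (Ext A i N C)" if "i \<noteq> 0" for i using cogen_cotilt(2)[OF N] that by (cases i) auto
    qed
  }
qed

lemma hom0_Ext0: "fgm A M \<Longrightarrow> trivial_group (Ext A 0 M C) \<longleftrightarrow> hom0 A M C"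
  unfolding hom0_def by (rule Ext_0[OF _ modC])

lemma hom0_C_Q: "hom0 A M C \<Longrightarrow> hom0 A M Q" by (rule addr_hom0[OF modQ addrQC]) (use modC in auto)

lemma hom0_Q_c: "hom0 A M Q \<Longrightarrow> i < k \<Longrightarrow> hom0 A M (c i)" by (rule addr_hom0[OF modc addrcQ]) (use modQ in auto)

lemma hom0_Q_J: "hom0 A M Q \<Longrightarrow> i \<noteq> k \<Longrightarrow> hom0 A M (J i)"
proof -
  assume h: "hom0 A M Q" and i: "i \<noteq> k"
  show ?thesis
  proof (cases "i < k")
    case True
    then show ?thesis using Jc[OF True] hom0_Q_c[OF h, of "k - 1 - i"] by simp
  next
    case False
    then show ?thesis using i by (intro hom0_zero_right Jz) simp
  qed
qed

text \<open>\<open>\<eta>\<close> embeds \<open>c k\<close> in \<open>J 0 = c (k - 1)\<close>, which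
  lies in add Q because \<open>k\<close> is at least 1.\<close>

lemma hom0_Q_ck:
  assumes h: "hom0 A M Q"
  shows "hom0 A M (c k)" unfolding hom0_def
proof (intro ballI)
  fix f x assume f: "f \<in> lhom A M (c k)" and x: "x \<in> carrier M"
  have "hom0 A M (J 0)" by (rule hom0_Q_J[OF h]) (use k1 in simp)
  then have "\<eta> (f x) = zero (J 0)" using bspec[OF bspec[OF _ lhom_o[OF f j(3)]] x] by (simp add: hom0_def)
  then show "f x = zero (c k)" using j(10)[unfolded lhom_inj_iff[OF j(9) j(1) j(3)]] lhom_in[OF f x] by blast
qed

text \<open>By \<open>addr_C\<close> it is enough to treat \<open>c k\<close> and the injective
  \<open>c 0\<close>. For \<open>c k\<close>, every term of \<open>J\<close> except
  \<open>J k\<close> is zero or in add Q, so the Hom complex from \<open>M\<close> lives in degree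
  \<open>k\<close> only.\<close>

lemma Ext_C_of_hom0_Q:
  assumes M: "fgm A M" and h: "hom0 A M Q" and i: "i \<noteq> k"
  shows "trivial_group (Ext A i M C)"
proof (cases i)
  case 0
  have "hom0 A M C" by (rule addr_hom0[OF modC addr_C]) (use hom0_Q_ck[OF h] hom0_Q_c[OF h] k1 modc in auto)
  then show ?thesis using hom0_Ext0[OF M] 0 by simp
next
  case (Suc n)
  have "trivial_group (Ext A (Suc n) M (c k))" unfolding Ext_hexr[OF M Jres]
    by (rule hexr_hom0[OF j(1) j(1) j(2) hom0_Q_J[OF h]]) (use i Suc in simp)
  moreover have "trivial_group (Ext A (Suc n) M (c 0))" by (rule Ext_injective[OF M injc]) (use k1 in simp)
  ultimately show ?thesis unfolding Suc by (intro Ext_addr_right[OF M fgC addr_C]) (auto intro: fgc)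
qed

lemma cotilt_k: "(cotilt_class A k C :: ('a, 'm) module set) = ker_Hom_to A Q"
proof (intro equalityI subsetI)
  fix M :: "('a, 'm) module"
  {
    assume "M \<in> cotilt_class A k C"
    then have M: "fgm A M" "trivial_group (Ext A 0 M C)" using k1 by (auto simp: cotilt_class_def)
    then have "hom0 A M Q" using hom0_Ext0 hom0_C_Q by blast
    then show "M \<in> ker_Hom_to A Q" using M(1) zero_Hom[OF fg_left[OF M(1)] modQ] by (simp add: ker_Hom_to_def)
  next
    assume "M \<in> ker_Hom_to A Q"
    then have M: "fgm A M" "zero_module (Hom A M Q)" by (auto simp: ker_Hom_to_def)
    then have "hom0 A M Q" using zero_Hom[OF fg_left[OF M(1)] modQ] by blast
    then show "M \<in> cotilt_class A k C" using M(1) Ext_C_of_hom0_Q[OF M(1)] by (simp add: cotilt_class_def)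
  }
qed

text \<open>Such a module has no maps to \<open>c 0\<close>, and as Ext^k vanishes as well, its maps
  to \<open>D A\<close> would lift to \<open>c 0\<close>; so it has no maps to \<open>D A\<close>
  either and is zero.\<close>

lemma cotilt_other:
  assumes i: "i \<noteq> 0" "i \<noteq> k"
  shows "(cotilt_class A i C :: ('a, 'm) module set) = zero_modules A"
proof (intro equalityI subsetI)
  fix M :: "('a, 'm) module"
  {
    assume "M \<in> cotilt_class A i C"
    then have M: "fgm A M" "trivial_group (Ext A 0 M C)" "trivial_group (Ext A (Suc (k - 1)) M C)"
      using i k1 by (auto simp: cotilt_class_def)
    have h: "hom0 A M Q" using M hom0_Ext0 hom0_C_Q by blast
    have k: "Suc (k - 1) = k" "J (k - 1) = c 0" using k1 Jc[of "k - 1"] by auto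
    have "trivial_group (Ext A (Suc (k - 1)) M (c k))" by (rule Ext_addr_right[OF M(1) fgc addrcC]) (use fgC M(3) in auto)
    then have hr: "hexr A M (J (k - 1)) (\<delta> (k - 1)) (J k) (\<delta> k) (J (Suc k))"
      using Ext_hexr[OF M(1) Jres, of "k - 1"] k(1) by simp
    note iso = mod_isoD[OF JD]
    have "hom0 A M DA" unfolding hom0_def
    proof (intro ballI)
      fix f x assume f: "f \<in> lhom A M DA" and x: "x \<in> carrier M"
      have ff: "(\<lambda>m. \<phi> (f m)) \<in> lhom A M (J k)" by (rule lhom_o[OF f iso(1)])
      have "\<delta> k (\<phi> (f a)) = zero (J (Suc k))" if "a \<in> carrier M" for a
        using lhom_in[OF lhom_o[OF ff j(2)] that] Jz[of "Suc k"] by (simp add: zero_module_def)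
      then obtain u where u: "u \<in> lhom A M (J (k - 1))" "\<forall>a\<in>carrier M. \<phi> (f a) = \<delta> (k - 1) (u a)"
        by (rule hexrD[OF hr ff])
      have "hom0 A M (J (k - 1))" by (rule hom0_Q_J[OF h]) (use k1 in simp)
      then have "u x = zero (J (k - 1))" using u(1) x unfolding hom0_def by blast
      then have "\<phi> (f x) = zero (J k)" using bspec[OF u(2) x] lhom_zero[OF j(1) j(1) j(2), of "k - 1"] k(1) by simp
      then have "\<psi> (\<phi> (f x)) = zero DA" using lhom_zero[OF j(1) DA_module iso(2)] by simp
      then show "f x = zero DA" using iso(3)[OF lhom_in[OF f x]] by simp
    qed
    then have "zero_module M" by (rule hom0_DA_zero[OF M(1)])
    then show "M \<in> zero_modules A" using M(1) by (simp add: zero_modules_def)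
  next
    assume "M \<in> zero_modules A"
    then have M: "fgm A M" "zero_module M" by (auto simp: zero_modules_def)
    have Mm: "lmod A M" by (rule fg_left[OF M(1)])
    obtain \<eta>' I \<delta>' where I: "inj_resolution A C \<eta>' I \<delta>'" by (rule inj_resolution_exists[OF fgC])
    note i = inj_resD[OF I]
    have "trivial_group (Ext A n M C)" for n
    proof (cases n)
      case 0
      then show ?thesis using hom0_Ext0[OF M(1)] hom0_zero_left[OF Mm modC M(2)] by simp
    next
      case (Suc n')
      show ?thesis unfolding Suc Ext_hexr[OF M(1) I] by (rule hexr_hom0[OF i(1) i(1) i(2) hom0_zero_left[OF Mm i(1) M(2)]])
    qed
    then show "M \<in> cotilt_class A i C" using M(1) by (simp add: cotilt_class_def)
  }
qed

end

section \<open>Modules over the endomorphism algebra\<close>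

locale endo = fdalg K A
  for K :: "'k ring" and A :: "('k, 'a) module" +
  fixes C :: "('a, 'c) module"
  assumes fg_C: "fgm A C"
begin

abbreviation EE where "EE \<equiv> End A C"
abbreviation BB where "BB \<equiv> opp EE"
text \<open>The functor Hom(C, -) from \<open>A\<close>-modules to \<open>B\<close>-modules; its
  action on maps is \<open>post\<close>.\<close>

abbreviation FF where "FF X \<equiv> Hom_over_End A C X"
abbreviation post where "post \<equiv> compose (carrier C)"

lemma mod_C: "lmod A C" by (rule fg_left[OF fg_C])

lemma EE_simps [simp]: "carrier EE = mhom A C C" "zero EE = (\<lambda>x\<in>carrier C. zero C)" "one EE = (\<lambda>x\<in>carrier C. x)"
  "f \<oplus>\<^bsub>EE\<^esub> g = (\<lambda>x\<in>carrier C. f x \<oplus>\<^bsub>C\<^esub> g x)" "f \<otimes>\<^bsub>EE\<^esub> g = post f g"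
  "a \<odot>\<^bsub>EE\<^esub> f = (\<lambda>x\<in>carrier C. (a \<odot>\<^bsub>A\<^esub> one A) \<odot>\<^bsub>C\<^esub> f x)"
  by (simp_all add: End_def Hom_def)

lemma FF_simps [simp]: "carrier (FF X) = mhom A C X" "zero (FF X) = (\<lambda>x\<in>carrier C. zero X)"
  "f \<oplus>\<^bsub>FF X\<^esub> g = (\<lambda>x\<in>carrier C. f x \<oplus>\<^bsub>X\<^esub> g x)" "b \<odot>\<^bsub>FF X\<^esub> f = post f b"
  by (simp_all add: Hom_over_End_def Hom_def)

lemma mhom_closed: "f \<in> mhom A M N \<Longrightarrow> x \<in> carrier M \<Longrightarrow> f x \<in> carrier N"
  by (rule lhom_in[OF mhom_lhom])

lemma mhom_comp:
  assumes M: "lmod A M" and f: "f \<in> mhom A M N" and g: "g \<in> lhom A N L"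
  shows "compose (carrier M) g f \<in> mhom A M L" using lhom_mhom[OF M lhom_o[OF mhom_lhom[OF f] g]] by (simp add: compose_def)

lemma id_C: "(\<lambda>x\<in>carrier C. x) \<in> mhom A C C" by (rule lhom_mhom[OF mod_C lhom_id])

lemma abelian_EE: "abelian_group EE"
  by (rule abelian_group_cong[OF lm_abelian[OF Hom_module[OF mod_C mod_C]]]) (simp_all add: End_def Hom_def)

lemma fdalg_EE: "fdalg K EE"
proof -
  interpret C: left_module A C by (rule mod_C)
  interpret H: left_module K "Hom A C C" by (rule Hom_module[OF mod_C mod_C])
  note cl = mhom_closed[of _ C C]
  have cp: "post f g \<in> mhom A C C" if "f \<in> mhom A C C" "g \<in> mhom A C C" for f g
    by (rule mhom_comp[OF mod_C that(2) mhom_lhom[OF that(1)]])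
  have idl: "post (\<lambda>x\<in>carrier C. x) f = f" and idr: "post f (\<lambda>x\<in>carrier C. x) = f"
    if f: "f \<in> mhom A C C" for f using mhom_ext[OF cp[OF id_C f] f] mhom_ext[OF cp[OF f id_C] f] cl[OF f] by (simp_all add: compose_def)
  have r: "ring EE"
  proof (rule ringI[OF abelian_EE])
    show "Group.monoid EE"
    proof (rule monoidI)
      fix f g h assume "f \<in> carrier EE" "g \<in> carrier EE" "h \<in> carrier EE"
      then have h: "h \<in> mhom A C C" by simp
      show "f \<otimes>\<^bsub>EE\<^esub> g \<otimes>\<^bsub>EE\<^esub> h = f \<otimes>\<^bsub>EE\<^esub> (g \<otimes>\<^bsub>EE\<^esub> h)"
        by (rule ext) (simp add: compose_def restrict_def cl[OF h])
    qed (simp_all add: cp id_C idl idr)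
    fix f g h assume "f \<in> carrier EE" "g \<in> carrier EE" "h \<in> carrier EE"
    then have fgh: "f \<in> mhom A C C" "g \<in> mhom A C C" "h \<in> mhom A C C" by auto
    show "(f \<oplus>\<^bsub>EE\<^esub> g) \<otimes>\<^bsub>EE\<^esub> h = f \<otimes>\<^bsub>EE\<^esub> h \<oplus>\<^bsub>EE\<^esub> g \<otimes>\<^bsub>EE\<^esub> h"
      by (rule ext) (simp add: compose_def restrict_def cl[OF fgh(3)])
    show "h \<otimes>\<^bsub>EE\<^esub> (f \<oplus>\<^bsub>EE\<^esub> g) = h \<otimes>\<^bsub>EE\<^esub> f \<oplus>\<^bsub>EE\<^esub> h \<otimes>\<^bsub>EE\<^esub> g"
      by (rule ext) (simp add: compose_def restrict_def cl[OF fgh(1)] cl[OF fgh(2)] lhom_add[OF mhom_lhom[OF fgh(3)]])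
  qed
  have sm: "smult EE = smult (Hom A C C)" by (simp add: End_def)
  have ad: "add EE = add (Hom A C C)" by (simp add: End_def)
  have ca: "carrier EE = carrier (Hom A C C)" by simp
  have m: "module K EE" by (rule moduleI[OF K.cring_axioms abelian_EE])
      (simp_all only: sm ad ca H.smult_closed H.smult_l_distr H.smult_r_distr H.smult_assoc H.smult_one)
  have f: "finitely_generated K EE" using fg_Hom[OF fg_C fg_C] by (simp add: fg_module_def finitely_generated_def End_def finsum_def)
  have "(c \<odot>\<^bsub>EE\<^esub> x) \<otimes>\<^bsub>EE\<^esub> y = c \<odot>\<^bsub>EE\<^esub> (x \<otimes>\<^bsub>EE\<^esub> y) \<and> x \<otimes>\<^bsub>EE\<^esub> (c \<odot>\<^bsub>EE\<^esub> y) = c \<odot>\<^bsub>EE\<^esub> (x \<otimes>\<^bsub>EE\<^esub> y)"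
    if "c \<in> carrier K" "x \<in> carrier EE" "y \<in> carrier EE" for c x y
  proof -
    have xy: "x \<in> mhom A C C" "y \<in> mhom A C C" using that by auto
    show ?thesis
      by (intro conjI ext) (simp_all add: compose_def restrict_def cl[OF xy(1)] cl[OF xy(2)] lhom_smult[OF mhom_lhom[OF xy(1)]] that(1))
  qed
  then show ?thesis using r m f field_K by (simp add: fdalg_def fd_algebra_def del: EE_simps)
qed

lemma fdalg_BB: "fdalg K BB" by (rule fdalg_opp[OF fdalg_EE])

sublocale E: fdalg K EE by (rule fdalg_EE)
sublocale B: fdalg K BB by (rule fdalg_BB)

lemma F_module:
  assumes X: "lmod A X"
  shows "lmod BB (FF X)"
proof -
  interpret C: left_module A C by (rule mod_C)
  interpret X: left_module A X by fact
  have ab: "abelian_group (FF X)"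
    by (rule abelian_group_cong[OF lm_abelian[OF Hom_module[OF mod_C X]]]) (simp_all add: Hom_over_End_def Hom_def)
  show ?thesis
  proof (rule left_moduleI[OF B.ring_A ab])
    fix a f assume "a \<in> carrier BB" "f \<in> carrier (FF X)"
    then show "a \<odot>\<^bsub>FF X\<^esub> f \<in> carrier (FF X)" using mhom_comp[OF mod_C _ mhom_lhom] by simp
  next
    fix a b f assume "a \<in> carrier BB" "b \<in> carrier BB" "f \<in> carrier (FF X)"
    then have abf: "a \<in> mhom A C C" "b \<in> mhom A C C" "f \<in> mhom A C X" by auto
    show "(a \<oplus>\<^bsub>BB\<^esub> b) \<odot>\<^bsub>FF X\<^esub> f = a \<odot>\<^bsub>FF X\<^esub> f \<oplus>\<^bsub>FF X\<^esub> b \<odot>\<^bsub>FF X\<^esub> f"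
      by (rule ext) (simp add: compose_def restrict_def mhom_closed[OF abf(1)] mhom_closed[OF abf(2)] lhom_add[OF mhom_lhom[OF abf(3)]])
    show "(a \<otimes>\<^bsub>BB\<^esub> b) \<odot>\<^bsub>FF X\<^esub> f = a \<odot>\<^bsub>FF X\<^esub> (b \<odot>\<^bsub>FF X\<^esub> f)"
      by (rule ext) (simp add: compose_def restrict_def mhom_closed[OF abf(1)])
  next
    fix a f g assume "a \<in> carrier BB" "f \<in> carrier (FF X)" "g \<in> carrier (FF X)"
    then have a: "a \<in> mhom A C C" by auto
    show "a \<odot>\<^bsub>FF X\<^esub> (f \<oplus>\<^bsub>FF X\<^esub> g) = a \<odot>\<^bsub>FF X\<^esub> f \<oplus>\<^bsub>FF X\<^esub> a \<odot>\<^bsub>FF X\<^esub> g"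
      by (rule ext) (simp add: compose_def restrict_def mhom_closed[OF a])
  next
    fix f assume "f \<in> carrier (FF X)"
    then have f: "f \<in> mhom A C X" by simp
    show "one BB \<odot>\<^bsub>FF X\<^esub> f = f" using mhom_ext[OF mhom_comp[OF mod_C id_C mhom_lhom[OF f]] f] by (simp add: compose_def)
  qed
qed

lemma F_map:
  assumes X: "lmod A X" and Y: "lmod A Y" and g: "g \<in> lhom A X Y"
  shows "post g \<in> lhom BB (FF X) (FF Y)"
proof (rule lhomI)
  fix u assume "u \<in> carrier (FF X)"
  then have u: "u \<in> mhom A C X" by simp
  show "post g u \<in> carrier (FF Y)" using mhom_comp[OF mod_C u g] by simp
  show "post g (b \<odot>\<^bsub>FF X\<^esub> u) = b \<odot>\<^bsub>FF Y\<^esub> post g u" if "b \<in> carrier BB" for b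
  proof (rule ext)
    fix x
    have b: "b \<in> mhom A C C" using that by simp
    show "post g (b \<odot>\<^bsub>FF X\<^esub> u) x = (b \<odot>\<^bsub>FF Y\<^esub> post g u) x"
      by (cases "x \<in> carrier C") (simp_all add: compose_def mhom_closed[OF b])
  qed
  show "post g (u \<oplus>\<^bsub>FF X\<^esub> v) = post g u \<oplus>\<^bsub>FF Y\<^esub> post g v"
    if "v \<in> carrier (FF X)" for v
  proof (rule ext)
    fix x
    have v: "v \<in> mhom A C X" using that by simp
    show "post g (u \<oplus>\<^bsub>FF X\<^esub> v) x = (post g u \<oplus>\<^bsub>FF Y\<^esub> post g v) x" by (cases "x \<in> carrier C")
        (simp_all add: compose_def lhom_add[OF g mhom_closed[OF u] mhom_closed[OF v]])
  qed
qed

lemma F_msum: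
  assumes X: "lmod A X" and f: "\<And>s. s < n \<Longrightarrow> f s \<in> mhom A C X" and x: "x \<in> carrier C"
  shows "msum (FF X) f n x = msum X (\<lambda>s. f s x) n" using f by (induction n) (use x in auto)

lemma F_msum_eq:
  assumes X: "lmod A X" and f: "\<And>s. s < n \<Longrightarrow> f s \<in> mhom A C X" and u: "u \<in> mhom A C X"
    and eq: "\<And>x. x \<in> carrier C \<Longrightarrow> u x = msum X (\<lambda>s. f s x) n"
  shows "u = msum (FF X) f n"
proof (rule mhom_ext[OF u])
  interpret F: left_module BB "FF X" by (rule F_module[OF X])
  have "msum (FF X) f n \<in> carrier (FF X)" by (rule F.msum_closed) (use f in simp)
  then show "msum (FF X) f n \<in> mhom A C X" by simp
qed (use F_msum[OF X f] eq in simp)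

lemma F_addr:
  assumes X: "lmod A X" and mod: "\<And>Y. Y \<in> \<X> \<Longrightarrow> lmod A Y" and a: "addr A \<X> X"
  shows "addr BB ((\<lambda>Y. FF Y) ` \<X>) (FF X)"
proof -
  obtain n Y i r where Y: "\<forall>s<(n::nat). Y s \<in> \<X>" and i: "\<forall>s<n. i s \<in> lhom A X (Y s)"
    and r: "\<forall>s<n. r s \<in> lhom A (Y s) X" and eq: "\<forall>m\<in>carrier X. m = msum X (\<lambda>s. r s (i s m)) n"
    by (rule addrE[OF a])
  have Ym: "lmod A (Y s)" if "s < n" for s using mod Y that by blast
  show ?thesis unfolding addr_factors
  proof (rule factorsI[of n "\<lambda>s. FF (Y s)" _ "\<lambda>s u. post (i s) u" _ _ "\<lambda>s u. post (r s) u"])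
    show "\<forall>s<n. FF (Y s) \<in> (\<lambda>Y. FF Y) ` \<X>" using Y by blast
    show "\<forall>s<n. post (i s) \<in> lhom BB (FF X) (FF (Y s))" using F_map[OF X Ym] i by blast
    show "\<forall>s<n. post (r s) \<in> lhom BB (FF (Y s)) (FF X)" using F_map[OF Ym X] r by blast
    show "\<forall>u\<in>carrier (FF X). u = msum (FF X) (\<lambda>s. post (r s) (post (i s) u)) n"
    proof
      fix u assume "u \<in> carrier (FF X)"
      then have u: "u \<in> mhom A C X" by simp
      show "u = msum (FF X) (\<lambda>s. post (r s) (post (i s) u)) n"
      proof (rule F_msum_eq[OF X _ u])
        show "post (r s) (post (i s) u) \<in> mhom A C X" if "s < n" for s
          using mhom_comp[OF mod_C mhom_comp[OF mod_C u i[rule_format, OF that]] r[rule_format, OF that]] .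
        fix x assume x: "x \<in> carrier C"
        have "u x = msum X (\<lambda>s. r s (i s (u x))) n" using bspec[OF eq mhom_closed[OF u x]] .
        then show "u x = msum X (\<lambda>s. post (r s) (post (i s) u) x) n" using x by (simp add: compose_def)
      qed
    qed
  qed
qed

text \<open>A dual basis of Hom(C, X) over \<open>B\<close>: the maps from C to \<open>X\<close> in
  the \<open>addr\<close> decomposition are the elements \<open>\<rho> s\<close>, the maps from
  \<open>X\<close> to C give the coordinates \<open>\<iota> s\<close>. The link between
  \<open>\<iota> s\<close> and \<open>i s\<close> is recorded for \<open>F_full\<close>.\<close>

lemma F_expand:
  assumes X: "lmod A X" and a: "addr A {C} X"
  obtains n \<iota> \<rho> r i where "\<forall>s<(n::nat). \<iota> s \<in> lhom BB (FF X) (regular BB)" "\<forall>s<n. \<rho> s \<in> carrier (FF X)"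
    "\<forall>u\<in>carrier (FF X). u = msum (FF X) (\<lambda>s. \<iota> s u \<odot>\<^bsub>FF X\<^esub> \<rho> s) n"
    "\<forall>s<n. i s \<in> lhom A X C" "\<forall>s<n. \<forall>u\<in>carrier (FF X). \<iota> s u = post (i s) u"
proof -
  obtain n Y i r where Y: "\<forall>s<(n::nat). Y s \<in> {C}" and i0: "\<forall>s<n. i s \<in> lhom A X (Y s)"
    and r0: "\<forall>s<n. r s \<in> lhom A (Y s) X" and eq: "\<forall>m\<in>carrier X. m = msum X (\<lambda>s. r s (i s m)) n"
    by (rule addrE[OF a])
  have i: "i s \<in> lhom A X C" and r: "r s \<in> lhom A C X" if "s < n" for s using Y i0 r0 that by auto
  show thesis
  proof (rule that[of n "\<lambda>s u. post (i s) u" "\<lambda>s. restrict (r s) (carrier C)" i])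
    show "\<forall>s<n. post (i s) \<in> lhom BB (FF X) (regular BB)"
    proof (intro allI impI)
      fix s assume s: "s < n"
      \<comment> \<open>\<open>FF C\<close> and \<open>regular BB\<close> have the same carrier,
        addition and action, although they are built differently.\<close>
      have *: "f \<in> lhom BB (FF X) (regular BB)" if "f \<in> lhom BB (FF X) (FF C)" for f using that by (auto simp: lhom_def)
      show "post (i s) \<in> lhom BB (FF X) (regular BB)" by (rule *[OF F_map[OF X mod_C i[OF s]]])
    qed
    show \<rho>: "\<forall>s<n. restrict (r s) (carrier C) \<in> carrier (FF X)" using lhom_mhom[OF mod_C r] by simp
    show "\<forall>u\<in>carrier (FF X). u = msum (FF X) (\<lambda>s. post (i s) u \<odot>\<^bsub>FF X\<^esub> restrict (r s) (carrier C)) n"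
    proof
      fix u assume "u \<in> carrier (FF X)"
      then have u: "u \<in> mhom A C X" by simp
      show "u = msum (FF X) (\<lambda>s. post (i s) u \<odot>\<^bsub>FF X\<^esub> restrict (r s) (carrier C)) n"
      proof (rule F_msum_eq[OF X _ u])
        fix s assume s: "s < n"
        have iu: "post (i s) u \<in> mhom A C C" by (rule mhom_comp[OF mod_C u i[OF s]])
        show "post (i s) u \<odot>\<^bsub>FF X\<^esub> restrict (r s) (carrier C) \<in> mhom A C X"
          using mhom_comp[OF mod_C iu mhom_lhom[OF lhom_mhom[OF mod_C r[OF s]]]] by simp
      next
        fix x assume x: "x \<in> carrier C"
        have ux: "u x \<in> carrier X" by (rule mhom_closed[OF u x])
        have "u x = msum X (\<lambda>s. r s (i s (u x))) n" by (rule bspec[OF eq ux])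
        also have "\<dots> = msum X (\<lambda>s. (post (i s) u \<odot>\<^bsub>FF X\<^esub> restrict (r s) (carrier C)) x) n"
          by (rule msum_cong) (use x lhom_in[OF i ux] in \<open>simp add: compose_def\<close>)
        finally show "u x = msum X (\<lambda>s. (post (i s) u \<odot>\<^bsub>FF X\<^esub> restrict (r s) (carrier C)) x) n" .
      qed
    qed
  qed (use i in auto)
qed

lemma F_fg:
  assumes X: "lmod A X" and a: "addr A {C} X"
  shows "fgm BB (FF X)"
proof -
  obtain n \<iota> \<rho> i where \<iota>: "\<forall>s<(n::nat). \<iota> s \<in> lhom BB (FF X) (regular BB)" and \<rho>: "\<forall>s<n. \<rho> s \<in> carrier (FF X)"
    and eq: "\<forall>u\<in>carrier (FF X). u = msum (FF X) (\<lambda>s. \<iota> s u \<odot>\<^bsub>FF X\<^esub> \<rho> s) n"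
    and "\<forall>s<n. i s \<in> lhom A X C" "\<forall>s<n. \<forall>u\<in>carrier (FF X). \<iota> s u = post (i s) u"
    by (rule F_expand[OF X a])
  interpret F: left_module BB "FF X" by (rule F_module[OF X])
  have "gens BB (FF X) (\<rho> ` {..<n})" unfolding gens_def
  proof (intro conjI allI impI subsetI)
    fix T u assume T: "submod BB (FF X) T" "\<rho> ` {..<n} \<subseteq> T" and u: "u \<in> carrier (FF X)"
    have "\<iota> s u \<odot>\<^bsub>FF X\<^esub> \<rho> s \<in> T" if s: "s < n" for s
    proof -
      have "\<iota> s u \<in> carrier BB" using lhom_in[OF \<iota>[rule_format, OF s] u] by simp
      moreover have "\<rho> s \<in> T" using T(2) s by blast
      ultimately show ?thesis using T(1) unfolding submod_def by blast
    qed
    then have "msum (FF X) (\<lambda>s. \<iota> s u \<odot>\<^bsub>FF X\<^esub> \<rho> s) n \<in> T" by (rule F.submod_msum[OF T(1)])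
    then show "u \<in> T" using bspec[OF eq u] by simp
  qed (use \<rho> in auto)
  then show ?thesis by (rule fg_moduleI[OF F_module[OF X]])
qed

text \<open>The dual basis defines the lift: \<open>u\<close> goes to the sum of the
  \<open>\<iota> s u\<close> acting on preimages \<open>m s\<close> of
  \<open>f (\<rho> s)\<close>.\<close>

lemma F_projective:
  assumes X: "lmod A X" and a: "addr A {C} X"
  shows "projective BB (FF X)" unfolding projective_def
proof (intro conjI allI impI F_fg[OF X a])
  fix M :: "('k, 'c \<Rightarrow> 'c) umodule" and N :: "('k, 'c \<Rightarrow> 'c) umodule" and g f
  assume "fgm BB M \<and> fgm BB N \<and> g \<in> mhom BB M N \<and> g ` carrier M = carrier N \<and> f \<in> mhom BB (FF X) N"
  then have M: "lmod BB M" and N: "lmod BB N" and g: "g \<in> lhom BB M N" and s: "g ` carrier M = carrier N"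
    and f: "f \<in> mhom BB (FF X) N" and fl: "f \<in> lhom BB (FF X) N" using mhom_lhom fg_left by auto
  obtain n \<iota> \<rho> i where \<iota>: "\<forall>s<(n::nat). \<iota> s \<in> lhom BB (FF X) (regular BB)" and \<rho>: "\<forall>s<n. \<rho> s \<in> carrier (FF X)"
    and eq: "\<forall>u\<in>carrier (FF X). u = msum (FF X) (\<lambda>s. \<iota> s u \<odot>\<^bsub>FF X\<^esub> \<rho> s) n"
    and "\<forall>s<n. i s \<in> lhom A X C" "\<forall>s<n. \<forall>u\<in>carrier (FF X). \<iota> s u = post (i s) u"
    by (rule F_expand[OF X a])
  interpret M: left_module BB M by fact
  have FX: "lmod BB (FF X)" by (rule F_module[OF X])
  interpret F: left_module BB "FF X" by fact
  have "\<forall>s. \<exists>m. s < n \<longrightarrow> m \<in> carrier M \<and> g m = f (\<rho> s)"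
  proof
    fix s
    show "\<exists>m. s < n \<longrightarrow> m \<in> carrier M \<and> g m = f (\<rho> s)"
    proof (cases "s < n")
      case True
      then have "f (\<rho> s) \<in> carrier N" using \<rho> lhom_in[OF fl] by blast
      then have "f (\<rho> s) \<in> g ` carrier M" using s by simp
      then show ?thesis by (elim imageE) auto
    qed simp
  qed
  from choice[OF this] obtain m where m: "\<forall>s. s < n \<longrightarrow> m s \<in> carrier M \<and> g (m s) = f (\<rho> s)" by (elim exE)
  have \<iota>c: "\<iota> s u \<in> carrier BB" if "s < n" "u \<in> carrier (FF X)" for s u
    using lhom_in[OF \<iota>[rule_format, OF that(1)] that(2)] by simp
  have h: "(\<lambda>u. msum M (\<lambda>s. \<iota> s u \<odot>\<^bsub>M\<^esub> m s) n) \<in> lhom BB (FF X) M"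
  proof (rule lhom_msum_map[OF M])
    fix s assume s: "s < n"
    then have ms: "m s \<in> carrier M" using m by blast
    have "(\<lambda>b. b \<odot>\<^bsub>M\<^esub> m s) \<in> lhom BB (regular BB) M"
      by (rule lhomI) (use ms in \<open>auto simp: M.smult_l_distr M.smult_assoc simp del: EE_simps opp_simps\<close>)
    from lhom_o[OF \<iota>[rule_format, OF s] this] show "(\<lambda>u. \<iota> s u \<odot>\<^bsub>M\<^esub> m s) \<in> lhom BB (FF X) M" .
  qed
  have gh: "g (msum M (\<lambda>s. \<iota> s u \<odot>\<^bsub>M\<^esub> m s) n) = f u" if u: "u \<in> carrier (FF X)" for u
  proof -
    have "g (msum M (\<lambda>s. \<iota> s u \<odot>\<^bsub>M\<^esub> m s) n) = msum N (\<lambda>s. g (\<iota> s u \<odot>\<^bsub>M\<^esub> m s)) n"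
      by (rule lhom_msum[OF M N g]) (use m \<iota>c[OF _ u] in blast)
    also have "\<dots> = msum N (\<lambda>s. f (\<iota> s u \<odot>\<^bsub>FF X\<^esub> \<rho> s)) n"
    proof (rule msum_cong)
      fix s assume s: "s < n"
      then show "g (\<iota> s u \<odot>\<^bsub>M\<^esub> m s) = f (\<iota> s u \<odot>\<^bsub>FF X\<^esub> \<rho> s)"
        using lhom_smult[OF g \<iota>c[OF s u], of "m s"] lhom_smult[OF fl \<iota>c[OF s u], of "\<rho> s"] m \<rho> by simp
    qed
    also have "\<dots> = f (msum (FF X) (\<lambda>s. \<iota> s u \<odot>\<^bsub>FF X\<^esub> \<rho> s) n)"
      by (rule lhom_msum[OF FX N fl, symmetric]) (use \<rho> \<iota>c[OF _ u] F.smult_closed in blast)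
    also have "\<dots> = f u" using bspec[OF eq u] by simp
    finally show ?thesis .
  qed
  let ?h = "restrict (\<lambda>u. msum M (\<lambda>s. \<iota> s u \<odot>\<^bsub>M\<^esub> m s) n) (carrier (FF X))"
  have "compose (carrier (FF X)) g ?h = f"
  proof (rule extensionalityI[of _ "carrier (FF X)"])
    show "f \<in> extensional (carrier (FF X))" using f by (auto simp: mhom_def PiE_def)
    show "compose (carrier (FF X)) g ?h u = f u" if "u \<in> carrier (FF X)" for u
      using gh[OF that] that by (simp add: compose_def del: FF_simps)
  qed simp
  then show "\<exists>h\<in>mhom BB (FF X) M. compose (carrier (FF X)) g h = f" by (rule bexI[OF _ lhom_mhom[OF FX h]])
qed

text \<open>The values of \<open>\<phi>\<close> on the dual basis dictate the map:
  \<open>f x\<close> is the sum of the \<open>\<phi> (\<rho> s) (i s x)\<close>. In this way maps of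
  \<open>B\<close>-modules are brought back to \<open>A\<close>-modules.\<close>

lemma F_full:
  assumes X: "lmod A X" and a: "addr A {C} X" and Y: "lmod A Y" and \<phi>: "\<phi> \<in> lhom BB (FF X) (FF Y)"
  obtains f where "f \<in> lhom A X Y" "\<forall>u\<in>carrier (FF X). \<phi> u = post f u"
proof -
  obtain n \<iota> \<rho> i where \<iota>: "\<forall>s<(n::nat). \<iota> s \<in> lhom BB (FF X) (regular BB)" and \<rho>: "\<forall>s<n. \<rho> s \<in> carrier (FF X)"
    and eq: "\<forall>u\<in>carrier (FF X). u = msum (FF X) (\<lambda>s. \<iota> s u \<odot>\<^bsub>FF X\<^esub> \<rho> s) n"
    and i: "\<forall>s<n. i s \<in> lhom A X C" and \<iota>i: "\<forall>s<n. \<forall>u\<in>carrier (FF X). \<iota> s u = post (i s) u"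
    by (rule F_expand[OF X a])
  have FX: "lmod BB (FF X)" and FY: "lmod BB (FF Y)" using F_module X Y by auto
  interpret F: left_module BB "FF X" by fact
  have \<iota>c: "\<iota> s u \<in> carrier BB" if "s < n" "u \<in> carrier (FF X)" for s u
    using lhom_in[OF \<iota>[rule_format, OF that(1)] that(2)] by simp
  have \<phi>\<rho>: "\<phi> (\<rho> s) \<in> mhom A C Y" if "s < n" for s using lhom_in[OF \<phi>] \<rho> that by simp
  let ?f = "\<lambda>x. msum Y (\<lambda>s. \<phi> (\<rho> s) (i s x)) n"
  have "?f \<in> lhom A X Y" by (rule lhom_msum_map[OF Y]) (use lhom_o[OF _ mhom_lhom[OF \<phi>\<rho>]] i in blast)
  moreover have "\<phi> u = post ?f u" if u: "u \<in> carrier (FF X)" for u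
  proof -
    have um: "u \<in> mhom A C X" using u by simp
    have ip: "\<iota> s u \<odot>\<^bsub>FF Y\<^esub> \<phi> (\<rho> s) = \<phi> (\<iota> s u \<odot>\<^bsub>FF X\<^esub> \<rho> s)" if s: "s < n" for s
      using lhom_smult[OF \<phi> \<iota>c[OF s u], of "\<rho> s"] \<rho> s by simp
    have cl: "\<iota> s u \<odot>\<^bsub>FF X\<^esub> \<rho> s \<in> carrier (FF X)" if s: "s < n" for s
      using \<rho> s \<iota>c[OF s u] F.smult_closed by blast
    have cl': "\<phi> (\<iota> s u \<odot>\<^bsub>FF X\<^esub> \<rho> s) \<in> mhom A C Y" if s: "s < n" for s
      using lhom_in[OF \<phi> cl[OF s]] by simp
    have e1: "\<phi> u = msum (FF Y) (\<lambda>s. \<phi> (\<iota> s u \<odot>\<^bsub>FF X\<^esub> \<rho> s)) n"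
      using trans[OF arg_cong[OF bspec[OF eq u], of \<phi>]
          lhom_msum[OF FX FY \<phi>, of n "\<lambda>s. \<iota> s u \<odot>\<^bsub>FF X\<^esub> \<rho> s", OF cl]] .
    show "\<phi> u = post ?f u"
    proof (rule mhom_ext)
      show "\<phi> u \<in> mhom A C Y" using lhom_in[OF \<phi> u] by simp
      show "post ?f u \<in> mhom A C Y" by (rule mhom_comp[OF mod_C um \<open>?f \<in> lhom A X Y\<close>])
      fix x assume x: "x \<in> carrier C"
      have "\<phi> u x = msum Y (\<lambda>s. \<phi> (\<iota> s u \<odot>\<^bsub>FF X\<^esub> \<rho> s) x) n"
        using F_msum[OF Y cl' x] e1 by simp
      also have "\<dots> = ?f (u x)"
      proof (rule msum_cong)
        fix s assume s: "s < n"
        have "\<phi> (\<iota> s u \<odot>\<^bsub>FF X\<^esub> \<rho> s) x = (\<iota> s u \<odot>\<^bsub>FF Y\<^esub> \<phi> (\<rho> s)) x" using ip[OF s] by simp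
        also have "\<dots> = \<phi> (\<rho> s) (i s (u x))" using \<iota>i u s x by (simp add: compose_def)
        finally show "\<phi> (\<iota> s u \<odot>\<^bsub>FF X\<^esub> \<rho> s) x = \<phi> (\<rho> s) (i s (u x))" .
      qed
      finally show "\<phi> u x = post ?f u x" using x by (simp add: compose_def)
    qed
  qed
  ultimately show thesis by (intro that[of ?f]) auto
qed

section \<open>The dual of C and its projective resolution\<close>

abbreviation DDC where "DDC \<equiv> dual_over_End K A C"

lemma over_End_module: "lmod EE (over_End C)"
proof -
  interpret C: left_module A C by (rule mod_C)
  have ab: "abelian_group (over_End C)" by (rule abelian_group_cong[OF C.M.abelian_group_axioms]) (simp_all add: over_End_def)
  show ?thesis by (rule left_moduleI[OF E.ring_A ab])
      (auto simp: over_End_def compose_def mhom_closed lhom_add[OF mhom_lhom])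
qed

lemma DDC_module: "lmod BB DDC" unfolding dual_over_End_def by (rule E.dual_module[OF over_End_module])

lemma DDC_simps [simp]:
  "\<phi> \<oplus>\<^bsub>DDC\<^esub> \<psi> = (\<lambda>x\<in>carrier C. \<phi> x \<oplus>\<^bsub>K\<^esub> \<psi> x)" "b \<odot>\<^bsub>DDC\<^esub> \<phi> = (\<lambda>x\<in>carrier C. \<phi> (b x))"
  by (simp_all add: dual_over_End_def dual_def over_End_def)

lemma DDC_carrier: "\<phi> \<in> carrier DDC \<longleftrightarrow> \<phi> \<in> extensional (carrier C) \<and> \<phi> \<in> lhom K (kspace A C) (regular K)"
proof -
  have "lhom K (kspace EE (over_End C)) (regular K) = lhom K (kspace A C) (regular K)"
  proof -
    have "(c \<odot>\<^bsub>EE\<^esub> one EE) x = (c \<odot>\<^bsub>A\<^esub> one A) \<odot>\<^bsub>C\<^esub> x" if "x \<in> carrier C" for c x using that by simp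
    then show ?thesis by (auto simp: lhom_def kspace_def over_End_def simp del: EE_simps)
  qed
  moreover have "carrier (over_End C) = carrier C" by (simp add: over_End_def)
  ultimately show ?thesis unfolding dual_over_End_def E.dual_carrier by simp
qed

text \<open>The adjunction \<open>hat\<close> for the module C, now linear over \<open>B\<close>: a
  map from C to \<open>D A\<close> corresponds to the functional obtained by evaluation at
  \<open>one A\<close>.\<close>

lemma F_DA_iso:
  "mod_iso BB (FF DA) DDC (\<lambda>u. \<lambda>x\<in>carrier C. u x (one A)) (\<lambda>\<phi>. restrict (hat C \<phi>) (carrier C))"
  unfolding mod_iso_def
proof (intro conjI ballI)
  interpret C: left_module A C by (rule mod_C)
  have FD: "lmod BB (FF DA)" by (rule F_module[OF DA_module])
  show \<Phi>: "(\<lambda>u. \<lambda>x\<in>carrier C. u x (one A)) \<in> lhom BB (FF DA) DDC"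
  proof (rule lhomI)
    fix u assume "u \<in> carrier (FF DA)"
    then have u: "u \<in> mhom A C DA" by simp
    have "(\<lambda>x. u x (one A)) \<in> lhom K (kspace A C) (regular K)" by (rule lhom_DA_functional(1)[OF mod_C mhom_lhom[OF u]])
    then have "(\<lambda>x\<in>carrier C. u x (one A)) \<in> lhom K (kspace A C) (regular K)"
      by (rule lhom_cong[OF _ kspace_module[OF mod_C]]) simp
    then show "(\<lambda>x\<in>carrier C. u x (one A)) \<in> carrier DDC" unfolding DDC_carrier by simp
  next
    fix b u assume "b \<in> carrier BB"
    then have b: "b \<in> mhom A C C" by simp
    show "(\<lambda>x\<in>carrier C. (b \<odot>\<^bsub>FF DA\<^esub> u) x (one A)) = b \<odot>\<^bsub>DDC\<^esub> (\<lambda>x\<in>carrier C. u x (one A))"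
      by (rule ext) (simp add: compose_def restrict_def mhom_closed[OF b])
  qed (simp add: restrict_def fun_eq_iff)
  have \<Psi>c: "restrict (hat C \<phi>) (carrier C) \<in> mhom A C DA" if "\<phi> \<in> carrier DDC" for \<phi>
    using lhom_mhom[OF mod_C lhom_hat[OF mod_C]] that unfolding DDC_carrier by blast
  show \<Psi>\<Phi>: "restrict (hat C (\<lambda>x\<in>carrier C. u x (one A))) (carrier C) = u" if "u \<in> carrier (FF DA)" for u
  proof (rule mhom_ext)
    show u: "u \<in> mhom A C DA" using that by simp
    show "restrict (hat C (\<lambda>x\<in>carrier C. u x (one A))) (carrier C) \<in> mhom A C DA"
      by (rule \<Psi>c[OF lhom_in[OF \<Phi> that]])
    fix x assume x: "x \<in> carrier C"
    have "hat C (\<lambda>x\<in>carrier C. u x (one A)) x a = u x a" for a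
    proof (cases "a \<in> carrier A")
      case True
      then show ?thesis using lhom_DA_functional(2)[OF mod_C mhom_lhom[OF u] x True] x by (simp add: hat_def)
    next
      case False
      then show ?thesis using mhom_closed[OF u x] by (auto simp: hat_def DA_carrier extensional_def)
    qed
    then show "restrict (hat C (\<lambda>x\<in>carrier C. u x (one A))) (carrier C) x = u x" using x by auto
  qed
  show \<Phi>\<Psi>: "(\<lambda>x\<in>carrier C. restrict (hat C \<phi>) (carrier C) x (one A)) = \<phi>" if "\<phi> \<in> carrier DDC" for \<phi>
    using that unfolding DDC_carrier by (auto simp: hat_def fun_eq_iff extensional_def)
  show "(\<lambda>\<phi>. restrict (hat C \<phi>) (carrier C)) \<in> lhom BB DDC (FF DA)"
  proof -
    have b: "bij_betw (\<lambda>u. \<lambda>x\<in>carrier C. u x (one A)) (carrier (FF DA)) (carrier DDC)"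
      by (rule bij_betwI[of _ _ _ "\<lambda>\<phi>. restrict (hat C \<phi>) (carrier C)"])
        (use lhom_in[OF \<Phi>] \<Psi>c \<Psi>\<Phi> \<Phi>\<Psi> in auto)
    have "inv_into (carrier (FF DA)) (\<lambda>u. \<lambda>x\<in>carrier C. u x (one A)) \<phi> = restrict (hat C \<phi>) (carrier C)"
      if \<phi>: "\<phi> \<in> carrier DDC" for \<phi>
      by (rule inv_into_f_eq[OF bij_betw_imp_inj_on[OF b]]) (use \<Psi>c[OF \<phi>] \<Phi>\<Psi>[OF \<phi>] in auto)
    then show ?thesis by (intro lhom_cong[OF lhom_inverse[OF FD \<Phi> b] DDC_module]) simp
  qed
qed

end

text \<open>Moves exactness at \<open>Y\<close> to copies of \<open>X\<close> and \<open>Y\<close>;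
  of the comparison \<open>h\<close> in the third position only the kernel matters.\<close>

lemma mod_iso_exact:
  assumes X: "mod_iso R X X' a a'" and Y: "mod_iso R Y Y' b b'" and ex: "f ` carrier X = {y \<in> carrier Y. g y = zero Z}"
    and gc: "\<And>y. y \<in> carrier Y \<Longrightarrow> g y \<in> carrier Z" and h: "\<And>z. z \<in> carrier Z \<Longrightarrow> h z = zero Z' \<longleftrightarrow> z = zero Z"
  shows "(\<lambda>x. b (f (a' x))) ` carrier X' = {y \<in> carrier Y'. h (g (b' y)) = zero Z'}"
proof -
  note x = mod_isoD[OF X] and y = mod_isoD[OF Y]
  have "a' ` carrier X' = carrier X" using mod_isoD(7)[OF mod_iso_sym[OF X]] by (simp add: bij_betw_def)
  moreover have "(\<lambda>x. b (f (a' x))) ` carrier X' = b ` f ` a' ` carrier X'" by (simp only: image_image)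
  ultimately have "(\<lambda>x. b (f (a' x))) ` carrier X' = b ` (f ` carrier X)" by simp
  also have "\<dots> = b ` {y \<in> carrier Y. g y = zero Z}" by (simp add: ex)
  also have "\<dots> = {y \<in> carrier Y'. h (g (b' y)) = zero Z'}"
  proof (intro equalityI subsetI)
    fix z assume "z \<in> b ` {y \<in> carrier Y. g y = zero Z}"
    then obtain v where v: "v \<in> carrier Y" "g v = zero Z" "z = b v" by auto
    then show "z \<in> {y \<in> carrier Y'. h (g (b' y)) = zero Z'}" using y(3,5) h[of "g v"] gc[OF v(1)] by simp
  next
    fix z assume "z \<in> {y \<in> carrier Y'. h (g (b' y)) = zero Z'}"
    then have z: "z \<in> carrier Y'" "h (g (b' z)) = zero Z'" by auto
    then have "g (b' z) = zero Z" using h gc y(6) by simp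
    then show "z \<in> b ` {y \<in> carrier Y. g y = zero Z}" using y(4,6) z(1) by (intro image_eqI[of _ _ "b' z"]) auto
  qed
  finally show ?thesis .
qed

lemma mod_iso_zero_iff:
  assumes "mod_iso R M N \<phi> \<psi>" "lmod R M" "lmod R N" "z \<in> carrier M"
  shows "\<phi> z = zero N \<longleftrightarrow> z = zero M"
proof
  assume "\<phi> z = zero N"
  then have "\<psi> (\<phi> z) = zero M" using lhom_zero[OF assms(3,2) mod_isoD(2)[OF assms(1)]] by simp
  then show "z = zero M" using mod_isoD(3)[OF assms(1) assms(4)] by simp
qed (use lhom_zero[OF assms(2,3) mod_isoD(1)[OF assms(1)]] in simp)

lemma (in endo) F_exact:
  assumes X: "lmod A X" and Y: "lmod A Y" and Z: "lmod A Z" and f: "f \<in> lhom A X Y" and g: "g \<in> lhom A Y Z"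
    and gf: "\<And>x. x \<in> carrier X \<Longrightarrow> g (f x) = zero Z" and hr: "hexr A C X f Y g Z"
  shows "post f ` carrier (FF X) = {u \<in> carrier (FF Y). post g u = zero (FF Z)}"
proof (intro equalityI subsetI)
  fix v assume "v \<in> post f ` carrier (FF X)"
  then obtain u where u: "u \<in> mhom A C X" "v = post f u" by auto
  have "post g v = (\<lambda>x\<in>carrier C. zero Z)" by (rule ext) (simp add: u(2) compose_def restrict_def gf[OF mhom_closed[OF u(1)]])
  then show "v \<in> {u \<in> carrier (FF Y). post g u = zero (FF Z)}" using mhom_comp[OF mod_C u(1) f] u(2) by simp
next
  fix v assume "v \<in> {u \<in> carrier (FF Y). post g u = zero (FF Z)}"
  then have v: "v \<in> mhom A C Y" and gv: "post g v = (\<lambda>x\<in>carrier C. zero Z)" by auto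
  have "g (v a) = zero Z" if "a \<in> carrier C" for a using fun_cong[OF gv, of a] that by (simp add: compose_def)
  then obtain w where w: "w \<in> lhom A C X" "\<forall>a\<in>carrier C. v a = f (w a)" by (rule hexrD[OF hr mhom_lhom[OF v]])
  have wm: "restrict w (carrier C) \<in> mhom A C X" by (rule lhom_mhom[OF mod_C w(1)])
  have "v = post f (restrict w (carrier C))"
    by (rule mhom_ext[OF v mhom_comp[OF mod_C wm f]]) (use w(2) in \<open>simp add: compose_def\<close>)
  then show "v \<in> post f ` carrier (FF X)" using wm by (intro image_eqI[of _ _ "restrict w (carrier C)"]) simp_all
qed

sublocale coshift \<subseteq> endo K A C by (rule endo.intro[OF fdalg_axioms endo_axioms.intro[OF fgC]])

context coshift_res begin

text \<open>Hom(C, -) applied to the cotilting sequence: it stays exact because positive Ext of C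
  into \<open>c k\<close> vanishes, its terms are projective because the \<open>c i\<close> lie in
  add C, and it ends in Hom(C, D A), which is DC. The last clause says that positive Ext of DC into
  Hom(C, Q) vanishes; it rests on fullness over add C and on injectivity of
  \<open>Q\<close>.\<close>

lemma resolution_DC:
  obtains p dp ep \<alpha> \<beta> where "proj_resolution BB p dp ep DDC" "\<forall>i>k. zero_module (p i)"
    "\<forall>i\<le>k. mod_iso BB (FF (c i)) (p i) (\<alpha> i) (\<beta> i)" "\<forall>n. hexl_at BB p dp n (FF Q)"
proof -
  \<comment> \<open>\<open>c k\<close> and its resolution \<open>J\<close> as one exact sequence, so
    that the position of \<open>c k\<close> is treated like the others.\<close>
  define W where "W = (\<lambda>i. case i of 0 \<Rightarrow> c k | Suc i \<Rightarrow> J i)"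
  define \<theta> where "\<theta> = (\<lambda>i. case i of 0 \<Rightarrow> \<eta> | Suc i \<Rightarrow> \<delta> i)"
  have W0 [simp]: "W 0 = c k" "\<theta> 0 = \<eta>" "W (Suc i) = J i" "\<theta> (Suc i) = \<delta> i" for i
    by (simp_all add: W_def \<theta>_def)
  have Wc: "W i = c (k - i)" if "i \<le> k" for i using that Jc by (cases i) auto
  have Wfg: "fgm A (W i)" for i by (cases i) (auto simp: j(7) j(8))
  have \<theta>l: "\<theta> i \<in> lhom A (W i) (W (Suc i))" for i by (cases i) (auto simp: j(2) j(3))
  have \<theta>\<theta>: "\<theta> (Suc i) (\<theta> i x) = zero (W (Suc (Suc i)))" if "x \<in> carrier (W i)" for i x
    using that j(4,5) by (cases i) auto
  have exW: "\<theta> i ` carrier (W i) = {x \<in> carrier (W (Suc i)). \<theta> (Suc i) x = zero (W (Suc (Suc i)))}" for i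
    using j(11,12) by (cases i) auto
  have hexW: "hexr_at A C W \<theta> i" for i
  proof (cases i)
    case 0
    then show ?thesis using hexr_left_exact[OF modC j(9) j(1) j(3) j(10) j(11)] by simp
  next
    case (Suc n)
    then show ?thesis using rigid_c(3)[OF fgC addr_refl[OF modC], of n] by simp
  qed
  have \<eta>0: "x = zero (c k)" if "x \<in> carrier (c k)" "\<eta> x = zero (J 0)" for x
    using that j(10)[unfolded lhom_inj_iff[OF j(9) j(1) j(3)]] by blast
  \<comment> \<open>Back to the descending numbering of \<open>c\<close>, with the zero module
    \<open>c (Suc k)\<close> repeated; \<open>D\<close> is \<open>\<theta>\<close> read
    backwards.\<close>
  define X where "X i = (if i \<le> k then c i else c (Suc k))" for i
  define D where "D i = (if i < k then \<theta> (k - 1 - i) else (\<lambda>_. zero (X i)))" for i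
  have Xfg: "fgm A (X i)" for i by (auto simp: X_def intro: fgc)
  have Xm: "lmod A (X i)" for i by (rule fg_left[OF Xfg])
  have Xz: "zero_module (X i)" if "k < i" for i using that cz by (auto simp: X_def)
  have XC: "addr A {C} (X i)" for i
  proof (cases "i \<le> k")
    case True
    then show ?thesis using addrcC by (simp add: X_def)
  next
    case False
    then have "carrier (X i) = {zero (X i)}" using Xz by (simp add: zero_module_def)
    then show ?thesis unfolding addr_def by (intro exI[of _ 0]) simp
  qed
  have XW: "X (Suc i) = W (k - 1 - i)" "X i = W (Suc (k - 1 - i))" if "i < k" for i
  proof -
    have e: "k - (k - 1 - i) = Suc i" "k - Suc (k - 1 - i) = i" and l: "k - 1 - i \<le> k" "Suc (k - 1 - i) \<le> k" using that by auto
    show "X (Suc i) = W (k - 1 - i)" "X i = W (Suc (k - 1 - i))" unfolding Wc[OF l(1)] Wc[OF l(2)] e using that by (simp_all add: X_def)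
  qed
  have Dl: "D i \<in> lhom A (X (Suc i)) (X i)" for i
  proof (cases "i < k")
    case True
    then show ?thesis using \<theta>l[of "k - 1 - i"] XW[OF True] by (simp add: D_def del: W0)
  next
    case False
    then show ?thesis using lhom_const0[OF Xm] by (simp add: D_def)
  qed
  have step: "X (Suc (Suc i)) = W (k - 2 - i)" "X (Suc i) = W (Suc (k - 2 - i))" "X i = W (Suc (Suc (k - 2 - i)))"
    "D (Suc i) = \<theta> (k - 2 - i)" "D i = \<theta> (Suc (k - 2 - i))" if "Suc i < k" for i
  proof -
    have e: "k - 1 - Suc i = k - 2 - i" "k - 1 - i = Suc (k - 2 - i)" using that by auto
    have "D (Suc i) = \<theta> (k - 1 - Suc i)" "D i = \<theta> (k - 1 - i)" using that by (auto simp: D_def)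
    note x = this XW[OF that] XW[OF Suc_lessD[OF that]]
    show "X (Suc (Suc i)) = W (k - 2 - i)" "X (Suc i) = W (Suc (k - 2 - i))" "X i = W (Suc (Suc (k - 2 - i)))"
      "D (Suc i) = \<theta> (k - 2 - i)" "D i = \<theta> (Suc (k - 2 - i))" using x unfolding e by (simp_all only:)
  qed
  have last: "X (Suc i) = c k" "D i = \<eta>" "X i = J 0" "zero_module (X (Suc (Suc i)))" if "Suc i = k" for i
  proof -
    have "i < k" "k - 1 - i = 0" using that by auto
    then show "X (Suc i) = c k" "D i = \<eta>" "X i = J 0" "zero_module (X (Suc (Suc i)))"
      using XW[of i] Xz[of "Suc (Suc i)"] that by (simp_all add: D_def)
  qed
  have DD: "D i (D (Suc i) x) = zero (X i)" if x: "x \<in> carrier (X (Suc (Suc i)))" for i x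
  proof -
    consider "Suc i < k" | "Suc i \<ge> k" by linarith
    then show ?thesis
    proof cases
      case 1
      show ?thesis using \<theta>\<theta>[of x "k - 2 - i"] x unfolding step[OF 1] by simp
    next
      case 2
      then have "D (Suc i) x = zero (X (Suc i))" by (simp add: D_def)
      then show ?thesis using lhom_zero[OF Xm Xm Dl] by simp
    qed
  qed
  have exX: "{x \<in> carrier (X (Suc i)). D i x = zero (X i)} \<subseteq> D (Suc i) ` carrier (X (Suc (Suc i)))" for i
  proof -
    have D0: "zero (X (Suc i)) \<in> D (Suc i) ` carrier (X (Suc (Suc i)))"
      by (rule image_eqI) (rule lhom_zero[OF Xm Xm Dl, symmetric], rule lm_zero[OF Xm])
    consider "Suc i < k" | "Suc i = k" | "k < Suc i" by linarith
    then show ?thesis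
    proof cases
      case 1
      show ?thesis using exW[of "k - 2 - i"] unfolding step[OF 1] by simp
    next
      case 2
      have "{x \<in> carrier (X (Suc i)). D i x = zero (X i)} \<subseteq> {zero (X (Suc i))}"
        unfolding last(1-3)[OF 2] using \<eta>0 by blast
      then show ?thesis using D0 by blast
    next
      case 3
      then have "carrier (X (Suc i)) = {zero (X (Suc i))}" using Xz[of "Suc i"] by (simp add: zero_module_def)
      then show ?thesis using D0 by auto
    qed
  qed
  \<comment> \<open>For \<open>i = k - 1\<close> the module above \<open>c k\<close> is zero, and
    injectivity of \<open>\<eta>\<close> takes the place of vanishing Ext.\<close>
  have hexX: "hexr A C (X (Suc (Suc i))) (D (Suc i)) (X (Suc i)) (D i) (X i)" if i: "i < k" for i
  proof -
    consider "Suc i < k" | "Suc i = k" using i by linarith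
    then show ?thesis
    proof cases
      case 1
      show ?thesis using hexW[of "k - 2 - i"] unfolding step[OF 1] .
    next
      case 2
      show ?thesis
      proof (rule hexrI)
        fix u assume u: "u \<in> lhom A C (X (Suc i))" and uz: "\<And>a. a \<in> carrier C \<Longrightarrow> D i (u a) = zero (X i)"
        have "u a = zero (X (Suc i))" if "a \<in> carrier C" for a
          using \<eta>0[of "u a"] uz[OF that] lhom_in[OF u that] unfolding last(1-3)[OF 2] by blast
        then have "\<forall>a\<in>carrier C. u a = D (Suc i) (zero (X (Suc (Suc i))))" using lhom_zero[OF Xm Xm Dl] by simp
        then show "\<exists>u'. u' \<in> lhom A C (X (Suc (Suc i))) \<and> (\<forall>a\<in>carrier C. u a = D (Suc i) (u' a))"
          using lhom_const0[OF Xm] by (intro exI[of _ "\<lambda>_. zero (X (Suc (Suc i)))"]) blast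
      qed
    qed
  qed
  have k': "0 < k" "k - 1 - 0 = k - 1" "Suc (k - 1) = k" using k1 by auto
  have X0: "X (Suc 0) = W (k - 1)" "X 0 = W k" "D 0 = \<theta> (k - 1)" using XW[OF k'(1)] k' by (simp_all add: D_def del: W0)
  note iso = mod_isoD[OF JD]
  \<comment> \<open>\<open>\<theta> k\<close> runs from \<open>c 0\<close> to the copy
    \<open>J k\<close>; \<open>\<psi>\<close> returns to \<open>D A\<close> itself.\<close>
  define E0 where "E0 x = \<psi> (\<theta> k x)" for x
  have \<theta>k: "\<theta> k \<in> lhom A (X 0) (J k)" using \<theta>l[of k] X0 by simp
  have E0: "E0 \<in> lhom A (X 0) DA" unfolding E0_def by (rule lhom_o[OF \<theta>k iso(2)])
  have \<psi>0: "\<psi> z = zero DA \<longleftrightarrow> z = zero (J k)" if "z \<in> carrier (J k)" for z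
    by (rule mod_iso_zero_iff[OF mod_iso_sym[OF JD] j(1) DA_module that])
  have E0D: "E0 (D 0 x) = zero DA" if "x \<in> carrier (X (Suc 0))" for x
  proof -
    have "\<theta> k (D 0 x) = zero (J k)" using \<theta>\<theta>[of x "k - 1"] that X0 k'(3) by simp
    then show ?thesis unfolding E0_def using \<psi>0[of "zero (J k)"] lm_zero[OF j(1)] by simp
  qed
  have hexE0: "hexr A C (X (Suc 0)) (D 0) (X 0) E0 DA"
  proof (rule hexrI)
    fix u assume u: "u \<in> lhom A C (X 0)" and uz: "\<And>a. a \<in> carrier C \<Longrightarrow> E0 (u a) = zero DA"
    have h: "hexr A C (X (Suc 0)) (D 0) (X 0) (\<theta> k) (J k)" using hexW[of "k - 1"] X0 k'(3) by simp
    have "\<theta> k (u a) = zero (J k)" if a: "a \<in> carrier C" for a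
      using uz[OF a] \<psi>0 lhom_in[OF lhom_o[OF u \<theta>k] a] by (simp add: E0_def)
    then obtain u' where "u' \<in> lhom A C (X (Suc 0))" "\<forall>a\<in>carrier C. u a = D 0 (u' a)" by (rule hexrD[OF h u])
    then show "\<exists>u'. u' \<in> lhom A C (X (Suc 0)) \<and> (\<forall>a\<in>carrier C. u a = D 0 (u' a))" by blast
  qed
  \<comment> \<open>Surjectivity is the vanishing of Ext^k from C to \<open>c k\<close>, the term
    after \<open>J k\<close> being zero.\<close>
  have E0_onto: "post E0 ` carrier (FF (X 0)) = carrier (FF DA)"
  proof (intro equalityI subsetI)
    fix v assume "v \<in> carrier (FF DA)"
    then have v: "v \<in> mhom A C DA" by simp
    have \<phi>v: "(\<lambda>a. \<phi> (v a)) \<in> lhom A C (J k)" by (rule lhom_o[OF mhom_lhom[OF v] iso(1)])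
    have "\<theta> (Suc k) (\<phi> (v a)) = zero (W (Suc (Suc k)))" if "a \<in> carrier C" for a
      using lhom_in[OF lhom_o[OF \<phi>v j(2)] that] Jz[of "Suc k"] by (simp add: zero_module_def)
    moreover have "hexr A C (X 0) (\<theta> k) (J k) (\<theta> (Suc k)) (W (Suc (Suc k)))" using hexW[of k] X0 by simp
    ultimately obtain u where u: "u \<in> lhom A C (X 0)" "\<forall>a\<in>carrier C. \<phi> (v a) = \<theta> k (u a)"
      using hexrD[OF _ \<phi>v] by blast
    have um: "restrict u (carrier C) \<in> mhom A C (X 0)" by (rule lhom_mhom[OF modC u(1)])
    have "v = post E0 (restrict u (carrier C))"
    proof (rule mhom_ext[OF v mhom_comp[OF modC um E0]])
      fix a assume a: "a \<in> carrier C"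
      have "v a = \<psi> (\<phi> (v a))" using iso(3)[OF mhom_closed[OF v a]] by simp
      then show "v a = post E0 (restrict u (carrier C)) a" using u(2) a by (simp add: compose_def E0_def)
    qed
    then show "v \<in> post E0 ` carrier (FF (X 0))" using um by (intro image_eqI[of _ _ "restrict u (carrier C)"]) simp_all
  qed (use mhom_comp[OF modC _ E0] in auto)
  have FXm: "lmod BB (FF (X i))" for i by (rule F_module[OF Xm])
  have FDAm: "lmod BB (FF DA)" by (rule F_module[OF DA_module])
  \<comment> \<open>Resolutions consist of modules on \<open>nat \<Rightarrow> 'k\<close>, so a copy
    of each \<open>FF (X i)\<close> is chosen together with its isomorphism.\<close>
  have "\<forall>i. \<exists>t. case t of (U :: ('k, 'c \<Rightarrow> 'c) umodule, a, b) \<Rightarrow> fgm BB U \<and> mod_iso BB (FF (X i)) U a b"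
  proof
    fix i
    obtain U :: "('k, 'c \<Rightarrow> 'c) umodule" and a b where "fgm BB U" "mod_iso BB (FF (X i)) U a b"
      by (rule B.umodule_copy[OF F_fg[OF Xm XC]])
    then show "\<exists>t. case t of (U :: ('k, 'c \<Rightarrow> 'c) umodule, a, b) \<Rightarrow> fgm BB U \<and> mod_iso BB (FF (X i)) U a b"
      by (intro exI[of _ "(U, a, b)"]) simp
  qed
  from choice[OF this] obtain t where
    t: "\<forall>i. case t i of (U :: ('k, 'c \<Rightarrow> 'c) umodule, a, b) \<Rightarrow> fgm BB U \<and> mod_iso BB (FF (X i)) U a b" by (elim exE)
  define p where "p i = fst (t i)" for i
  define \<alpha> where "\<alpha> i = fst (snd (t i))" for i
  define \<beta> where "\<beta> i = snd (snd (t i))" for i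
  have pfg: "fgm BB (p i)" and pi: "mod_iso BB (FF (X i)) (p i) (\<alpha> i) (\<beta> i)" for i
    using spec[OF t, of i] by (auto simp: p_def \<alpha>_def \<beta>_def split: prod.splits)
  have pm: "lmod BB (p i)" for i by (rule fg_left[OF pfg])
  note pD = mod_isoD[OF pi]
  define dq where "dq i x = \<alpha> i (post (D i) (\<beta> (Suc i) x))" for i x
  let ?\<Phi> = "\<lambda>u. \<lambda>x\<in>carrier C. u x (one A)"
  define eq where "eq x = ?\<Phi> (post E0 (\<beta> 0 x))" for x
  note \<Phi> = mod_isoD[OF F_DA_iso]
  have FD: "post (D i) \<in> lhom BB (FF (X (Suc i))) (FF (X i))" for i by (rule F_map[OF Xm Xm Dl])
  have FE: "post E0 \<in> lhom BB (FF (X 0)) (FF DA)" by (rule F_map[OF Xm DA_module E0])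
  have dql: "dq i \<in> lhom BB (p (Suc i)) (p i)" for i unfolding dq_def by (rule lhom_o[OF lhom_o[OF pD(2) FD] pD(1)])
  have eql: "eq \<in> lhom BB (p 0) DDC" unfolding eq_def by (rule lhom_o[OF lhom_o[OF pD(2) FE] \<Phi>(1)])
  have eqs: "eq ` carrier (p 0) = carrier DDC"
  proof -
    have b: "\<beta> 0 ` carrier (p 0) = carrier (FF (X 0))"
      using mod_isoD(7)[OF mod_iso_sym[OF pi[of 0]]] by (simp add: bij_betw_def del: FF_simps)
    have "eq ` carrier (p 0) = ?\<Phi> ` (post E0 ` (\<beta> 0 ` carrier (p 0)))"
      unfolding image_image by (rule image_cong) (simp_all add: eq_def)
    also have "\<dots> = carrier DDC" unfolding b E0_onto using \<Phi>(7) by (simp add: bij_betw_def del: FF_simps)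
    finally show ?thesis .
  qed
  have pproj: "projective BB (p i)" for i
    by (rule B.addr_projective[where \<X> = "{FF (X i)}", OF pfg addr_iso[OF pm _ mod_iso_sym[OF pi]]]) (use F_projective[OF Xm XC] in auto)
  have pz: "zero_module (p i)" if "k < i" for i
  proof -
    have z: "carrier (X i) = {zero (X i)}" using Xz[OF that] by (simp add: zero_module_def)
    have "zero_module (FF (X i))"
    proof -
      have "u = (\<lambda>x\<in>carrier C. zero (X i))" if "u \<in> mhom A C (X i)" for u
        by (rule mhom_ext[OF that lhom_mhom[OF modC lhom_const0[OF Xm]]]) (use mhom_closed[OF that] z in auto)
      then have "mhom A C (X i) = {\<lambda>x\<in>carrier C. zero (X i)}"
        using lhom_mhom[OF modC lhom_const0[OF Xm]] by (intro equalityI subsetI) simp_all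
      then show ?thesis by (simp add: zero_module_def)
    qed
    then have "carrier (FF (X i)) = {zero (FF (X i))}" by (simp add: zero_module_def)
    moreover have "\<alpha> i ` carrier (FF (X i)) = carrier (p i)" using pD(7) by (simp add: bij_betw_def del: FF_simps)
    ultimately have "carrier (p i) = {\<alpha> i (zero (FF (X i)))}" by (simp del: FF_simps)
    then show ?thesis using lm_zero[OF pm, of i] by (auto simp: zero_module_def simp del: FF_simps)
  qed
  define dp where "dp i = restrict (dq i) (carrier (p (Suc i)))" for i
  have res: "proj_resolution BB p dp (restrict eq (carrier (p 0))) DDC" unfolding dp_def
  proof (rule B.proj_resolution_finite[where P = p and d = dq and k = k])
    show "fgm BB DDC" by (rule fg_image[OF pfg DDC_module eql eqs])
    show "dq 0 ` carrier (p 1) = {x \<in> carrier (p 0). eq x = zero DDC}" unfolding dq_def eq_def One_nat_def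
    proof (rule mod_iso_exact[where h = ?\<Phi> and g = "\<lambda>u. post E0 u" and Z = "FF DA"
          and f = "\<lambda>u. post (D 0) u", OF pi pi])
      show "post (D 0) ` carrier (FF (X (Suc 0))) =
        {u \<in> carrier (FF (X 0)). post E0 u = zero (FF DA)}"
        by (rule F_exact[OF Xm Xm DA_module Dl E0 E0D hexE0])
      show "post E0 y \<in> carrier (FF DA)" if "y \<in> carrier (FF (X 0))" for y by (rule lhom_in[OF FE that])
      show "?\<Phi> z = zero DDC \<longleftrightarrow> z = zero (FF DA)" if "z \<in> carrier (FF DA)" for z
        by (rule mod_iso_zero_iff[OF F_DA_iso FDAm DDC_module that])
    qed
    show "dq (Suc i) ` carrier (p (Suc (Suc i))) = {x \<in> carrier (p (Suc i)). dq i x = zero (p i)}" if i: "i < k" for i unfolding dq_def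
    proof (rule mod_iso_exact[where h = "\<alpha> i" and g = "\<lambda>u. post (D i) u" and Z = "FF (X i)"
          and f = "\<lambda>u. post (D (Suc i)) u", OF pi pi])
      show "(\<lambda>u. post (D (Suc i)) u) ` carrier (FF (X (Suc (Suc i)))) =
        {u \<in> carrier (FF (X (Suc i))). post (D i) u = zero (FF (X i))}"
        by (rule F_exact[OF Xm Xm Xm Dl Dl DD hexX[OF i]])
      show "post (D i) y \<in> carrier (FF (X i))" if "y \<in> carrier (FF (X (Suc i)))" for y by (rule lhom_in[OF FD that])
      show "\<alpha> i z = zero (p i) \<longleftrightarrow> z = zero (FF (X i))" if "z \<in> carrier (FF (X i))" for z
        by (rule mod_iso_zero_iff[OF pi FXm pm that])
    qed
  qed (use eql eqs dql pproj pm pz in auto)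
  have hl: "hexl_at BB p dp n (FF Q)" for n
  proof (rule hexlI)
    fix w assume w: "w \<in> lhom BB (p (Suc n)) (FF Q)"
      and wz: "\<And>x. x \<in> carrier (p (Suc (Suc n))) \<Longrightarrow> w (dp (Suc n) x) = zero (FF Q)"
    \<comment> \<open>Fullness turns the cocycle \<open>w\<close> into a map \<open>f\<close> of
      \<open>A\<close>-modules.\<close>
    obtain f where f: "f \<in> lhom A (X (Suc n)) Q" "\<forall>u\<in>carrier (FF (X (Suc n))). w (\<alpha> (Suc n) u) = post f u"
      by (rule F_full[OF Xm XC modQ lhom_o[OF pD(1) w]])
    have fDv: "f (D (Suc n) (v y)) = zero Q" if v: "v \<in> mhom A C (X (Suc (Suc n)))" and y: "y \<in> carrier C" for v y
    proof -
      have vF: "v \<in> carrier (FF (X (Suc (Suc n))))" using v by simp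
      have av: "\<alpha> (Suc (Suc n)) v \<in> carrier (p (Suc (Suc n)))" by (rule pD(5)[OF vF])
      have "dp (Suc n) (\<alpha> (Suc (Suc n)) v) = \<alpha> (Suc n) (post (D (Suc n)) v)"
        using av pD(3)[OF vF] by (simp add: dp_def dq_def)
      then have "w (\<alpha> (Suc n) (post (D (Suc n)) v)) = (\<lambda>x\<in>carrier C. zero Q)" using wz[OF av] by simp
      moreover have "post (D (Suc n)) v \<in> carrier (FF (X (Suc n)))" by (rule lhom_in[OF FD vF])
      ultimately have e: "post f (post (D (Suc n)) v) = (\<lambda>x\<in>carrier C. zero Q)" using f(2) by simp
      show ?thesis using fun_cong[OF e, of y] y by (simp add: compose_def)
    qed
    interpret Q: left_module A Q by (rule modQ)
    \<comment> \<open>So far \<open>f\<close> after \<open>D\<close> is known to vanish only on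
      values of maps from C. As the module lies in add C, each of its elements is a sum of such
      values.\<close>
    have fD: "f (D (Suc n) x) = zero Q" if x: "x \<in> carrier (X (Suc (Suc n)))" for x
    proof -
      obtain m Y i r where Y: "\<forall>s<(m::nat). Y s \<in> {C}" and i: "\<forall>s<m. i s \<in> lhom A (X (Suc (Suc n))) (Y s)"
        and r: "\<forall>s<m. r s \<in> lhom A (Y s) (X (Suc (Suc n)))"
        and e: "\<forall>x\<in>carrier (X (Suc (Suc n))). x = msum (X (Suc (Suc n))) (\<lambda>s. r s (i s x)) m"
        by (rule addrE[OF XC[of "Suc (Suc n)"]])
      have fDl: "(\<lambda>x. f (D (Suc n) x)) \<in> lhom A (X (Suc (Suc n))) Q" by (rule lhom_o[OF Dl f(1)])
      have rs: "r s \<in> lhom A C (X (Suc (Suc n)))" and isx: "i s x \<in> carrier C" if "s < m" for s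
        using Y i r that lhom_in[of "i s" A "X (Suc (Suc n))" C x] x by auto
      have "f (D (Suc n) x) = f (D (Suc n) (msum (X (Suc (Suc n))) (\<lambda>s. r s (i s x)) m))" using bspec[OF e x] by simp
      also have "\<dots> = msum Q (\<lambda>s. f (D (Suc n) (r s (i s x)))) m"
        by (rule lhom_msum[OF Xm modQ fDl]) (use lhom_in[OF rs isx] in blast)
      also have "\<dots> = zero Q"
      proof (rule Q.msum_zero)
        fix s assume s: "s < m"
        show "f (D (Suc n) (r s (i s x))) = zero Q" using fDv[OF lhom_mhom[OF modC rs[OF s]] isx[OF s]] isx[OF s] by simp
      qed
      finally show ?thesis .
    qed
    \<comment> \<open>Exactness at \<open>X (Suc n)\<close> and injectivity of \<open>Q\<close>
      factor \<open>f\<close> through \<open>D n\<close>.\<close>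
    obtain f' where f': "f' \<in> lhom A (X n) Q" "\<forall>x\<in>carrier (X (Suc n)). f x = f' (D n x)"
      by (rule hexlD[OF inj_hexl[OF injQ Xfg Xfg Xfg Dl exX] f(1)]) (rule fD)
    show "\<exists>w'. w' \<in> lhom BB (p n) (FF Q) \<and> (\<forall>y\<in>carrier (p (Suc n)). w y = w' (dp n y))"
    proof (intro exI conjI ballI)
      show "(\<lambda>y. post f' (\<beta> n y)) \<in> lhom BB (p n) (FF Q)" by (rule lhom_o[OF pD(2) F_map[OF Xm modQ f'(1)]])
      fix y assume y: "y \<in> carrier (p (Suc n))"
      have bF: "\<beta> (Suc n) y \<in> carrier (FF (X (Suc n)))" by (rule pD(6)[OF y])
      have bm: "\<beta> (Suc n) y \<in> mhom A C (X (Suc n))" using bF by simp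
      have "w y = w (\<alpha> (Suc n) (\<beta> (Suc n) y))" using pD(4)[OF y] by simp
      also have "\<dots> = post f (\<beta> (Suc n) y)" using f(2) bF by blast
      also have "\<dots> = post f' (post (D n) (\<beta> (Suc n) y))"
        by (rule ext) (simp add: compose_def restrict_def f'(2) mhom_closed[OF bm])
      also have "post (D n) (\<beta> (Suc n) y) = \<beta> n (dp n y)" using pD(3)[OF lhom_in[OF FD bF]] y by (simp add: dp_def dq_def)
      finally show "w y = post f' (\<beta> n (dp n y))" .
    qed
  qed
  show thesis
  proof (rule that[OF res])
    show "\<forall>i>k. zero_module (p i)" using pz by blast
    show "\<forall>i\<le>k. mod_iso BB (FF (c i)) (p i) (\<alpha> i) (\<beta> i)"
    proof (intro allI impI)
      fix i assume "i \<le> k"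
      then show "mod_iso BB (FF (c i)) (p i) (\<alpha> i) (\<beta> i)" using pi[of i] by (simp add: X_def)
    qed
    show "\<forall>n. hexl_at BB p dp n (FF Q)" using hl by blast
  qed
qed

end

section \<open>The tilting classes\<close>

context fdalg begin

text \<open>An injective module embeds in a power of \<open>D A\<close>, and the embedding
  splits.\<close>

lemma injective_addr_DA:
  assumes Q: "injective A Q"
  shows "addr A {DA} Q"
proof -
  have fQ: "fgm A Q" by (rule injective_fg[OF Q])
  have Qm: "lmod A Q" by (rule fg_left[OF fQ])
  obtain n f where f: "\<forall>i<(n::nat). f i \<in> lhom A Q DA" "{zero Q} = {m \<in> carrier Q. \<forall>i<n. f i m = zero DA}"
    by (rule DA_separates[OF fQ left_module.submod_zero[OF Qm]])
  obtain U :: "('k, 'a) umodule" and g where U: "in_add A DA U" "fgm A U" and g: "g \<in> lhom A Q U"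
    and ker: "{m \<in> carrier Q. g m = zero U} = {m \<in> carrier Q. \<forall>i<n. f i m = zero DA}"
    and "\<forall>i<n. \<exists>p\<in>lhom A U DA. \<forall>m\<in>carrier Q. f i m = p (g m)" by (rule tuple_kernel[OF fQ fg_DA f(1)])
  have Um: "lmod A U" by (rule fg_left[OF U(2)])
  have "\<forall>x\<in>carrier Q. g x = zero U \<longrightarrow> x = zero Q" using ker unfolding f(2)[symmetric] by blast
  then obtain h where h: "h \<in> lhom A U Q" "\<forall>x\<in>carrier Q. h (g x) = x" by (rule injective_lift[OF Q fQ U(2) g lhom_id])
  have "addr A {U} Q" by (rule addr_retract[OF Qm _ g h(1)]) (use h(2) in simp_all)
  then show ?thesis by (rule addr_trans[OF Qm, rotated]) (use Um in_add_addr[OF ring_A DA_module U(1)] in auto)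
qed

lemma Hom_into_submod:
  assumes X: "lmod A X" and Y: "lmod A Y" and S: "submod A Y S"
  shows "submod K (Hom A X Y) {f \<in> mhom A X Y. \<forall>x\<in>carrier X. f x \<in> S}" (is "submod K ?V ?T")
proof -
  interpret X: left_module A X by fact
  interpret V: left_module K ?V by (rule Hom_module[OF X Y])
  show ?thesis unfolding submod_def
  proof (intro conjI ballI)
    show "zero ?V \<in> ?T" using V.M.zero_closed S by (simp add: submod_def)
    fix f g assume fg: "f \<in> ?T" "g \<in> ?T"
    have "f \<oplus>\<^bsub>?V\<^esub> g \<in> carrier ?V" by (rule V.M.a_closed) (use fg in auto)
    then show "f \<oplus>\<^bsub>?V\<^esub> g \<in> ?T" using fg S by (simp add: submod_def)
  next
    fix c f assume c: "c \<in> carrier K" and f: "f \<in> ?T"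
    have "c \<odot>\<^bsub>?V\<^esub> f \<in> carrier ?V" by (rule V.smult_closed) (use c f in auto)
    then show "c \<odot>\<^bsub>?V\<^esub> f \<in> ?T" using c f S by (simp add: submod_def)
  qed auto
qed

text \<open>Finitely many maps generate the space of maps from \<open>X\<close> with image in
  \<open>S\<close>; their sum on a power of \<open>X\<close> has an image containing all images in
  question. Containment of images is the form in which \<open>pg_generates\<close> uses the
  approximation.\<close>

lemma right_approx:
  assumes Y: "fgm A Y" and X: "fgm A X" and S: "submod A Y S"
  obtains U :: "('k, 'a) umodule" and g where "in_add A X U" "fgm A U" "g \<in> lhom A U Y"
    "g ` carrier U \<subseteq> S" "\<forall>f\<in>lhom A X Y. f ` carrier X \<subseteq> S \<longrightarrow> f ` carrier X \<subseteq> g ` carrier U"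
proof -
  have Y': "lmod A Y" and X': "lmod A X" using Y X fg_left by auto
  let ?V = "Hom A X Y" and ?T = "\<lambda>S. {f \<in> mhom A X Y. \<forall>x\<in>carrier X. f x \<in> S}"
  note T = Hom_into_submod[OF X' Y']
  obtain G where G: "gens K (subm ?V (?T S)) G" using fg_moduleD(2)[OF fspace_fg_submod[OF field_K fg_Hom[OF X Y] T[OF S]]] by blast
  then obtain n and f :: "nat \<Rightarrow> _" where f: "G = f ` {i. i < n}"
    using finite_imp_nat_seg_image_inj_on[of G] by (auto simp: gens_def)
  have fT: "f i \<in> ?T S" if "i < n" for i using G f that by (auto simp: gens_def)
  have fl: "\<forall>i<n. f i \<in> lhom A X Y" using fT mhom_lhom by blast
  have fS: "\<forall>i<n. f i ` carrier X \<subseteq> S" using fT by blast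
  obtain U :: "('k, 'a) umodule" and g where U: "in_add A X U" "fgm A U" and g: "g \<in> lhom A U Y"
    and gS: "g ` carrier U \<subseteq> S" and fg: "\<forall>i<n. f i ` carrier X \<subseteq> g ` carrier U"
    by (rule cotuple_image[OF Y' X fl S fS])
  have Um: "lmod A U" by (rule fg_left[OF U(2)])
  have gU: "submod A Y (g ` carrier U)" by (rule submod_image[OF Um Y' g left_module.submod_carrier[OF Um]])
  have "submod K (subm ?V (?T S)) (?T (g ` carrier U))" using T[OF gU] gS unfolding submod_def by auto
  moreover have "G \<subseteq> ?T (g ` carrier U)" using f fT fg by blast
  ultimately have all: "?T S \<subseteq> ?T (g ` carrier U)" using G unfolding gens_def by simp
  show thesis
  proof (rule that[OF U g gS], intro ballI impI)
    fix h assume h: "h \<in> lhom A X Y" and hS: "h ` carrier X \<subseteq> S"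
    have "restrict h (carrier X) \<in> ?T S" using lhom_mhom[OF X' h] hS by auto
    then have "restrict h (carrier X) \<in> ?T (g ` carrier U)" using all by blast
    then show "h ` carrier X \<subseteq> g ` carrier U" by auto
  qed
qed

text \<open>A map out of \<open>X\<close> is a sum of maps factoring through \<open>P\<close>, so
  the test on \<open>P\<close> decides for all of add P.\<close>

lemma addr_image:
  assumes Y: "lmod A Y" and X: "lmod A X" and a: "addr A {P} X"
    and T: "submod A Y T" and PT: "\<forall>f\<in>lhom A P Y. f ` carrier P \<subseteq> S \<longrightarrow> f ` carrier P \<subseteq> T"
    and h: "h \<in> lhom A X Y" and hS: "h ` carrier X \<subseteq> S"
  shows "h ` carrier X \<subseteq> T"
proof (rule image_subsetI)
  interpret Y: left_module A Y by fact
  fix x assume x: "x \<in> carrier X"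
  obtain n Z i r where Z: "\<forall>s<(n::nat). Z s \<in> {P}" and i: "\<forall>s<n. i s \<in> lhom A X (Z s)"
    and r: "\<forall>s<n. r s \<in> lhom A (Z s) X" and e: "\<forall>x\<in>carrier X. x = msum X (\<lambda>s. r s (i s x)) n"
    by (rule addrE[OF a])
  have i': "i s \<in> lhom A X P" and r': "r s \<in> lhom A P X" if "s < n" for s using Z i r that by auto
  have "h (r s (i s x)) \<in> T" if s: "s < n" for s
  proof -
    have hr: "(\<lambda>y. h (r s y)) \<in> lhom A P Y" by (rule lhom_o[OF r'[OF s] h])
    have "(\<lambda>y. h (r s y)) ` carrier P \<subseteq> S" using hS lhom_in[OF r'[OF s]] by blast
    then have "(\<lambda>y. h (r s y)) ` carrier P \<subseteq> T" using mp[OF bspec[OF PT hr]] by blast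
    then show ?thesis using lhom_in[OF i'[OF s] x] by blast
  qed
  then have "msum Y (\<lambda>s. h (r s (i s x))) n \<in> T" by (rule Y.submod_msum[OF T])
  also have "msum Y (\<lambda>s. h (r s (i s x))) n = h (msum X (\<lambda>s. r s (i s x)) n)"
    by (rule lhom_msum[OF X Y h, symmetric]) (rule lhom_in[OF r' lhom_in[OF i' x]])
  also have "\<dots> = h x" using bspec[OF e x] by simp
  finally show "h x \<in> T" .
qed

lemma Hom_exact_projective:
  assumes P: "projective A P" and X: "fgm A X" "fgm A Y"
    and f: "f \<in> lhom A X Y" and ex: "f ` carrier X = {y \<in> carrier Y. g y = zero Z}"
  shows "(\<lambda>h. compose (carrier P) f h) ` mhom A P X =
     {h \<in> mhom A P Y. compose (carrier P) g h = (\<lambda>x\<in>carrier P. zero Z)}"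
proof (intro equalityI subsetI)
  have Pm: "lmod A P" by (rule fg_left[OF projective_fg[OF P]])
  fix h
  {
    assume "h \<in> (\<lambda>h. compose (carrier P) f h) ` mhom A P X"
    then obtain h' where h': "h' \<in> mhom A P X" "h = compose (carrier P) f h'" by blast
    note c = lhom_in[OF mhom_lhom[OF h'(1)]]
    have "h \<in> mhom A P Y" using lhom_mhom[OF Pm lhom_o[OF mhom_lhom[OF h'(1)] f]] by (simp add: h' compose_def)
    moreover have "g (f (h' x)) = zero Z" if "x \<in> carrier P" for x using ex c[OF that] by blast
    then have "compose (carrier P) g h = (\<lambda>x\<in>carrier P. zero Z)" by (auto simp: h' compose_def intro!: restrict_ext)
    ultimately show "h \<in> {h \<in> mhom A P Y. compose (carrier P) g h = (\<lambda>x\<in>carrier P. zero Z)}" by simp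
  next
    assume "h \<in> {h \<in> mhom A P Y. compose (carrier P) g h = (\<lambda>x\<in>carrier P. zero Z)}"
    then have hm: "h \<in> mhom A P Y" and hg: "compose (carrier P) g h = (\<lambda>x\<in>carrier P. zero Z)" by auto
    note hl = mhom_lhom[OF hm]
    have "g (h x) = zero Z" if "x \<in> carrier P" for x using fun_cong[OF hg, of x] that by (simp add: compose_def)
    then have "h ` carrier P \<subseteq> f ` carrier X" unfolding ex using lhom_in[OF hl] by auto
    then obtain w where w: "w \<in> lhom A P X" "\<forall>x\<in>carrier P. f (w x) = h x" by (rule projective_lift[OF P X f hl])
    have wm: "restrict w (carrier P) \<in> mhom A P X" by (rule lhom_mhom[OF Pm w(1)])
    have "h = compose (carrier P) f (restrict w (carrier P))"
    proof (rule mhom_ext[OF hm])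
      show "compose (carrier P) f (restrict w (carrier P)) \<in> mhom A P Y"
        using lhom_mhom[OF Pm lhom_o[OF mhom_lhom[OF wm] f]] by (simp add: compose_def)
      show "h x = compose (carrier P) f (restrict w (carrier P)) x" if "x \<in> carrier P" for x using w(2) that by (simp add: compose_def)
    qed
    then show "h \<in> (\<lambda>h. compose (carrier P) f h) ` mhom A P X" by (rule image_eqI[OF _ wm])
  }
qed

text \<open>Dual to \<open>cogenI\<close>: Hom from the projective \<open>P\<close> keeps the
  sequence exact.\<close>

lemma genI:
  fixes N :: "('a, 'm) module" and Y :: "nat \<Rightarrow> ('k, 'a) umodule"
  assumes P: "projective A P" and E: "exact_seq_onto A m Y d e N" and add: "\<forall>i\<le>m. in_add A P (Y i)"
  shows "N \<in> gen A m P"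
proof -
  have fg: "\<forall>i\<le>m. fgm A (Y i)" and N: "fgm A N" and d: "\<forall>i<m. d i \<in> mhom A (Y (Suc i)) (Y i)"
    and e: "e \<in> mhom A (Y 0) N" and es: "e ` carrier (Y 0) = carrier N"
    and e0: "0 < m \<longrightarrow> d 0 ` carrier (Y 1) = {x \<in> carrier (Y 0). e x = zero N}"
    and ex: "\<forall>i. Suc i < m \<longrightarrow> d (Suc i) ` carrier (Y (Suc (Suc i))) = {x \<in> carrier (Y (Suc i)). d i x = zero (Y i)}"
    using E by (auto simp: exact_seq_onto_def exact_onto_def exact_at_def)
  have Y0: "fgm A (Y 0)" using fg by simp
  have "exact_onto m (\<lambda>i. Hom A P (Y i)) (\<lambda>i f. compose (carrier P) (d i) f)
          (\<lambda>f. compose (carrier P) e f) (Hom A P N)" unfolding exact_onto_def exact_at_def Hom_simps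
  proof (intro conjI allI impI)
    have "e ` carrier (Y 0) = {y \<in> carrier N. (\<lambda>_. zero N) y = zero N}" using es by simp
    from Hom_exact_projective[OF P Y0 N mhom_lhom[OF e] this]
    show "(\<lambda>f. compose (carrier P) e f) ` mhom A P (Y 0) = mhom A P N" by (simp add: compose_def)
  next
    assume m: "0 < m"
    have Y1: "fgm A (Y 1)" and d0: "d 0 \<in> mhom A (Y 1) (Y 0)" using fg d m by auto
    show "(\<lambda>f. compose (carrier P) (d 0) f) ` mhom A P (Y 1) =
      {x \<in> mhom A P (Y 0). compose (carrier P) e x = (\<lambda>x\<in>carrier P. zero N)}"
      by (rule Hom_exact_projective[OF P Y1 Y0 mhom_lhom[OF d0]]) (use e0 m in blast)
  next
    fix i assume i: "Suc i < m"
    have f3: "fgm A (Y (Suc (Suc i)))" "fgm A (Y (Suc i))" and d2: "d (Suc i) \<in> lhom A (Y (Suc (Suc i))) (Y (Suc i))"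
      using fg d i by (auto intro: mhom_lhom)
    show "(\<lambda>f. compose (carrier P) (d (Suc i)) f) ` mhom A P (Y (Suc (Suc i))) =
      {x \<in> mhom A P (Y (Suc i)). compose (carrier P) (d i) x = (\<lambda>x\<in>carrier P. zero (Y i))}"
      by (rule Hom_exact_projective[OF P f3 d2]) (use ex i in blast)
  qed
  then show ?thesis unfolding gen_def using E add by blast
qed

end

lemma hexl_hom0:
  assumes Z: "lmod R Z" and h: "hom0 R Y I" and I: "lmod R I"
  shows "hexl R X f Y g Z I"
proof (rule hexlI)
  fix w assume "w \<in> lhom R Y I"
  then have "\<forall>y\<in>carrier Y. w y = zero I" using h by (simp add: hom0_def)
  then show "\<exists>w'. w' \<in> lhom R Z I \<and> (\<forall>y\<in>carrier Y. w y = w' (g y))"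
    using lhom_const0[OF I] by (intro exI[of _ "\<lambda>_. zero I"]) auto
qed

section \<open>Dimension shifting over B and the tilting classes\<close>

locale coshift_tilt = coshift_res K A Q C k c dc ec \<eta> J \<delta> \<phi> \<psi>
  for K :: "'k ring" and A :: "('k, 'a) module" and Q :: "('a, 'q) module" and C :: "('a, 'c) module"
    and k c dc ec \<eta> J \<delta> \<phi> \<psi> +
  fixes p :: "nat \<Rightarrow> ('k, 'c \<Rightarrow> 'c) umodule" and dp ep \<alpha> \<beta>
  assumes Pres: "proj_resolution BB p dp ep DDC" and pz: "\<And>i. k < i \<Longrightarrow> zero_module (p i)"
    and pc: "\<And>i. i \<le> k \<Longrightarrow> mod_iso BB (FF (c i)) (p i) (\<alpha> i) (\<beta> i)"
    and pQ: "\<And>n. hexl_at BB p dp n (FF Q)"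
begin

lemmas P = B.proj_resD[OF Pres]

lemma projFQ: "projective BB (FF Q)" by (rule F_projective[OF modQ addrQC])
lemma fgFQ: "fgm BB (FF Q)" by (rule F_fg[OF modQ addrQC])
lemma modFQ: "lmod BB (FF Q)" by (rule F_module[OF modQ])

lemma addr_Fc: "i < k \<Longrightarrow> addr BB {FF Q} (FF (c i))" using F_addr[OF modc _ addrcQ, of i] modQ by simp

lemma addr_p: 
  assumes "i < k"
  shows "addr BB {FF Q} (p i)"
proof -
  have "addr BB {FF (c i)} (p i)" by (rule addr_iso[OF P(1) _ mod_iso_sym[OF pc]]) (use assms in auto)
  then show ?thesis by (rule addr_trans[OF P(1), rotated]) (use F_module[OF modc] addr_Fc assms in auto)
qed

text \<open>The acyclicity of add P on which \<open>pg_shift\<close> relies.\<close>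

lemma hexl_add:
  assumes Y: "lmod BB Y" and a: "addr BB {FF Q} Y"
  shows "hexl_at BB p dp n Y" by (rule addr_hexl[OF Y a]) (use modFQ pQ lhom_in[OF P(2)] in auto)

text \<open>Hom(C, -) applied to the injective \<open>Q\<close> as a member of add D A. Weaker than
  being a summand of DC, it is what \<open>hom0_DDC\<close> asks for.\<close>

lemma addr_FQ: "addr BB {DDC} (FF Q)"
proof -
  have "addr BB {FF DA} (FF Q)" using F_addr[OF modQ _ injective_addr_DA[OF injQ]] DA_module by simp
  moreover have FD: "lmod BB (FF DA)" by (rule F_module[OF DA_module])
  have "addr BB {DDC} (FF DA)" by (rule addr_iso[OF FD _ F_DA_iso]) simp
  then have "Y \<in> {FF DA} \<Longrightarrow> lmod BB Y \<and> addr BB {DDC} Y" for Y using FD by simp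
  ultimately show ?thesis using addr_trans[OF modFQ] by blast
qed

text \<open>\<open>pg i Y S\<close> says that \<open>Ext\<^sup>i\<^sup>+\<^sup>1(DC, S) = 0\<close> for the submodule \<open>S\<close> of \<open>Y\<close>.\<close>

definition pg :: "nat \<Rightarrow> ('c \<Rightarrow> 'c, 'y) module \<Rightarrow> 'y set \<Rightarrow> bool" where
  "pg i Y S \<longleftrightarrow> (\<forall>f\<in>lhom BB (p (Suc i)) Y. f ` carrier (p (Suc i)) \<subseteq> S \<longrightarrow>
     (\<forall>x\<in>carrier (p (Suc (Suc i))). f (dp (Suc i) x) = zero Y) \<longrightarrow>
     (\<exists>h\<in>lhom BB (p i) Y. h ` carrier (p i) \<subseteq> S \<and> (\<forall>x\<in>carrier (p (Suc i)). f x = h (dp i x))))"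

lemma pgD:
  assumes "pg i Y S" "f \<in> lhom BB (p (Suc i)) Y" "f ` carrier (p (Suc i)) \<subseteq> S"
    "\<forall>x\<in>carrier (p (Suc (Suc i))). f (dp (Suc i) x) = zero Y"
  obtains h where "h \<in> lhom BB (p i) Y" "h ` carrier (p i) \<subseteq> S" "\<forall>x\<in>carrier (p (Suc i)). f x = h (dp i x)"
  using mp[OF mp[OF bspec[OF assms(1)[unfolded pg_def] assms(2)] assms(3)] assms(4)] that by blast

lemma pg_hexl:
  assumes Y: "lmod BB Y"
  shows "pg i Y (carrier Y) \<longleftrightarrow> hexl_at BB p dp i Y"
proof -
  have "f ` carrier (p j) \<subseteq> carrier Y" if "f \<in> lhom BB (p j) Y" for f j using lhom_in[OF that] by blast
  then show ?thesis unfolding pg_def hexl_def by simp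
qed

lemma pg_trivial:
  assumes Y: "lmod BB Y" and S: "submod BB Y S" and i: "k < Suc i"
  shows "pg i Y S" unfolding pg_def
proof (intro ballI impI)
  fix f assume f: "f \<in> lhom BB (p (Suc i)) Y"
  have "carrier (p (Suc i)) = {zero (p (Suc i))}" using pz[OF i] by (simp add: zero_module_def)
  then show "\<exists>h\<in>lhom BB (p i) Y. h ` carrier (p i) \<subseteq> S \<and> (\<forall>x\<in>carrier (p (Suc i)). f x = h (dp i x))"
    using lhom_zero[OF P(1) Y f] S by (intro bexI[OF _ lhom_const0[OF Y]]) (auto simp: submod_def)
qed

text \<open>The connecting isomorphism of \<open>0 -> ker g -> Y' -> g(Y') -> 0\<close>, where
  positive Ext of DC into \<open>Y'\<close> vanishes. Maps into the image of \<open>g\<close> are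
  lifted to \<open>Y'\<close> by projectivity of the \<open>p i\<close>.\<close>

lemma pg_shift:
  fixes Y :: "('c \<Rightarrow> 'c, 'y) module" and Y' :: "('c \<Rightarrow> 'c, 'z) module"
  assumes Y: "fgm BB Y" and Y': "fgm BB Y'" and g: "g \<in> lhom BB Y' Y" and a: "addr BB {FF Q} Y'"
  shows "pg i Y (g ` carrier Y') \<longleftrightarrow> pg (Suc i) Y' {y \<in> carrier Y'. g y = zero Y}"
proof
  have Ym: "lmod BB Y" and Ym': "lmod BB Y'" using Y Y' fg_left by auto
  interpret Y: left_module BB Y by fact
  interpret Y': left_module BB Y' by fact
  note hl = hexl_add[OF Ym' a]
  {
    assume pg: "pg i Y (g ` carrier Y')"
    show "pg (Suc i) Y' {y \<in> carrier Y'. g y = zero Y}" unfolding pg_def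
    proof (intro ballI impI)
      fix f assume f: "f \<in> lhom BB (p (Suc (Suc i))) Y'" and fS: "f ` carrier (p (Suc (Suc i))) \<subseteq> {y \<in> carrier Y'. g y = zero Y}"
        and fz: "\<forall>x\<in>carrier (p (Suc (Suc (Suc i)))). f (dp (Suc (Suc i)) x) = zero Y'"
      obtain h where h: "h \<in> lhom BB (p (Suc i)) Y'" "\<forall>x\<in>carrier (p (Suc (Suc i))). f x = h (dp (Suc i) x)"
        by (rule hexlD[OF hl f]) (use fz in blast)
      have gh: "(\<lambda>x. g (h x)) \<in> lhom BB (p (Suc i)) Y" by (rule lhom_o[OF h(1) g])
      have 1: "(\<lambda>x. g (h x)) ` carrier (p (Suc i)) \<subseteq> g ` carrier Y'" using lhom_in[OF h(1)] by blast
      have 2: "\<forall>x\<in>carrier (p (Suc (Suc i))). g (h (dp (Suc i) x)) = zero Y"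
      proof
        fix x assume x: "x \<in> carrier (p (Suc (Suc i)))"
        have "g (f x) = zero Y" using fS x by blast
        then show "g (h (dp (Suc i) x)) = zero Y" using h(2) x by simp
      qed
      obtain u where u: "u \<in> lhom BB (p i) Y" "u ` carrier (p i) \<subseteq> g ` carrier Y'"
        "\<forall>x\<in>carrier (p (Suc i)). g (h x) = u (dp i x)" by (rule pgD[OF pg gh 1 2])
      obtain v where v: "v \<in> lhom BB (p i) Y'" "\<forall>x\<in>carrier (p i). g (v x) = u x"
        by (rule B.projective_lift[OF P(6) Y' Y g u(1,2)])
      have vd: "(\<lambda>x. v (dp i x)) \<in> lhom BB (p (Suc i)) Y'" by (rule lhom_o[OF P(2) v(1)])
      show "\<exists>h\<in>lhom BB (p (Suc i)) Y'. h ` carrier (p (Suc i)) \<subseteq> {y \<in> carrier Y'. g y = zero Y} \<and>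
          (\<forall>x\<in>carrier (p (Suc (Suc i))). f x = h (dp (Suc i) x))"
      proof (rule bexI[OF _ lhom_diff[OF Ym' h(1) vd]], intro conjI image_subsetI ballI)
        fix x assume x: "x \<in> carrier (p (Suc i))"
        have c: "h x \<in> carrier Y'" "v (dp i x) \<in> carrier Y'" using lhom_in[OF h(1) x] lhom_in[OF vd x] by auto
        have "g (v (dp i x)) = g (h x)" using u(3) v(2) lhom_in[OF P(2) x] x by simp
        then show "h x \<ominus>\<^bsub>Y'\<^esub> v (dp i x) \<in> {y \<in> carrier Y'. g y = zero Y}"
          using lhom_minus[OF Ym' Ym g c] c lhom_in[OF g c(1)] by (simp add: Y.minus_diff_zero_iff Y'.M.minus_closed)
      next
        fix x assume x: "x \<in> carrier (p (Suc (Suc i)))"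
        have "v (dp i (dp (Suc i) x)) = zero Y'" using P(4)[OF x] lhom_zero[OF P(1) Ym' v(1)] by simp
        then show "f x = h (dp (Suc i) x) \<ominus>\<^bsub>Y'\<^esub> v (dp i (dp (Suc i) x))"
          using h(2) x lhom_in[OF f x] by (simp add: Y'.M.minus_eq)
      qed
    qed
  next
    assume pg: "pg (Suc i) Y' {y \<in> carrier Y'. g y = zero Y}"
    show "pg i Y (g ` carrier Y')" unfolding pg_def
    proof (intro ballI impI)
      fix f assume f: "f \<in> lhom BB (p (Suc i)) Y" and fS: "f ` carrier (p (Suc i)) \<subseteq> g ` carrier Y'"
        and fz: "\<forall>x\<in>carrier (p (Suc (Suc i))). f (dp (Suc i) x) = zero Y"
      obtain f' where f': "f' \<in> lhom BB (p (Suc i)) Y'" "\<forall>x\<in>carrier (p (Suc i)). g (f' x) = f x"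
        by (rule B.projective_lift[OF P(6) Y' Y g f fS])
      have fd: "(\<lambda>x. f' (dp (Suc i) x)) \<in> lhom BB (p (Suc (Suc i))) Y'" by (rule lhom_o[OF P(2) f'(1)])
      have 1: "(\<lambda>x. f' (dp (Suc i) x)) ` carrier (p (Suc (Suc i))) \<subseteq> {y \<in> carrier Y'. g y = zero Y}"
        using lhom_in[OF fd] f'(2) fz lhom_in[OF P(2)] by auto
      have 2: "\<forall>x\<in>carrier (p (Suc (Suc (Suc i)))). f' (dp (Suc i) (dp (Suc (Suc i)) x)) = zero Y'"
        using P(4) lhom_zero[OF P(1) Ym' f'(1)] by simp
      obtain u where u: "u \<in> lhom BB (p (Suc i)) Y'" "u ` carrier (p (Suc i)) \<subseteq> {y \<in> carrier Y'. g y = zero Y}"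
        "\<forall>x\<in>carrier (p (Suc (Suc i))). f' (dp (Suc i) x) = u (dp (Suc i) x)" by (rule pgD[OF pg fd 1 2])
      have df: "(\<lambda>x. f' x \<ominus>\<^bsub>Y'\<^esub> u x) \<in> lhom BB (p (Suc i)) Y'" by (rule lhom_diff[OF Ym' f'(1) u(1)])
      have dz: "f' (dp (Suc i) x) \<ominus>\<^bsub>Y'\<^esub> u (dp (Suc i) x) = zero Y'" if x: "x \<in> carrier (p (Suc (Suc i)))" for x
        using bspec[OF u(3) x] lhom_in[OF fd x] by (simp add: Y'.minus_diff_zero_iff)
      obtain v where v: "v \<in> lhom BB (p i) Y'" "\<forall>x\<in>carrier (p (Suc i)). f' x \<ominus>\<^bsub>Y'\<^esub> u x = v (dp i x)"
        by (rule hexlD[OF hl df]) (rule dz)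
      show "\<exists>h\<in>lhom BB (p i) Y. h ` carrier (p i) \<subseteq> g ` carrier Y' \<and> (\<forall>x\<in>carrier (p (Suc i)). f x = h (dp i x))"
      proof (rule bexI[OF _ lhom_o[OF v(1) g]], intro conjI image_subsetI ballI)
        fix x assume x: "x \<in> carrier (p (Suc i))"
        have c: "f' x \<in> carrier Y'" "u x \<in> carrier Y'" using lhom_in[OF f'(1) x] lhom_in[OF u(1) x] by auto
        have "g (u x) = zero Y" using u(2) x by blast
        then have "g (f' x \<ominus>\<^bsub>Y'\<^esub> u x) = f x"
          using lhom_minus[OF Ym' Ym g c] f'(2) x lhom_in[OF f x] by (simp add: Y.M.minus_eq)
        then show "f x = g (v (dp i x))" using v(2) x by simp
      qed (use lhom_in[OF v(1)] in blast)
    qed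
  }
qed

text \<open>By \<open>addr_C\<close> the regular \<open>B\<close>-module lies in the additive
  closure of \<open>FF (c k)\<close> and \<open>FF (c 0)\<close>, so the elements of
  \<open>S\<close> are reached by maps from these two. \<open>FF (c 0)\<close> lies in add P. A map
  from \<open>FF (c k)\<close>, a copy of the last term \<open>p k\<close>, factors through
  \<open>p (k - 1)\<close>, again in add P, because Ext^k of DC into \<open>S\<close>
  vanishes.\<close>

lemma pg_generates:
  fixes Y :: "('c \<Rightarrow> 'c, 'y) module"
  assumes Y: "fgm BB Y" and S: "submod BB Y S" and pg: "pg (k - 1) Y S"
    and T: "submod BB Y T" and PT: "\<forall>f\<in>lhom BB (FF Q) Y. f ` carrier (FF Q) \<subseteq> S \<longrightarrow> f ` carrier (FF Q) \<subseteq> T"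
  shows "S \<subseteq> T"
proof
  fix n assume n: "n \<in> S"
  have Ym: "lmod BB Y" by (rule fg_left[OF Y])
  interpret Y: left_module BB Y by fact
  have nY: "n \<in> carrier Y" using n S by (auto simp: submod_def)
  have Fm: "lmod BB (FF C)" by (rule F_module[OF modC])
  \<comment> \<open>The map from the regular module, in the guise of \<open>FF C\<close>, that takes
    the identity of C to \<open>n\<close>.\<close>
  have a: "(\<lambda>u. u \<odot>\<^bsub>Y\<^esub> n) \<in> lhom BB (FF C) Y"
  proof (rule lhomI)
    fix u v assume u: "u \<in> carrier (FF C)"
    then have uB: "u \<in> carrier BB" by simp
    show "u \<odot>\<^bsub>Y\<^esub> n \<in> carrier Y" by (rule Y.smult_closed[OF uB nY])
    {
      assume "v \<in> carrier (FF C)"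
      then have vB: "v \<in> carrier BB" by simp
      show "(u \<oplus>\<^bsub>FF C\<^esub> v) \<odot>\<^bsub>Y\<^esub> n = u \<odot>\<^bsub>Y\<^esub> n \<oplus>\<^bsub>Y\<^esub> v \<odot>\<^bsub>Y\<^esub> n" using Y.smult_l_distr[OF uB vB nY] by simp
    next
      assume vB: "v \<in> carrier BB"
      show "(v \<odot>\<^bsub>FF C\<^esub> u) \<odot>\<^bsub>Y\<^esub> n = v \<odot>\<^bsub>Y\<^esub> (u \<odot>\<^bsub>Y\<^esub> n)" using Y.smult_assoc[OF vB uB nY] by simp
    }
  qed
  have aS: "(\<lambda>u. u \<odot>\<^bsub>Y\<^esub> n) ` carrier (FF C) \<subseteq> S" using S n by (auto simp: submod_def)
  have k: "Suc (k - 1) = k" "k - 1 < k" using k1 by auto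
  have "addr BB ((\<lambda>X. FF X) ` {c k, c 0}) (FF C)" by (rule F_addr[OF modC _ addr_C]) (auto intro: modc)
  then obtain m X i r where X: "\<forall>s<(m::nat). X s \<in> (\<lambda>X. FF X) ` {c k, c 0}" and i: "\<forall>s<m. i s \<in> lhom BB (FF C) (X s)"
    and r: "\<forall>s<m. r s \<in> lhom BB (X s) (FF C)" and e: "\<forall>u\<in>carrier (FF C). u = msum (FF C) (\<lambda>s. r s (i s u)) m"
    by (rule addrE)
  have wT: "w ` carrier (X s) \<subseteq> T" if s: "s < m" and w: "w \<in> lhom BB (X s) Y" and wS: "w ` carrier (X s) \<subseteq> S" for s w
  proof -
    consider "X s = FF (c k)" | "X s = FF (c 0)" using X s by blast
    then show ?thesis
    proof cases
      case 1
      note iso = mod_isoD[OF pc[OF order_refl]]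
      have w': "w \<in> lhom BB (FF (c k)) Y" using w 1 by simp
      have wb: "(\<lambda>x. w (\<beta> k x)) \<in> lhom BB (p (Suc (k - 1))) Y" unfolding k(1) by (rule lhom_o[OF iso(2) w'])
      have bS: "(\<lambda>x. w (\<beta> k x)) ` carrier (p (Suc (k - 1))) \<subseteq> S" unfolding k(1)
      proof (rule image_subsetI)
        fix x assume "x \<in> carrier (p k)"
        then have "\<beta> k x \<in> carrier (X s)" unfolding 1 by (rule iso(6))
        then show "w (\<beta> k x) \<in> S" by (rule subsetD[OF wS imageI])
      qed
      \<comment> \<open>The cocycle condition holds because the term after \<open>p k\<close> is
        zero.\<close>
      have z: "\<forall>x\<in>carrier (p (Suc (Suc (k - 1)))). w (\<beta> k (dp (Suc (k - 1)) x)) = zero Y"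
      proof
        fix x assume "x \<in> carrier (p (Suc (Suc (k - 1))))"
        then have "x = zero (p (Suc (Suc (k - 1))))" using pz[of "Suc k"] unfolding k(1) by (simp add: zero_module_def)
        then show "w (\<beta> k (dp (Suc (k - 1)) x)) = zero Y" using lhom_zero[OF P(1) Ym lhom_o[OF P(2) wb]] by simp
      qed
      obtain h where h: "h \<in> lhom BB (p (k - 1)) Y" "h ` carrier (p (k - 1)) \<subseteq> S"
        "\<forall>x\<in>carrier (p (Suc (k - 1))). w (\<beta> k x) = h (dp (k - 1) x)" by (rule pgD[OF pg wb bS z])
      have hT: "h ` carrier (p (k - 1)) \<subseteq> T" by (rule B.addr_image[OF Ym P(1) addr_p[OF k(2)] T PT h(1,2)])
      show ?thesis
      proof (rule image_subsetI)
        fix x assume x: "x \<in> carrier (X s)"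
        then have x': "x \<in> carrier (FF (c k))" by (simp only: 1)
        have ax: "\<alpha> k x \<in> carrier (p (Suc (k - 1)))" unfolding k(1) by (rule iso(5)[OF x'])
        have "w x = h (dp (k - 1) (\<alpha> k x))" using bspec[OF h(3) ax] by (simp only: iso(3)[OF x'])
        moreover have "h (dp (k - 1) (\<alpha> k x)) \<in> T" by (rule subsetD[OF hT imageI[OF lhom_in[OF P(2) ax]]])
        ultimately show "w x \<in> T" by (simp only:)
      qed
    next
      case 2
      show ?thesis unfolding 2
        by (rule B.addr_image[OF Ym F_module[OF modc] addr_Fc T PT w[unfolded 2] wS[unfolded 2]]) (use k1 in simp_all)
    qed
  qed
  let ?u1 = "\<lambda>x\<in>carrier C. x"
  have id1: "?u1 \<in> carrier (FF C)" using id_C by simp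
  have ix: "i s ?u1 \<in> carrier (X s)" if "s < m" for s by (rule lhom_in[OF i[rule_format, OF that] id1])
  have "?u1 = one BB" by simp
  then have "n = ?u1 \<odot>\<^bsub>Y\<^esub> n" using Y.smult_one[OF nY] by (simp only:)
  also have "\<dots> = msum (FF C) (\<lambda>s. r s (i s ?u1)) m \<odot>\<^bsub>Y\<^esub> n" using bspec[OF e id1] by (simp only:)
  also have "\<dots> = msum Y (\<lambda>s. r s (i s ?u1) \<odot>\<^bsub>Y\<^esub> n) m"
    by (rule lhom_msum[OF Fm Ym a]) (rule lhom_in[OF r[rule_format] ix])
  also have "\<dots> \<in> T"
  proof (rule Y.submod_msum[OF T])
    fix s assume s: "s < m"
    have "(\<lambda>x. r s x \<odot>\<^bsub>Y\<^esub> n) ` carrier (X s) \<subseteq> T"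
      by (rule wT[OF s lhom_o[OF r[rule_format, OF s] a]]) (use aS lhom_in[OF r[rule_format, OF s]] in blast)
    then show "r s (i s ?u1) \<odot>\<^bsub>Y\<^esub> n \<in> T" using ix[OF s] by blast
  qed
  finally show "n \<in> T" .
qed

text \<open>A right approximation of \<open>S\<close> by add P is onto by
  \<open>pg_generates\<close>.\<close>

lemma gen_step:
  fixes Y :: "('c \<Rightarrow> 'c, 'y) module"
  assumes Y: "fgm BB Y" and S: "submod BB Y S" and pg: "pg (k - 1) Y S"
  obtains U :: "('k, 'c \<Rightarrow> 'c) umodule" and g where "in_add BB (FF Q) U" "fgm BB U" "g \<in> lhom BB U Y"
    "g ` carrier U = S" "\<forall>i. pg i Y S \<longrightarrow> pg (Suc i) U {u \<in> carrier U. g u = zero Y}"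
proof -
  obtain U :: "('k, 'c \<Rightarrow> 'c) umodule" and g where U: "in_add BB (FF Q) U" "fgm BB U" and g: "g \<in> lhom BB U Y"
    and gS: "g ` carrier U \<subseteq> S" and ap: "\<forall>f\<in>lhom BB (FF Q) Y. f ` carrier (FF Q) \<subseteq> S \<longrightarrow> f ` carrier (FF Q) \<subseteq> g ` carrier U"
    by (rule B.right_approx[OF Y fgFQ S])
  have Um: "lmod BB U" by (rule fg_left[OF U(2)])
  have "submod BB Y (g ` carrier U)" by (rule submod_image[OF Um fg_left[OF Y] g left_module.submod_carrier[OF Um]])
  then have "S \<subseteq> g ` carrier U" by (rule pg_generates[OF Y S pg _ ap])
  then have im: "g ` carrier U = S" using gS by blast
  have a: "addr BB {FF Q} U" by (rule in_add_addr[OF B.ring_A modFQ U(1)])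
  show thesis by (rule that[OF U g im]) (use pg_shift[OF Y U(2) g a] im in blast)
qed

lemma tilt_gen:
  fixes N :: "('c \<Rightarrow> 'c, 'n) module"
  assumes N: "fgm BB N" and E: "\<forall>n. trivial_group (Ext BB (Suc n) DDC N)"
  shows "N \<in> gen BB (k - 1) (FF Q)"
proof -
  have Nm: "lmod BB N" by (rule fg_left[OF N])
  have pgN: "pg n N (carrier N)" for n using E unfolding B.Ext_hexl[OF N Pres] pg_hexl[OF Nm] by blast
  obtain Y0 :: "('k, 'c \<Rightarrow> 'c) umodule" and e where Y0: "in_add BB (FF Q) Y0" "fgm BB Y0" and e: "e \<in> lhom BB Y0 N"
    and es: "e ` carrier Y0 = carrier N"
    and pg0: "\<forall>i. pg i N (carrier N) \<longrightarrow> pg (Suc i) Y0 {u \<in> carrier Y0. e u = zero N}"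
    by (rule gen_step[OF N left_module.submod_carrier[OF Nm] pgN])
  have Y0m: "lmod BB Y0" by (rule fg_left[OF Y0(2)])
  \<comment> \<open>Kernels take the place of cokernels: each cover raises by one the index from
    which vanishing is known, and the next cover uses index \<open>k - 1\<close>.\<close>
  let ?P = "\<lambda>n Y S. n < k \<longrightarrow> fgm BB Y \<and> submod BB Y S \<and> in_add BB (FF Q) Y \<and> (\<forall>i. pg (Suc n + i) Y S)"
  let ?Q = "\<lambda>n Y S g T S'. Suc n < k \<longrightarrow> g \<in> lhom BB T Y \<and> g ` carrier T = S \<and> S' = {u \<in> carrier T. g u = zero Y}"
  have P0: "?P 0 Y0 {u \<in> carrier Y0. e u = zero N}" using Y0 submod_kernel[OF Y0m Nm e] pg0 pgN by simp
  have step: "\<exists>(T :: ('k, 'c \<Rightarrow> 'c) umodule) S' g. ?P (Suc n) T S' \<and> ?Q n Y S g T S'"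
    if P: "?P n Y S" for n and Y :: "('k, 'c \<Rightarrow> 'c) umodule" and S
  proof (cases "Suc n < k")
    case False
    then show ?thesis by blast
  next
    case True
    then have Y: "fgm BB Y" "submod BB Y S" and pY: "\<forall>i. pg (Suc n + i) Y S" using P by auto
    have "Suc n + (k - 1 - Suc n) = k - 1" using True by simp
    then have "pg (k - 1) Y S" using spec[OF pY, of "k - 1 - Suc n"] by metis
    then obtain T :: "('k, 'c \<Rightarrow> 'c) umodule" and g where T: "in_add BB (FF Q) T" "fgm BB T" "g \<in> lhom BB T Y"
      "g ` carrier T = S" "\<forall>i. pg i Y S \<longrightarrow> pg (Suc i) T {u \<in> carrier T. g u = zero Y}" by (rule gen_step[OF Y])
    have "submod BB T {u \<in> carrier T. g u = zero Y}" by (rule submod_kernel[OF fg_left[OF T(2)] fg_left[OF Y(1)] T(3)])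
    moreover have "\<forall>i. pg (Suc (Suc n) + i) T {u \<in> carrier T. g u = zero Y}" using T(5) pY by simp
    ultimately show ?thesis using T by (intro exI[of _ T] exI[of _ "{u \<in> carrier T. g u = zero Y}"] exI[of _ g]) simp
  qed
  obtain Y S g where Yi: "Y 0 = Y0" "S 0 = {u \<in> carrier Y0. e u = zero N}" and YP: "\<forall>n. ?P n (Y n) (S n)"
    and YQ: "\<forall>n. ?Q n (Y n) (S n) (g n) (Y (Suc n)) (S (Suc n))" by (rule seq_build[where P = ?P and Q = ?Q, OF P0 step])
  have Yfg: "fgm BB (Y n)" "in_add BB (FF Q) (Y n)" if "n < k" for n using YP that by blast+
  have gl: "g n \<in> lhom BB (Y (Suc n)) (Y n)" and gS: "g n ` carrier (Y (Suc n)) = S n"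
    and gk: "S (Suc n) = {u \<in> carrier (Y (Suc n)). g n u = zero (Y n)}" if "Suc n < k" for n using spec[OF YQ, of n] that by auto
  have "exact_seq_onto BB (k - 1) Y (\<lambda>n. restrict (g n) (carrier (Y (Suc n)))) (restrict e (carrier (Y 0))) N"
    unfolding exact_seq_onto_def exact_onto_def exact_at_def
  proof (intro conjI allI impI N)
    show "fgm BB (Y i)" if "i \<le> k - 1" for i using Yfg that k1 by simp
    show "restrict (g i) (carrier (Y (Suc i))) \<in> mhom BB (Y (Suc i)) (Y i)" if "i < k - 1" for i
      by (rule lhom_mhom[OF fg_left[OF Yfg(1)] gl]) (use that in auto)
    show "restrict e (carrier (Y 0)) \<in> mhom BB (Y 0) N" unfolding Yi by (rule lhom_mhom[OF Y0m e])
    show "restrict e (carrier (Y 0)) ` carrier (Y 0) = carrier N" unfolding Yi using es by simp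
    show "restrict (g 0) (carrier (Y (Suc 0))) ` carrier (Y 1) = {x \<in> carrier (Y 0). restrict e (carrier (Y 0)) x = zero N}"
      if "0 < k - 1"
    proof -
      have "Suc 0 < k" using that by simp
      then show ?thesis using gS[of 0] Yi by auto
    qed
    show "restrict (g (Suc i)) (carrier (Y (Suc (Suc i)))) ` carrier (Y (Suc (Suc i))) =
      {x \<in> carrier (Y (Suc i)). restrict (g i) (carrier (Y (Suc i))) x = zero (Y i)}" if s: "Suc i < k - 1" for i
    proof -
      have "Suc (Suc i) < k" "Suc i < k" using s by auto
      then have "g (Suc i) ` carrier (Y (Suc (Suc i))) = {u \<in> carrier (Y (Suc i)). g i u = zero (Y i)}"
        using gS[of "Suc i"] gk[of i] by simp
      then show ?thesis by auto
    qed
  qed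
  then show ?thesis by (rule B.genI[OF projFQ]) (use Yfg k1 in auto)
qed

text \<open>Along the \<open>k\<close> terms of the sequence, degree \<open>n + 1\<close> is shifted
  to degree \<open>n + k + 1\<close>, where the resolution \<open>p\<close> of DC is zero.\<close>

lemma gen_tilt:
  fixes N :: "('c \<Rightarrow> 'c, 'n) module"
  assumes "N \<in> gen BB (k - 1) (FF Q)"
  shows "fgm BB N" "trivial_group (Ext BB (Suc n) DDC N)"
proof -
  obtain Y :: "nat \<Rightarrow> ('k, 'c \<Rightarrow> 'c) umodule" and d e where E: "exact_seq_onto BB (k - 1) Y d e N"
    and add: "\<forall>i\<le>k - 1. in_add BB (FF Q) (Y i)" using assms unfolding gen_def by blast
  have fg: "\<forall>i\<le>k - 1. fgm BB (Y i)" and N: "fgm BB N" and d: "\<forall>i<k - 1. d i \<in> mhom BB (Y (Suc i)) (Y i)"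
    and e: "e \<in> mhom BB (Y 0) N" and es: "e ` carrier (Y 0) = carrier N"
    and e0: "0 < k - 1 \<longrightarrow> d 0 ` carrier (Y (Suc 0)) = {x \<in> carrier (Y 0). e x = zero N}"
    and ex: "\<forall>i. Suc i < k - 1 \<longrightarrow> d (Suc i) ` carrier (Y (Suc (Suc i))) = {x \<in> carrier (Y (Suc i)). d i x = zero (Y i)}"
    using E by (auto simp: exact_seq_onto_def exact_onto_def exact_at_def)
  show "fgm BB N" by (rule N)
  have Nm: "lmod BB N" by (rule fg_left[OF N])
  note el = mhom_lhom[OF e]
  have a: "addr BB {FF Q} (Y i)" if "i \<le> k - 1" for i by (rule in_add_addr[OF B.ring_A modFQ]) (use add that in blast)
  have Yf: "fgm BB (Y i)" if "i \<le> k - 1" for i using fg that by blast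
  have Ym: "lmod BB (Y i)" if "i \<le> k - 1" for i by (rule fg_left[OF Yf[OF that]])
  have dl: "d i \<in> lhom BB (Y (Suc i)) (Y i)" if "i < k - 1" for i using d that by (auto intro: mhom_lhom)
  define S where "S i = (case i of 0 \<Rightarrow> {x \<in> carrier (Y 0). e x = zero N} | Suc i \<Rightarrow> {x \<in> carrier (Y (Suc i)). d i x = zero (Y i)})" for i
  have SS: "submod BB (Y i) (S i)" if i: "i \<le> k - 1" for i
  proof (cases i)
    case 0
    then show ?thesis using submod_kernel[OF Ym Nm el] by (simp add: S_def)
  next
    case (Suc i')
    then show ?thesis using submod_kernel[OF Ym Ym dl, of i'] i by (simp add: S_def)
  qed
  have im: "d i ` carrier (Y (Suc i)) = S i" if "i < k - 1" for i using e0 ex that by (cases i) (simp_all add: S_def)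
  \<comment> \<open>Induction from the far end \<open>Y (k - 1)\<close>, counted by the distance
    \<open>t\<close> from it.\<close>
  have "pg (Suc (n + (k - 1 - t))) (Y (k - 1 - t)) (S (k - 1 - t))" if "t \<le> k - 1" for t using that
  proof (induction t)
    case 0
    show ?case by (rule pg_trivial[OF Ym SS]) (use k1 in auto)
  next
    case (Suc t)
    let ?s = "k - 1 - Suc t"
    have s: "k - 1 - t = Suc ?s" "?s < k - 1" "Suc ?s \<le> k - 1" "?s \<le> k - 1" using Suc.prems by auto
    have "pg (Suc (Suc (n + ?s))) (Y (Suc ?s)) {x \<in> carrier (Y (Suc ?s)). d ?s x = zero (Y ?s)}"
      using Suc.IH Suc.prems unfolding s(1) by (simp add: S_def)
    then have "pg (Suc (n + ?s)) (Y ?s) (d ?s ` carrier (Y (Suc ?s)))"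
      by (rule iffD2[OF pg_shift[OF Yf[OF s(4)] Yf[OF s(3)] dl[OF s(2)] a[OF s(3)]]])
    then show ?case unfolding im[OF s(2)] .
  qed
  from this[of "k - 1"] have "pg (Suc n) (Y 0) {x \<in> carrier (Y 0). e x = zero N}" by (simp add: S_def)
  then have "pg n N (e ` carrier (Y 0))" by (rule iffD2[OF pg_shift[OF N Yf[OF le0] el a[OF le0]]])
  then show "trivial_group (Ext BB (Suc n) DDC N)" unfolding B.Ext_hexl[OF N Pres] es pg_hexl[OF Nm] .
qed

lemma tilt_0: "(tilt_class BB 0 DDC :: ('c \<Rightarrow> 'c, 'n) module set) = gen BB (k - 1) (FF Q)"
proof (intro equalityI subsetI)
  fix N :: "('c \<Rightarrow> 'c, 'n) module"
  {
    assume "N \<in> tilt_class BB 0 DDC"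
    then show "N \<in> gen BB (k - 1) (FF Q)" by (intro tilt_gen) (auto simp: tilt_class_def)
  next
    assume N: "N \<in> gen BB (k - 1) (FF Q)"
    show "N \<in> tilt_class BB 0 DDC" unfolding tilt_class_def
    proof (intro CollectI conjI allI impI)
      show "fgm BB N" by (rule gen_tilt(1)[OF N])
      show "trivial_group (Ext BB i DDC N)" if "i \<noteq> 0" for i using gen_tilt(2)[OF N] that by (cases i) auto
    qed
  }
qed

lemma Ext0_hom0: "lmod BB N \<Longrightarrow> trivial_group (Ext BB 0 DDC N) \<longleftrightarrow> hom0 BB DDC N"
  unfolding hom0_def by (rule B.Ext_0[OF P(8)])

lemma hom0_DDC: "lmod BB N \<Longrightarrow> hom0 BB DDC N \<Longrightarrow> hom0 BB (FF Q) N"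
  by (rule addr_hom0_left[OF modFQ _ addr_FQ]) auto

lemma hom0_p:
  assumes N: "lmod BB N" and h: "hom0 BB (FF Q) N" and i: "i \<noteq> k"
  shows "hom0 BB (p i) N"
proof (cases "i < k")
  case True
  show ?thesis by (rule addr_hom0_left[OF P(1) N addr_p[OF True]]) (use h in auto)
next
  case False
  then show ?thesis using i by (intro hom0_zero_left[OF P(1) N] pz) simp
qed

text \<open>Every \<open>p i\<close> with \<open>i \<noteq> k\<close> is zero or in add P, so the
  Hom complex into \<open>N\<close> lives in degree \<open>k\<close>; in degree 0 the vanishing
  descends to DC because \<open>p 0\<close> covers it.\<close>

lemma Ext_of_hom0:
  fixes N :: "('c \<Rightarrow> 'c, 'n) module"
  assumes N: "fgm BB N" and h: "hom0 BB (FF Q) N" and i: "i \<noteq> k"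
  shows "trivial_group (Ext BB i DDC N)"
proof (cases i)
  case 0
  have Nm: "lmod BB N" by (rule fg_left[OF N])
  have p0: "hom0 BB (p 0) N" by (rule hom0_p[OF Nm h]) (use k1 in simp)
  have "hom0 BB DDC N" unfolding hom0_def
  proof (intro ballI)
    fix f x assume f: "f \<in> lhom BB DDC N" and "x \<in> carrier DDC"
    then have "x \<in> ep ` carrier (p 0)" using P(10) by simp
    then obtain y where y: "y \<in> carrier (p 0)" "x = ep y" by (rule imageE)
    show "f x = zero N" using bspec[OF bspec[OF p0[unfolded hom0_def] lhom_o[OF P(3) f]] y(1)] y(2) by simp
  qed
  then show ?thesis using Ext0_hom0[OF Nm] 0 by simp
next
  case (Suc n)
  have Nm: "lmod BB N" by (rule fg_left[OF N])
  have "hom0 BB (p (Suc n)) N" by (rule hom0_p[OF Nm h]) (use i Suc in simp)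
  then show ?thesis unfolding Suc B.Ext_hexl[OF N Pres] by (rule hexl_hom0[OF P(1) _ Nm])
qed

lemma tilt_k: "(tilt_class BB k DDC :: ('c \<Rightarrow> 'c, 'n) module set) = ker_Hom_from BB (FF Q)"
proof (intro equalityI subsetI)
  fix N :: "('c \<Rightarrow> 'c, 'n) module"
  {
    assume "N \<in> tilt_class BB k DDC"
    then have N: "fgm BB N" "trivial_group (Ext BB 0 DDC N)" using k1 by (auto simp: tilt_class_def)
    have Nm: "lmod BB N" by (rule fg_left[OF N(1)])
    have "hom0 BB (FF Q) N" using N(2) unfolding Ext0_hom0[OF Nm] by (rule hom0_DDC[OF Nm])
    then show "N \<in> ker_Hom_from BB (FF Q)" using N(1) B.zero_Hom[OF modFQ Nm] by (simp add: ker_Hom_from_def)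
  next
    assume "N \<in> ker_Hom_from BB (FF Q)"
    then have N: "fgm BB N" "zero_module (Hom BB (FF Q) N)" by (auto simp: ker_Hom_from_def)
    have "hom0 BB (FF Q) N" using N(2) unfolding B.zero_Hom[OF modFQ fg_left[OF N(1)]] .
    then show "N \<in> tilt_class BB k DDC" using N(1) Ext_of_hom0[OF N(1)] by (simp add: tilt_class_def)
  }
qed

text \<open>\<open>pg_generates\<close> is applied with \<open>T\<close> zero: as Ext^k vanishes,
  the module is generated by images of \<open>P\<close>, and these are zero.\<close>

lemma tilt_other:
  assumes i: "i \<noteq> 0" "i \<noteq> k"
  shows "(tilt_class BB i DDC :: ('c \<Rightarrow> 'c, 'n) module set) = zero_modules BB"
proof (intro equalityI subsetI)
  fix N :: "('c \<Rightarrow> 'c, 'n) module"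
  {
    assume "N \<in> tilt_class BB i DDC"
    then have N: "fgm BB N" "trivial_group (Ext BB 0 DDC N)" "trivial_group (Ext BB (Suc (k - 1)) DDC N)"
      using i k1 by (auto simp: tilt_class_def)
    have Nm: "lmod BB N" by (rule fg_left[OF N(1)])
    have k: "Suc (k - 1) = k" "k - 1 \<noteq> k" using k1 by auto
    have h: "hom0 BB (FF Q) N" using N(2) unfolding Ext0_hom0[OF Nm] by (rule hom0_DDC[OF Nm])
    have pg: "pg (k - 1) N (carrier N)" using N(3) unfolding B.Ext_hexl[OF N(1) Pres] pg_hexl[OF Nm] .
    interpret N: left_module BB N by (rule Nm)
    have "carrier N \<subseteq> {zero N}"
      by (rule pg_generates[OF N(1) N.submod_carrier pg N.submod_zero]) (use h in \<open>auto simp: hom0_def simp del: FF_simps\<close>)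
    then have "zero_module N" using lm_zero[OF Nm] by (auto simp: zero_module_def)
    then show "N \<in> zero_modules BB" using N(1) by (simp add: zero_modules_def)
  next
    assume "N \<in> zero_modules BB"
    then have N: "fgm BB N" "zero_module N" by (auto simp: zero_modules_def)
    have Nm: "lmod BB N" by (rule fg_left[OF N(1)])
    have h: "hom0 BB M N" for M :: "('c \<Rightarrow> 'c, 'x) module" by (rule hom0_zero_right[OF N(2)])
    have "trivial_group (Ext BB n DDC N)" for n
    proof (cases n)
      case 0
      then show ?thesis using Ext0_hom0[OF Nm] hom0_zero_right[OF N(2)] by simp
    next
      case (Suc n')
      show ?thesis unfolding Suc B.Ext_hexl[OF N(1) Pres] by (rule hexl_hom0[OF P(1) hom0_zero_right[OF N(2)] Nm])
    qed
    then show "N \<in> tilt_class BB i DDC" using N(1) by (simp add: tilt_class_def)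
  }
qed

end

section \<open>Indecomposable modules\<close>

text \<open>For finitely generated modules the same as \<open>summand\<close>
  (\<open>summand_retract\<close>, \<open>summand_is_retract\<close>), but without a complement, so
  that transitivity is mere composition.\<close>

definition retract :: "('r, 'x) ring_scheme \<Rightarrow> ('r, 'm) module \<Rightarrow> ('r, 'n) module \<Rightarrow> bool" where
  "retract R M N \<longleftrightarrow> (\<exists>i\<in>lhom R M N. \<exists>r\<in>lhom R N M. \<forall>x\<in>carrier M. r (i x) = x)"

lemma retractI: "i \<in> lhom R M N \<Longrightarrow> r \<in> lhom R N M \<Longrightarrow> \<forall>x\<in>carrier M. r (i x) = x \<Longrightarrow> retract R M N"
  unfolding retract_def by (rule bexI, rule bexI)

lemma retractE:
  assumes "retract R M N"
  obtains i r where "i \<in> lhom R M N" "r \<in> lhom R N M" "\<forall>x\<in>carrier M. r (i x) = x"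
  using assms unfolding retract_def by (elim bexE) (rule that)

lemma retract_trans:
  assumes "retract R L M" "retract R M N"
  shows "retract R L N"
proof -
  obtain i r where 1: "i \<in> lhom R L M" "r \<in> lhom R M L" "\<forall>x\<in>carrier L. r (i x) = x" by (rule retractE[OF assms(1)])
  obtain j s where 2: "j \<in> lhom R M N" "s \<in> lhom R N M" "\<forall>x\<in>carrier M. s (j x) = x" by (rule retractE[OF assms(2)])
  have "r (s (j (i x))) = x" if x: "x \<in> carrier L" for x using bspec[OF 2(3) lhom_in[OF 1(1) x]] bspec[OF 1(3) x] by simp
  then show ?thesis by (intro retractI[OF lhom_o[OF 1(1) 2(1)] lhom_o[OF 2(2) 1(2)]]) blast
qed

lemma retract_iso:
  assumes "mod_iso R M N \<phi> \<psi>"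
  shows "retract R M N" by (rule retractI[OF mod_isoD(1,2)[OF assms]]) (use mod_isoD(3)[OF assms] in blast)

lemma retract_of_bij:
  assumes V: "lmod R V" and i: "i \<in> lhom R V X" and r: "r \<in> lhom R X V"
    and b: "bij_betw (\<lambda>x. r (i x)) (carrier V) (carrier V)"
  shows "retract R V X"
proof -
  let ?h = "inv_into (carrier V) (\<lambda>x. r (i x))"
  have h: "?h \<in> lhom R V V" by (rule lhom_inverse[OF V lhom_o[OF i r] b])
  have "?h (r (i x)) = x" if "x \<in> carrier V" for x using bij_betw_inv_into_left[OF b that] .
  then show ?thesis by (intro retractI[OF i lhom_o[OF r h]]) blast
qed

lemma retract_inj: "\<forall>x\<in>carrier M. r (i x) = x \<Longrightarrow> inj_on i (carrier M)" by (rule inj_on_inverseI[of _ r]) blast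

lemma iso_modE:
  assumes M: "lmod R M" and "iso_mod R M N"
  obtains \<phi> \<psi> where "mod_iso R M N \<phi> \<psi>"
proof -
  obtain f where f: "f \<in> mhom R M N" "bij_betw f (carrier M) (carrier N)" using assms(2) unfolding iso_mod_def by blast
  from mod_iso_bij[OF M mhom_lhom[OF f(1)] f(2)] show thesis by (rule that)
qed

lemma zero_module_iso:
  assumes iso: "mod_iso R M N \<phi> \<psi>" and M: "lmod R M" and N: "lmod R N" and z: "zero_module N"
  shows "zero_module M"
proof -
  have "x = zero M" if x: "x \<in> carrier M" for x
    using mod_iso_zero_iff[OF iso M N x] mod_isoD(5)[OF iso x] z by (simp add: zero_module_def)
  then have "carrier M \<subseteq> {zero M}" by (rule_tac subsetI) simp
  then show ?thesis using lm_zero[OF M] unfolding zero_module_def by blast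
qed

text \<open>Enlarges a summand by a retract of its complement; this drives the maximality argument
  of \<open>injective_summand_DA\<close>.\<close>

lemma split_by_dsum_retract:
  assumes M: "lmod R M" and N: "lmod R N" and L: "lmod R L"
    and s: "split_by R M N i r L \<psi> \<rho>" and V: "lmod R V" and VL: "retract R V L"
  shows "retract R (dsum N V) M"
proof -
  obtain p q where pq: "p \<in> lhom R V L" "q \<in> lhom R L V" "\<forall>x\<in>carrier V. q (p x) = x" by (rule retractE[OF VL])
  note s = split_byD[OF s]
  interpret N: left_module R N by fact
  interpret L: left_module R L by fact
  have pr: "fst \<in> lhom R (dsum N V) N" "snd \<in> lhom R (dsum N V) V" by (auto intro!: lhomI)
  have f: "(\<lambda>x. i (fst x) \<oplus>\<^bsub>M\<^esub> \<psi> (p (snd x))) \<in> lhom R (dsum N V) M"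
    by (rule lhom_plus[OF M lhom_o[OF pr(1) s(1)] lhom_o[OF lhom_o[OF pr(2) pq(1)] s(3)]])
  have qr: "(\<lambda>x. q (\<rho> x)) \<in> lhom R M V" by (rule lhom_o[OF s(4) pq(2)])
  have g: "(\<lambda>x. (r x, q (\<rho> x))) \<in> lhom R M (dsum N V)"
    by (rule lhomI) (simp_all add: lhom_in[OF s(2)] lhom_in[OF qr] lhom_add[OF s(2)] lhom_add[OF qr]
        lhom_smult[OF s(2)] lhom_smult[OF qr])
  show ?thesis
  proof (rule retractI[OF f g], rule ballI)
    fix x assume "x \<in> carrier (dsum N V)"
    then have x: "fst x \<in> carrier N" "snd x \<in> carrier V" by auto
    have y: "p (snd x) \<in> carrier L" by (rule lhom_in[OF pq(1) x(2)])
    have c: "i (fst x) \<in> carrier M" "\<psi> (p (snd x)) \<in> carrier M" by (rule lhom_in[OF s(1) x(1)], rule lhom_in[OF s(3) y])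
    have "r (i (fst x) \<oplus>\<^bsub>M\<^esub> \<psi> (p (snd x))) = fst x" using lhom_add[OF s(2) c] s(5)[OF x(1)] s(8)[OF y] x(1) by simp
    moreover have "\<rho> (i (fst x) \<oplus>\<^bsub>M\<^esub> \<psi> (p (snd x))) = p (snd x)"
      using lhom_add[OF s(4) c] s(6)[OF x(1)] s(7)[OF y] y by simp
    ultimately show "(r (i (fst x) \<oplus>\<^bsub>M\<^esub> \<psi> (p (snd x))), q (\<rho> (i (fst x) \<oplus>\<^bsub>M\<^esub> \<psi> (p (snd x))))) = x"
      using bspec[OF pq(3) x(2)] by simp
  qed
qed

section \<open>Locality of endomorphisms and Krull-Schmidt arguments\<close>

context fdalg begin

abbreviation dimk where "dimk M \<equiv> gdim K (kspace A M)"

lemma dimk_le: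
  assumes "fgm A M" "fgm A N" "f \<in> lhom A M N" "inj_on f (carrier M)"
  shows "dimk M \<le> dimk N" "f ` carrier M \<noteq> carrier N \<Longrightarrow> dimk M < dimk N"
  using gdim_inj_le[OF field_K fg_kspace[OF assms(1)] fg_kspace[OF assms(2)] lhom_kspace[OF assms(3)]] assms(4) by simp_all

lemma retract_dsum:
  assumes N: "lmod A N" and L: "lmod A L"
  shows "retract A N (dsum N L)"
proof -
  interpret L: left_module A L by fact
  have "(\<lambda>x. (x, zero L)) \<in> lhom A N (dsum N L)" "fst \<in> lhom A (dsum N L) N" by (auto intro!: lhomI)
  then show ?thesis by (rule retractI) simp
qed

lemma dimk_dsum_less:
  assumes N: "fgm A N" and L: "lmod A L" and V: "fgm A V" and iso: "mod_iso A (dsum N L) V \<phi> \<psi>" and nz: "\<not> zero_module L"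
  shows "dimk N < dimk V"
proof -
  have Nm: "lmod A N" by (rule fg_left[OF N])
  interpret L: left_module A L by fact
  interpret N: left_module A N by fact
  note v = mod_isoD[OF iso]
  have j: "(\<lambda>x. \<phi> (x, zero L)) \<in> lhom A N V" by (rule lhom_o[OF _ v(1)], rule lhomI) auto
  have ri: "\<forall>x\<in>carrier N. fst (\<psi> (\<phi> (x, zero L))) = x" using v(3) by simp
  obtain l where l: "l \<in> carrier L" "l \<noteq> zero L" using nz lm_zero[OF L] by (auto simp: zero_module_def)
  have p: "(zero N, l) \<in> carrier (dsum N L)" using l by simp
  have "\<phi> (zero N, l) \<notin> (\<lambda>x. \<phi> (x, zero L)) ` carrier N"
  proof
    assume "\<phi> (zero N, l) \<in> (\<lambda>x. \<phi> (x, zero L)) ` carrier N"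
    then obtain x where x: "x \<in> carrier N" "\<phi> (zero N, l) = \<phi> (x, zero L)" by auto
    then have "\<psi> (\<phi> (zero N, l)) = \<psi> (\<phi> (x, zero L))" by simp
    then show False using v(3)[OF p] v(3)[of "(x, zero L)"] x(1) l by simp
  qed
  then have "(\<lambda>x. \<phi> (x, zero L)) ` carrier N \<noteq> carrier V" using v(5)[OF p] by blast
  then show ?thesis by (rule dimk_le(2)[OF N V j retract_inj[where r = "\<lambda>x. fst (\<psi> x)"], rotated]) (rule ri)
qed

lemma endo_inj_bij:
  assumes V: "fgm A V" and f: "f \<in> lhom A V V" and i: "inj_on f (carrier V)"
  shows "bij_betw f (carrier V) (carrier V)" using dimk_le(2)[OF V V f i] i by (auto simp: bij_betw_def)

lemma endo_surj_bij:
  assumes V: "fgm A V" and f: "f \<in> lhom A V V" and s: "f ` carrier V = carrier V"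
  shows "bij_betw f (carrier V) (carrier V)" using endo_surj_inj[OF field_K fg_kspace[OF V] lhom_kspace[OF f]] s by (simp add: bij_betw_def)

lemma submod_eq_dimk:
  assumes V: "fgm A V" and S: "submod A V S" and T: "submod A V T" and ST: "S \<subseteq> T" and d: "dimk (subm V T) \<le> dimk (subm V S)"
  shows "S = T"
proof (rule ccontr)
  assume "S \<noteq> T"
  moreover have "(\<lambda>x. x) \<in> lhom A (subm V S) (subm V T)" using ST by (auto intro!: lhomI)
  ultimately have "dimk (subm V S) < dimk (subm V T)" using dimk_le(2)[OF fg_submodule[OF V S] fg_submodule[OF V T]] by simp
  then show False using d by simp
qed

lemma indec_fg: "indecomposable A V \<Longrightarrow> fgm A V" by (simp add: indecomposable_def)

text \<open>The complement supplied by \<open>retract_split\<close> must vanish, since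
  \<open>V\<close> is indecomposable and \<open>X\<close> is nonzero.\<close>

lemma indec_retract:
  assumes V: "indecomposable A V" and X: "fgm A X" and nz: "\<not> zero_module X"
    and i: "i \<in> lhom A X V" and r: "r \<in> lhom A V X" and ri: "\<forall>x\<in>carrier X. r (i x) = x"
  shows "bij_betw i (carrier X) (carrier V)"
proof -
  have fV: "fgm A V" by (rule indec_fg[OF V])
  have Vm: "lmod A V" and Xm: "lmod A X" using fV X fg_left by auto
  interpret V: left_module A V by fact
  obtain X' :: "('k, 'a) umodule" and \<phi> \<phi>' where X': "fgm A X'" "mod_iso A X X' \<phi> \<phi>'" by (rule umodule_copy[OF X])
  note x = mod_isoD[OF X'(2)]
  have Xm': "lmod A X'" by (rule fg_left[OF X'(1)])
  have ri': "\<forall>x\<in>carrier X'. \<phi> (r (i (\<phi>' x))) = x" using ri x(4,6) by simp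
  obtain L :: "('k, 'a) umodule" and \<psi> \<rho> where L: "fgm A L"
    and s: "split_by A V X' (\<lambda>x. i (\<phi>' x)) (\<lambda>x. \<phi> (r x)) L \<psi> \<rho>" and iso: "iso_mod A (dsum X' L) V"
    by (rule retract_split[OF fV X'(1) lhom_o[OF x(2) i] lhom_o[OF r x(1)] ri'])
  note s = split_byD[OF s]
  have Lm: "lmod A L" by (rule fg_left[OF L])
  have "zero_module X' \<or> zero_module L" using V X'(1) L iso unfolding indecomposable_def by blast
  moreover have "\<not> zero_module X'" using zero_module_iso[OF X'(2) Xm Xm'] nz by blast
  ultimately have z: "zero_module L" by blast
  have "v \<in> i ` carrier X" if v: "v \<in> carrier V" for v
  proof -
    have "\<rho> v = zero L" using lhom_in[OF s(4) v] z by (simp add: zero_module_def)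
    moreover have rv: "r v \<in> carrier X" by (rule lhom_in[OF r v])
    ultimately have "v = i (r v)" using s(9)[OF v] lhom_zero[OF Lm Vm s(3)] x(3)[OF rv] lhom_in[OF i rv] by simp
    then show ?thesis using rv by (rule image_eqI)
  qed
  then have "i ` carrier X = carrier V" using lhom_in[OF i] by blast
  then show ?thesis using retract_inj[where i = i and r = r, OF ri] by (simp add: bij_betw_def)
qed

text \<open>Fitting's lemma applied to \<open>f\<close>: the module is the sum of the image and the kernel of a large power
  of \<open>f\<close>, so \<open>f\<close> is bijective or nilpotent, and in the latter case \<open>g = 1 - f\<close> is injective.\<close>

lemma indec_sum:
  assumes V: "indecomposable A V" and f: "f \<in> lhom A V V" and g: "g \<in> lhom A V V"
    and fg: "\<forall>x\<in>carrier V. x = f x \<oplus>\<^bsub>V\<^esub> g x"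
  shows "bij_betw f (carrier V) (carrier V) \<or> bij_betw g (carrier V) (carrier V)"
proof -
  have fV: "fgm A V" by (rule indec_fg[OF V])
  have Vm: "lmod A V" by (rule fg_left[OF fV])
  interpret V: left_module A V by fact
  have pw: "(f ^^ n) \<in> lhom A V V" for n
  proof (induction n)
    case 0
    show ?case using lhom_id[of A V] by (simp add: id_def)
  next
    case (Suc n)
    from lhom_o[OF this f] show ?case by (simp add: comp_def)
  qed
  have S: "submod A V ((f ^^ n) ` carrier V)" for n by (rule submod_image[OF Vm Vm pw V.submod_carrier])
  define D where "D n = dimk (subm V ((f ^^ n) ` carrier V))" for n
  \<comment> \<open>The power with the smallest image: from there on images no longer shrink, so
    \<open>h\<close> maps its own image \<open>?I\<close> onto itself.\<close>
  obtain m where m: "\<forall>n. D m \<le> D n" using ex_has_least_nat[of "\<lambda>_. True" 0 D] by blast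
  define h where "h = f ^^ m"
  have h: "h \<in> lhom A V V" unfolding h_def by (rule pw)
  let ?I = "h ` carrier V"
  have I: "submod A V ?I" unfolding h_def by (rule S)
  have Ic: "?I \<subseteq> carrier V" using I by (simp add: submod_def)
  have hI: "h ` ?I = ?I"
  proof (rule submod_eq_dimk[OF fV _ I])
    have e: "h ` ?I = (f ^^ (m + m)) ` carrier V" by (simp add: h_def funpow_add image_comp)
    show "submod A V (h ` ?I)" unfolding e by (rule S)
    show "h ` ?I \<subseteq> ?I" using Ic by blast
    have "D m \<le> D (m + m)" using m by blast
    then show "dimk (subm V ?I) \<le> dimk (subm V (h ` ?I))" unfolding D_def e[symmetric] by (simp add: h_def)
  qed
  let ?W = "subm V ?I"
  have fW: "fgm A ?W" by (rule fg_submodule[OF fV I])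
  have hW: "h \<in> lhom A ?W ?W" and hVW: "h \<in> lhom A V ?W" using h Ic by (auto simp: lhom_def)
  have b: "bij_betw h (carrier ?W) (carrier ?W)" by (rule endo_surj_bij[OF fW hW]) (use hI in simp)
  let ?t = "inv_into (carrier ?W) h"
  have t: "?t \<in> lhom A ?W ?W" by (rule lhom_inverse[OF fg_left[OF fW] hW b])
  have inc: "(\<lambda>x. x) \<in> lhom A ?W V" using Ic by (auto intro!: lhomI)
  \<comment> \<open>\<open>?t\<close> after \<open>h\<close> retracts \<open>V\<close> onto the
    image of \<open>h\<close>, which is therefore zero or all of \<open>V\<close>.\<close>
  have th: "\<forall>x\<in>carrier ?W. ?t (h x) = x" using bij_betw_inv_into_left[OF b] by blast
  show ?thesis
  proof (cases "zero_module ?W")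
    case False
    have "bij_betw (\<lambda>x. x) (carrier ?W) (carrier V)" by (rule indec_retract[OF V fW False inc lhom_o[OF hVW t] th])
    then have IV: "?I = carrier V" by (simp add: bij_betw_def)
    have fs: "submod A V (f ` carrier V)" using S[of 1] by simp
    have "D m \<le> D 1" using m by blast
    then have "dimk (subm V (carrier V)) \<le> dimk (subm V (f ` carrier V))" unfolding D_def h_def[symmetric] IV by simp
    then have "f ` carrier V = carrier V" by (rule submod_eq_dimk[OF fV fs V.submod_carrier, rotated]) (use lhom_in[OF f] in blast)
    then show ?thesis using endo_surj_bij[OF fV f] by blast
  next
    case True
    \<comment> \<open>On the kernel of \<open>g\<close> the map \<open>f\<close> is the identity,
      hence so is its power \<open>h\<close>, which is zero in this case.\<close>
    have "inj_on g (carrier V)" unfolding lhom_inj_iff[OF Vm Vm g]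
    proof (intro ballI impI)
      fix x assume x: "x \<in> carrier V" "g x = zero V"
      then have fx: "f x = x" using bspec[OF fg x(1)] lhom_in[OF f x(1)] by simp
      have "(f ^^ n) x = x" for n by (induction n) (simp_all add: fx)
      then have "h x = x" by (simp add: h_def)
      then show "x = zero V" using True lhom_in[OF hVW x(1)] by (simp add: zero_module_def)
    qed
    then show ?thesis using endo_inj_bij[OF fV g] by blast
  qed
qed

text \<open>Composition with the inverse \<open>?t\<close> normalizes the sum to the identity,
  \<open>indec_sum\<close> separates the last summand, and induction treats the rest. This is the
  locality of the endomorphism ring.\<close>

lemma indec_msum:
  assumes V: "indecomposable A V" and f: "\<And>s. s < n \<Longrightarrow> f s \<in> lhom A V V"
    and b: "bij_betw (\<lambda>x. msum V (\<lambda>s. f s x) n) (carrier V) (carrier V)"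
  shows "\<exists>s<n. bij_betw (f s) (carrier V) (carrier V)" using f b
proof (induction n)
  case 0
  then have "carrier V = (\<lambda>x. zero V) ` carrier V" by (simp add: bij_betw_def)
  then have "zero_module V" using lm_zero[OF fg_left[OF indec_fg[OF V]]] unfolding zero_module_def by blast
  then show ?case using V by (simp add: indecomposable_def)
next
  case (Suc n)
  have Vm: "lmod A V" by (rule fg_left[OF indec_fg[OF V]])
  let ?F = "\<lambda>x. msum V (\<lambda>s. f s x) n" and ?H = "\<lambda>x. msum V (\<lambda>s. f s x) (Suc n)"
  have F: "?F \<in> lhom A V V" and H: "?H \<in> lhom A V V" by (rule lhom_msum_map[OF Vm], use Suc.prems(1) in simp)+
  have fn: "f n \<in> lhom A V V" using Suc.prems(1) by simp
  let ?t = "inv_into (carrier V) ?H"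
  have t: "?t \<in> lhom A V V" by (rule lhom_inverse[OF Vm H Suc.prems(2)])
  have tb: "bij_betw ?H (carrier V) (carrier V)" by (rule Suc.prems(2))
  have dec: "bij_betw u (carrier V) (carrier V)" if u: "u \<in> lhom A V V" and ub: "bij_betw (\<lambda>x. u (?t x)) (carrier V) (carrier V)" for u
  proof -
    have "bij_betw ((\<lambda>x. u (?t x)) \<circ> ?H) (carrier V) (carrier V)" by (rule bij_betw_trans[OF tb ub])
    moreover have "((\<lambda>x. u (?t x)) \<circ> ?H) x = u x" if "x \<in> carrier V" for x
      unfolding comp_def using bij_betw_inv_into_left[OF tb that] by (simp only:)
    ultimately show ?thesis using bij_betw_cong by blast
  qed
  have "\<forall>x\<in>carrier V. x = ?F (?t x) \<oplus>\<^bsub>V\<^esub> f n (?t x)"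
  proof
    fix x assume "x \<in> carrier V"
    then have "?H (?t x) = x" by (rule bij_betw_inv_into_right[OF tb])
    then show "x = ?F (?t x) \<oplus>\<^bsub>V\<^esub> f n (?t x)" by simp
  qed
  from indec_sum[OF V lhom_o[OF t F] lhom_o[OF t fn] this]
  show ?case
  proof
    assume "bij_betw (\<lambda>x. ?F (?t x)) (carrier V) (carrier V)"
    then have "bij_betw ?F (carrier V) (carrier V)" by (rule dec[OF F])
    then have "\<exists>s<n. bij_betw (f s) (carrier V) (carrier V)" using Suc.IH Suc.prems(1) by simp
    then show ?case using less_SucI by blast
  next
    assume "bij_betw (\<lambda>x. f n (?t x)) (carrier V) (carrier V)"
    then have "bij_betw (f n) (carrier V) (carrier V)" by (rule dec[OF fn])
    then show ?case by blast
  qed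
qed

text \<open>The identity of \<open>V\<close> is a sum of maps through \<open>X\<close>, and by
  \<open>indec_msum\<close> a single one of them is already bijective.\<close>

lemma indec_addr:
  assumes V: "indecomposable A V" and a: "addr A {X} V"
  shows "retract A V X"
proof -
  have Vm: "lmod A V" by (rule fg_left[OF indec_fg[OF V]])
  obtain n Z i r where Z: "\<forall>s<(n::nat). Z s \<in> {X}" and i: "\<forall>s<n. i s \<in> lhom A V (Z s)"
    and r: "\<forall>s<n. r s \<in> lhom A (Z s) V" and e: "\<forall>x\<in>carrier V. x = msum V (\<lambda>s. r s (i s x)) n"
    by (rule addrE[OF a])
  have i': "i s \<in> lhom A V X" and r': "r s \<in> lhom A X V" if "s < n" for s using Z i r that by auto
  have "bij_betw (\<lambda>x. msum V (\<lambda>s. r s (i s x)) n) (carrier V) (carrier V) = bij_betw (\<lambda>x. x) (carrier V) (carrier V)"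
    by (rule bij_betw_cong) (use e in simp)
  then have "bij_betw (\<lambda>x. msum V (\<lambda>s. r s (i s x)) n) (carrier V) (carrier V)" by (simp add: bij_betw_def)
  then have "\<exists>s<n. bij_betw (\<lambda>x. r s (i s x)) (carrier V) (carrier V)"
    by (rule indec_msum[where f = "\<lambda>s x. r s (i s x)", OF V, rotated]) (rule lhom_o[OF i' r'])
  then obtain s where "s < n" "bij_betw (\<lambda>x. r s (i s x)) (carrier V) (carrier V)" by (elim exE conjE) (rule that)
  then show ?thesis by (intro retract_of_bij[OF Vm i' r'])
qed

text \<open>A nonzero retract of least dimension cannot be decomposed further.\<close>

lemma indec_retract_exists:
  assumes M: "fgm A M" and nz: "\<not> zero_module M"
  obtains V :: "('k, 'a) umodule" where "indecomposable A V" "retract A V M"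
proof -
  let ?P = "\<lambda>V :: ('k, 'a) umodule. fgm A V \<and> \<not> zero_module V \<and> retract A V M"
  obtain M' :: "('k, 'a) umodule" and \<phi> \<psi> where M': "fgm A M'" "mod_iso A M M' \<phi> \<psi>" by (rule umodule_copy[OF M])
  have Mm: "lmod A M" and Mm': "lmod A M'" using M M' fg_left by auto
  have "\<not> zero_module M'" using zero_module_iso[OF M'(2) Mm Mm'] nz by blast
  then have "?P M'" using M'(1) retract_iso[OF mod_iso_sym[OF M'(2)]] by blast
  from ex_has_least_nat[of ?P, OF this, of dimk]
  obtain V :: "('k, 'a) umodule" where V: "fgm A V" "\<not> zero_module V" "retract A V M"
    and min: "\<forall>W. ?P W \<longrightarrow> dimk V \<le> dimk W" by blast
  have "indecomposable A V" unfolding indecomposable_def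
  proof (intro conjI allI impI V(1,2))
    fix N L :: "('k, 'a) umodule"
    assume "fgm A N \<and> fgm A L \<and> iso_mod A (dsum N L) V"
    then have N: "fgm A N" and L: "fgm A L" and iso: "iso_mod A (dsum N L) V" by auto
    have Nm: "lmod A N" and Lm: "lmod A L" and Vm: "lmod A V" using N L V(1) fg_left by auto
    have Dm: "lmod A (dsum N L)" by (rule dsum_module[OF Nm Lm])
    interpret L: left_module A L by fact
    obtain \<phi> \<psi> where iso: "mod_iso A (dsum N L) V \<phi> \<psi>" by (rule iso_modE[OF Dm iso])
    have NM: "retract A N M" by (rule retract_trans[OF retract_trans[OF retract_dsum[OF Nm Lm] retract_iso[OF iso]] V(3)])
    show "zero_module N \<or> zero_module L" using dimk_dsum_less[OF N Lm V(1) iso] min N NM by fastforce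
  qed
  then show thesis by (rule that[OF _ V(3)])
qed

text \<open>The identity of \<open>V\<close> is the sum over \<open>s\<close> of maps through
  \<open>X s\<close>, one of which is bijective. This makes \<open>V\<close> a retract of the
  indecomposable \<open>X s\<close>, hence isomorphic to it.\<close>

lemma indec_component:
  fixes V :: "('a, 'v) module" and X :: "nat \<Rightarrow> ('a, 'x) module"
  assumes V: "indecomposable A V" and X: "\<And>s. s < n \<Longrightarrow> indecomposable A (X s)"
    and u: "u \<in> lhom A V (dsum_upto n X)" and v: "v \<in> lhom A (dsum_upto n X) V" and vu: "\<forall>x\<in>carrier V. v (u x) = x"
  obtains s where "s < n" "(\<lambda>x. u x s) \<in> lhom A V (X s)" "bij_betw (\<lambda>x. u x s) (carrier V) (carrier (X s))"
proof -
  let ?D = "dsum_upto n X"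
  have Vm: "lmod A V" by (rule fg_left[OF indec_fg[OF V]])
  have Xm: "lmod A (X s)" if "s < n" for s by (rule fg_left[OF indec_fg[OF X[OF that]]])
  have Dm: "lmod A ?D" by (rule dsum_upto_module[OF ring_A Xm])
  have us: "(\<lambda>x. u x s) \<in> lhom A V (X s)" and vs: "(\<lambda>y. v (single n X s y)) \<in> lhom A (X s) V" if "s < n" for s
    using lhom_o[OF u lhom_proj[OF that]] lhom_o[OF lhom_single[where X = X, OF Xm that] v] by auto
  have f: "(\<lambda>x. v (single n X s (u x s))) \<in> lhom A V V" if "s < n" for s by (rule lhom_o[OF us[OF that] vs[OF that]])
  have e: "msum V (\<lambda>s. v (single n X s (u x s))) n = x" if x: "x \<in> carrier V" for x
  proof -
    have ux: "u x \<in> carrier ?D" by (rule lhom_in[OF u x])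
    have sc: "single n X s (u x s) \<in> carrier ?D" if "s < n" for s
      by (rule lhom_in[OF lhom_single[where X = X, OF Xm that] lhom_in[OF us[OF that] x]])
    have "msum V (\<lambda>s. v (single n X s (u x s))) n = v (msum ?D (\<lambda>s. single n X s (u x s)) n)"
      by (rule lhom_msum[OF Dm Vm v sc, symmetric])
    also have "\<dots> = v (u x)" using dsum_upto_expand[where X = X, OF ring_A Xm ux] by simp
    also have "\<dots> = x" using vu x by blast
    finally show ?thesis .
  qed
  have "bij_betw (\<lambda>x. msum V (\<lambda>s. v (single n X s (u x s))) n) (carrier V) (carrier V) =
    bij_betw (\<lambda>x. x) (carrier V) (carrier V)" by (rule bij_betw_cong) (rule e)
  then have "bij_betw (\<lambda>x. msum V (\<lambda>s. v (single n X s (u x s))) n) (carrier V) (carrier V)" by (simp add: bij_betw_def)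
  then have "\<exists>s<n. bij_betw (\<lambda>x. v (single n X s (u x s))) (carrier V) (carrier V)"
    by (rule indec_msum[where f = "\<lambda>s x. v (single n X s (u x s))", OF V, rotated]) (rule f)
  then obtain s where s: "s < n" and b: "bij_betw (\<lambda>x. v (single n X s (u x s))) (carrier V) (carrier V)"
    by (elim exE conjE) (rule that)
  let ?t = "inv_into (carrier V) (\<lambda>x. v (single n X s (u x s)))"
  have t: "?t \<in> lhom A V V" by (rule lhom_inverse[OF Vm f[OF s] b])
  have "\<forall>x\<in>carrier V. ?t (v (single n X s (u x s))) = x" using bij_betw_inv_into_left[OF b] by blast
  moreover have "\<not> zero_module V" using V by (simp add: indecomposable_def)
  ultimately have "bij_betw (\<lambda>x. u x s) (carrier V) (carrier (X s))"
    by (intro indec_retract[OF X[OF s] indec_fg[OF V] _ us[OF s] lhom_o[OF vs[OF s] t]])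
  then show thesis by (rule that[OF s us[OF s]])
qed

text \<open>Two complementary copies of \<open>V\<close> in \<open>\<Oplus> X\<^sub>s\<close> force two isomorphic summands: the first copy
  projects isomorphically onto some \<open>X\<^sub>s\<close>, and the second can be modified by it so as to
  avoid \<open>X\<^sub>s\<close>.\<close>

lemma indec_multiplicity:
  fixes V :: "('a, 'v) module" and X :: "nat \<Rightarrow> ('k, 'a) umodule"
  assumes V: "indecomposable A V" and X: "\<And>s. s < n \<Longrightarrow> indecomposable A (X s)"
    and ni: "\<forall>s<n. \<forall>t<n. s \<noteq> t \<longrightarrow> \<not> iso_mod A (X s) (X t)"
    and a: "a \<in> lhom A V (dsum_upto n X)" and c: "c \<in> lhom A (dsum_upto n X) V" and ca: "\<forall>x\<in>carrier V. c (a x) = x"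
    and b: "b \<in> lhom A V (dsum_upto n X)" and d: "d \<in> lhom A (dsum_upto n X) V" and db: "\<forall>x\<in>carrier V. d (b x) = x"
    and da: "\<forall>x\<in>carrier V. d (a x) = zero V"
  shows False
proof -
  let ?D = "dsum_upto n X"
  have Vm: "lmod A V" by (rule fg_left[OF indec_fg[OF V]])
  interpret V: left_module A V by fact
  have Xm: "lmod A (X s)" if "s < n" for s by (rule fg_left[OF indec_fg[OF X[OF that]]])
  have Dm: "lmod A ?D" by (rule dsum_upto_module[OF ring_A Xm])
  obtain s where s: "s < n" and \<alpha>: "(\<lambda>x. a x s) \<in> lhom A V (X s)" and \<alpha>b: "bij_betw (\<lambda>x. a x s) (carrier V) (carrier (X s))"
    by (rule indec_component[where X = X, OF V X a c ca])
  let ?t = "inv_into (carrier V) (\<lambda>x. a x s)"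
  have t: "?t \<in> lhom A (X s) V" by (rule lhom_inverse[OF Vm \<alpha> \<alpha>b])
  have bs: "(\<lambda>x. b x s) \<in> lhom A V (X s)" by (rule lhom_o[OF b lhom_proj[OF s]])
  have w2: "(\<lambda>x. a (?t (b x s))) \<in> lhom A V ?D" by (rule lhom_o[OF lhom_o[OF bs t] a])
  \<comment> \<open>Subtracting a suitable element of the first copy kills component
    \<open>s\<close>; \<open>d\<close> still retracts the modified copy because \<open>d\<close>
    vanishes on the first.\<close>
  let ?w = "\<lambda>x. b x \<ominus>\<^bsub>?D\<^esub> a (?t (b x s))"
  have w: "?w \<in> lhom A V ?D" by (rule lhom_diff[OF Dm b w2])
  have dw: "\<forall>x\<in>carrier V. d (?w x) = x"
  proof
    fix x assume x: "x \<in> carrier V"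
    have "d (a (?t (b x s))) = zero V" using da lhom_in[OF lhom_o[OF bs t] x] by blast
    then show "d (?w x) = x" using lhom_minus[OF Dm Vm d lhom_in[OF b x] lhom_in[OF w2 x]] db x by (simp add: V.M.minus_eq)
  qed
  have ws: "?w x s = zero (X s)" if x: "x \<in> carrier V" for x
  proof -
    interpret X: left_module A "X s" by (rule Xm[OF s])
    have c: "b x s \<in> carrier (X s)" by (rule lhom_in[OF bs x])
    have e: "a (?t (b x s)) s = b x s" using bij_betw_inv_into_right[OF \<alpha>b c] .
    have "?w x s = b x s \<ominus>\<^bsub>X s\<^esub> a (?t (b x s)) s"
      by (rule lhom_minus[OF Dm Xm[OF s] lhom_proj[OF s] lhom_in[OF b x] lhom_in[OF w2 x]])
    also have "\<dots> = zero (X s)" unfolding e by (rule iffD2[OF X.minus_diff_zero_iff[OF c c] refl])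
    finally show ?thesis .
  qed
  obtain s' where s': "s' < n" and \<beta>: "(\<lambda>x. ?w x s') \<in> lhom A V (X s')" and \<beta>b: "bij_betw (\<lambda>x. ?w x s') (carrier V) (carrier (X s'))"
    by (rule indec_component[where X = X and u = ?w and v = d, OF V X w d dw])
  have "s \<noteq> s'"
  proof
    assume ss: "s = s'"
    have "x = zero V" if x: "x \<in> carrier V" for x by (rule inj_onD[OF bij_betw_imp_inj_on[OF \<beta>b] _ x lm_zero[OF Vm]])
        (simp only: ss[symmetric] ws[OF x] ws[OF lm_zero[OF Vm]])
    then have "zero_module V" using lm_zero[OF Vm] by (auto simp: zero_module_def)
    then show False using V by (simp add: indecomposable_def)
  qed
  moreover have "iso_mod A (X s) (X s')"
  proof (rule iso_modI[OF Xm[OF s] lhom_o[OF t \<beta>]])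
    from bij_betw_trans[OF bij_betw_inv_into[OF \<alpha>b] \<beta>b]
    show "bij_betw (\<lambda>x. ?w (?t x) s') (carrier (X s)) (carrier (X s'))" by (simp only: comp_def)
  qed
  ultimately show False using ni s s' by blast
qed

lemma summand_is_retract:
  fixes M :: "('a, 'm) module" and N :: "('a, 'n) module"
  assumes "summand A N M"
  shows "retract A N M"
proof -
  obtain L :: "('k, 'a) umodule" where N: "fgm A N" and L: "fgm A L" and iso: "iso_mod A (dsum N L) M"
    using assms unfolding summand_def by blast
  have Nm: "lmod A N" and Lm: "lmod A L" using N L fg_left by auto
  obtain \<phi> \<psi> where iso: "mod_iso A (dsum N L) M \<phi> \<psi>" by (rule iso_modE[OF dsum_module[OF Nm Lm] iso])
  show ?thesis by (rule retract_trans[OF retract_dsum[OF Nm Lm] retract_iso[OF iso]])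
qed

text \<open>Take a common retract \<open>U\<close> of \<open>Q\<close> and \<open>D A\<close> of
  largest dimension, with complements \<open>L\<close> and \<open>L'\<close>. An indecomposable
  retract \<open>V\<close> of \<open>L\<close> is a retract of \<open>D A\<close>, hence of
  \<open>U\<close> or of \<open>L'\<close>. In the first case \<open>V\<close> occurs twice in the
  regular module, which is basic; in the second the sum of \<open>U\<close> and \<open>V\<close> is
  a larger common retract. So \<open>L\<close> is zero.\<close>

lemma injective_summand_DA:
  assumes Q: "injective A Q" and QR: "retract A Q (regular A)" and bas: "basic_algebra A"
  shows "retract A Q DA"
proof -
  have fQ: "fgm A Q" by (rule injective_fg[OF Q])
  have Qm: "lmod A Q" by (rule fg_left[OF fQ])
  obtain n and X :: "nat \<Rightarrow> ('k, 'a) umodule" where X: "\<forall>i<n. indecomposable A (X i)"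
    and ni: "\<forall>i<n. \<forall>j<n. i \<noteq> j \<longrightarrow> \<not> iso_mod A (X i) (X j)" and iso: "iso_mod A (dsum_upto n X) (regular A)"
    using bas unfolding basic_algebra_def basic_module_def by blast
  have Xi: "indecomposable A (X s)" if "s < n" for s using X that by blast
  have Dm: "lmod A (dsum_upto n X)" by (rule dsum_upto_module[OF ring_A fg_left[OF indec_fg[OF Xi]]])
  obtain \<phi> \<psi> where "mod_iso A (dsum_upto n X) (regular A) \<phi> \<psi>" by (rule iso_modE[OF Dm iso])
  from retract_trans[OF QR retract_iso[OF mod_iso_sym[OF this]]] obtain e e' where
    e: "e \<in> lhom A Q (dsum_upto n X)" "e' \<in> lhom A (dsum_upto n X) Q" "\<forall>x\<in>carrier Q. e' (e x) = x" by (rule retractE)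
  let ?P = "\<lambda>U :: ('k, 'a) umodule. fgm A U \<and> retract A U Q \<and> retract A U DA"
  \<comment> \<open>The zero module shows that common retracts exist, and the dimension of
    \<open>Q\<close> bounds theirs.\<close>
  obtain Z :: "('k, 'a) umodule" where Z: "lmod A Z" "zero_module Z" by (rule zero_umodule)
  have Zr: "retract A Z M" if "lmod A M" for M :: "('a, 'm) module"
    by (rule retractI[OF lhom_const0[OF that] lhom_const0[OF Z(1)]]) (use Z(2) in \<open>simp add: zero_module_def\<close>)
  have "?P Z" using fg_zero[OF Z] Zr[OF Qm] Zr[OF DA_module] by blast
  moreover have "\<forall>U. ?P U \<longrightarrow> dimk U < Suc (dimk Q)"
  proof (intro allI impI)
    fix U assume U: "?P U"
    then obtain i r where ir: "i \<in> lhom A U Q" "r \<in> lhom A Q U" "\<forall>x\<in>carrier U. r (i x) = x" using retractE by blast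
    show "dimk U < Suc (dimk Q)" using dimk_le(1)[OF _ fQ ir(1) retract_inj[where i = i and r = r, OF ir(3)]] U by simp
  qed
  ultimately have "\<exists>U. ?P U \<and> (\<forall>W. ?P W \<longrightarrow> dimk W \<le> dimk U)" by (rule ex_has_greatest_nat)
  then obtain U :: "('k, 'a) umodule" where U: "fgm A U" and UQ: "retract A U Q" and UD: "retract A U DA"
    and max: "\<forall>W. ?P W \<longrightarrow> dimk W \<le> dimk U" by blast
  have Um: "lmod A U" by (rule fg_left[OF U])
  obtain i r where ir: "i \<in> lhom A U Q" "r \<in> lhom A Q U" "\<forall>x\<in>carrier U. r (i x) = x" by (rule retractE[OF UQ])
  obtain L :: "('k, 'a) umodule" and \<psi> \<rho> where L: "fgm A L" and sQ: "split_by A Q U i r L \<psi> \<rho>"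
    and "iso_mod A (dsum U L) Q" by (rule retract_split[OF fQ U ir(1,2)]) (rule ir(3))
  note q = split_byD[OF sQ]
  have Lm: "lmod A L" by (rule fg_left[OF L])
  show ?thesis
  proof (cases "zero_module L")
    case True
    interpret Q: left_module A Q by (rule Qm)
    have "\<forall>x\<in>carrier Q. i (r x) = x"
    proof
      fix x assume x: "x \<in> carrier Q"
      have "\<rho> x = zero L" using lhom_in[OF q(4) x] True by (simp add: zero_module_def)
      then show "i (r x) = x" using q(9)[OF x] lhom_zero[OF Lm Qm q(3)] lhom_in[OF lhom_o[OF q(2,1)] x] by simp
    qed
    then show ?thesis by (rule retract_trans[OF retractI[OF q(2,1)] UD])
  next
    case False
    obtain V :: "('k, 'a) umodule" where V: "indecomposable A V" and VL: "retract A V L" by (rule indec_retract_exists[OF L False])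
    have fV: "fgm A V" by (rule indec_fg[OF V])
    have Vm: "lmod A V" by (rule fg_left[OF fV])
    have Vnz: "\<not> zero_module V" using V by (simp add: indecomposable_def)
    interpret V: left_module A V by fact
    interpret U: left_module A U by fact
    have "retract A L Q" by (rule retractI[OF q(3,4)]) (use q(7) in blast)
    then have "retract A V Q" by (rule retract_trans[OF VL])
    then obtain i' r' where "i' \<in> lhom A V Q" "r' \<in> lhom A Q V" "\<forall>x\<in>carrier V. r' (i' x) = x" by (rule retractE)
    then have "addr A {Q} V" by (intro addr_retract[OF Vm, where X = Q]) simp_all
    then have "addr A {DA} V" by (rule addr_trans[OF Vm, rotated]) (use Qm injective_addr_DA[OF Q] in auto)
    then have "retract A V DA" by (rule indec_addr[OF V])
    then obtain v v' where v: "v \<in> lhom A V DA" "v' \<in> lhom A DA V" "\<forall>x\<in>carrier V. v' (v x) = x" by (rule retractE)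
    obtain iD rD where irD: "iD \<in> lhom A U DA" "rD \<in> lhom A DA U" "\<forall>x\<in>carrier U. rD (iD x) = x" by (rule retractE[OF UD])
    obtain L' :: "('k, 'a) umodule" and \<sigma> \<tau> where L': "fgm A L'" and sD: "split_by A DA U iD rD L' \<sigma> \<tau>"
      and "iso_mod A (dsum U L') DA" by (rule retract_split[OF fg_DA U irD(1,2)]) (rule irD(3))
    note D = split_byD[OF sD]
    have Lm': "lmod A L'" by (rule fg_left[OF L'])
    have 1: "(\<lambda>x. v' (iD x)) \<in> lhom A U V" "(\<lambda>x. rD (v x)) \<in> lhom A V U"
      and 2: "(\<lambda>x. v' (\<sigma> x)) \<in> lhom A L' V" "(\<lambda>x. \<tau> (v x)) \<in> lhom A V L'"
      by (rule lhom_o[OF D(1) v(2)], rule lhom_o[OF v(1) D(2)], rule lhom_o[OF D(3) v(2)], rule lhom_o[OF v(1) D(4)])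
    have "\<forall>x\<in>carrier V. x = v' (iD (rD (v x))) \<oplus>\<^bsub>V\<^esub> v' (\<sigma> (\<tau> (v x)))"
    proof
      fix x assume x: "x \<in> carrier V"
      have vx: "v x \<in> carrier DA" by (rule lhom_in[OF v(1) x])
      have "v' (v x) = v' (iD (rD (v x)) \<oplus>\<^bsub>DA\<^esub> \<sigma> (\<tau> (v x)))" using arg_cong[OF D(9)[OF vx], of v'] .
      also have "\<dots> = v' (iD (rD (v x))) \<oplus>\<^bsub>V\<^esub> v' (\<sigma> (\<tau> (v x)))"
        by (rule lhom_add[OF v(2) lhom_in[OF lhom_o[OF D(2,1)] vx] lhom_in[OF lhom_o[OF D(4,3)] vx]])
      finally show "x = v' (iD (rD (v x))) \<oplus>\<^bsub>V\<^esub> v' (\<sigma> (\<tau> (v x)))" using bspec[OF v(3) x] by (simp only:)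
    qed
    from indec_sum[OF V lhom_o[OF 1(2,1)] lhom_o[OF 2(2,1)] this]
    show ?thesis
    proof
      \<comment> \<open>\<open>V\<close> is a retract of both \<open>U\<close> and \<open>L\<close>,
        which gives two complementary copies of it in \<open>Q\<close> and thus in the regular
        module.\<close>
      assume "bij_betw (\<lambda>x. v' (iD (rD (v x)))) (carrier V) (carrier V)"
      then have "retract A V U" by (rule retract_of_bij[OF Vm 1(2,1)])
      then obtain p p' where p: "p \<in> lhom A V U" "p' \<in> lhom A U V" "\<forall>x\<in>carrier V. p' (p x) = x" by (rule retractE)
      obtain s s' where s: "s \<in> lhom A V L" "s' \<in> lhom A L V" "\<forall>x\<in>carrier V. s' (s x) = x" by (rule retractE[OF VL])
      have ip: "(\<lambda>x. i (p x)) \<in> lhom A V Q" by (rule lhom_o[OF p(1) q(1)])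
      have \<psi>s: "(\<lambda>x. \<psi> (s x)) \<in> lhom A V Q" by (rule lhom_o[OF s(1) q(3)])
      have False
      proof (rule indec_multiplicity[where X = X, OF V Xi ni])
        show "(\<lambda>x. e (i (p x))) \<in> lhom A V (dsum_upto n X)" by (rule lhom_o[OF ip e(1)])
        show "(\<lambda>x. p' (r (e' x))) \<in> lhom A (dsum_upto n X) V" by (rule lhom_o[OF lhom_o[OF e(2) q(2)] p(2)])
        show "(\<lambda>x. e (\<psi> (s x))) \<in> lhom A V (dsum_upto n X)" by (rule lhom_o[OF \<psi>s e(1)])
        show "(\<lambda>x. s' (\<rho> (e' x))) \<in> lhom A (dsum_upto n X) V" by (rule lhom_o[OF lhom_o[OF e(2) q(4)] s(2)])
        show "\<forall>x\<in>carrier V. p' (r (e' (e (i (p x))))) = x"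
          using bspec[OF e(3) lhom_in[OF ip]] q(5)[OF lhom_in[OF p(1)]] p(3) by simp
        show "\<forall>x\<in>carrier V. s' (\<rho> (e' (e (\<psi> (s x))))) = x"
          using bspec[OF e(3) lhom_in[OF \<psi>s]] q(7)[OF lhom_in[OF s(1)]] s(3) by simp
        show "\<forall>x\<in>carrier V. s' (\<rho> (e' (e (i (p x))))) = zero V"
          using bspec[OF e(3) lhom_in[OF ip]] q(6)[OF lhom_in[OF p(1)]] lhom_zero[OF Lm Vm s(2)] by simp
      qed
      then show ?thesis ..
    next
      \<comment> \<open>\<open>V\<close> splits off both complements and can be added to
        \<open>U\<close> on either side.\<close>
      assume "bij_betw (\<lambda>x. v' (\<sigma> (\<tau> (v x)))) (carrier V) (carrier V)"
      then have VL': "retract A V L'" by (rule retract_of_bij[OF Vm 2(2,1)])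
      obtain W :: "('k, 'a) umodule" and \<phi> \<phi>' where W: "fgm A W" "mod_iso A (dsum U V) W \<phi> \<phi>'"
        by (rule umodule_copy[OF fg_dsum[OF U fV]])
      have WD: "retract A W (dsum U V)" by (rule retract_iso[OF mod_iso_sym[OF W(2)]])
      have "retract A W Q" by (rule retract_trans[OF WD split_by_dsum_retract[OF Qm Um Lm sQ Vm VL]])
      moreover have "retract A W DA" by (rule retract_trans[OF WD split_by_dsum_retract[OF DA_module Um Lm' sD Vm VL']])
      ultimately have le: "dimk W \<le> dimk U" using max W(1) by blast
      have "dimk U < dimk W" by (rule dimk_dsum_less[OF U Vm W(1,2) Vnz])
      then show ?thesis using le by simp
    qed
  qed
qed

end

lemma (in endo) F_retract:
  assumes X: "lmod A X" and Y: "lmod A Y" and XY: "retract A X Y"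
  shows "retract BB (FF X) (FF Y)"
proof -
  obtain i r where ir: "i \<in> lhom A X Y" "r \<in> lhom A Y X" "\<forall>x\<in>carrier X. r (i x) = x" by (rule retractE[OF XY])
  show ?thesis
  proof (rule retractI[OF F_map[OF X Y ir(1)] F_map[OF Y X ir(2)]], rule ballI)
    fix u assume "u \<in> carrier (FF X)"
    then have u: "u \<in> mhom A C X" by simp
    show "post r (post i u) = u" by (rule mhom_ext[OF mhom_comp[OF mod_C mhom_comp[OF mod_C u ir(1)] ir(2)] u])
        (simp add: compose_def ir(3) mhom_closed[OF u])
  qed
qed

theorem theorem5p8:
  fixes K :: "'k ring"
    and \<Gamma> :: "('k, 'a) module"
    and Q :: "('a, 'q) module"
    and C :: "('a, 'c) module"
    and d k :: nat
  assumes "fd_algebra K \<Gamma>"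
    and "basic_algebra \<Gamma>"
    and "domdim_eq \<Gamma> (d + 1)"
    and "maximal_proj_inj_summand \<Gamma> Q"
    and "1 \<le> k" and "k \<le> d + 1"
    and "coshifted K \<Gamma> Q k C"
    and "B = opp (End \<Gamma> C)"
    and "DC = dual_over_End K \<Gamma> C"
    and "P = Hom_over_End \<Gamma> C Q"
  shows "projective B P \<and> summand B P DC \<and>
         (\<forall>j. (cotilt_class \<Gamma> j C :: ('a, 'm) module set) =
                (if j = 0 then cogen \<Gamma> (k - 1) Q
                 else if j = k then ker_Hom_to \<Gamma> Q
                 else zero_modules \<Gamma>)) \<and>
         (\<forall>j. (tilt_class B j DC :: ('c \<Rightarrow> 'c, 'n) module set) =
                (if j = 0 then gen B (k - 1) P
                 else if j = k then ker_Hom_from B P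
                 else zero_modules B))"
proof -
  interpret fdalg K \<Gamma> by (rule fdalg.intro) fact
  have sp: "special_cotilting K \<Gamma> Q k C" using assms(7) by (simp add: coshifted_def)
  then obtain c where c: "cotilting_sequence K \<Gamma> k C c" "\<forall>j<k. in_add \<Gamma> Q (c j)"
    unfolding special_cotilting_def by blast
  have ct: "cotilting K \<Gamma> k C" "injective \<Gamma> Q" "in_add \<Gamma> C Q" using sp by (auto simp: special_cotilting_def)
  obtain dc ec where s: "exact_seq_onto \<Gamma> (Suc k) c dc ec DA" "zero_module (c (Suc k))" "\<forall>j\<le>k. in_add \<Gamma> C (c j)"
    using c(1) unfolding cotilting_sequence_def by blast
  interpret coshift K \<Gamma> Q C k c dc ec by unfold_locales (use ct s c(2) assms(5) in \<open>auto simp: cotilting_def\<close>)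
  obtain \<eta> J \<delta> \<phi> \<psi> where res: "inj_resolution \<Gamma> (c k) \<eta> J \<delta>" "\<forall>i<k. J i = c (k - 1 - i)"
    "mod_iso \<Gamma> DA (J k) \<phi> \<psi>" "\<forall>i>k. zero_module (J i)" by (rule resolution_c)
  interpret coshift_res K \<Gamma> Q C k c dc ec \<eta> J \<delta> \<phi> \<psi> by unfold_locales (use res in auto)
  obtain p dp ep \<alpha> \<beta> where pres: "proj_resolution BB p dp ep DDC" "\<forall>i>k. zero_module (p i)"
    "\<forall>i\<le>k. mod_iso BB (FF (c i)) (p i) (\<alpha> i) (\<beta> i)" "\<forall>n. hexl_at BB p dp n (FF Q)" by (rule resolution_DC)
  interpret coshift_tilt K \<Gamma> Q C k c dc ec \<eta> J \<delta> \<phi> \<psi> p dp ep \<alpha> \<beta>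
    by unfold_locales (use pres in blast)+
  \<comment> \<open>\<open>P\<close> is to be a summand of DC itself and not just of a power of it.
    \<open>Q\<close> is a retract of \<open>D A\<close>, and Hom(C, -) carries this over to Hom(C, D
    A), which is DC.\<close>
  have "proj_inj_summand \<Gamma> Q" using assms(4) by (simp add: maximal_proj_inj_summand_def)
  then have "summand \<Gamma> Q (regular \<Gamma>)" by (simp add: proj_inj_summand_def)
  then have "retract \<Gamma> Q (regular \<Gamma>)" by (rule summand_is_retract)
  then have "retract \<Gamma> Q DA" by (rule injective_summand_DA[OF ct(2) _ assms(2)])
  then have "retract BB (FF Q) (FF DA)" by (rule F_retract[OF modQ DA_module])
  then have "retract BB (FF Q) DDC" by (rule retract_trans[OF _ retract_iso[OF F_DA_iso]])
  then have "summand BB (FF Q) DDC" unfolding retract_def using B.summand_retract[OF P(8) fgFQ] by blast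
  moreover have "(cotilt_class \<Gamma> j C :: ('a, 'm) module set) =
      (if j = 0 then cogen \<Gamma> (k - 1) Q else if j = k then ker_Hom_to \<Gamma> Q else zero_modules \<Gamma>)" for j
    using assms(5) by (cases "j = 0"; cases "j = k") (simp_all add: cotilt_0[unfolded One_nat_def] cotilt_k cotilt_other)
  moreover have "(tilt_class BB j DDC :: ('c \<Rightarrow> 'c, 'n) module set) =
      (if j = 0 then gen BB (k - 1) (FF Q) else if j = k then ker_Hom_from BB (FF Q) else zero_modules BB)" for j
    using assms(5) by (cases "j = 0"; cases "j = k") (simp_all add: tilt_0[unfolded One_nat_def] tilt_k tilt_other)
  ultimately show ?thesis unfolding assms(8-10) using projFQ by blast
qed

end
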